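(* Let $G(\lambda)$ be $T$-even and let $\mathcal S(\lambda)=\left[\begin{array}{c|c}P(\lambda)&B^T\\ \hline B&A-\lambda E\end{array}\right]$ be the system matrix of a minimal $T$-even realization $G(\lambda)=P(\lambda)+B^T(\lambda E-A)^{-1}B$. Let $0\le h\le m-1$ be even, $\mathbf w$ the simple admissible tuple of $\{0:h\}$ with symmetric complement $\mathbf c_w$, $\mathbf z+m$ any admissible tuple of $\{0:m-h-1\}$ and $\mathbf c_z+m$ the symmetric complement of $\mathbf z+m$. Consider the GFPR $\mathbb L(\lambda)=(\lambda\mathbb M^{\mathcal S}_{\mathbf z}-\mathbb M^{\mathcal S}_{\mathbf w})\mathbb M^P_{\mathbf c_w}\mathbb M^P_{\mathbf c_z}$ associated with $\mathcal S(\lambda)$, and $L(\lambda)=(\lambda M^P_{\mathbf z}-M^P_{\mathbf w})M^P_{\mathbf c_w}M^P_{\mathbf c_z}$. Then there exists a unique quasi-identity matrix $\mathbb Q=\mathrm{diag}(\mathbf s\,Q,I_r)$ such that $$\mathbb Q\mathbb L(\lambda)=\left[\begin{array}{c|c}\mathbf s\,QL(\lambda)&e_{m-i_0(\mathbf w)}\otimes B^T\\ \hline e^T_{m-i_0(\mathbf w)}\otimes B&A-\lambda E\end{array}\right]$$ is $T$-even, where $Q$ is the (unique up to multiplication by $-1$) quasi-identity matrix such that $QL(\lambda)$ is $T$-even, and $\mathbf s$ is the $(m-i_0(\mathbf w))$-th parameter of $Q$. Assume that $\mathrm{Ind}(\mathbf z+m)=0$ when the leading coefficient $A_m$ of $P(\lambda)$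 is singular. Then $\mathbb Q\mathbb L(\lambda)$ is a Rosenbrock strong linearization of $G(\lambda)$. The transfer function $\mathbb G(\lambda)=\mathbf s\,QL(\lambda)+(e_{m-i_0(\mathbf w)}\otimes B^T)(\lambda E-A)^{-1}(e^T_{m-i_0(\mathbf w)}\otimes B)$ of $\mathbb Q\mathbb L(\lambda)$ is $T$-even.
   Context: Setting: a rational matrix or pencil $F(\lambda)$ is $T$-even (Hamiltonian) if $F(-\lambda)^T=F(\lambda)$. $P(\lambda)=\sum_{i=0}^m\lambda^iA_i$, $A_i\in\mathbb C^{n\times n}$, $A_m\ne0$, $m\ge1$. A $T$-even realization $G(\lambda)=P(\lambda)+B^T(\lambda E-A)^{-1}B$ has $P(\lambda)$ and $\lambda E-A$ both $T$-even, $A,E\in\mathbb C^{r\times r}$, $E$ nonsingular, $B\in\mathbb C^{r\times n}$; minimal means $r$ is smallest possible among all realizations of $G$. $e_j$ is the $j$-th column of $I_m$. Fiedler matrices: $M_0^P=\mathrm{diag}(I_{(m-1)n},-A_0)$, $M_{-m}^P=\mathrm{diag}(A_m,I_{(m-1)n})$, and for $1\le i\le m-1$, $M_i^P=\mathrm{diag}\big(I_{(m-i-1)n},\begin{bmatrix}-A_i&I_n\\ I_n&0\end{bmatrix},I_{(i-1)n}\big)$, $M_{-i}^P=(M_i^P)^{-1}=\mathrm{diag}\big(I_{(m-i-1)n},\begin{bmatrix}0&I_n\\ I_n&A_i\end{bmatrix},I_{(i-1)n}\big)$; $\mathbb M_i^P=\mathrm{diag}(M_i^P,I_r)$ for $-m\le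 i\le m-1$. $\mathbb M_0^{\mathcal S}=\left[\begin{array}{c|c}M_0^P&-e_m\otimes B^T\\ \hline -e_m^T\otimes B&-A\end{array}\right]$, $\mathbb M_{-m}^{\mathcal S}=\mathrm{diag}(M_{-m}^P,-E)$, $\mathbb M_{\pm i}^{\mathcal S}=\mathrm{diag}(M_{\pm i}^P,I_r)$ for $1\le i\le m-1$. For a tuple $\mathbf t=(t_1,\dots,t_k)$, $M^P_{\mathbf t},\mathbb M^P_{\mathbf t},\mathbb M^{\mathcal S}_{\mathbf t}$ are the ordered products (empty product $=$ identity). Tuples: $(a:b)=(a,a+1,\dots,b)$ if $a\le b$, empty otherwise; tuples separated by commas are concatenated; $\mathbf t+k$ adds $k$ to each entry. $i_0(\mathbf w)$ is the largest $p\ge0$ such that $(p,\dots,1,0)$ is a subtuple of $\mathbf w$ (obtained by deleting entries). An admissible tuple of $\{0:k\}$ with index $p=\mathrm{Ind}(\mathbf w)$, $0\le p\le k$, $k-p$ even, is $\mathbf w=(k-1:k,\,k-3:k-2,\dots,p+1:p+2,\,0:p)$; it is simple if $p\in\{0,1\}$ ($p=0$ for $k$ even). Its symmetric complement is $\mathbf c_w=(k-1,k-3,\dots,p+3,p+1,(0:p)_{rev_c})$ if $p\ge1$, where $(0:p)_{rev_c}=(0:p-1,0:p-2,\dots,0:1,0)$; $\mathbf c_w=(k-1,k-3,\dots,1)$ if $p=0,k>0$; $\mathbf c_w=\emptyset$ if $k=0$. Quasi-identity: $Q\in\mathbb C^{mn\times mn}$ is a quasi-identity matrix if $Q=\epsilon_1I_n\oplus\cdots\oplus\epsilon_mI_n$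 with $\epsilon_i\in\{\pm1\}$; $\epsilon_j$ is its $j$-th parameter. It is a known result that, for $P$ $T$-even and tuples as in the claim, there is, up to multiplication by $-1$, a unique quasi-identity $Q$ such that $QL(\lambda)$ is $T$-even. A matrix polynomial is unimodular if its determinant is a nonzero constant; a square rational matrix is biproper if its limit at $\infty$ exists and is nonsingular. Rosenbrock strong linearization of $G(\lambda)$: an $(mn+r)\times(mn+r)$ pencil $\mathbb T(\lambda)=\left[\begin{array}{c|c}\mathcal X-\lambda\mathcal Y&\mathcal C\\ \hline\mathcal B&H-\lambda K\end{array}\right]$ with $K\in\mathbb C^{r\times r}$ nonsingular, irreducible ($[\mathcal B\ \ H-\lambda K]$ and $\begin{bmatrix}\mathcal C\\ H-\lambda K\end{bmatrix}$ have rank $r$ for all $\lambda\in\mathbb C$), such that (i) $\mathrm{diag}(U(\lambda),U_0)\,\mathbb T(\lambda)\,\mathrm{diag}(V(\lambda),V_0)=\mathrm{diag}(I_{(m-1)n},\mathcal S(\lambda))$ for some $mn\times mn$ unimodular $U,V$ and nonsingular $U_0,V_0\in\mathbb C^{r\times r}$; (ii) $\mathcal O_\ell(\lambda)\lambda^{-1}\mathbb G(\lambda)\mathcal O_r(\lambda)=\mathrm{diag}(I_{(m-1)n},\lambda^{-m}G(\lambda))$ for some $mn\times mn$ biproper $\mathcal O_\ell,\mathcal O_r$, where $\mathbb G(\lambda)=\mathcal X-\lambda\mathcal Y+\mathcal C(\lambda K-H)^{-1}\mathcal B$ is the transfer function. *)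

theory Defs
  imports
    "Jordan_Normal_Form.Determinant"
    "Jordan_Normal_Form.Gauss_Jordan_Elimination"
    "Jordan_Normal_Form.DL_Rank"
    "HOL-Computational_Algebra.Polynomial_Factorial"
    "HOL-Library.Sublist"
begin

section \<open>Polynomial and rational matrices\<close>

text \<open>Polynomial matrices have type \<^typ>\<open>complex poly mat\<close>, rational matrices have type
  \<^typ>\<open>complex poly fract mat\<close>.\<close>

abbreviation lam :: "complex poly" where
  "lam \<equiv> [:0, 1:]"

definition const_mat :: "complex mat \<Rightarrow> complex poly mat" where
  "const_mat A = map_mat (\<lambda>a. [:a:]) A"

definition rat_mat :: "complex poly mat \<Rightarrow> complex poly fract mat" where
  "rat_mat F = map_mat to_fract F"

definition coeff_mat :: "complex poly mat \<Rightarrow> nat \<Rightarrow> complex mat" where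
  "coeff_mat F i = map_mat (\<lambda>p. coeff p i) F"

lemma pcompose_neg_lam_eq_0_iff: "pcompose p (- lam) = 0 \<longleftrightarrow> p = 0"
  by (simp add: pcompose_eq_0_iff)

text \<open>Substitution of \<open>-\<lambda>\<close> for \<open>\<lambda>\<close> in a rational function; the value does not depend on the
  representation as a fraction.\<close>

definition fract_reflect :: "complex poly fract \<Rightarrow> complex poly fract" where
  "fract_reflect x = (THE y. \<exists>p q. q \<noteq> 0 \<and> x = Fract p q \<and>
     y = Fract (pcompose p (- lam)) (pcompose q (- lam)))"

lemma fract_reflect_Fract:
  assumes "q \<noteq> 0"
  shows "fract_reflect (Fract p q) = Fract (pcompose p (- lam)) (pcompose q (- lam))"
  unfolding fract_reflect_def
proof (rule the_equality)
  show "\<exists>p' q'. q' \<noteq> 0 \<and> Fract p q = Fract p' q' \<and>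
      Fract (pcompose p (- lam)) (pcompose q (- lam))
        = Fract (pcompose p' (- lam)) (pcompose q' (- lam))"
    using assms by blast
next
  fix y
  assume "\<exists>p' q'. q' \<noteq> 0 \<and> Fract p q = Fract p' q' \<and>
      y = Fract (pcompose p' (- lam)) (pcompose q' (- lam))"
  then obtain p' q' where q': "q' \<noteq> 0" and eq: "Fract p q = Fract p' q'"
    and y: "y = Fract (pcompose p' (- lam)) (pcompose q' (- lam))"
    by blast
  from eq have "p * q' = p' * q"
    using assms q' by (simp add: eq_fract)
  then have "pcompose p (- lam) * pcompose q' (- lam)
      = pcompose p' (- lam) * pcompose q (- lam)"
    by (metis pcompose_mult)
  moreover have "pcompose q (- lam) \<noteq> 0" "pcompose q' (- lam) \<noteq> 0"
    using assms q' pcompose_neg_lam_eq_0_iff by blast+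
  ultimately show "y = Fract (pcompose p (- lam)) (pcompose q (- lam))"
    unfolding y by (simp add: eq_fract del: minus_pCons)
qed

definition T_even_poly :: "complex poly mat \<Rightarrow> bool" where
  "T_even_poly F \<longleftrightarrow> transpose_mat (map_mat (\<lambda>p. pcompose p (- lam)) F) = F"

definition T_even_rat :: "complex poly fract mat \<Rightarrow> bool" where
  "T_even_rat F \<longleftrightarrow> transpose_mat (map_mat fract_reflect F) = F"

definition unimodular :: "nat \<Rightarrow> complex poly mat \<Rightarrow> bool" where
  "unimodular N U \<longleftrightarrow> U \<in> carrier_mat N N \<and> (\<exists>c. c \<noteq> 0 \<and> det U = [:c:])"

text \<open>The limit does not depend on the chosen representative \<open>p / q\<close>, since \<open>q\<close> has only
  finitely many zeros.\<close>

definition fract_limit_at_infinity :: "complex poly fract \<Rightarrow> complex \<Rightarrow> bool" where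
  "fract_limit_at_infinity x c \<longleftrightarrow>
     (\<exists>p q. q \<noteq> 0 \<and> x = Fract p q \<and> ((\<lambda>t. poly p t / poly q t) \<longlongrightarrow> c) at_infinity)"

definition biproper :: "nat \<Rightarrow> complex poly fract mat \<Rightarrow> bool" where
  "biproper N F \<longleftrightarrow> F \<in> carrier_mat N N \<and>
     (\<exists>C \<in> carrier_mat N N. det C \<noteq> 0 \<and>
        (\<forall>i<N. \<forall>j<N. fract_limit_at_infinity (F $$ (i, j)) (C $$ (i, j))))"

section \<open>Realizations\<close>

definition transfer_function ::
  "complex poly mat \<Rightarrow> complex mat \<Rightarrow> complex mat \<Rightarrow> complex mat \<Rightarrow> complex mat
    \<Rightarrow> complex poly fract mat" where
  "transfer_function D C E A B =
     rat_mat D + rat_mat (const_mat C)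
       * the (mat_inverse (rat_mat (lam \<cdot>\<^sub>m const_mat E - const_mat A)))
       * rat_mat (const_mat B)"

definition is_realization ::
  "nat \<Rightarrow> nat \<Rightarrow> complex poly fract mat
    \<Rightarrow> complex poly mat \<Rightarrow> complex mat \<Rightarrow> complex mat \<Rightarrow> complex mat \<Rightarrow> complex mat \<Rightarrow> bool" where
  "is_realization n r G P C E A B \<longleftrightarrow>
     P \<in> carrier_mat n n \<and> C \<in> carrier_mat n r \<and> E \<in> carrier_mat r r \<and>
     A \<in> carrier_mat r r \<and> B \<in> carrier_mat r n \<and> det E \<noteq> 0 \<and>
     G = transfer_function P C E A B"

text \<open>Minimality is among all realizations of \<open>G\<close>, not only the \<open>T\<close>-even ones.\<close>

definition is_minimal_realization ::
  "nat \<Rightarrow> nat \<Rightarrow> complex poly fract mat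
    \<Rightarrow> complex poly mat \<Rightarrow> complex mat \<Rightarrow> complex mat \<Rightarrow> complex mat \<Rightarrow> complex mat \<Rightarrow> bool" where
  "is_minimal_realization n r G P C E A B \<longleftrightarrow>
     is_realization n r G P C E A B \<and>
     (\<forall>r' P' C' E' A' B'. is_realization n r' G P' C' E' A' B' \<longrightarrow> r \<le> r')"

definition is_minimal_T_even_realization ::
  "nat \<Rightarrow> nat \<Rightarrow> complex poly fract mat
    \<Rightarrow> complex poly mat \<Rightarrow> complex mat \<Rightarrow> complex mat \<Rightarrow> complex mat \<Rightarrow> bool" where
  "is_minimal_T_even_realization n r G P E A B \<longleftrightarrow>
     is_minimal_realization n r G P (transpose_mat B) E A B \<and>
     T_even_poly P \<and> T_even_poly (lam \<cdot>\<^sub>m const_mat E - const_mat A)"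

definition system_matrix ::
  "complex poly mat \<Rightarrow> complex mat \<Rightarrow> complex mat \<Rightarrow> complex mat \<Rightarrow> complex poly mat" where
  "system_matrix P E A B =
     four_block_mat P (const_mat (transpose_mat B))
       (const_mat B) (const_mat A - lam \<cdot>\<^sub>m const_mat E)"

section \<open>Fiedler matrices\<close>

definition kronecker :: "'a :: semiring_0 mat \<Rightarrow> 'a mat \<Rightarrow> 'a mat" where
  "kronecker A B = mat (dim_row A * dim_row B) (dim_col A * dim_col B)
     (\<lambda>(i, j). A $$ (i div dim_row B, j div dim_col B) * B $$ (i mod dim_row B, j mod dim_col B))"

text \<open>The \<open>j\<close>-th column of the identity, as an \<open>m \<times> 1\<close> matrix; \<open>j\<close> counts from 1.\<close>

definition e_col :: "nat \<Rightarrow> nat \<Rightarrow> complex mat" where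
  "e_col m j = mat_of_cols m [unit_vec m (j - 1)]"

text \<open>In the following two definitions \<open>c i\<close> is the coefficient of \<open>\<lambda>^i\<close>, and the index \<open>i\<close>
  is meant to range over \<open>{-m..m-1}\<close>.\<close>

definition fiedler :: "nat \<Rightarrow> nat \<Rightarrow> (nat \<Rightarrow> complex mat) \<Rightarrow> int \<Rightarrow> complex mat" where
  "fiedler m n c i =
    (if i = 0 then diag_block_mat [1\<^sub>m ((m - 1) * n), - c 0]
     else if i = - int m then diag_block_mat [c m, 1\<^sub>m ((m - 1) * n)]
     else if i > 0 then
       diag_block_mat [1\<^sub>m ((m - nat i - 1) * n),
         four_block_mat (- c (nat i)) (1\<^sub>m n) (1\<^sub>m n) (0\<^sub>m n n),
         1\<^sub>m ((nat i - 1) * n)]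
     else
       diag_block_mat [1\<^sub>m ((m - nat (- i) - 1) * n),
         four_block_mat (0\<^sub>m n n) (1\<^sub>m n) (1\<^sub>m n) (c (nat (- i))),
         1\<^sub>m ((nat (- i) - 1) * n)])"

definition fiedler_P :: "nat \<Rightarrow> nat \<Rightarrow> nat \<Rightarrow> (nat \<Rightarrow> complex mat) \<Rightarrow> int \<Rightarrow> complex mat" where
  "fiedler_P m n r c i = diag_block_mat [fiedler m n c i, 1\<^sub>m r]"

definition fiedler_S ::
  "nat \<Rightarrow> nat \<Rightarrow> nat \<Rightarrow> (nat \<Rightarrow> complex mat) \<Rightarrow> complex mat \<Rightarrow> complex mat \<Rightarrow> complex mat
    \<Rightarrow> int \<Rightarrow> complex mat" where
  "fiedler_S m n r c E A B i =
    (if i = 0 then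
       four_block_mat (fiedler m n c 0) (- kronecker (e_col m m) (transpose_mat B))
         (- kronecker (transpose_mat (e_col m m)) B) (- A)
     else if i = - int m then diag_block_mat [fiedler m n c i, - E]
     else diag_block_mat [fiedler m n c i, 1\<^sub>m r])"

text \<open>Ordered product over a tuple of \<open>N \<times> N\<close> matrices; the empty product is the identity.\<close>

definition tuple_prod :: "nat \<Rightarrow> (int \<Rightarrow> complex mat) \<Rightarrow> int list \<Rightarrow> complex mat" where
  "tuple_prod N M t = foldr (\<lambda>i X. M i * X) t (1\<^sub>m N)"

section \<open>Index tuples\<close>

text \<open>The library list \<open>[a..b]\<close> of integers is the tuple \<open>(a:b)\<close>.\<close>

definition tuple_shift :: "int list \<Rightarrow> int \<Rightarrow> int list" where
  "tuple_shift t k = map (\<lambda>i. i + k) t"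

definition tuple_i0 :: "int list \<Rightarrow> nat" where
  "tuple_i0 t = (GREATEST p. subseq (rev [0..int p]) t)"

definition admissible_tuple :: "nat \<Rightarrow> nat \<Rightarrow> int list \<Rightarrow> bool" where
  "admissible_tuple k p t \<longleftrightarrow> p \<le> k \<and> even (k - p) \<and>
     t = concat (map (\<lambda>j. [int k - 2 * int j - 1..int k - 2 * int j]) [0..<(k - p) div 2])
       @ [0..int p]"

definition simple_admissible_tuple :: "nat \<Rightarrow> nat \<Rightarrow> int list \<Rightarrow> bool" where
  "simple_admissible_tuple k p t \<longleftrightarrow> admissible_tuple k p t \<and> p \<in> {0, 1}"

text \<open>The tuple \<open>(0:p-1, 0:p-2, \<dots>, 0:1, 0)\<close>; it is empty for \<open>p = 0\<close>.\<close>

definition rev_c :: "nat \<Rightarrow> int list" where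
  "rev_c p = concat (map (\<lambda>s. [0..s]) (rev [0..int p - 1]))"

text \<open>As \<open>rev_c 0\<close> is empty, the cases \<open>p \<ge> 1\<close>, \<open>p = 0 < k\<close> and \<open>k = 0\<close> need not be distinguished.\<close>

definition sym_complement :: "nat \<Rightarrow> nat \<Rightarrow> int list" where
  "sym_complement k p = map (\<lambda>j. int k - 2 * int j - 1) [0..<(k - p) div 2] @ rev_c p"

section \<open>Quasi-identity matrices\<close>

text \<open>The parameters \<open>\<epsilon> 1, \<dots>, \<epsilon> m\<close> are numbered from 1.\<close>

definition quasi_identity :: "nat \<Rightarrow> nat \<Rightarrow> (nat \<Rightarrow> complex) \<Rightarrow> complex mat \<Rightarrow> bool" where
  "quasi_identity m n \<epsilon> Q \<longleftrightarrow> (\<forall>i\<in>{1..m}. \<epsilon> i \<in> {1, -1}) \<and>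
     Q = diag_block_mat (map (\<lambda>i. \<epsilon> i \<cdot>\<^sub>m 1\<^sub>m n) [1..<m + 1])"

section \<open>Rosenbrock strong linearizations\<close>

definition append_cols :: "'a :: zero mat \<Rightarrow> 'a mat \<Rightarrow> 'a mat" where
  "append_cols A B = four_block_mat A B (0\<^sub>m 0 (dim_col A)) (0\<^sub>m 0 (dim_col B))"

text \<open>\<open>S\<close> is the system matrix of the given realization of \<open>G\<close> with state dimension \<open>r\<close>.
  The first argument of \<^const>\<open>vec_space.rank\<close> is the number of rows.\<close>

definition rosenbrock_strong_linearization ::
  "nat \<Rightarrow> nat \<Rightarrow> nat \<Rightarrow> complex poly mat \<Rightarrow> complex poly fract mat \<Rightarrow> complex poly mat \<Rightarrow> bool" where
  "rosenbrock_strong_linearization m n r S G T \<longleftrightarrow>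
    (\<exists>X Y C B H K.
       X \<in> carrier_mat (m * n) (m * n) \<and> Y \<in> carrier_mat (m * n) (m * n) \<and>
       C \<in> carrier_mat (m * n) r \<and> B \<in> carrier_mat r (m * n) \<and>
       H \<in> carrier_mat r r \<and> K \<in> carrier_mat r r \<and> det K \<noteq> 0 \<and>
       T = four_block_mat (const_mat X - lam \<cdot>\<^sub>m const_mat Y) (const_mat C)
             (const_mat B) (const_mat H - lam \<cdot>\<^sub>m const_mat K) \<and>
       (\<forall>t :: complex.
          vec_space.rank r (append_cols B (H - t \<cdot>\<^sub>m K)) = r \<and>
          vec_space.rank (m * n + r) (C @\<^sub>r (H - t \<cdot>\<^sub>m K)) = r) \<and>
       (\<exists>U V U0 V0. unimodular (m * n) U \<and> unimodular (m * n) V \<and>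
          U0 \<in> carrier_mat r r \<and> V0 \<in> carrier_mat r r \<and> det U0 \<noteq> 0 \<and> det V0 \<noteq> 0 \<and>
          diag_block_mat [U, const_mat U0] * T * diag_block_mat [V, const_mat V0]
            = diag_block_mat [1\<^sub>m ((m - 1) * n), S]) \<and>
       (\<exists>Ol Or. biproper (m * n) Ol \<and> biproper (m * n) Or \<and>
          Ol * (inverse (to_fract lam)
                  \<cdot>\<^sub>m transfer_function (const_mat X - lam \<cdot>\<^sub>m const_mat Y) C K H B) * Or
            = diag_block_mat [1\<^sub>m ((m - 1) * n), inverse (to_fract lam) ^ m \<cdot>\<^sub>m G]))"

end

theory Submission
  imports Defs
begin

text \<open>
  Write $N = mn$, $X_1 = M_{\mathbf z} M_{\mathbf c_w} M_{\mathbf c_z}$ and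
  $X_0 = M_{\mathbf w} M_{\mathbf c_w} M_{\mathbf c_z}$, so that $L(\lambda) = \lambda X_1 - X_0$.  Every
  matrix $M_i$ differs from the identity in at most two neighbouring block rows, so products of such matrices
  are followed by their action on block vectors; matrices commute if the absolute values of their
  indices are at least two apart.

  Signs.  Transposing a product of Fiedler matrices reverses the tuple and replaces each $A_i$ by
  $A_i^T = (-1)^i A_i$.  The tuples of $X_0$ and $X_1$ are palindromes up to admissible commutations, and
  replacing $A_i$ by $(-1)^i A_i$ conjugates a product by diagonal sign matrices (\<open>sign_gprod\<close>).  The sign
  matrix \<open>qd\<close> is chosen so that it appears on both sides, up to one overall minus sign for $X_1$
  (\<open>transposes\<close>); this is the existence of $Q$.  For uniqueness, a nonzero block of $X_0$ or $X_1$
  in position $(b,j)$ fixes the product of the $b$-th and $j$-th sign, and enough blocks are nonzero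
  to link all of them (\<open>sign_unique\<close>).  The row and column borders of $\mathbb L$ each contain one
  block, $B$ or $B^T$, in position $j = m - i_0(\mathbf w)$, which fixes the remaining global sign as soon as
  $B \neq 0$; minimality gives $B \neq 0$ when $r > 0$.

  Finite structure.  After multiplication by invertible products of Fiedler matrices on both sides the
  pencil becomes $\lambda M_{-m} - L\, M_0\, R$, where each of $M_1, \dots, M_{m-1}$ occurs exactly once, in $L$ or in
  $R$ (\<open>strip_w\<close>, \<open>strip_z\<close>).  Such a pencil is reduced by \<open>elimination\<close>: removing one factor at a time, from
  $M_{m-1}$ down to $M_1$, is a Horner scheme which accumulates $P(\lambda)$ in the last block, and the steps do not
  change the borders.  The condition on $A_m$ and the index of $\mathbf z + m$ makes the stripped factors invertible.

  Infinity.  The transfer function is the same pencil with $A_0$ replaced by the rational matrix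
  $A_0 + B^T(\lambda E - A)^{-1}B$, whose entries are proper.  Dividing by $\lambda$ and reversing the order of the
  blocks turns it into a pencil of the same kind with parameter $1/\lambda$ (\<open>reversed_elimination\<close>).  The
  elimination is carried out over an arbitrary commutative ring with a chosen subring, so it applies over
  polynomials and again over the ring of proper rational functions; invertible matrices over the latter are biproper.

  Irreducibility of the linearization is that of the realization: a left vector that kills $B$ and
  $A - tE$ would allow one state to be deleted (\<open>minimal_left_kernel\<close>).
\<close>

section \<open>Block vectors and block actions\<close>

definition unblk :: "nat \<Rightarrow> nat \<Rightarrow> (nat \<Rightarrow> nat \<Rightarrow> 'a) \<Rightarrow> 'a vec" where
  "unblk m n x = vec (m * n) (\<lambda>r. x (r div n) (r mod n))"

definition blk :: "nat \<Rightarrow> 'a vec \<Rightarrow> nat \<Rightarrow> nat \<Rightarrow> 'a" where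
  "blk n v b a = v $ (b * n + a)"

definition mv :: "nat \<Rightarrow> 'a :: semiring_0 mat \<Rightarrow> (nat \<Rightarrow> 'a) \<Rightarrow> nat \<Rightarrow> 'a" where
  "mv n A y a = (\<Sum>d<n. A $$ (a, d) * y d)"

text \<open>A block matrix is handled through its action on block vectors \<open>x b a\<close> (entry \<open>a\<close> of block \<open>b\<close>).  Products
  become compositions of functions, which avoids all index arithmetic with \<open>div\<close> and \<open>mod\<close> in the
  arguments below.\<close>

definition bacts :: "nat \<Rightarrow> nat \<Rightarrow> 'a :: semiring_0 mat
    \<Rightarrow> ((nat \<Rightarrow> nat \<Rightarrow> 'a) \<Rightarrow> nat \<Rightarrow> nat \<Rightarrow> 'a) \<Rightarrow> bool" where
  "bacts m n M f \<longleftrightarrow> M \<in> carrier_mat (m * n) (m * n) \<and>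
     (\<forall>x. M *\<^sub>v unblk m n x = unblk m n (f x))"

lemma block_index:
  fixes a b m n :: nat
  assumes "b < m" "a < n"
  shows "b * n + a < m * n" "(b * n + a) div n = b" "(b * n + a) mod n = a"
proof -
  have "b * n + a < b * n + n" using assms by simp
  also have "\<dots> = Suc b * n" by simp
  also have "\<dots> \<le> m * n" using assms by (intro mult_le_mono) auto
  finally show "b * n + a < m * n" .
qed (use assms in auto)

lemma block_split:
  fixes r m n :: nat
  assumes "r < m * n"
  shows "r div n < m" "r mod n < n" "r = (r div n) * n + r mod n"
  using assms by (auto simp: less_mult_imp_div_less intro!: mod_less_divisor gr0I)

lemma block_cases:
  fixes r m n :: nat
  assumes "r < m * n"
  obtains b a where "b < m" "a < n" "r = b * n + a"
  using block_split[OF assms] by blast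

lemma unblk_carrier [simp]: "unblk m n x \<in> carrier_vec (m * n)" "dim_vec (unblk m n x) = m * n"
  by (auto simp: unblk_def)

lemma unblk_index [simp]: "b < m \<Longrightarrow> a < n \<Longrightarrow> unblk m n x $ (b * n + a) = x b a"
  by (simp add: unblk_def block_index)

lemma unblk_blk: "v \<in> carrier_vec (m * n) \<Longrightarrow> unblk m n (blk n v) = v"
  by (auto simp: unblk_def blk_def)

lemma unblk_cong: "(\<And>b a. b < m \<Longrightarrow> a < n \<Longrightarrow> x b a = y b a) \<Longrightarrow> unblk m n x = unblk m n y"
  unfolding unblk_def by (rule eq_vecI) (auto simp: block_split)

lemma unblk_eq_iff: "unblk m n x = unblk m n y \<longleftrightarrow> (\<forall>b<m. \<forall>a<n. x b a = y b a)"
  by (metis unblk_cong unblk_index)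

lemma unblk_minus: "unblk m n x - unblk m n y = unblk m n (\<lambda>b a. x b a - y b a)"
  by (auto simp: unblk_def)

lemma unblk_smult: "t \<cdot>\<^sub>v unblk m n x = unblk m n (\<lambda>b a. t * x b a)"
  by (auto simp: unblk_def)

lemma sum_blocks:
  fixes f :: "nat \<Rightarrow> 'a :: comm_monoid_add"
  shows "(\<Sum>r<m * n. f r) = (\<Sum>c<m. \<Sum>d<n. f (c * n + d))"
proof -
  have "(\<Sum>c<m. \<Sum>d<n. f (c * n + d)) = (\<Sum>c<m. sum f {c * n..<c * n + n})"
  proof (rule sum.cong[OF refl])
    fix c show "(\<Sum>d<n. f (c * n + d)) = sum f {c * n..<c * n + n}"
      using sum.shift_bounds_nat_ivl[of f 0 "c * n" n] by (simp add: atLeast0LessThan add.commute)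
  qed
  also have "\<dots> = (\<Sum>r<m * n. f r)"
    by (rule sum.nat_group)
  finally show ?thesis ..
qed

lemma bactsI:
  fixes M :: "'a :: semiring_0 mat"
  assumes M: "M \<in> carrier_mat (m * n) (m * n)"
    and f: "\<And>x b a. b < m \<Longrightarrow> a < n \<Longrightarrow>
      (\<Sum>c<m. \<Sum>d<n. M $$ (b * n + a, c * n + d) * x c d) = f x b a"
  shows "bacts m n M f"
  unfolding bacts_def
proof (intro conjI allI M)
  fix x
  show "M *\<^sub>v unblk m n x = unblk m n (f x)"
  proof (rule eq_vecI)
    fix r assume "r < dim_vec (unblk m n (f x))"
    then obtain b a where ba: "b < m" "a < n" "r = b * n + a"
      by (auto elim: block_cases)
    then have r: "r < m * n" by (simp add: block_index)
    have "(M *\<^sub>v unblk m n x) $ r = (\<Sum>s<m * n. M $$ (r, s) * unblk m n x $ s)"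
      using r M by (simp add: scalar_prod_def atLeast0LessThan)
    also have "\<dots> = (\<Sum>c<m. \<Sum>d<n. M $$ (r, c * n + d) * x c d)"
      by (simp add: sum_blocks)
    also have "\<dots> = f x b a" using ba f by simp
    finally show "(M *\<^sub>v unblk m n x) $ r = unblk m n (f x) $ r"
      using ba by simp
  qed (use M in auto)
qed

lemma bacts_carrier: "bacts m n M f \<Longrightarrow> M \<in> carrier_mat (m * n) (m * n)"
  by (simp add: bacts_def)

lemma bacts_apply: "bacts m n M f \<Longrightarrow> M *\<^sub>v unblk m n x = unblk m n (f x)"
  by (simp add: bacts_def)

lemma bacts_cong:
  assumes "bacts m n M f" "\<And>x b a. b < m \<Longrightarrow> a < n \<Longrightarrow> f x b a = g x b a"
  shows "bacts m n M g"
  using assms unfolding bacts_def by (metis unblk_cong)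

lemma mat_eq_via_vec:
  fixes A :: "'a :: semiring_1 mat"
  assumes A: "A \<in> carrier_mat k l" and B: "B \<in> carrier_mat k l"
    and eq: "\<And>v. v \<in> carrier_vec l \<Longrightarrow> A *\<^sub>v v = B *\<^sub>v v"
  shows "A = B"
proof (rule mat_col_eqI)
  fix i assume "i < dim_col B"
  then have i: "i < l" using B by simp
  have "col A i = A *\<^sub>v unit_vec l i" using A i by (intro eq_vecI) auto
  also have "\<dots> = B *\<^sub>v unit_vec l i" by (rule eq) simp
  also have "\<dots> = col B i" using B i by (intro eq_vecI) auto
  finally show "col A i = col B i" .
qed (use A B in auto)

lemma bacts_eqI:
  fixes M M' :: "'a :: semiring_1 mat"
  assumes M: "bacts m n M f" and M': "bacts m n M' g"
    and fg: "\<And>x b a. b < m \<Longrightarrow> a < n \<Longrightarrow> f x b a = g x b a"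
  shows "M = M'"
proof (rule mat_eq_via_vec)
  fix v :: "'a vec" assume v: "v \<in> carrier_vec (m * n)"
  have "M *\<^sub>v unblk m n (blk n v) = M' *\<^sub>v unblk m n (blk n v)"
    using fg by (simp add: bacts_apply[OF M] bacts_apply[OF M'] unblk_eq_iff)
  then show "M *\<^sub>v v = M' *\<^sub>v v" using v by (simp add: unblk_blk)
qed (use M M' bacts_carrier in auto)

lemma bacts_mult:
  fixes M M' :: "'a :: comm_semiring_0 mat"
  assumes M: "bacts m n M f" and M': "bacts m n M' g"
  shows "bacts m n (M * M') (\<lambda>x. f (g x))"
  using bacts_carrier[OF M] bacts_carrier[OF M'] unfolding bacts_def
  by (auto simp: assoc_mult_mat_vec[where ?n\<^sub>1.0 = "m * n" and ?n\<^sub>2.0 = "m * n" and ?n\<^sub>3.0 = "m * n"]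
      bacts_apply[OF M] bacts_apply[OF M'])

lemma bacts_one: "bacts m n (1\<^sub>m (m * n) :: 'a :: semiring_1 mat) (\<lambda>x. x)"
  by (auto simp: bacts_def)

lemma bacts_minus:
  fixes M M' :: "'a :: comm_ring_1 mat"
  assumes M: "bacts m n M f" and M': "bacts m n M' g"
  shows "bacts m n (M - M') (\<lambda>x b a. f x b a - g x b a)"
  using bacts_carrier[OF M] bacts_carrier[OF M'] unfolding bacts_def
  by (auto simp: minus_mult_distrib_mat_vec[where ?nr = "m * n" and ?nc = "m * n"]
      bacts_apply[OF M] bacts_apply[OF M'] unblk_minus)

lemma smult_mat_mult_vec:
  fixes A :: "'a :: comm_ring_1 mat"
  assumes "A \<in> carrier_mat k l" "v \<in> carrier_vec l"
  shows "(t \<cdot>\<^sub>m A) *\<^sub>v v = t \<cdot>\<^sub>v (A *\<^sub>v v)"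
  using assms by (auto intro!: eq_vecI simp: scalar_prod_def sum_distrib_left algebra_simps)

lemma bacts_smult:
  fixes M :: "'a :: comm_ring_1 mat"
  assumes M: "bacts m n M f"
  shows "bacts m n (t \<cdot>\<^sub>m M) (\<lambda>x b a. t * f x b a)"
proof -
  have "t \<cdot>\<^sub>m M *\<^sub>v unblk m n x = unblk m n (\<lambda>b a. t * f x b a)" for x
    using bacts_carrier[OF M] bacts_apply[OF M, of x]
    by (simp add: smult_mat_mult_vec unblk_smult)
  then show ?thesis using bacts_carrier[OF M] by (simp add: bacts_def)
qed

lemma mv_add: "mv n A (\<lambda>d. y d + z d) a = mv n A y a + mv n A z a"
  by (simp add: mv_def sum.distrib algebra_simps)

lemma mv_minus: "mv n A (\<lambda>d. y d - z d) a = mv n A y a - (mv n A z a :: 'a :: comm_ring_1)"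
  by (simp add: mv_def sum_subtractf algebra_simps)

lemma mv_uminus: "mv n A (\<lambda>d. - z d) a = - (mv n A z a :: 'a :: comm_ring_1)"
  by (simp add: mv_def sum_negf)

lemma mv_smult: "mv n A (\<lambda>d. t * z d) a = t * (mv n A z a :: 'a :: comm_ring_1)"
  by (simp add: mv_def sum_distrib_left algebra_simps)

lemma mv_zero [simp]: "mv n A (\<lambda>d. 0) a = 0"
  by (simp add: mv_def)

lemma mv_cong: "(\<And>d. d < n \<Longrightarrow> y d = z d) \<Longrightarrow> mv n A y a = mv n A z a"
  by (simp add: mv_def)

section \<open>Fiedler matrices over a commutative ring\<close>

text \<open>The entries of the Fiedler matrices, indexed by block and position in the block.  Unlike \<^const>\<open>fiedler\<close>, the
  resulting matrix makes sense over every commutative ring; it is used over complex numbers, polynomials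
  and rational functions.\<close>

definition fblk :: "nat \<Rightarrow> (nat \<Rightarrow> 'a :: comm_ring_1 mat) \<Rightarrow> int \<Rightarrow> nat \<Rightarrow> nat \<Rightarrow> nat \<Rightarrow> nat \<Rightarrow> 'a" where
  "fblk m c i b b' a a' =
    (if i = 0 then
       (if b = m - 1 \<and> b' = m - 1 then - c 0 $$ (a, a') else if b = b' \<and> a = a' then 1 else 0)
     else if i = - int m then
       (if b = 0 \<and> b' = 0 then c m $$ (a, a') else if b = b' \<and> a = a' then 1 else 0)
     else let p = m - nat \<bar>i\<bar> - 1; q = m - nat \<bar>i\<bar> in
       if b = p \<and> b' = p then (if i > 0 then - c (nat i) $$ (a, a') else 0)
       else if b = q \<and> b' = q then (if i > 0 then 0 else c (nat (- i)) $$ (a, a'))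
       else if b = p \<and> b' = q \<or> b = q \<and> b' = p \<or> b = b' then (if a = a' then 1 else 0)
       else 0)"

definition gfied :: "nat \<Rightarrow> nat \<Rightarrow> (nat \<Rightarrow> 'a :: comm_ring_1 mat) \<Rightarrow> int \<Rightarrow> 'a mat" where
  "gfied m n c i = mat (m * n) (m * n)
     (\<lambda>(r, s). fblk m c i (r div n) (s div n) (r mod n) (s mod n))"

lemma gfied_carrier [simp]: "gfied m n c i \<in> carrier_mat (m * n) (m * n)"
  "dim_row (gfied m n c i) = m * n" "dim_col (gfied m n c i) = m * n"
  by (auto simp: gfied_def)

lemma gfied_index [simp]:
  assumes "b < m" "a < n" "b' < m" "a' < n"
  shows "gfied m n c i $$ (b * n + a, b' * n + a') = fblk m c i b b' a a'"
  using assms by (simp add: gfied_def block_index)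

definition fapp :: "nat \<Rightarrow> nat \<Rightarrow> (nat \<Rightarrow> 'a :: comm_ring_1 mat) \<Rightarrow> int
    \<Rightarrow> (nat \<Rightarrow> nat \<Rightarrow> 'a) \<Rightarrow> nat \<Rightarrow> nat \<Rightarrow> 'a" where
  "fapp m n c i x b =
    (if i = 0 then (if b = m - 1 then (\<lambda>a. - mv n (c 0) (x b) a) else x b)
     else if i = - int m then (if b = 0 then mv n (c m) (x b) else x b)
     else if i > 0 then
       (if b = m - nat i - 1 then (\<lambda>a. x (b + 1) a - mv n (c (nat i)) (x b) a)
        else if b = m - nat i then x (b - 1) else x b)
     else
       (if b = m - nat (- i) - 1 then x (b + 1)
        else if b = m - nat (- i) then (\<lambda>a. x (b - 1) a + mv n (c (nat (- i))) (x b) a)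
        else x b))"

lemma fapp_mid:
  assumes "i \<noteq> 0" "i \<noteq> - int m" "m - nat \<bar>i\<bar> = k + 1"
  shows "fapp m n c i x b = (if i > 0 then
       (if b = k then (\<lambda>a. x (k + 1) a - mv n (c (nat i)) (x k) a)
        else if b = k + 1 then x k else x b)
     else
       (if b = k then x (k + 1)
        else if b = k + 1 then (\<lambda>a. x k a + mv n (c (nat (- i))) (x (k + 1)) a)
        else x b))"
proof (cases "i > 0")
  case True
  then have "m - nat i = k + 1" using assms(3) by simp
  then show ?thesis unfolding fapp_def using True assms(1,2) by simp
next
  case False
  then have "m - nat (- i) = k + 1" using assms(3) by simp
  then show ?thesis unfolding fapp_def using False assms(1,2) by simp
qed

lemma fblk_mid:
  assumes "i \<noteq> 0" "i \<noteq> - int m" "m - nat \<bar>i\<bar> = k + 1"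
  shows "fblk m c i b b' a a' =
        (if b = k \<and> b' = k then (if i > 0 then - c (nat i) $$ (a, a') else 0)
       else if b = k + 1 \<and> b' = k + 1 then (if i > 0 then 0 else c (nat (- i)) $$ (a, a'))
       else if b = k \<and> b' = k + 1 \<or> b = k + 1 \<and> b' = k \<or> b = b' then (if a = a' then 1 else 0)
       else 0)"
  unfolding fblk_def Let_def assms(3) using assms(1,2) by simp

lemma sum_delta_inner:
  fixes x :: "nat \<Rightarrow> 'a :: comm_ring_1"
  assumes "a < n"
  shows "(\<Sum>d<n. (if a = d then 1 else 0) * x d) = x a"
proof -
  have "(\<Sum>d<n. (if a = d then 1 else 0) * x d) = (\<Sum>d<n. if a = d then x d else 0)"
    by (intro sum.cong) auto
  also have "\<dots> = x a" using assms by simp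
  finally show ?thesis .
qed

lemma sum_delta_blocks:
  fixes x :: "nat \<Rightarrow> nat \<Rightarrow> 'a :: comm_ring_1"
  assumes "b < m" "a < n"
  shows "(\<Sum>c<m. \<Sum>d<n. (if b = c \<and> a = d then 1 else 0) * x c d) = x b a"
proof -
  have "(\<Sum>c<m. \<Sum>d<n. (if b = c \<and> a = d then 1 else 0) * x c d)
      = (\<Sum>c<m. if b = c then \<Sum>d<n. (if a = d then 1 else 0) * x c d else 0)"
    by (intro sum.cong refl) (auto intro!: sum.cong)
  also have "\<dots> = (\<Sum>d<n. (if a = d then 1 else 0) * x b d)"
    using assms by (simp add: sum.delta')
  also have "\<dots> = x b a" by (rule sum_delta_inner[OF assms(2)])
  finally show ?thesis .
qed

lemma sum_two:
  fixes f :: "nat \<Rightarrow> 'a :: comm_monoid_add"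
  assumes "p < m" "q < m" "p \<noteq> q" "\<And>c. c < m \<Longrightarrow> c \<noteq> p \<Longrightarrow> c \<noteq> q \<Longrightarrow> f c = 0"
  shows "(\<Sum>c<m. f c) = f p + f q"
proof -
  have "(\<Sum>c<m. f c) = (\<Sum>c\<in>{p, q}. f c)"
    using assms by (intro sum.mono_neutral_right) auto
  then show ?thesis using assms by simp
qed

lemma sum_one:
  fixes f :: "nat \<Rightarrow> 'a :: comm_monoid_add"
  assumes "p < m" "\<And>c. c < m \<Longrightarrow> c \<noteq> p \<Longrightarrow> f c = 0"
  shows "(\<Sum>c<m. f c) = f p"
proof -
  have "(\<Sum>c<m. f c) = (\<Sum>c\<in>{p}. f c)"
    using assms by (intro sum.mono_neutral_right) auto
  then show ?thesis by simp
qed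

definition idx :: "nat \<Rightarrow> int \<Rightarrow> bool" where
  "idx m i \<longleftrightarrow> - int m \<le> i \<and> i < int m"

lemma bacts_gfied:
  fixes c :: "nat \<Rightarrow> 'a :: comm_ring_1 mat"
  assumes i: "idx m i"
  shows "bacts m n (gfied m n c i) (fapp m n c i)"
proof (rule bactsI)
  fix x :: "nat \<Rightarrow> nat \<Rightarrow> 'a" and b a
  assume b: "b < m" and a: "a < n"
  have "(\<Sum>c'<m. \<Sum>d<n. gfied m n c i $$ (b * n + a, c' * n + d) * x c' d)
     = (\<Sum>c'<m. \<Sum>d<n. fblk m c i b c' a d * x c' d)" (is "_ = ?S")
    using a b by (intro sum.cong) auto
  also have "?S = fapp m n c i x b a"
  proof -
    have *: "?S = (\<Sum>d<n. fblk m c i b b a d * x b d)" 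
      if "\<And>c' d. c' < m \<Longrightarrow> c' \<noteq> b \<Longrightarrow> d < n \<Longrightarrow> fblk m c i b c' a d = 0"
      using that b by (intro sum_one) auto
    have diag: "?S = x b a" if "\<And>c' d. fblk m c i b c' a d = (if b = c' \<and> a = d then 1 else 0)"
      using that sum_delta_blocks[OF b a] by simp
    consider "i = 0" "b = m - 1" | "i = 0" "b \<noteq> m - 1"
      | "i = - int m" "i \<noteq> 0" "b = 0" | "i = - int m" "i \<noteq> 0" "b \<noteq> 0"
      | "i \<noteq> 0" "i \<noteq> - int m" by blast
    then show ?thesis
    proof cases
      case 1
      then show ?thesis
        by (subst *) (auto simp: fblk_def fapp_def mv_def sum_negf)
    next
      case 2
      then show ?thesis by (subst diag) (auto simp: fblk_def fapp_def)
    next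
      case 3
      then show ?thesis
        by (subst *) (auto simp: fblk_def fapp_def mv_def)
    next
      case 4
      then show ?thesis by (subst diag) (auto simp: fblk_def fapp_def)
    next
      case 5
      define p where "p = m - nat \<bar>i\<bar> - 1"
      have q: "m - nat \<bar>i\<bar> = p + 1" and pm: "p + 1 < m"
        using 5 i by (auto simp: p_def idx_def)
      note f = fblk_mid[OF 5 q] and g = fapp_mid[OF 5 q]
      have two: "?S = (\<Sum>d<n. fblk m c i b p a d * x p d) + (\<Sum>d<n. fblk m c i b (p + 1) a d * x (p + 1) d)"
        if "b = p \<or> b = p + 1"
        using that pm by (intro sum_two) (auto simp: f)
      consider "b = p" "i > 0" | "b = p" "i < 0" | "b = p + 1" "i > 0" | "b = p + 1" "i < 0" | "b \<noteq> p" "b \<noteq> p + 1"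
        using 5 by linarith
      then show ?thesis
      proof cases
        case 1
        then show ?thesis using two sum_delta_inner[OF a, of "x (p + 1)"]
          by (simp add: f g mv_def sum_negf)
      next
        case 2
        then show ?thesis using two sum_delta_inner[OF a, of "x (p + 1)"] by (simp add: f g)
      next
        case 3
        then show ?thesis using two sum_delta_inner[OF a, of "x p"] by (simp add: f g)
      next
        case 4
        then show ?thesis using two sum_delta_inner[OF a, of "x p"] by (simp add: f g mv_def)
      next
        case c5: 5
        have "fapp m n c i x b = x b" using c5 by (simp add: g)
        moreover have "?S = x b a" by (rule diag) (use c5 in \<open>auto simp: f\<close>)
        ultimately show ?thesis by simp
      qed
    qed
  qed
  finally show "(\<Sum>c'<m. \<Sum>d<n. gfied m n c i $$ (b * n + a, c' * n + d) * x c' d)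
     = fapp m n c i x b a" .
qed simp

lemma block_less:
  fixes a b n k :: nat
  assumes "a < n"
  shows "b * n + a < k * n \<longleftrightarrow> b < k"
proof
  assume "b < k" then show "b * n + a < k * n" using assms by (rule block_index(1))
next
  assume *: "b * n + a < k * n"
  show "b < k"
  proof (rule ccontr)
    assume "\<not> b < k"
    then have "k * n \<le> b * n" by (intro mult_le_mono) auto
    then show False using * by linarith
  qed
qed

lemma block_eq:
  fixes a b n a' b' :: nat
  assumes "a < n" "a' < n"
  shows "b * n + a = b' * n + a' \<longleftrightarrow> b = b' \<and> a = a'"
  using block_index(2,3)[OF lessI assms(1), of b] block_index(2,3)[OF lessI assms(2), of b'] by auto

lemma diag_three_index:
  fixes F :: "'a :: {zero, one} mat"
  assumes F: "F \<in> carrier_mat D D" and R: "R < K + D + L" and S: "S < K + D + L"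
  shows "diag_block_mat [1\<^sub>m K, F, 1\<^sub>m L] $$ (R, S) =
    (if K \<le> R \<and> R < K + D \<and> K \<le> S \<and> S < K + D then F $$ (R - K, S - K)
     else if R = S then 1 else 0)"
  using assms by (auto simp: Let_def)

lemma diag_three_block:
  fixes F :: "'a :: {zero, one} mat"
  assumes F: "F \<in> carrier_mat (2 * n) (2 * n)"
    and b: "b < k + 2 + l" and b': "b' < k + 2 + l" and a: "a < n" and a': "a' < n"
  shows "diag_block_mat [1\<^sub>m (k * n), F, 1\<^sub>m (l * n)] $$ (b * n + a, b' * n + a') =
    (if k \<le> b \<and> b < k + 2 \<and> k \<le> b' \<and> b' < k + 2 then F $$ ((b - k) * n + a, (b' - k) * n + a')
     else if b = b' \<and> a = a' then 1 else 0)"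
proof -
  have less: "b * n + a < k * n + 2 * n + l * n" "b' * n + a' < k * n + 2 * n + l * n"
    using block_index(1)[OF b a] block_index(1)[OF b' a'] by (simp_all add: algebra_simps)
  have iff: "k * n \<le> b * n + a \<longleftrightarrow> k \<le> b" "k * n \<le> b' * n + a' \<longleftrightarrow> k \<le> b'"
    "b * n + a < k * n + 2 * n \<longleftrightarrow> b < k + 2" "b' * n + a' < k * n + 2 * n \<longleftrightarrow> b' < k + 2"
    using block_less[OF a, of b k] block_less[OF a', of b' k]
      block_less[OF a, of b "k + 2"] block_less[OF a', of b' "k + 2"]
    unfolding not_less[symmetric] distrib_right by auto
  have sub: "b * n + a - k * n = (b - k) * n + a" if "k \<le> b" for b a
    using that by (simp add: diff_mult_distrib mult_le_mono1)
  show ?thesis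
    unfolding diag_three_index[OF F less] iff block_eq[OF a a']
    by (simp add: sub cong: if_cong conj_cong)
qed

lemma four_block_index:
  assumes "A \<in> carrier_mat n n" "B \<in> carrier_mat n n" "C \<in> carrier_mat n n" "D \<in> carrier_mat n n"
    and "b < 2" "b' < 2" "a < n" "a' < n"
  shows "four_block_mat A B C D $$ (b * n + a, b' * n + a') =
    (if b = 0 \<and> b' = 0 then A else if b = 0 then B else if b' = 0 then C else D) $$ (a, a')"
  using assms by (auto simp: less_2_cases_iff)

lemma fiedler_carrier:
  assumes c: "\<And>i. c i \<in> carrier_mat n n" and i: "idx m i"
  shows "fiedler m n c i \<in> carrier_mat (m * n) (m * n)"
proof -
  have [simp]: "dim_row (c i) = n" "dim_col (c i) = n" for i using c[of i] by auto
  have m: "0 < m" using i by (auto simp: idx_def)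
  have "(m - Suc 0) * n + n = m * n" using m by (cases m) auto
  moreover have "(m - nat j - 1) * n + (n + n + (nat j - 1) * n) = m * n" if j: "0 < j" "j < int m" for j
  proof -
    have "(m - nat j - 1) + 2 + (nat j - 1) = m" using j by linarith
    then show ?thesis by (metis (no_types, lifting) add.assoc distrib_right mult_2)
  qed
  ultimately show ?thesis using i
    by (intro carrier_matI) (auto simp: fiedler_def Let_def idx_def add.commute)
qed

lemma diag_two_index:
  assumes "A \<in> carrier_mat k k" "B \<in> carrier_mat l l" "R < k + l" "S < k + l"
  shows "diag_block_mat [A, B] $$ (R, S) =
    (if R < k \<and> S < k then A $$ (R, S) else if k \<le> R \<and> k \<le> S then B $$ (R - k, S - k) else 0)"
  using assms by (auto simp: Let_def)

lemma four_block_index_cases: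
  assumes "A \<in> carrier_mat n n" "B \<in> carrier_mat n n" "C \<in> carrier_mat n n" "D \<in> carrier_mat n n"
    and a: "a < n" "a' < n" and b: "k \<le> b" "b < k + 2" "k \<le> b'" "b' < k + 2"
  shows "four_block_mat A B C D $$ ((b - k) * n + a, (b' - k) * n + a') =
    (if b = k \<and> b' = k then A else if b = k then B else if b' = k then C else D) $$ (a, a')"
proof -
  have "b - k = 0 \<longleftrightarrow> b = k" "b' - k = 0 \<longleftrightarrow> b' = k" using b by auto
  then show ?thesis
    using four_block_index[OF assms(1-4) _ _ a, of "b - k" "b' - k"] b by simp
qed

lemma fiedler_eq_gfied:
  assumes c: "\<And>i. c i \<in> carrier_mat n n" and i: "idx m i"
  shows "fiedler m n c i = gfied m n c i"
proof (rule eq_matI)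
  have [simp]: "dim_row (c i) = n" "dim_col (c i) = n" for i using c[of i] by auto
  fix r s
  assume "r < dim_row (gfied m n c i)" "s < dim_col (gfied m n c i)"
  then obtain b a b' a' where *: "b < m" "a < n" "b' < m" "a' < n"
    and rs: "r = b * n + a" "s = b' * n + a'"
    by (auto elim!: block_cases)
  have m: "0 < m" using i by (auto simp: idx_def)
  have eq: "b * n + a = b' * n + a' \<longleftrightarrow> b = b' \<and> a = a'" by (rule block_eq) (use * in auto)
  consider "i = 0" | "i \<noteq> 0" "i = - int m" | "i \<noteq> 0" "i \<noteq> - int m" by blast
  then show "fiedler m n c i $$ (r, s) = gfied m n c i $$ (r, s)"
  proof cases
    case 1
    have mn: "m * n = (m - 1) * n + n" using m by (cases m) auto
    have "b * n + a < (m - 1) * n \<longleftrightarrow> b < m - 1" "b' * n + a' < (m - 1) * n \<longleftrightarrow> b' < m - 1"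
      by (rule block_less; use * in simp)+
    moreover have "b = m - 1" if "\<not> b < m - 1" using that * by linarith
    moreover have "b' = m - 1" if "\<not> b' < m - 1" using that * by linarith
    moreover have "b * n + a < (m - 1) * n + n" "b' * n + a' < (m - 1) * n + n"
      using block_index(1)[OF *(1,2)] block_index(1)[OF *(3,4)] mn by auto
    ultimately show ?thesis using 1 * m unfolding rs
      by (auto simp: fiedler_def fblk_def Let_def eq)
  next
    case 2
    have mn: "m * n = n + (m - 1) * n" using m by (cases m) auto
    have zero: "b * n + a < n \<longleftrightarrow> b = 0" "b' * n + a' < n \<longleftrightarrow> b' = 0"
      using block_less[of a n b 1] block_less[of a' n b' 1] * by auto
    have R: "b * n + a < n + (m - 1) * n" and S: "b' * n + a' < n + (m - 1) * n"
      using block_index(1)[OF *(1,2)] block_index(1)[OF *(3,4)] mn by auto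
    have F: "fiedler m n c i = diag_block_mat [c m, 1\<^sub>m ((m - 1) * n)]"
      using 2 m by (simp add: fiedler_def)
    have "b * n + a - n < (m - 1) * n" "b' * n + a' - n < (m - 1) * n" if "n \<le> b * n + a" "n \<le> b' * n + a'"
      using that R S by linarith+
    moreover have "b * n + a - n = b' * n + a' - n \<longleftrightarrow> b * n + a = b' * n + a'"
      if "n \<le> b * n + a" "n \<le> b' * n + a'"
      using that by linarith
    ultimately have "(1\<^sub>m ((m - 1) * n) :: complex mat) $$ (b * n + a - n, b' * n + a' - n) = (if b = b' \<and> a = a' then 1 else 0)"
      if "n \<le> b * n + a" "n \<le> b' * n + a'"
      using that unfolding eq by (subst index_one_mat) auto
    then have "fiedler m n c i $$ (r, s) = fblk m c i b b' a a'"
      unfolding F rs by (subst diag_two_index[OF c one_carrier_mat R S])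
        (use 2 m in \<open>auto simp: zero not_less[symmetric] fblk_def\<close>)
    then show ?thesis unfolding rs gfied_index[OF *] .
  next
    case 3
    define k l where "k = m - nat \<bar>i\<bar> - 1" and "l = nat \<bar>i\<bar> - 1"
    have ml: "m = k + 2 + l" using 3 i by (auto simp: k_def l_def idx_def)
    have q: "m - nat \<bar>i\<bar> = k + 1" using 3 i by (auto simp: k_def l_def idx_def)
    have f: "fblk m c i b b' a a' =
        (if b = k \<and> b' = k then (if i > 0 then - c (nat i) $$ (a, a') else 0)
       else if b = k + 1 \<and> b' = k + 1 then (if i > 0 then 0 else c (nat (- i)) $$ (a, a'))
       else if b = k \<and> b' = k + 1 \<or> b = k + 1 \<and> b' = k \<or> b = b' then (if a = a' then 1 else 0)
       else 0)"
      using fblk_mid[OF 3 q] .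
    show ?thesis
    proof (cases "i > 0")
      case True
      have F: "fiedler m n c i = diag_block_mat [1\<^sub>m (k * n),
          four_block_mat (- c (nat i)) (1\<^sub>m n) (1\<^sub>m n) (0\<^sub>m n n), 1\<^sub>m (l * n)]"
        using True 3 by (simp add: fiedler_def k_def l_def)
      have "fiedler m n c i $$ (r, s) = (if k \<le> b \<and> b < k + 2 \<and> k \<le> b' \<and> b' < k + 2
          then (if b = k \<and> b' = k then - c (nat i) else if b = k then 1\<^sub>m n else if b' = k then 1\<^sub>m n else 0\<^sub>m n n) $$ (a, a')
          else if b = b' \<and> a = a' then 1 else 0)"
        unfolding F rs
        by (subst diag_three_block[OF _ *(1,3)[unfolded ml] *(2,4)])
          (auto simp: c four_block_index_cases[OF _ _ _ _ *(2,4)])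
      also have "\<dots> = fblk m c i b b' a a'"
        unfolding f using True * by auto
      finally show ?thesis unfolding rs gfied_index[OF *] .
    next
      case False
      then have ng: "nat (- i) = nat \<bar>i\<bar>" by simp
      have F: "fiedler m n c i = diag_block_mat [1\<^sub>m (k * n),
          four_block_mat (0\<^sub>m n n) (1\<^sub>m n) (1\<^sub>m n) (c (nat (- i))), 1\<^sub>m (l * n)]"
        using False 3 ng by (simp add: fiedler_def k_def l_def)
      have "fiedler m n c i $$ (r, s) = (if k \<le> b \<and> b < k + 2 \<and> k \<le> b' \<and> b' < k + 2
          then (if b = k \<and> b' = k then 0\<^sub>m n n else if b = k then 1\<^sub>m n else if b' = k then 1\<^sub>m n else c (nat (- i))) $$ (a, a')
          else if b = b' \<and> a = a' then 1 else 0)"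
        unfolding F rs
        by (subst diag_three_block[OF _ *(1,3)[unfolded ml] *(2,4)])
          (auto simp: c four_block_index_cases[OF _ _ _ _ *(2,4)])
      also have "\<dots> = fblk m c i b b' a a'"
        unfolding f using False * by auto
      finally show ?thesis unfolding rs gfied_index[OF *] .
    qed
  qed
qed (use fiedler_carrier[of c, OF c i] in auto)

section \<open>Products of Fiedler matrices\<close>

text \<open>The block rows that the Fiedler matrix with index \<open>i\<close> does not fix: a pair of neighbours, or a single block
  for the two extreme indices.\<close>

definition pr :: "nat \<Rightarrow> int \<Rightarrow> nat set" where
  "pr m i = {b. b < m \<and> (int b = int m - \<bar>i\<bar> - 1 \<or> int b = int m - \<bar>i\<bar>)}"

lemma idx_cases:
  assumes "idx m i"
  obtains (zero) "i = 0" "pr m i = {m - 1}" "0 < m" | (low) "i = - int m" "i \<noteq> 0" "pr m i = {0}" "0 < m"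
    | (mid) k where "i \<noteq> 0" "i \<noteq> - int m" "m - nat \<bar>i\<bar> = k + 1" "k + 1 < m" "pr m i = {k, k + 1}"
proof -
  consider "i = 0" | "i = - int m" "i \<noteq> 0" | "i \<noteq> 0" "i \<noteq> - int m" by blast
  then show thesis
  proof cases
    case 1 then show thesis using assms by (intro zero) (auto simp: pr_def idx_def)
  next
    case 2 then show thesis using assms by (intro low) (auto simp: pr_def idx_def)
  next
    case 3 then show thesis using assms
      by (intro mid[of "m - nat \<bar>i\<bar> - 1"]) (auto simp: pr_def idx_def)
  qed
qed

lemma fapp_outside:
  assumes "idx m i" "b < m" "b \<notin> pr m i"
  shows "fapp m n c i x b = x b"
  using assms(1)
proof (cases rule: idx_cases)
  case zero then show ?thesis using assms by (simp add: fapp_def)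
next
  case low then show ?thesis using assms by (simp add: fapp_def)
next
  case (mid k) then show ?thesis using assms by (simp add: fapp_mid)
qed

lemma fapp_local:
  assumes "idx m i" "\<And>b. b \<in> pr m i \<Longrightarrow> x b = y b" "b \<in> pr m i"
  shows "fapp m n c i x b = fapp m n c i y b"
  using assms(1)
proof (cases rule: idx_cases)
  case zero then show ?thesis using assms by (simp add: fapp_def)
next
  case low then show ?thesis using assms by (simp add: fapp_def)
next
  case (mid k) then show ?thesis using assms by (auto simp: fapp_mid)
qed

definition far :: "int \<Rightarrow> int \<Rightarrow> bool" where
  "far i j \<longleftrightarrow> 2 \<le> \<bar>\<bar>i\<bar> - \<bar>j\<bar>\<bar>"

lemma far_sym: "far i j \<longleftrightarrow> far j i"
  by (auto simp: far_def)

lemma far_disjoint: "far i j \<Longrightarrow> pr m i \<inter> pr m j = {}"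
  by (auto simp: far_def pr_def)

lemma fapp_commute:
  assumes "idx m i" "idx m j" "far i j" "b < m"
  shows "fapp m n c i (fapp m n c j x) b = fapp m n c j (fapp m n c i x) b"
proof -
  have disj: "d \<notin> pr m j" if "d \<in> pr m i" for d using far_disjoint[OF assms(3)] that by blast
  have lt: "d < m" if "d \<in> pr m i" for i d using that by (simp add: pr_def)
  consider "b \<in> pr m i" | "b \<in> pr m j" "b \<notin> pr m i" | "b \<notin> pr m i" "b \<notin> pr m j" by blast
  then show ?thesis
  proof cases
    case 1
    then show ?thesis using assms disj lt
      by (simp add: fapp_outside[of m j] fapp_local[of m i "fapp m n c j x" x])
  next
    case 2
    then show ?thesis using assms disj lt
      by (subst fapp_outside[OF assms(1)], simp_all)
        (metis fapp_local fapp_outside disj)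
  next
    case 3
    then show ?thesis using assms by (simp add: fapp_outside)
  qed
qed

lemma gfied_commute:
  assumes "idx m i" "idx m j" "far i j"
  shows "gfied m n c i * gfied m n c j = gfied m n c j * gfied m n c i"
  by (rule bacts_eqI[OF bacts_mult[OF bacts_gfied bacts_gfied] bacts_mult[OF bacts_gfied bacts_gfied]])
    (simp_all add: assms fapp_commute[OF assms])

lemma gfied_inverse:
  assumes "0 < \<bar>i\<bar>" "\<bar>i\<bar> < int m"
  shows "gfied m n c i * gfied m n c (- i) = 1\<^sub>m (m * n)"
proof -
  have i: "idx m i" "idx m (- i)" using assms by (auto simp: idx_def)
  show ?thesis
  proof (rule bacts_eqI[OF bacts_mult[OF bacts_gfied[OF i(1)] bacts_gfied[OF i(2)]] bacts_one])
    fix x :: "nat \<Rightarrow> nat \<Rightarrow> 'a" and b a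
    assume "b < m" "a < n"
    define k where "k = m - nat \<bar>i\<bar> - 1"
    have k: "m - nat \<bar>i\<bar> = k + 1" "m - nat \<bar>- i\<bar> = k + 1" using assms by (auto simp: k_def)
    have ne: "i \<noteq> 0" "i \<noteq> - int m" "- i \<noteq> 0" "- i \<noteq> - int m" using assms by auto
    show "fapp m n c i (fapp m n c (- i) x) b a = x b a"
      unfolding fapp_mid[OF ne(1,2) k(1)] fapp_mid[OF ne(3,4) k(2)] using ne by auto
  qed
qed

definition gprod :: "nat \<Rightarrow> (int \<Rightarrow> 'a :: semiring_1 mat) \<Rightarrow> int list \<Rightarrow> 'a mat" where
  "gprod N M t = foldr (\<lambda>i X. M i * X) t (1\<^sub>m N)"

lemma tuple_prod_eq_gprod: "tuple_prod = gprod"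
  by (intro ext) (simp add: tuple_prod_def gprod_def)

lemma gprod_Nil [simp]: "gprod N M [] = 1\<^sub>m N"
  and gprod_Cons [simp]: "gprod N M (i # t) = M i * gprod N M t"
  by (simp_all add: gprod_def)

lemma gprod_carrier:
  "(\<And>i. i \<in> set t \<Longrightarrow> M i \<in> carrier_mat N N) \<Longrightarrow> gprod N M t \<in> carrier_mat N N"
  by (induction t) (auto intro!: mult_carrier_mat)

lemma gprod_gfied_carrier [simp]:
  "gprod (m * n) (gfied m n c) t \<in> carrier_mat (m * n) (m * n)"
  "dim_row (gprod (m * n) (gfied m n c) t) = m * n"
  "dim_col (gprod (m * n) (gfied m n c) t) = m * n"
  using gprod_carrier[of t "gfied m n c" "m * n"] by auto

lemma gprod_append:
  assumes "\<And>i. i \<in> set s \<union> set t \<Longrightarrow> M i \<in> carrier_mat N N"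
  shows "gprod N M (s @ t) = gprod N M s * gprod N M t"
  using assms
proof (induction s)
  case Nil
  then show ?case using gprod_carrier[of t M N] by (simp add: left_mult_one_mat)
next
  case (Cons i s)
  have "gprod N M s \<in> carrier_mat N N" "gprod N M t \<in> carrier_mat N N" "M i \<in> carrier_mat N N"
    using Cons.prems by (auto intro!: gprod_carrier)
  then show ?case using Cons by (simp add: assoc_mult_mat[of _ N N _ N _ N])
qed

lemma gprod_snoc:
  assumes "\<And>j. j \<in> set t \<Longrightarrow> M j \<in> carrier_mat N N" "M i \<in> carrier_mat N N"
  shows "gprod N M (t @ [i]) = gprod N M t * M i"
proof -
  have "gprod N M (t @ [i]) = gprod N M t * gprod N M [i]"
    by (rule gprod_append) (use assms in auto)
  then show ?thesis using assms(2) by simp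
qed

lemma gprod_cong:
  "(\<And>i. i \<in> set t \<Longrightarrow> M i = M' i) \<Longrightarrow> gprod N M t = gprod N M' t"
  by (induction t) auto

lemma mat_commute_gprod:
  assumes X: "X \<in> carrier_mat N N" and M: "\<And>i. i \<in> set t \<Longrightarrow> M i \<in> carrier_mat N N"
    and c: "\<And>i. i \<in> set t \<Longrightarrow> X * M i = M i * X"
  shows "X * gprod N M t = gprod N M t * X"
  using M c
proof (induction t)
  case Nil
  then show ?case using X by simp
next
  case (Cons i t)
  have car: "gprod N M t \<in> carrier_mat N N" "M i \<in> carrier_mat N N"
    using Cons.prems by (auto intro!: gprod_carrier)
  have "X * gprod N M (i # t) = (X * M i) * gprod N M t"
    using X car by (simp add: assoc_mult_mat[of _ N N _ N _ N])
  also have "\<dots> = M i * (X * gprod N M t)"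
    using X car Cons.prems by (simp add: assoc_mult_mat[of _ N N _ N _ N])
  also have "\<dots> = gprod N M (i # t) * X"
    using X car Cons by (simp add: assoc_mult_mat[of _ N N _ N _ N])
  finally show ?case .
qed

lemma gprod_commute:
  assumes M: "\<And>i. i \<in> set s \<union> set t \<Longrightarrow> M i \<in> carrier_mat N N"
    and c: "\<And>i j. i \<in> set s \<Longrightarrow> j \<in> set t \<Longrightarrow> M i * M j = M j * M i"
  shows "gprod N M s * gprod N M t = gprod N M t * gprod N M s"
proof (rule mat_commute_gprod)
  show "gprod N M s \<in> carrier_mat N N" using M by (auto intro!: gprod_carrier)
  fix i assume i: "i \<in> set t"
  show "gprod N M s * M i = M i * gprod N M s"
    using mat_commute_gprod[of "M i" N s M] M c i by force
qed (use M in auto)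

lemma gprod_rev:
  assumes M: "\<And>i. i \<in> set t \<Longrightarrow> M i \<in> carrier_mat N N"
    and c: "\<And>i j. i \<in> set t \<Longrightarrow> j \<in> set t \<Longrightarrow> M i * M j = M j * M i"
  shows "gprod N M (rev t) = gprod N M t"
  using assms
proof (induction t)
  case (Cons i t)
  have "gprod N M (rev (i # t)) = gprod N M (rev t) * M i"
    using Cons.prems gprod_snoc[of "rev t" M N i] by simp
  also have "\<dots> = gprod N M t * M i" using Cons by simp
  also have "\<dots> = M i * gprod N M t" 
    using Cons.prems by (intro mat_commute_gprod[symmetric]) simp_all
  finally show ?case by simp
qed simp

lemma gprod_inverse:
  assumes M: "\<And>i. i \<in> set t \<Longrightarrow> M i \<in> carrier_mat N N \<and> M (- i) \<in> carrier_mat N N \<and> M i * M (- i) = 1\<^sub>m N"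
  shows "gprod N M t * gprod N M (rev (map uminus t)) = 1\<^sub>m N"
  using assms
proof (induction t)
  case (Cons i t)
  let ?A = "gprod N M t" and ?B = "gprod N M (rev (map uminus t))"
  have car: "?A \<in> carrier_mat N N" "?B \<in> carrier_mat N N" "M i \<in> carrier_mat N N" "M (- i) \<in> carrier_mat N N"
    using Cons.prems by (auto intro!: gprod_carrier)
  have "gprod N M (rev (map uminus (i # t))) = ?B * M (- i)"
    using Cons.prems car gprod_snoc[of "rev (map uminus t)" M N "- i"] by auto
  then have "gprod N M (i # t) * gprod N M (rev (map uminus (i # t))) = M i * (?A * ?B) * M (- i)"
    using car by (simp add: assoc_mult_mat[of _ N N _ N _ N])
  also have "\<dots> = 1\<^sub>m N" using Cons by (simp add: right_mult_one_mat[OF car(3)])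
  finally show ?case .
qed simp

lemma gprod_gfied_inverse:
  assumes "\<And>i. i \<in> set t \<Longrightarrow> 0 < \<bar>i\<bar> \<and> \<bar>i\<bar> < int m"
  shows "gprod (m * n) (gfied m n c) t * gprod (m * n) (gfied m n c) (rev (map uminus t)) = 1\<^sub>m (m * n)"
    "gprod (m * n) (gfied m n c) (rev (map uminus t)) * gprod (m * n) (gfied m n c) t = 1\<^sub>m (m * n)"
proof -
  show "gprod (m * n) (gfied m n c) t * gprod (m * n) (gfied m n c) (rev (map uminus t)) = 1\<^sub>m (m * n)"
    by (rule gprod_inverse) (use assms in \<open>auto intro!: gfied_inverse\<close>)
  have "gprod (m * n) (gfied m n c) (rev (map uminus t))
     * gprod (m * n) (gfied m n c) (rev (map uminus (rev (map uminus t)))) = 1\<^sub>m (m * n)"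
    by (rule gprod_inverse) (use assms in \<open>auto intro!: gfied_inverse\<close>)
  then show "gprod (m * n) (gfied m n c) (rev (map uminus t)) * gprod (m * n) (gfied m n c) t = 1\<^sub>m (m * n)"
    by (simp add: comp_def flip: rev_map)
qed

lemma transpose_gprod:
  assumes "\<And>i. i \<in> set t \<Longrightarrow> M i \<in> carrier_mat N N"
  shows "(gprod N M t)\<^sup>T = gprod N (\<lambda>i. (M i :: 'a :: comm_semiring_1 mat)\<^sup>T) (rev t)"
  using assms
proof (induction t)
  case (Cons i t)
  have car: "gprod N M t \<in> carrier_mat N N" "M i \<in> carrier_mat N N"
    using Cons.prems by (auto intro!: gprod_carrier)
  have "gprod N (\<lambda>i. (M i)\<^sup>T) (rev t @ [i]) = gprod N (\<lambda>i. (M i)\<^sup>T) (rev t) * (M i)\<^sup>T"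
    by (rule gprod_snoc) (use Cons.prems in auto)
  then show ?case using Cons car
    by (simp add: transpose_mult[of _ N N _ N])
qed simp

lemma transpose_gfied:
  assumes "\<And>i. c i \<in> carrier_mat n n" "idx m i"
  shows "(gfied m n c i)\<^sup>T = gfied m n (\<lambda>i. (c i)\<^sup>T) i"
proof (rule eq_matI)
  have [simp]: "dim_row (c i) = n" "dim_col (c i) = n" for i using assms(1)[of i] by auto
  fix r s assume "r < dim_row (gfied m n (\<lambda>i. (c i)\<^sup>T) i)" "s < dim_col (gfied m n (\<lambda>i. (c i)\<^sup>T) i)"
  then obtain b a b' a' where *: "b < m" "a < n" "b' < m" "a' < n"
    and rs: "r = b * n + a" "s = b' * n + a'"
    by (auto elim!: block_cases)
  have "fblk m c i b' b a' a = fblk m (\<lambda>i. (c i)\<^sup>T) i b b' a a'"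
    using assms(2)
  proof (cases rule: idx_cases)
    case zero then show ?thesis using * by (auto simp: fblk_def)
  next
    case low then show ?thesis using * by (auto simp: fblk_def)
  next
    case (mid k) then show ?thesis using * unfolding fblk_mid[OF mid(1-3)] by auto
  qed
  then show "(gfied m n c i)\<^sup>T $$ (r, s) = gfied m n (\<lambda>i. (c i)\<^sup>T) i $$ (r, s)"
    using * by (simp add: rs block_index)
qed auto

lemma (in comm_ring_hom) map_gfied:
  assumes "\<And>i. c i \<in> carrier_mat n n" "idx m i"
  shows "map_mat hom (gfied m n c i) = gfied m n (\<lambda>i. map_mat hom (c i)) i"
proof (rule eq_matI)
  have [simp]: "dim_row (c i) = n" "dim_col (c i) = n" for i using assms(1)[of i] by auto
  fix r s assume "r < dim_row (gfied m n (\<lambda>i. map_mat hom (c i)) i)" "s < dim_col (gfied m n (\<lambda>i. map_mat hom (c i)) i)"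
  then obtain b a b' a' where *: "b < m" "a < n" "b' < m" "a' < n"
    and rs: "r = b * n + a" "s = b' * n + a'"
    by (auto elim!: block_cases)
  have "hom (fblk m c i b b' a a') = fblk m (\<lambda>i. map_mat hom (c i)) i b b' a a'"
    using assms(2)
  proof (cases rule: idx_cases)
    case zero then show ?thesis using * by (auto simp: fblk_def hom_distribs)
  next
    case low then show ?thesis using * by (auto simp: fblk_def)
  next
    case (mid k) then show ?thesis using * unfolding fblk_mid[OF mid(1-3)] by (auto simp: hom_distribs)
  qed
  then show "map_mat hom (gfied m n c i) $$ (r, s) = gfied m n (\<lambda>i. map_mat hom (c i)) i $$ (r, s)"
    using * by (simp add: rs block_index)
qed auto

lemma (in semiring_hom) map_gprod:
  assumes "\<And>i. i \<in> set t \<Longrightarrow> M i \<in> carrier_mat N N"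
  shows "map_mat hom (gprod N M t) = gprod N (\<lambda>i. map_mat hom (M i)) t"
  using assms
proof (induction t)
  case (Cons i t)
  have car: "gprod N M t \<in> carrier_mat N N" "M i \<in> carrier_mat N N"
    using Cons.prems by (auto intro!: gprod_carrier)
  show ?case using Cons car by (simp add: mat_hom_mult[OF car(2,1)])
qed (simp add: mat_hom_one)

section \<open>Actions of products\<close>

definition gapp :: "nat \<Rightarrow> nat \<Rightarrow> (nat \<Rightarrow> 'a :: comm_ring_1 mat) \<Rightarrow> int list
    \<Rightarrow> (nat \<Rightarrow> nat \<Rightarrow> 'a) \<Rightarrow> nat \<Rightarrow> nat \<Rightarrow> 'a" where
  "gapp m n c t x = foldr (fapp m n c) t x"

lemma gapp_Nil [simp]: "gapp m n c [] x = x"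
  and gapp_Cons [simp]: "gapp m n c (i # t) x = fapp m n c i (gapp m n c t x)"
  and gapp_append [simp]: "gapp m n c (s @ t) x = gapp m n c s (gapp m n c t x)"
  by (simp_all add: gapp_def)

lemma bacts_gprod:
  assumes "\<And>i. i \<in> set t \<Longrightarrow> idx m i"
  shows "bacts m n (gprod (m * n) (gfied m n c) t) (gapp m n c t)"
  using assms
proof (induction t)
  case Nil
  show ?case by (simp add: bacts_one gapp_def)
next
  case (Cons i t)
  show ?case using bacts_mult[OF bacts_gfied[of m i n c] Cons.IH] Cons.prems
    by simp
qed

lemma gapp_outside:
  assumes "\<And>i. i \<in> set t \<Longrightarrow> idx m i" "\<And>i. i \<in> set t \<Longrightarrow> b \<notin> pr m i" "b < m"
  shows "gapp m n c t x b = x b"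
  using assms by (induction t) (auto simp: fapp_outside)

definition single :: "nat \<Rightarrow> (nat \<Rightarrow> 'a :: zero) \<Rightarrow> nat \<Rightarrow> nat \<Rightarrow> 'a" where
  "single b y = (\<lambda>c a. if c = b then y a else 0)"

text \<open>The matrix $e_b \otimes I_n$, with blocks counted from 0.  The borders of the linearization are multiples of it.\<close>

definition Ecol :: "nat \<Rightarrow> nat \<Rightarrow> nat \<Rightarrow> 'a :: semiring_1 mat" where
  "Ecol m n b = mat (m * n) n (\<lambda>(r, a). if r = b * n + a then 1 else 0)"

lemma Ecol_carrier [simp]: "Ecol m n b \<in> carrier_mat (m * n) n"
  "dim_row (Ecol m n b) = m * n" "dim_col (Ecol m n b) = n"
  by (auto simp: Ecol_def)

lemma Ecol_mult_vec:
  assumes "b < m"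
  shows "Ecol m n b *\<^sub>v vec n y = unblk m n (single b (y :: nat \<Rightarrow> 'a :: comm_ring_1))"
proof (rule eq_vecI)
  fix r assume "r < dim_vec (unblk m n (single b y))"
  then obtain b' a where *: "b' < m" "a < n" "r = b' * n + a"
    by (auto elim: block_cases)
  have "(Ecol m n b *\<^sub>v vec n y) $ r = (\<Sum>d<n. (if b' = b \<and> a = d then 1 else 0) * y d)"
    using * by (simp add: scalar_prod_def atLeast0LessThan Ecol_def block_index block_eq)
  also have "\<dots> = single b y b' a"
    using sum_delta_inner[OF *(2), of y] by (cases "b' = b") (auto simp: single_def)
  finally show "(Ecol m n b *\<^sub>v vec n y) $ r = unblk m n (single b y) $ r"
    using * by simp
qed simp

lemma Erow_mult_vec:
  assumes "b < m"
  shows "(Ecol m n b)\<^sup>T *\<^sub>v unblk m n x = vec n (x b :: nat \<Rightarrow> 'a :: comm_ring_1)"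
proof (rule eq_vecI)
  fix a assume "a < dim_vec (vec n (x b))"
  then have a: "a < n" by simp
  have "((Ecol m n b)\<^sup>T *\<^sub>v unblk m n x) $ a
      = (\<Sum>s<m * n. (if s = b * n + a then 1 else 0) * unblk m n x $ s)"
    using a by (simp add: scalar_prod_def atLeast0LessThan Ecol_def)
  also have "\<dots> = x b a"
    by (subst sum_one[of "b * n + a"]) (use assms a in \<open>auto simp: block_index\<close>)
  finally show "((Ecol m n b)\<^sup>T *\<^sub>v unblk m n x) $ a = vec n (x b) $ a" using a by simp
qed simp

lemma bacts_Ecol:
  fixes M :: "'a :: comm_ring_1 mat"
  assumes M: "bacts m n M f" and b: "b < m" "b' < m"
    and f: "\<And>y c a. c < m \<Longrightarrow> a < n \<Longrightarrow> f (single b y) c a = single b' y c a"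
  shows "M * Ecol m n b = Ecol m n b'"
proof (rule mat_eq_via_vec)
  fix v :: "'a vec" assume v: "v \<in> carrier_vec n"
  have veq: "v = vec n (\<lambda>a. v $ a)" using v by auto
  have "(M * Ecol m n b) *\<^sub>v v = M *\<^sub>v (Ecol m n b *\<^sub>v v)"
    using bacts_carrier[OF M] v by (intro assoc_mult_mat_vec) auto
  also have "\<dots> = Ecol m n b' *\<^sub>v v"
    by (subst (1 2) veq) (simp add: Ecol_mult_vec b bacts_apply[OF M] unblk_eq_iff f)
  finally show "(M * Ecol m n b) *\<^sub>v v = Ecol m n b' *\<^sub>v v" .
qed (use bacts_carrier[OF M] in auto)

lemma bacts_Erow:
  fixes M :: "'a :: comm_ring_1 mat"
  assumes M: "bacts m n M f" and b: "b < m" "b' < m"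
    and f: "\<And>x a. a < n \<Longrightarrow> f x b a = x b' a"
  shows "(Ecol m n b)\<^sup>T * M = (Ecol m n b')\<^sup>T"
proof (rule mat_eq_via_vec)
  fix v :: "'a vec" assume v: "v \<in> carrier_vec (m * n)"
  have "((Ecol m n b)\<^sup>T * M) *\<^sub>v unblk m n x = (Ecol m n b')\<^sup>T *\<^sub>v unblk m n x" for x
  proof -
    have "((Ecol m n b)\<^sup>T * M) *\<^sub>v unblk m n x = (Ecol m n b)\<^sup>T *\<^sub>v (M *\<^sub>v unblk m n x)"
      using bacts_carrier[OF M] by (intro assoc_mult_mat_vec) auto
    also have "\<dots> = (Ecol m n b')\<^sup>T *\<^sub>v unblk m n x"
      using f by (auto simp: bacts_apply[OF M] Erow_mult_vec b)
    finally show ?thesis .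
  qed
  from this[of "blk n v"] show "((Ecol m n b)\<^sup>T * M) *\<^sub>v v = (Ecol m n b')\<^sup>T *\<^sub>v v"
    using v by (simp add: unblk_blk)
qed (use bacts_carrier[OF M] in auto)

section \<open>Invertible matrices over a subring\<close>

definition subring_set :: "'a :: comm_ring_1 set \<Rightarrow> bool" where
  "subring_set R \<longleftrightarrow> 1 \<in> R \<and> (\<forall>x\<in>R. \<forall>y\<in>R. x + y \<in> R \<and> x * y \<in> R) \<and> (\<forall>x\<in>R. - x \<in> R)"

lemma subring_setD:
  assumes "subring_set R"
  shows "1 \<in> R" "0 \<in> R" "x \<in> R \<Longrightarrow> y \<in> R \<Longrightarrow> x + y \<in> R"
    "x \<in> R \<Longrightarrow> y \<in> R \<Longrightarrow> x * y \<in> R" "x \<in> R \<Longrightarrow> - x \<in> R"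
proof -
  show *: "1 \<in> R" "x \<in> R \<Longrightarrow> y \<in> R \<Longrightarrow> x + y \<in> R"
    "x \<in> R \<Longrightarrow> y \<in> R \<Longrightarrow> x * y \<in> R" "x \<in> R \<Longrightarrow> - x \<in> R" for x y
    using assms by (auto simp: subring_set_def)
  show "0 \<in> R" using *(1) *(2)[of 1 "- 1"] *(4)[of 1] by simp
qed

lemma subring_sum:
  assumes "subring_set R" "\<And>i. i \<in> S \<Longrightarrow> f i \<in> R"
  shows "sum f S \<in> R"
  using assms(2) by (induction S rule: infinite_finite_induct) (auto intro: subring_setD[OF assms(1)])

definition over :: "'a set \<Rightarrow> 'a mat \<Rightarrow> bool" where
  "over R M \<longleftrightarrow> (\<forall>i<dim_row M. \<forall>j<dim_col M. M $$ (i, j) \<in> R)"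

lemma over_one: "subring_set R \<Longrightarrow> over R (1\<^sub>m k)"
  by (auto simp: over_def subring_setD)

lemma over_mult: "subring_set R \<Longrightarrow> over R A \<Longrightarrow> over R B \<Longrightarrow> dim_col A = dim_row B \<Longrightarrow> over R (A * B)"
  by (auto simp: over_def scalar_prod_def intro!: subring_sum subring_setD(4))

lemma over_add: "subring_set R \<Longrightarrow> over R A \<Longrightarrow> over R B \<Longrightarrow> A \<in> carrier_mat k l \<Longrightarrow> B \<in> carrier_mat k l \<Longrightarrow> over R (A + B)"
  by (auto simp: over_def subring_setD(3))

lemma over_smult: "subring_set R \<Longrightarrow> over R A \<Longrightarrow> t \<in> R \<Longrightarrow> over R (t \<cdot>\<^sub>m A)"
  by (auto simp: over_def subring_setD(4))

lemma over_uminus: "subring_set R \<Longrightarrow> over R A \<Longrightarrow> over R (- A)"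
  by (auto simp: over_def subring_setD(5))

text \<open>Invertibility inside the matrices over a subring.  For the whole ring of polynomials it is
  unimodularity, for the proper rational functions it implies biproperness.\<close>

definition inv_over :: "'a :: comm_ring_1 set \<Rightarrow> nat \<Rightarrow> 'a mat \<Rightarrow> bool" where
  "inv_over R N U \<longleftrightarrow> U \<in> carrier_mat N N \<and> over R U \<and>
     (\<exists>U' \<in> carrier_mat N N. over R U' \<and> U * U' = 1\<^sub>m N \<and> U' * U = 1\<^sub>m N)"

lemma inv_over_carrier: "inv_over R N U \<Longrightarrow> U \<in> carrier_mat N N"
  by (simp add: inv_over_def)

lemma inv_overI:
  assumes "U \<in> carrier_mat N N" "U' \<in> carrier_mat N N" "over R U" "over R U'"
    "U * U' = 1\<^sub>m N" "U' * U = 1\<^sub>m N"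
  shows "inv_over R N U"
  using assms by (auto simp: inv_over_def)

lemma inv_over_one: "subring_set R \<Longrightarrow> inv_over R N (1\<^sub>m N)"
  by (rule inv_overI[of _ _ "1\<^sub>m N"]) (auto simp: over_one)

lemma mult_square_carrier [simp]:
  "A \<in> carrier_mat N N \<Longrightarrow> B \<in> carrier_mat N N \<Longrightarrow> A * B \<in> carrier_mat N N"
  by (rule mult_carrier_mat)

lemma mat_mult_middle:
  fixes A :: "'a :: semiring_0 mat"
  assumes "A \<in> carrier_mat N N" "B \<in> carrier_mat N N" "C \<in> carrier_mat N N" "D \<in> carrier_mat N N"
  shows "(A * B) * (C * D) = A * (B * C) * D"
  using assms by (simp add: assoc_mult_mat[of _ N N _ N _ N])

lemma inv_over_mult:
  assumes R: "subring_set R" and A: "inv_over R N A" and B: "inv_over R N B"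
  shows "inv_over R N (A * B)"
proof -
  obtain A' B' where *: "A \<in> carrier_mat N N" "B \<in> carrier_mat N N" "A' \<in> carrier_mat N N" "B' \<in> carrier_mat N N"
    "over R A" "over R B" "over R A'" "over R B'"
    "A * A' = 1\<^sub>m N" "A' * A = 1\<^sub>m N" "B * B' = 1\<^sub>m N" "B' * B = 1\<^sub>m N"
    using A B unfolding inv_over_def by blast
  have "(A * B) * (B' * A') = A * (B * B') * A'" "(B' * A') * (A * B) = B' * (A' * A) * B"
    using *(1-4) by (simp_all only: mat_mult_middle)
  then have "(A * B) * (B' * A') = 1\<^sub>m N" "(B' * A') * (A * B) = 1\<^sub>m N"
    using * by simp_all
  then show ?thesis
    using * R by (intro inv_overI[of _ _ "B' * A'"]) (auto intro!: over_mult)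
qed

lemma over_gfied:
  assumes R: "subring_set R" and c: "\<And>j. j \<le> m \<Longrightarrow> int j = \<bar>i\<bar> \<Longrightarrow> over R (c j) \<and> c j \<in> carrier_mat n n"
    and i: "idx m i"
  shows "over R (gfied m n c i)"
  unfolding over_def
proof (intro allI impI)
  fix r s assume "r < dim_row (gfied m n c i)" "s < dim_col (gfied m n c i)"
  then obtain b a b' a' where *: "b < m" "a < n" "b' < m" "a' < n"
    and rs: "r = b * n + a" "s = b' * n + a'"
    by (auto elim!: block_cases)
  have el: "c j $$ (a, a') \<in> R \<and> dim_row (c j) = n \<and> dim_col (c j) = n" if "int j = \<bar>i\<bar>" "j \<le> m" for j
    using c[OF that(2,1)] * by (auto simp: over_def)
  note R' = subring_setD[OF R]
  have "fblk m c i b b' a a' \<in> R"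
    using i
  proof (cases rule: idx_cases)
    case zero then show ?thesis using * el[of 0] by (auto simp: fblk_def R')
  next
    case low then show ?thesis using * el[of m] by (auto simp: fblk_def R')
  next
    case (mid k)
    have "c (nat i) $$ (a, a') \<in> R" if "i > 0" using el[of "nat i"] mid(2) assms(3) that by (auto simp: idx_def)
    moreover have "c (nat (- i)) $$ (a, a') \<in> R" if "\<not> i > 0" using el[of "nat (- i)"] assms(3) that by (auto simp: idx_def)
    ultimately show ?thesis unfolding fblk_mid[OF mid(1-3)]
      using R'(1,2) R'(5)[of "c (nat i) $$ (a, a')"] by presburger
  qed
  then show "gfied m n c i $$ (r, s) \<in> R" using * by (simp add: rs)
qed

lemma inv_over_gfied:
  assumes R: "subring_set R" and c: "\<And>j. 0 < j \<Longrightarrow> j < m \<Longrightarrow> over R (c j) \<and> c j \<in> carrier_mat n n"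
    and i: "0 < \<bar>i\<bar>" "\<bar>i\<bar> < int m"
  shows "inv_over R (m * n) (gfied m n c i)"
proof (rule inv_overI[of _ _ "gfied m n c (- i)"])
  show "over R (gfied m n c i)" "over R (gfied m n c (- i))"
    using i by (auto intro!: over_gfied[OF R] c simp: idx_def)
  show "gfied m n c i * gfied m n c (- i) = 1\<^sub>m (m * n)" by (rule gfied_inverse[OF i])
  show "gfied m n c (- i) * gfied m n c i = 1\<^sub>m (m * n)"
    using gfied_inverse[of "- i" m n c] i by simp
qed auto

lemma inv_over_gprod:
  assumes R: "subring_set R" and c: "\<And>j. 0 < j \<Longrightarrow> j < m \<Longrightarrow> over R (c j) \<and> c j \<in> carrier_mat n n"
    and t: "\<And>i. i \<in> set t \<Longrightarrow> 0 < \<bar>i\<bar> \<and> \<bar>i\<bar> < int m"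
  shows "inv_over R (m * n) (gprod (m * n) (gfied m n c) t)"
  using t by (induction t) (auto simp: inv_over_one[OF R] intro!: inv_over_mult[OF R] inv_over_gfied[OF R] c)

text \<open>The block elementary matrix with \<open>X\<close> in block position \<open>(d, e)\<close>.\<close>

definition elem :: "nat \<Rightarrow> nat \<Rightarrow> nat \<Rightarrow> nat \<Rightarrow> 'a :: comm_ring_1 mat \<Rightarrow> 'a mat" where
  "elem m n d e X = mat (m * n) (m * n) (\<lambda>(r, s). (if r = s then 1 else 0)
     + (if r div n = d \<and> s div n = e then X $$ (r mod n, s mod n) else 0))"

lemma elem_carrier [simp]: "elem m n d e X \<in> carrier_mat (m * n) (m * n)"
  "dim_row (elem m n d e X) = m * n" "dim_col (elem m n d e X) = m * n"
  by (auto simp: elem_def)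

lemma elem_index:
  assumes "b < m" "a < n" "b' < m" "a' < n"
  shows "elem m n d e X $$ (b * n + a, b' * n + a') =
    (if b = b' \<and> a = a' then 1 else 0) + (if b = d \<and> b' = e then X $$ (a, a') else 0)"
  using assms by (simp add: elem_def block_index block_eq)

lemma bacts_elem:
  fixes X :: "'a :: comm_ring_1 mat"
  assumes "e < m"
  shows "bacts m n (elem m n d e X) (\<lambda>x b. if b = d then (\<lambda>a. x d a + mv n X (x e) a) else x b)"
proof (rule bactsI)
  fix x :: "nat \<Rightarrow> nat \<Rightarrow> 'a" and b a
  assume b: "b < m" and a: "a < n"
  have "(\<Sum>c<m. \<Sum>d'<n. elem m n d e X $$ (b * n + a, c * n + d') * x c d')
     = (\<Sum>c<m. \<Sum>d'<n. (if b = c \<and> a = d' then 1 else 0) * x c d')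
       + (\<Sum>c<m. \<Sum>d'<n. (if b = d \<and> c = e then X $$ (a, d') else 0) * x c d')"
    unfolding sum.distrib[symmetric]
    using a b by (intro sum.cong refl) (simp add: elem_index distrib_right)
  also have "(\<Sum>c<m. \<Sum>d'<n. (if b = d \<and> c = e then X $$ (a, d') else 0) * x c d')
      = (if b = d then mv n X (x e) a else 0)"
    using assms by (subst sum_one[of e]) (auto simp: mv_def)
  finally show "(\<Sum>c<m. \<Sum>d'<n. elem m n d e X $$ (b * n + a, c * n + d') * x c d')
     = (if b = d then (\<lambda>a. x d a + mv n X (x e) a) else x b) a"
    using sum_delta_blocks[OF b a, of x] by auto
qed (simp add: elem_def)

lemma over_elem:
  assumes R: "subring_set R" and X: "over R X" "X \<in> carrier_mat n n"
  shows "over R (elem m n d e X)"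
  unfolding over_def
proof (intro allI impI)
  fix r s assume rs: "r < dim_row (elem m n d e X)" "s < dim_col (elem m n d e X)"
  then have lt: "r < m * n" "s < m * n" by (auto simp: elem_def)
  then have "X $$ (r mod n, s mod n) \<in> R"
    using X block_split[OF lt(1)] block_split[OF lt(2)] by (auto simp: over_def)
  then show "elem m n d e X $$ (r, s) \<in> R"
    using lt by (auto simp: elem_def intro!: subring_setD[OF R])
qed

lemma elem_inverse:
  assumes "e < m" "d \<noteq> e" "X \<in> carrier_mat n n"
  shows "elem m n d e X * elem m n d e (- X) = 1\<^sub>m (m * n)"
proof (rule bacts_eqI[OF bacts_mult[OF bacts_elem[OF assms(1)] bacts_elem[OF assms(1)]] bacts_one])
  fix x :: "nat \<Rightarrow> nat \<Rightarrow> 'a" and b a assume "b < m" "a < n"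
  moreover have "mv n (- X) y a = - mv n X y a" if "a < n" for y a
    using assms(3) that by (simp add: mv_def sum_negf)
  ultimately show "(if b = d then \<lambda>a. (if d = d then \<lambda>a. x d a + mv n (- X) (x e) a else x d) a +
            mv n X (if e = d then \<lambda>a. x d a + mv n (- X) (x e) a else x e) a
        else if b = d then \<lambda>a. x d a + mv n (- X) (x e) a else x b) a = x b a"
    using assms by auto
qed

lemma inv_over_elem:
  assumes R: "subring_set R" and X: "over R X" "X \<in> carrier_mat n n" and de: "e < m" "d \<noteq> e"
  shows "inv_over R (m * n) (elem m n d e X)"
proof (rule inv_overI[of _ _ "elem m n d e (- X)"])
  show "elem m n d e X * elem m n d e (- X) = 1\<^sub>m (m * n)"
    by (rule elem_inverse[OF de X(2)])
  show "elem m n d e (- X) * elem m n d e X = 1\<^sub>m (m * n)"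
    using elem_inverse[OF de, of "- X" n] X by simp
qed (use X in \<open>auto intro!: over_elem[OF R] over_uminus[OF R]\<close>)

definition bdiag :: "nat \<Rightarrow> nat \<Rightarrow> (nat \<Rightarrow> 'a :: comm_ring_1 mat) \<Rightarrow> 'a mat" where
  "bdiag m n f = mat (m * n) (m * n)
     (\<lambda>(r, s). if r div n = s div n then f (r div n) $$ (r mod n, s mod n) else 0)"

lemma bacts_bdiag: "bacts m n (bdiag m n f) (\<lambda>x b. mv n (f b) (x b))"
proof (rule bactsI)
  fix x :: "nat \<Rightarrow> nat \<Rightarrow> 'a" and b a
  assume b: "b < m" and a: "a < n"
  show "(\<Sum>c<m. \<Sum>d'<n. bdiag m n f $$ (b * n + a, c * n + d') * x c d') = mv n (f b) (x b) a"
    using a b by (subst sum_one[of b]) (auto simp: bdiag_def block_index mv_def)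
qed (simp add: bdiag_def)

section \<open>Eliminating a Fiedler pencil\<close>

lemma mv_scalar:
  assumes "a < n"
  shows "mv n (t \<cdot>\<^sub>m 1\<^sub>m n) z a = t * (z a :: 'a :: comm_ring_1)"
  using assms unfolding mv_def by (subst sum_one[of a]) auto

lemma mv_zero_mat: "a < n \<Longrightarrow> mv n (0\<^sub>m n n) z a = 0"
  by (simp add: mv_def)

lemma mv_smult_add:
  fixes A :: "'a :: comm_ring_1 mat"
  assumes "A \<in> carrier_mat n n" "B \<in> carrier_mat n n" "a < n"
  shows "mv n (t \<cdot>\<^sub>m (A + B)) z a = t * mv n A z a + t * mv n B z a"
proof -
  have "mv n (t \<cdot>\<^sub>m (A + B)) z a = (\<Sum>d<n. t * (A $$ (a, d) * z d) + t * (B $$ (a, d) * z d))"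
    unfolding mv_def using assms by (intro sum.cong) (auto simp: algebra_simps)
  then show ?thesis by (simp add: mv_def sum.distrib sum_distrib_left)
qed

text \<open>The first summand of the pencil when the leading \<open>d\<close> blocks have been cleared: \<open>t\<close> is the parameter of the
  pencil and \<open>\<Lambda>\<close> is the value that the Horner scheme has accumulated so far.\<close>

definition pivot :: "nat \<Rightarrow> nat \<Rightarrow> 'a :: comm_ring_1 \<Rightarrow> nat \<Rightarrow> 'a mat \<Rightarrow> 'a mat" where
  "pivot m n t d \<Lambda> = bdiag m n (\<lambda>b. if b < d then 0\<^sub>m n n else if b = d then \<Lambda> else t \<cdot>\<^sub>m 1\<^sub>m n)"

lemma bacts_pivot:
  "bacts m n (pivot m n t d \<Lambda>)
     (\<lambda>x b. if b < d then (\<lambda>a. 0) else if b = d then mv n \<Lambda> (x b) else (\<lambda>a. t * x b a))"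
proof (rule bacts_cong[OF bacts_bdiag[of m n "\<lambda>b. if b < d then 0\<^sub>m n n else if b = d then \<Lambda> else t \<cdot>\<^sub>m 1\<^sub>m n",
      folded pivot_def]])
  fix x :: "nat \<Rightarrow> nat \<Rightarrow> 'a" and b a assume "b < m" and a: "a < n"
  then show "mv n (if b < d then 0\<^sub>m n n else if b = d then \<Lambda> else t \<cdot>\<^sub>m 1\<^sub>m n) (x b) a =
     (if b < d then \<lambda>a. 0 else if b = d then mv n \<Lambda> (x b) else (\<lambda>a. t * x b a)) a"
    by (simp add: mv_scalar mv_zero_mat)
qed

text \<open>The indices $1, \dots, i$ are distributed to the left and to the right of $M_0$ by \<open>\<beta>\<close>.  The order, descending on the
  left and ascending on the right, puts the factor with the largest index outermost, where it can be removed.\<close>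

definition Lt :: "(nat \<Rightarrow> bool) \<Rightarrow> nat \<Rightarrow> int list" where
  "Lt \<beta> i = map int (rev (filter \<beta> [1..<Suc i]))"

definition Rt :: "(nat \<Rightarrow> bool) \<Rightarrow> nat \<Rightarrow> int list" where
  "Rt \<beta> i = map int (filter (\<lambda>j. \<not> \<beta> j) [1..<Suc i])"

lemma Lt_Suc: "Lt \<beta> (Suc i) = (if \<beta> (Suc i) then int (Suc i) # Lt \<beta> i else Lt \<beta> i)"
  and Rt_Suc: "Rt \<beta> (Suc i) = (if \<beta> (Suc i) then Rt \<beta> i else Rt \<beta> i @ [int (Suc i)])"
  by (simp_all add: Lt_def Rt_def)

lemma Lt_0 [simp]: "Lt \<beta> 0 = []" and Rt_0 [simp]: "Rt \<beta> 0 = []"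
  by (simp_all add: Lt_def Rt_def)

lemma set_Lt: "j \<in> set (Lt \<beta> i) \<Longrightarrow> 0 < j \<and> j \<le> int i"
  and set_Rt: "j \<in> set (Rt \<beta> i) \<Longrightarrow> 0 < j \<and> j \<le> int i"
  by (auto simp: Lt_def Rt_def)

lemma gapp_local:
  assumes "\<And>i. i \<in> set t \<Longrightarrow> idx m i" "\<And>i. i \<in> set t \<Longrightarrow> pr m i \<subseteq> S"
    "\<And>b. b \<in> S \<Longrightarrow> b < m \<Longrightarrow> x b = y b" "b \<in> S" "b < m"
  shows "gapp m n c t x b = gapp m n c t y b"
  using assms
proof (induction t arbitrary: b)
  case (Cons i t)
  have IH: "gapp m n c t x b = gapp m n c t y b" if "b \<in> S" "b < m" for b
    using Cons.prems that by (intro Cons.IH) auto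
  show ?case
  proof (cases "b \<in> pr m i")
    case True
    have "fapp m n c i (gapp m n c t x) b = fapp m n c i (gapp m n c t y) b"
    proof (rule fapp_local[OF _ _ True])
      show "idx m i" using Cons.prems by simp
      fix b assume "b \<in> pr m i"
      then have "b \<in> S" "b < m" using Cons.prems(2)[of i] by (auto simp: pr_def)
      then show "gapp m n c t x b = gapp m n c t y b" by (rule IH)
    qed
    then show ?thesis by simp
  next
    case False
    then show ?thesis using IH Cons.prems by (simp add: fapp_outside)
  qed
qed simp

text \<open>The map changes only blocks after \<open>d\<close>, and what it does there does not depend on the blocks up to \<open>d\<close>.\<close>

definition below :: "nat \<Rightarrow> nat \<Rightarrow> ((nat \<Rightarrow> nat \<Rightarrow> 'a) \<Rightarrow> nat \<Rightarrow> nat \<Rightarrow> 'a) \<Rightarrow> bool" where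
  "below m d y \<longleftrightarrow> (\<forall>x b. b \<le> d \<longrightarrow> b < m \<longrightarrow> y x b = x b) \<and>
     (\<forall>x x'. (\<forall>b. d < b \<longrightarrow> b < m \<longrightarrow> x b = x' b) \<longrightarrow> (\<forall>b. d < b \<longrightarrow> b < m \<longrightarrow> y x b = y x' b))"

lemma belowD:
  assumes "below m d y"
  shows "b \<le> d \<Longrightarrow> b < m \<Longrightarrow> y x b = x b"
    "(\<And>b. d < b \<Longrightarrow> b < m \<Longrightarrow> x b = x' b) \<Longrightarrow> d < b \<Longrightarrow> b < m \<Longrightarrow> y x b = y x' b"
  using assms unfolding below_def by blast+

lemma below_gapp:
  assumes "\<And>i. i \<in> set t \<Longrightarrow> 0 \<le> i \<and> i < int m \<and> int d + i < int m - 1"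
  shows "below m d (gapp m n c t)"
  unfolding below_def
proof (intro conjI allI impI)
  have i: "idx m i" if "i \<in> set t" for i using assms[OF that] by (auto simp: idx_def)
  have pr: "pr m i \<subseteq> {d<..}" if "i \<in> set t" for i using assms[OF that] by (auto simp: pr_def)
  fix x x' :: "nat \<Rightarrow> nat \<Rightarrow> 'a" and b
  show "gapp m n c t x b = x b" if "b \<le> d" "b < m"
    using that i pr by (intro gapp_outside) fastforce+
  show "gapp m n c t x b = gapp m n c t x' b" if "\<forall>b. d < b \<longrightarrow> b < m \<longrightarrow> x b = x' b" "d < b" "b < m"
    using that i pr by (intro gapp_local[where S = "{d<..}"]) auto
qed

text \<open>One Horner step.  The inverse $M_{-i}$ of the outermost factor has been multiplied onto the first summand; since
  \<open>Y\<close> is the identity on block \<open>d\<close> and does not mix it with later blocks, the two block operations clear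
  block \<open>d\<close> of the first summand, leave \<open>Y\<close> unchanged, and move $t(\Lambda + c_i)$ into the next block.\<close>

lemma elim_step_right:
  fixes Y :: "'a :: comm_ring_1 mat"
  assumes Y: "bacts m n Y y" and y: "below m d y" and d: "m = Suc (d + i)" "0 < i"
    and \<Lambda>: "\<Lambda> \<in> carrier_mat n n" and c: "c i \<in> carrier_mat n n"
  shows "elem m n (Suc d) d (t \<cdot>\<^sub>m 1\<^sub>m n) * (pivot m n t d \<Lambda> * gfied m n c (- int i) - Y) * elem m n d (Suc d) \<Lambda>
     = pivot m n t (Suc d) (t \<cdot>\<^sub>m (\<Lambda> + c i)) - Y"
proof -
  have idx: "idx m (- int i)" and lt: "d < m" "Suc d < m" using d by (auto simp: idx_def)
  have k: "- int i \<noteq> 0" "- int i \<noteq> - int m" "m - nat \<bar>- int i\<bar> = d + 1" using d by auto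
  note f = fapp_mid[OF k]
  note one = mv_scalar and sm = mv_smult_add[OF \<Lambda> c]
  have y1: "y x b = x b" if "b \<le> d" "b < m" for x b using belowD(1)[OF y that] .
  have y2: "y (\<lambda>b. if b = d then u else x b) b = y x b" if "d < b" "b < m" for x b u
    by (rule belowD(2)[OF y _ that]) auto
  show ?thesis
    apply (rule bacts_eqI[OF bacts_mult[OF bacts_mult[OF bacts_elem[OF lt(1)]
      bacts_minus[OF bacts_mult[OF bacts_pivot bacts_gfied[OF idx]] Y]] bacts_elem[OF lt(2)]]
      bacts_minus[OF bacts_pivot Y]])
    using lt d(2) apply (auto simp: one sm y1 y2 f mv_add mv_smult mv_minus algebra_simps)
    done
qed

text \<open>The mirror image of the previous step, for a factor that stands to the left of $M_0$.\<close>

lemma elim_step_left: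
  fixes Y :: "'a :: comm_ring_1 mat"
  assumes Y: "bacts m n Y y" and y: "below m d y" and d: "m = Suc (d + i)" "0 < i"
    and \<Lambda>: "\<Lambda> \<in> carrier_mat n n" and c: "c i \<in> carrier_mat n n"
  shows "elem m n (Suc d) d \<Lambda> * (gfied m n c (- int i) * pivot m n t d \<Lambda> - Y) * elem m n d (Suc d) (t \<cdot>\<^sub>m 1\<^sub>m n)
     = pivot m n t (Suc d) (t \<cdot>\<^sub>m (\<Lambda> + c i)) - Y"
proof -
  have idx: "idx m (- int i)" and lt: "d < m" "Suc d < m" using d by (auto simp: idx_def)
  have k: "- int i \<noteq> 0" "- int i \<noteq> - int m" "m - nat \<bar>- int i\<bar> = d + 1" using d by auto
  note f = fapp_mid[OF k]
  note one = mv_scalar and sm = mv_smult_add[OF \<Lambda> c]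
  have one': "mv n (A :: 'a mat) (mv n (t \<cdot>\<^sub>m 1\<^sub>m n) z) a = t * mv n A z a" if "a < n" for z a A
    using one by (simp add: mv_smult[symmetric] mv_scalar cong: mv_cong)
  have y1: "y x b = x b" if "b \<le> d" "b < m" for x b using belowD(1)[OF y that] .
  have y2: "y (\<lambda>b. if b = d then u else x b) b = y x b" if "d < b" "b < m" for x b u
    by (rule belowD(2)[OF y _ that]) auto
  show ?thesis
    apply (rule bacts_eqI[OF bacts_mult[OF bacts_mult[OF bacts_elem[OF lt(1)]
      bacts_minus[OF bacts_mult[OF bacts_gfied[OF idx] bacts_pivot] Y]] bacts_elem[OF lt(2)]]
      bacts_minus[OF bacts_pivot Y]])
    using lt d(2) apply (auto simp: one one' sm y1 y2 f mv_add mv_smult mv_minus algebra_simps)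
    done
qed

lemma bacts_Ecol_cong:
  fixes A B :: "'a :: comm_ring_1 mat"
  assumes A: "bacts m n A f" and B: "bacts m n B g" and b: "b < m"
    and fg: "\<And>y c a. c < m \<Longrightarrow> a < n \<Longrightarrow> f (single b y) c a = g (single b y) c a"
  shows "A * Ecol m n b = B * Ecol m n b"
proof (rule mat_eq_via_vec)
  fix v :: "'a vec" assume v: "v \<in> carrier_vec n"
  have veq: "v = vec n (\<lambda>a. v $ a)" using v by auto
  have "(A * Ecol m n b) *\<^sub>v v = A *\<^sub>v (Ecol m n b *\<^sub>v v)"
    using bacts_carrier[OF A] v by (intro assoc_mult_mat_vec) auto
  also have "\<dots> = B *\<^sub>v (Ecol m n b *\<^sub>v v)"
    by (subst (1 2) veq) (simp add: Ecol_mult_vec b bacts_apply[OF A] bacts_apply[OF B] unblk_eq_iff fg)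
  also have "\<dots> = (B * Ecol m n b) *\<^sub>v v"
    using bacts_carrier[OF B] v by (intro assoc_mult_mat_vec[symmetric]) auto
  finally show "(A * Ecol m n b) *\<^sub>v v = (B * Ecol m n b) *\<^sub>v v" .
qed (use bacts_carrier[OF A] bacts_carrier[OF B] in auto)

lemma bacts_Erow_cong:
  fixes A B :: "'a :: comm_ring_1 mat"
  assumes A: "bacts m n A f" and B: "bacts m n B g" and b: "b < m"
    and fg: "\<And>x a. a < n \<Longrightarrow> f x b a = g x b a"
  shows "(Ecol m n b)\<^sup>T * A = (Ecol m n b)\<^sup>T * B"
proof (rule mat_eq_via_vec)
  fix v :: "'a vec" assume v: "v \<in> carrier_vec (m * n)"
  have "((Ecol m n b)\<^sup>T * A) *\<^sub>v unblk m n x = ((Ecol m n b)\<^sup>T * B) *\<^sub>v unblk m n x" for x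
  proof -
    have "((Ecol m n b)\<^sup>T * A) *\<^sub>v unblk m n x = (Ecol m n b)\<^sup>T *\<^sub>v (A *\<^sub>v unblk m n x)"
      using bacts_carrier[OF A] by (intro assoc_mult_mat_vec) auto
    also have "\<dots> = (Ecol m n b)\<^sup>T *\<^sub>v (B *\<^sub>v unblk m n x)"
      using fg by (auto simp: bacts_apply[OF A] bacts_apply[OF B] Erow_mult_vec b)
    also have "\<dots> = ((Ecol m n b)\<^sup>T * B) *\<^sub>v unblk m n x"
      using bacts_carrier[OF B] by (intro assoc_mult_mat_vec[symmetric]) auto
    finally show ?thesis .
  qed
  from this[of "blk n v"] show "((Ecol m n b)\<^sup>T * A) *\<^sub>v v = ((Ecol m n b)\<^sup>T * B) *\<^sub>v v"
    using v by (simp add: unblk_blk)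
qed (use bacts_carrier[OF A] bacts_carrier[OF B] in auto)

text \<open>Adding \<open>c 0\<close> to \<open>horner c t (m - 1) (t \<cdot>\<^sub>m c m)\<close> gives the value at \<open>t\<close> of the polynomial with coefficients \<open>c\<close>
  (\<open>horner_total\<close>).\<close>

fun horner :: "(nat \<Rightarrow> 'a :: comm_ring_1 mat) \<Rightarrow> 'a \<Rightarrow> nat \<Rightarrow> 'a mat \<Rightarrow> 'a mat" where
  "horner c t 0 \<Lambda> = \<Lambda>"
| "horner c t (Suc i) \<Lambda> = horner c t i (t \<cdot>\<^sub>m (\<Lambda> + c (Suc i)))"

lemma bacts_L: "i < m \<Longrightarrow> bacts m n (gprod (m * n) (gfied m n c) (Lt \<beta> i)) (gapp m n c (Lt \<beta> i))"
  and bacts_R: "i < m \<Longrightarrow> bacts m n (gprod (m * n) (gfied m n c) (Rt \<beta> i)) (gapp m n c (Rt \<beta> i))"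
  by (rule bacts_gprod; force dest: set_Lt set_Rt simp: idx_def)+

text \<open>The block operations of a step involve block \<open>d\<close>, which is still zero in the border columns and rows; hence the
  borders survive the elimination.\<close>

lemma elim_border_col:
  fixes X :: "'a :: comm_ring_1 mat"
  assumes m: "m = Suc (d + i)" "0 < i" and X: "X \<in> carrier_mat n n"
    and t: "\<And>j. j \<in> set s \<Longrightarrow> 0 \<le> j \<and> j < int i"
  shows "elem m n (Suc d) d X * (gprod (m * n) (gfied m n c) s * Ecol m n (m - 1)) = gprod (m * n) (gfied m n c) s * Ecol m n (m - 1)"
    "((Ecol m n (m - 1))\<^sup>T * gprod (m * n) (gfied m n c) s) * elem m n d (Suc d) X = (Ecol m n (m - 1))\<^sup>T * gprod (m * n) (gfied m n c) s"
proof -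
  let ?G = "gprod (m * n) (gfied m n c) s"
  have lt: "d < m" "Suc d < m" "m - 1 < m" "d < m - 1" using m by auto
  have G: "bacts m n ?G (gapp m n c s)"
    by (rule bacts_gprod) (use t m in \<open>force simp: idx_def\<close>)
  have bel: "below m d (gapp m n c s)"
    by (rule below_gapp) (use t m in force)
  have "elem m n (Suc d) d X * (?G * Ecol m n (m - 1)) = (elem m n (Suc d) d X * ?G) * Ecol m n (m - 1)"
    by (simp add: assoc_mult_mat[of _ "m * n" "m * n" _ "m * n" _ n])
  also have "\<dots> = ?G * Ecol m n (m - 1)"
    by (rule bacts_Ecol_cong[OF bacts_mult[OF bacts_elem[OF lt(1)] G] G lt(3)])
      (use lt belowD(1)[OF bel, of d] in \<open>simp add: single_def\<close>)
  finally show "elem m n (Suc d) d X * (?G * Ecol m n (m - 1)) = ?G * Ecol m n (m - 1)" .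
  have "((Ecol m n (m - 1))\<^sup>T * ?G) * elem m n d (Suc d) X = (Ecol m n (m - 1))\<^sup>T * (?G * elem m n d (Suc d) X)"
    by (simp add: assoc_mult_mat[of _ n "m * n" _ "m * n" _ "m * n"])
  also have "\<dots> = (Ecol m n (m - 1))\<^sup>T * ?G"
  proof (rule bacts_Erow_cong[OF bacts_mult[OF G bacts_elem[OF lt(2)]] G lt(3)])
    fix x a
    show "gapp m n c s (\<lambda>b. if b = d then \<lambda>a. x d a + mv n X (x (Suc d)) a else x b) (m - 1) a
        = gapp m n c s x (m - 1) a"
      by (subst belowD(2)[OF bel, of _ x]) (use lt in auto)
  qed
  finally show "((Ecol m n (m - 1))\<^sup>T * ?G) * elem m n d (Suc d) X = (Ecol m n (m - 1))\<^sup>T * ?G" .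
qed

text \<open>The factors are removed from the largest index down to 1.  Only their inverses and block elementary matrices with
  entries in \<open>R\<close> are used, so the transformations are invertible over \<open>R\<close>; the last two equations say that they carry
  the borders of the stripped pencil to $e_m \otimes I_n$ and its transpose.\<close>

lemma elimination:
  fixes c :: "nat \<Rightarrow> 'a :: comm_ring_1 mat"
  assumes R: "subring_set R" and t: "t \<in> R"
    and c: "\<And>j. c j \<in> carrier_mat n n" "\<And>j. 0 < j \<Longrightarrow> j < m \<Longrightarrow> over R (c j)"
    and i: "i < m" and \<Lambda>: "\<Lambda> \<in> carrier_mat n n" "over R \<Lambda>"
  shows "\<exists>U V. inv_over R (m * n) U \<and> inv_over R (m * n) V \<and>
    U * (pivot m n t (m - 1 - i) \<Lambda>
        - gprod (m * n) (gfied m n c) (Lt \<beta> i) * gfied m n c 0 * gprod (m * n) (gfied m n c) (Rt \<beta> i)) * V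
      = pivot m n t (m - 1) (horner c t i \<Lambda>) - gfied m n c 0 \<and>
    U * (gprod (m * n) (gfied m n c) (Lt \<beta> i) * Ecol m n (m - 1)) = Ecol m n (m - 1) \<and>
    ((Ecol m n (m - 1))\<^sup>T * gprod (m * n) (gfied m n c) (Rt \<beta> i)) * V = (Ecol m n (m - 1))\<^sup>T"
  using i \<Lambda>
proof (induction i arbitrary: \<Lambda>)
  case 0
  show ?case
    by (rule exI[of _ "1\<^sub>m (m * n)"], rule exI[of _ "1\<^sub>m (m * n)"])
      (use inv_over_one[OF R] in \<open>auto simp: pivot_def bdiag_def left_mult_one_mat[of _ "m * n" n]
        left_mult_one_mat[of _ "m * n" "m * n"] right_mult_one_mat[of _ "m * n" "m * n"]
        right_mult_one_mat[of _ n "m * n"]\<close>)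
next
  case (Suc i)
  let ?N = "m * n"
  define d where "d = m - 1 - Suc i"
  have d: "m = Suc (d + Suc i)" "0 < Suc i" and d': "m - 1 - i = Suc d"
    using Suc.prems by (auto simp: d_def)
  define J where "J = (Ecol m n (m - 1) :: 'a mat)"
  define L where "L = gprod ?N (gfied m n c) (Lt \<beta> i)"
  define T where "T = gprod ?N (gfied m n c) (Rt \<beta> i)"
  define Y where "Y = L * gfied m n c 0 * T"
  define D where "D = pivot m n t d \<Lambda>"
  define A where "A = gfied m n c (int (Suc i))"
  define A' where "A' = gfied m n c (- int (Suc i))"
  let ?y = "gapp m n c (Lt \<beta> i @ 0 # Rt \<beta> i)"
  have LR: "0 < j \<and> j \<le> int i" if "j \<in> set (Lt \<beta> i) \<union> set (Rt \<beta> i)" for j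
    using that set_Lt set_Rt by blast
  have y_eq: "?y = (\<lambda>x. gapp m n c (Lt \<beta> i) (fapp m n c 0 (gapp m n c (Rt \<beta> i) x)))"
    by (intro ext) simp
  have Yb: "bacts m n Y ?y"
    using bacts_mult[OF bacts_mult[OF bacts_L[of i m n c \<beta>] bacts_gfied[of m 0 n c]] bacts_R[of i m n c \<beta>]] Suc.prems
    by (simp add: Y_def L_def T_def idx_def y_eq)
  have yb: "below m d ?y"
    by (rule below_gapp) (use LR d in fastforce)
  have car: "L \<in> carrier_mat ?N ?N" "T \<in> carrier_mat ?N ?N" "Y \<in> carrier_mat ?N ?N" "D \<in> carrier_mat ?N ?N"
    "A \<in> carrier_mat ?N ?N" "A' \<in> carrier_mat ?N ?N" "J \<in> carrier_mat ?N n" "J\<^sup>T \<in> carrier_mat n ?N"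
    using bacts_carrier[OF Yb] by (auto simp: L_def T_def D_def A_def A'_def J_def pivot_def bdiag_def)
  have AA: "A * A' = 1\<^sub>m ?N" "A' * A = 1\<^sub>m ?N"
    using gfied_inverse[of "int (Suc i)" m n c] gfied_inverse[of "- int (Suc i)" m n c] Suc.prems(1)
    unfolding A_def A'_def minus_minus by linarith+
  define \<Lambda>' where "\<Lambda>' = t \<cdot>\<^sub>m (\<Lambda> + c (Suc i))"
  have "\<Lambda>' \<in> carrier_mat n n" "over R \<Lambda>'"
    using Suc.prems c[of "Suc i"] by (auto simp: \<Lambda>'_def intro!: over_smult[OF R _ t] over_add[OF R, of _ _ n n])
  from Suc.IH[OF _ this] Suc.prems obtain U V where
    UV: "inv_over R ?N U" "inv_over R ?N V"
      "U * (pivot m n t (Suc d) \<Lambda>' - Y) * V = pivot m n t (m - 1) (horner c t i \<Lambda>') - gfied m n c 0"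
      "U * (L * J) = J" "(J\<^sup>T * T) * V = J\<^sup>T"
    unfolding d' L_def[symmetric] T_def[symmetric] Y_def[symmetric] J_def[symmetric] by auto
  have UVc: "U \<in> carrier_mat ?N ?N" "V \<in> carrier_mat ?N ?N" using UV inv_over_carrier by auto
  have invA: "inv_over R ?N A'"
    unfolding A'_def by (rule inv_over_gfied[OF R]) (use c Suc.prems in auto)
  have tR: "t \<cdot>\<^sub>m 1\<^sub>m n \<in> carrier_mat n n" "over R (t \<cdot>\<^sub>m 1\<^sub>m n :: 'a mat)"
    by (auto intro!: over_smult[OF R _ t] over_one[OF R])
  define X X' where "X = (if \<beta> (Suc i) then \<Lambda> else t \<cdot>\<^sub>m 1\<^sub>m n)" and "X' = (if \<beta> (Suc i) then t \<cdot>\<^sub>m 1\<^sub>m n else \<Lambda>)"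
  have XR: "X \<in> carrier_mat n n" "over R X" "X' \<in> carrier_mat n n" "over R X'"
    using tR Suc.prems by (auto simp: X_def X'_def)
  define E E' where "E = elem m n (Suc d) d X" and "E' = elem m n d (Suc d) X'"
  have Ec: "E \<in> carrier_mat ?N ?N" "E' \<in> carrier_mat ?N ?N" by (auto simp: E_def E'_def)
  have invE: "inv_over R ?N E" "inv_over R ?N E'"
    unfolding E_def E'_def by (rule inv_over_elem[OF R]; use XR d in simp)+
  have bc: "E * (L * J) = L * J" unfolding E_def L_def J_def
    by (rule elim_border_col(1)[OF d XR(1)]) (use LR in force)
  have br: "(J\<^sup>T * T) * E' = J\<^sup>T * T" unfolding E'_def T_def J_def
    by (rule elim_border_col(2)[OF d XR(3)]) (use LR in force)
  show ?case
  proof (cases "\<beta> (Suc i)")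
    case True
    have L: "gprod ?N (gfied m n c) (Lt \<beta> (Suc i)) = A * L" and T: "gprod ?N (gfied m n c) (Rt \<beta> (Suc i)) = T"
      using True by (simp_all add: Lt_Suc Rt_Suc A_def L_def T_def)
    have K: "A' * (D - A * L * gfied m n c 0 * T) = A' * D - Y"
    proof -
      have "A' * (D - A * L * gfied m n c 0 * T) = A' * D - A' * (A * Y)"
        using car by (simp add: Y_def mult_minus_distrib_mat[of _ ?N ?N] assoc_mult_mat[of _ ?N ?N _ ?N _ ?N])
      also have "A' * (A * Y) = Y"
        using car AA by (simp add: assoc_mult_mat[of _ ?N ?N _ ?N _ ?N, symmetric])
      finally show ?thesis .
    qed
    have step: "E * (A' * D - Y) * E' = pivot m n t (Suc d) \<Lambda>' - Y"
    proof -
      have XX: "X = \<Lambda>" "X' = t \<cdot>\<^sub>m 1\<^sub>m n" using True by (simp_all add: X_def X'_def)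
      show ?thesis
        unfolding E_def E'_def XX A'_def D_def \<Lambda>'_def
        by (rule elim_step_left[where c = c and i = "Suc i", OF Yb yb d Suc.prems(2) c(1)])
    qed
    have Kc: "D - A * L * gfied m n c 0 * T \<in> carrier_mat ?N ?N" using car by auto
    show ?thesis
    proof (rule exI[of _ "U * (E * A')"], rule exI[of _ "E' * V"], intro conjI)
      show "inv_over R ?N (U * (E * A'))" "inv_over R ?N (E' * V)"
        using UV invA invE by (auto intro!: inv_over_mult[OF R])
      have "U * (E * A') * (D - A * L * gfied m n c 0 * T) * (E' * V)
        = U * (E * (A' * (D - A * L * gfied m n c 0 * T)) * E') * V"
        using UVc Ec car Kc by (simp add: assoc_mult_mat[of _ ?N ?N _ ?N _ ?N])
      also have "\<dots> = U * (pivot m n t (Suc d) \<Lambda>' - Y) * V" by (simp only: K step)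
      also have "\<dots> = pivot m n t (m - 1) (horner c t (Suc i) \<Lambda>) - gfied m n c 0"
        using UV by (simp add: \<Lambda>'_def)
      finally show "U * (E * A') * (pivot m n t (m - 1 - Suc i) \<Lambda> - gprod ?N (gfied m n c) (Lt \<beta> (Suc i)) * gfied m n c 0
          * gprod ?N (gfied m n c) (Rt \<beta> (Suc i))) * (E' * V) = pivot m n t (m - 1) (horner c t (Suc i) \<Lambda>) - gfied m n c 0"
        by (simp only: L T D_def d_def)
      have "U * (E * A') * (A * L * J) = U * (E * ((A' * A) * (L * J)))"
        using UVc Ec car by (simp add: assoc_mult_mat[of _ ?N ?N _ ?N _ ?N] assoc_mult_mat[of _ ?N ?N _ ?N _ n])
      also have "\<dots> = J" using car UV bc by (simp add: AA left_mult_one_mat[of _ ?N n])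
      finally show "U * (E * A') * (gprod ?N (gfied m n c) (Lt \<beta> (Suc i)) * Ecol m n (m - 1)) = Ecol m n (m - 1)"
        by (simp only: L J_def)
      have "(J\<^sup>T * T) * (E' * V) = ((J\<^sup>T * T) * E') * V"
        using UVc Ec car by (simp add: assoc_mult_mat[of _ n ?N _ ?N _ ?N])
      then have "(J\<^sup>T * T) * (E' * V) = J\<^sup>T" using br UV by simp
      then show "((Ecol m n (m - 1))\<^sup>T * gprod ?N (gfied m n c) (Rt \<beta> (Suc i))) * (E' * V) = (Ecol m n (m - 1))\<^sup>T"
        by (simp only: T J_def)
    qed
  next
    case False
    have L: "gprod ?N (gfied m n c) (Lt \<beta> (Suc i)) = L" using False by (simp add: Lt_Suc L_def)
    have T: "gprod ?N (gfied m n c) (Rt \<beta> (Suc i)) = T * A"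
      using False gprod_snoc[of "Rt \<beta> i" "gfied m n c" ?N "int (Suc i)"] by (simp add: Rt_Suc A_def T_def)
    have K: "(D - L * gfied m n c 0 * (T * A)) * A' = D * A' - Y"
    proof -
      have "L * gfied m n c 0 * (T * A) = Y * A"
        using car by (simp add: Y_def assoc_mult_mat[of _ ?N ?N _ ?N _ ?N])
      moreover have "(D - Y * A) * A' = D * A' - Y * A * A'"
        using car by (intro minus_mult_distrib_mat[of _ ?N ?N]) auto
      moreover have "Y * A * A' = Y"
        using car AA by (simp add: assoc_mult_mat[of _ ?N ?N _ ?N _ ?N])
      ultimately show ?thesis by simp
    qed
    have step: "E * (D * A' - Y) * E' = pivot m n t (Suc d) \<Lambda>' - Y"
    proof -
      have XX: "X' = \<Lambda>" "X = t \<cdot>\<^sub>m 1\<^sub>m n" using False by (simp_all add: X_def X'_def)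
      show ?thesis
        unfolding E_def E'_def XX A'_def D_def \<Lambda>'_def
        by (rule elim_step_right[where c = c and i = "Suc i", OF Yb yb d Suc.prems(2) c(1)])
    qed
    have Kc: "D - L * gfied m n c 0 * (T * A) \<in> carrier_mat ?N ?N" using car by auto
    show ?thesis
    proof (rule exI[of _ "U * E"], rule exI[of _ "A' * E' * V"], intro conjI)
      show "inv_over R ?N (U * E)" "inv_over R ?N (A' * E' * V)"
        using UV invA invE by (auto intro!: inv_over_mult[OF R])
      have "U * E * (D - L * gfied m n c 0 * (T * A)) * (A' * E' * V)
        = U * (E * ((D - L * gfied m n c 0 * (T * A)) * A') * E') * V"
        using UVc Ec car Kc by (simp add: assoc_mult_mat[of _ ?N ?N _ ?N _ ?N])
      also have "\<dots> = U * (pivot m n t (Suc d) \<Lambda>' - Y) * V" by (simp only: K step)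
      also have "\<dots> = pivot m n t (m - 1) (horner c t (Suc i) \<Lambda>) - gfied m n c 0"
        using UV by (simp add: \<Lambda>'_def)
      finally show "U * E * (pivot m n t (m - 1 - Suc i) \<Lambda> - gprod ?N (gfied m n c) (Lt \<beta> (Suc i)) * gfied m n c 0
          * gprod ?N (gfied m n c) (Rt \<beta> (Suc i))) * (A' * E' * V) = pivot m n t (m - 1) (horner c t (Suc i) \<Lambda>) - gfied m n c 0"
        by (simp only: L T D_def d_def)
      have "U * E * (L * J) = U * (E * (L * J))"
        using UVc Ec car by (simp add: assoc_mult_mat[of _ ?N ?N _ ?N _ n])
      then have "U * E * (L * J) = J" using UV bc by simp
      then show "U * E * (gprod ?N (gfied m n c) (Lt \<beta> (Suc i)) * Ecol m n (m - 1)) = Ecol m n (m - 1)"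
        by (simp only: L J_def)
      have "(J\<^sup>T * (T * A)) * (A' * E' * V) = (((J\<^sup>T * T) * (A * A')) * E') * V"
        using UVc Ec car by (simp add: assoc_mult_mat[of _ n ?N _ ?N _ ?N] assoc_mult_mat[of _ ?N ?N _ ?N _ ?N])
      also have "\<dots> = J\<^sup>T" using br UV car by (simp add: AA right_mult_one_mat[of _ n ?N])
      finally show "((Ecol m n (m - 1))\<^sup>T * gprod ?N (gfied m n c) (Rt \<beta> (Suc i))) * (A' * E' * V) = (Ecol m n (m - 1))\<^sup>T"
        by (simp only: T J_def)
    qed
  qed
qed

section \<open>Index tuples\<close>

lemma far_same_parity:
  assumes "even (i - j)" "i > 0 \<and> j > 0 \<or> i < 0 \<and> j < 0"
  shows "i = j \<or> far i j"
proof -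
  obtain k where k: "i - j = 2 * k" using assms(1) by (elim evenE)
  have "\<bar>\<bar>i\<bar> - \<bar>j\<bar>\<bar> = \<bar>i - j\<bar>" using assms(2) by auto
  then show ?thesis using k by (auto simp: far_def)
qed

lemma gprod_map: "gprod N M (map f t) = gprod N (\<lambda>i. M (f i)) t"
  by (induction t) auto

lemma gprod_interleave:
  assumes M: "\<And>j. j < s \<Longrightarrow> M (f j) \<in> carrier_mat N N \<and> M (g j) \<in> carrier_mat N N"
    and c: "\<And>j j'. j < j' \<Longrightarrow> j' < s \<Longrightarrow> M (f j') * M (g j) = M (g j) * M (f j')"
  shows "gprod N M (concat (map (\<lambda>j. [f j, g j]) [0..<s]))
    = gprod N M (map f [0..<s]) * gprod N M (map g [0..<s])"
  using assms
proof (induction s)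
  case (Suc s)
  let ?A = "gprod N M (map f [0..<s])" and ?B = "gprod N M (map g [0..<s])"
  have car: "?A \<in> carrier_mat N N" "?B \<in> carrier_mat N N" "M (f s) \<in> carrier_mat N N" "M (g s) \<in> carrier_mat N N"
    using Suc.prems by (auto intro!: gprod_carrier)
  have comm: "M (f s) * ?B = ?B * M (f s)"
    using Suc.prems car by (intro mat_commute_gprod) auto
  have "gprod N M (concat (map (\<lambda>j. [f j, g j]) [0..<Suc s]))
      = gprod N M (concat (map (\<lambda>j. [f j, g j]) [0..<s]) @ [f s, g s])" by simp
  also have "\<dots> = gprod N M (concat (map (\<lambda>j. [f j, g j]) [0..<s])) * gprod N M [f s, g s]"
    using Suc.prems by (intro gprod_append) auto
  also have "\<dots> = (?A * ?B) * (M (f s) * M (g s))"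
    using Suc by (simp add: right_mult_one_mat[OF car(4)])
  also have "\<dots> = (?A * M (f s)) * (?B * M (g s))"
    using car by (simp only: mat_mult_middle comm)
  also have "?A * M (f s) = gprod N M (map f [0..<Suc s])"
    using gprod_snoc[of "map f [0..<s]" M N "f s"] Suc.prems(1) by fastforce
  also have "?B * M (g s) = gprod N M (map g [0..<Suc s])"
    using gprod_snoc[of "map g [0..<s]" M N "g s"] Suc.prems(1) by fastforce
  finally show ?case .
qed simp

lemma rev_c_0 [simp]: "rev_c 0 = []"
  by (simp add: rev_c_def)

lemma rev_c_Suc: "rev_c (Suc p) = [0..int p] @ rev_c p"
proof -
  have "[0..int p] = [0..int p - 1] @ [int p]" by (rule upto_rec2) simp
  then show ?thesis by (simp add: rev_c_def)
qed

lemma set_rev_c: "i \<in> set (rev_c p) \<Longrightarrow> 0 \<le> i \<and> i < int p"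
  by (induction p) (auto simp: rev_c_Suc)

text \<open>The symmetric complement is made for this identity: moving the ascending tuple past \<open>rev_c p\<close> reverses it.  Only the
  relation that far matrices commute is used.\<close>

lemma rev_c_flip:
  assumes M: "\<And>i. 0 \<le> i \<Longrightarrow> i \<le> int p \<Longrightarrow> M i \<in> carrier_mat N N"
    and c: "\<And>i j. 0 \<le> i \<Longrightarrow> i + 2 \<le> j \<Longrightarrow> j \<le> int p \<Longrightarrow> M i * M j = M j * M i"
  shows "gprod N M [0..int p] * gprod N M (rev_c p) = gprod N M (rev_c p) * gprod N M (rev [0..int p])"
  using assms
proof (induction p)
  case 0
  then show ?case by simp
next
  case (Suc p)
  let ?A = "gprod N M [0..int p]" and ?B = "gprod N M (rev_c p)" and ?C = "gprod N M (rev [0..int p])"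
    and ?M = "M (1 + int p)"
  have up: "[0..int (Suc p)] = [0..int p] @ [1 + int p]"
    using upto_rec2[of 0 "int (Suc p)"] by simp
  have car: "?A \<in> carrier_mat N N" "?B \<in> carrier_mat N N" "?C \<in> carrier_mat N N" "?M \<in> carrier_mat N N"
    using Suc.prems(1) by (auto intro!: gprod_carrier dest: set_rev_c)
  have IH: "?A * ?B = ?B * ?C" by (rule Suc.IH; rule Suc.prems; simp)
  have comm: "?M * ?B = ?B * ?M"
    using Suc.prems car by (intro mat_commute_gprod) (fastforce dest: set_rev_c)+
  have A': "gprod N M [0..int (Suc p)] = ?A * ?M"
    unfolding up using Suc.prems(1) by (intro gprod_snoc) auto
  have B': "gprod N M (rev_c (Suc p)) = ?A * ?B"
    unfolding rev_c_Suc using Suc.prems(1) by (intro gprod_append) (auto dest: set_rev_c)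
  have C': "gprod N M (rev [0..int (Suc p)]) = ?M * ?C" unfolding up by simp
  have "?A * ?M * (?A * ?B) = ?A * (?M * ?B) * ?C"
    unfolding IH using car by (simp only: mat_mult_middle)
  also have "\<dots> = (?A * ?B) * (?M * ?C)"
    unfolding comm using car by (simp only: mat_mult_middle)
  finally show ?case unfolding A' B' C' .
qed

lemma rev_c_palindrome:
  assumes M: "\<And>i. 0 \<le> i \<Longrightarrow> i < int p \<Longrightarrow> M i \<in> carrier_mat N N"
    and c: "\<And>i j. 0 \<le> i \<Longrightarrow> i + 2 \<le> j \<Longrightarrow> j < int p \<Longrightarrow> M i * M j = M j * M i"
  shows "gprod N M (rev (rev_c p)) = gprod N M (rev_c p)"
  using assms
proof (induction p)
  case (Suc p)
  have "gprod N M (rev (rev_c (Suc p))) = gprod N M (rev (rev_c p)) * gprod N M (rev [0..int p])"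
    unfolding rev_c_Suc rev_append using Suc.prems(1) by (intro gprod_append) (auto dest: set_rev_c)
  also have "\<dots> = gprod N M (rev_c p) * gprod N M (rev [0..int p])"
    using Suc.IH Suc.prems by force
  also have "\<dots> = gprod N M [0..int p] * gprod N M (rev_c p)"
    by (rule rev_c_flip[symmetric]; rule Suc.prems; simp)
  also have "\<dots> = gprod N M (rev_c (Suc p))"
    unfolding rev_c_Suc using Suc.prems(1) by (intro gprod_append[symmetric]) (auto dest: set_rev_c)
  finally show ?case .
qed simp

text \<open>The parameters are read off from the tuples: $h = 2e$, and \<open>p\<close> and \<open>s\<close> are the index of $\mathbf z + m$ and the
  number of its pairs, so that $m - h - 1 = p + 2s$.\<close>

locale gfpr =
  fixes m e p s :: nat
  assumes m_eq: "m = 2 * e + 1 + p + 2 * s"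
begin

lemma m_int: "int m = 2 * int e + 1 + int p + 2 * int s"
  by (simp add: m_eq)

text \<open>The pairs of $\mathbf w$ split into odd members \<open>Ol\<close> (which also form $\mathbf c_w$) and even members \<open>El\<close>.  The pairs
  of $\mathbf z$ split in the same way into \<open>Zo\<close> and \<open>Ze\<close>; here the first members are the even ones, because
  $m - p$ is odd.  \<open>Np\<close> is the final run of $\mathbf z$, and $\mathbf c_z$ is \<open>Zo @ rc\<close>.\<close>

definition Ol where "Ol = map (\<lambda>j. int (2 * e) - 2 * int j - 1) [0..<e]"
definition El where "El = map (\<lambda>j. int (2 * e) - 2 * int j) [0..<e]"
definition Zo where "Zo = map (\<lambda>j. int (p + 2 * s) - 2 * int j - 1 - int m) [0..<s]"
definition Ze where "Ze = map (\<lambda>j. int (p + 2 * s) - 2 * int j - int m) [0..<s]"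
definition Np where "Np = map (\<lambda>i. i - int m) [0..int p]"
definition rc where "rc = map (\<lambda>i. i - int m) (rev_c p)"

lemma set_Ol: "i \<in> set Ol \<Longrightarrow> 1 \<le> i \<and> i \<le> 2 * int e - 1 \<and> odd i"
  by (auto simp: Ol_def)
lemma set_El: "i \<in> set El \<Longrightarrow> 2 \<le> i \<and> i \<le> 2 * int e \<and> even i"
  by (auto simp: El_def)
lemma set_Zo: "i \<in> set Zo \<Longrightarrow> 2 * int e + 2 \<le> - i \<and> - i \<le> int m - int p - 1 \<and> even i"
  by (auto simp: Zo_def m_int)
lemma set_Ze: "i \<in> set Ze \<Longrightarrow> 2 * int e + 1 \<le> - i \<and> - i \<le> int m - int p - 2 \<and> odd i"
  by (auto simp: Ze_def m_int)
lemma set_Np: "i \<in> set Np \<Longrightarrow> int m - int p \<le> - i \<and> - i \<le> int m"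
  by (auto simp: Np_def)
lemma set_rc: "i \<in> set rc \<Longrightarrow> int m - int p + 1 \<le> - i \<and> - i \<le> int m"
  by (auto simp: rc_def dest: set_rev_c)

lemmas sets = set_Ol set_El set_Zo set_Ze set_Np set_rc

lemma idx_sets: "i \<in> set Ol \<union> set El \<union> set Zo \<union> set Ze \<union> set Np \<union> set rc \<union> {0} \<Longrightarrow> idx m i"
  using m_int by (auto simp: idx_def dest!: sets)

definition wl where "wl = concat (map (\<lambda>j. [int (2 * e) - 2 * int j - 1..int (2 * e) - 2 * int j]) [0..<e]) @ [0]"
definition zl where "zl = map (\<lambda>i. i - int m)
  (concat (map (\<lambda>j. [int (p + 2 * s) - 2 * int j - 1..int (p + 2 * s) - 2 * int j]) [0..<s]) @ [0..int p])"

end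

locale gfpr_mats = gfpr +
  fixes n :: nat and c :: "nat \<Rightarrow> 'a :: comm_ring_1 mat"
begin

abbreviation "N \<equiv> m * n"
abbreviation "M \<equiv> gfied m n c"
abbreviation "G \<equiv> gprod N M"

lemma G_append: "G (u @ t) = G u * G t"
  by (rule gprod_append) simp

lemma G_commute:
  assumes "\<And>i j. i \<in> set u \<Longrightarrow> j \<in> set t \<Longrightarrow> idx m i \<and> idx m j \<and> far i j"
  shows "G u * G t = G t * G u"
  by (rule gprod_commute) (use assms in \<open>auto intro!: gfied_commute\<close>)

lemma G_rev:
  assumes "\<And>i j. i \<in> set t \<Longrightarrow> j \<in> set t \<Longrightarrow> idx m i \<and> idx m j \<and> (i = j \<or> far i j)"
  shows "G (rev t) = G t"
  by (rule gprod_rev) (use assms in \<open>metis gfied_carrier(1), metis gfied_commute\<close>)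

lemma pair_upto: "[x - 1..x] = [x - 1, x :: int]"
  by (simp add: upto_rec1)

text \<open>Consecutive pairs are far enough apart that the odd members can be collected in front.\<close>

lemma G_pairs:
  "G (concat (map (\<lambda>j. [int (2 * e) - 2 * int j - 1..int (2 * e) - 2 * int j]) [0..<e])) = G Ol * G El"
  unfolding pair_upto Ol_def El_def
  by (rule gprod_interleave) (auto intro!: gfied_commute simp: idx_def far_def m_int)

lemma G_wl: "G wl = G Ol * G El * M 0"
  unfolding wl_def G_append G_pairs by simp

lemma G_zl: "G zl = G Zo * G Ze * G Np"
proof -
  have "zl = concat (map (\<lambda>j. [int (p + 2 * s) - 2 * int j - 1 - int m, int (p + 2 * s) - 2 * int j - int m]) [0..<s]) @ Np"
    unfolding zl_def pair_upto Np_def by (simp add: map_concat comp_def)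
  then have "G zl = G (concat (map (\<lambda>j. [int (p + 2 * s) - 2 * int j - 1 - int m, int (p + 2 * s) - 2 * int j - int m]) [0..<s])) * G Np"
    by (simp add: G_append)
  also have "G (concat (map (\<lambda>j. [int (p + 2 * s) - 2 * int j - 1 - int m, int (p + 2 * s) - 2 * int j - int m]) [0..<s])) = G Zo * G Ze"
    unfolding Zo_def Ze_def
    by (rule gprod_interleave) (auto intro!: gfied_commute simp: idx_def far_def m_int)
  finally show ?thesis .
qed

definition E where "E = e + s"

lemma m_E: "int m = 2 * int E + 1 + int p"
  by (simp add: m_int E_def)

text \<open>The even indices up to \<open>2 * E\<close> go to the left of $M_0$.  They are the indices in \<open>El\<close> and the negatives of those
  in \<open>Zo\<close>; the last \<open>p\<close> indices all go to the right.\<close>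

definition \<beta> where "\<beta> j \<longleftrightarrow> even j \<and> j \<le> 2 * E"

lemma Lt_even: "k \<le> E \<Longrightarrow> Lt \<beta> (2 * k) = map (\<lambda>j. 2 * int k - 2 * int j) [0..<k]"
proof (induction k)
  case (Suc k)
  have "Lt \<beta> (2 * Suc k) = int (2 * Suc k) # Lt \<beta> (2 * k)"
    using Suc.prems by (simp add: Lt_Suc \<beta>_def)
  also have "\<dots> = map (\<lambda>j. 2 * int (Suc k) - 2 * int j) [0..<Suc k]"
    using Suc by (simp add: upt_conv_Cons map_Suc_upt[symmetric] comp_def del: upt_Suc)
  finally show ?case .
qed simp

lemma Rt_even: "k \<le> E \<Longrightarrow> Rt \<beta> (2 * k) = map (\<lambda>j. 2 * int j + 1) [0..<k]"
  by (induction k) (auto simp: Rt_Suc \<beta>_def)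

lemma LR_top: "Lt \<beta> (2 * E + q) = Lt \<beta> (2 * E)"
  "Rt \<beta> (2 * E + q) = Rt \<beta> (2 * E) @ map (\<lambda>j. 2 * int E + 1 + int j) [0..<q]"
  by (induction q) (auto simp: Lt_Suc Rt_Suc \<beta>_def)

lemma m1: "m - 1 = 2 * E + p"
  by (simp add: m_eq E_def)

lemma Lt_list: "Lt \<beta> (2 * E + p) = rev (map uminus Zo) @ El"
proof (rule nth_equalityI)
  show "length (Lt \<beta> (2 * E + p)) = length (rev (map uminus Zo) @ El)"
    by (simp add: LR_top Lt_even Zo_def El_def) (simp add: E_def)
  fix i assume "i < length (Lt \<beta> (2 * E + p))"
  then have "i < E" by (simp add: LR_top Lt_even)
  then show "Lt \<beta> (2 * E + p) ! i = (rev (map uminus Zo) @ El) ! i"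
    unfolding LR_top by (subst Lt_even) (auto simp: Zo_def El_def nth_append rev_nth m_int E_def)
qed

lemma Rt_list: "map uminus (Rt \<beta> (2 * E + p)) = (rev (map uminus Ol) @ Ze) @ rev (map (\<lambda>i. i - int m) [1..int p])"
proof -
  have "map uminus (map (\<lambda>j. 2 * int j + 1) [0..<E]) = rev (map uminus Ol) @ Ze"
    by (rule nth_equalityI) (auto simp: Ol_def Ze_def nth_append rev_nth m_int E_def)
  moreover have "map uminus (map (\<lambda>j. 2 * int E + 1 + int j) [0..<p]) = rev (map (\<lambda>i. i - int m) [1..int p])"
    by (rule nth_equalityI) (auto simp: rev_nth m_E)
  ultimately show ?thesis by (simp only: LR_top Rt_even order_refl map_append)
qed

text \<open>With these matrices $\lambda M_{\mathbf z} - M_{\mathbf w}$ is \<open>AL\<close> times $\lambda M_{-m} - L_1 M_0 T_1$ times \<open>T1i\<close>, the inverse of \<open>T1\<close>.\<close>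

definition AL where "AL = G Zo * G Ol"
definition L1 where "L1 = G (Lt \<beta> (2 * E + p))"
definition T1 where "T1 = G (Rt \<beta> (2 * E + p))"
definition T1i where "T1i = G (rev (map uminus (Rt \<beta> (2 * E + p))))"

lemma mats_carrier [simp]: "AL \<in> carrier_mat N N" "L1 \<in> carrier_mat N N" "T1 \<in> carrier_mat N N" "T1i \<in> carrier_mat N N"
  by (auto simp: AL_def L1_def T1_def T1i_def)

lemma T1_inverse: "T1 * T1i = 1\<^sub>m N" "T1i * T1 = 1\<^sub>m N"
  unfolding T1_def T1i_def using m_E by (auto intro!: gprod_gfied_inverse dest!: set_Rt)

lemma AL_L1: "AL * L1 = G Ol * G El"
proof -
  have inv: "G Zo * G (rev (map uminus Zo)) = 1\<^sub>m N"
    by (rule gprod_gfied_inverse(1)) (use m_int in \<open>auto dest!: sets\<close>)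
  have comm: "G Zo * G Ol = G Ol * G Zo"
    by (rule G_commute) (use m_int in \<open>auto dest!: sets simp: idx_def far_def\<close>)
  have "AL * L1 = (G Ol * G Zo) * (G (rev (map uminus Zo)) * G El)"
    unfolding AL_def L1_def Lt_list G_append comm ..
  also have "\<dots> = G Ol * (G Zo * G (rev (map uminus Zo))) * G El"
    by (rule mat_mult_middle) auto
  also have "\<dots> = G Ol * G El" by (simp add: inv)
  finally show ?thesis .
qed

lemma strip_w: "AL * (L1 * M 0 * T1) * T1i = G wl"
proof -
  have "AL * (L1 * M 0 * T1) * T1i = (AL * L1) * M 0 * (T1 * T1i)"
    by (simp add: assoc_mult_mat[of _ N N _ N _ N])
  then show ?thesis by (simp add: AL_L1 T1_inverse G_wl)
qed

lemma Np_Cons: "Np = - int m # map (\<lambda>i. i - int m) [1..int p]"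
  by (simp add: Np_def upto_rec1)

lemma T1i_eq: "M (- int m) * T1i = G Ze * G Np * G (rev (map uminus Ol))"
proof -
  let ?N1 = "map (\<lambda>i. i - int m) [1..int p]" and ?O = "rev (map uminus Ol)"
  have far: "i \<in> set ?O \<union> set Ze \<Longrightarrow> idx m i \<and> odd i \<and> - int m + 1 \<le> i \<and> i \<le> - 1" for i
    using m_int by (auto dest!: sets simp: idx_def)
  have "T1i = G (rev (rev ?N1) @ rev (?O @ Ze))"
    unfolding T1i_def Rt_list by simp
  also have "\<dots> = G ?N1 * G (rev (?O @ Ze))" by (simp add: G_append)
  also have "G (rev (?O @ Ze)) = G (?O @ Ze)"
  proof (rule G_rev)
    fix i j assume "i \<in> set (?O @ Ze)" "j \<in> set (?O @ Ze)"
    then have "idx m i \<and> odd i \<and> i \<le> - 1" "idx m j \<and> odd j \<and> j \<le> - 1" using far by auto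
    then show "idx m i \<and> idx m j \<and> (i = j \<or> far i j)"
      by (intro conjI far_same_parity) auto
  qed
  also have "G (?O @ Ze) = G Ze * G ?O"
    unfolding G_append by (rule G_commute) (use m_int in \<open>auto dest!: sets simp: idx_def far_def\<close>)
  finally have "M (- int m) * T1i = G Np * (G Ze * G ?O)"
    by (simp add: Np_Cons assoc_mult_mat[of _ N N _ N _ N])
  also have "\<dots> = (G Np * G Ze) * G ?O" by (simp add: assoc_mult_mat[of _ N N _ N _ N])
  also have "G Np * G Ze = G Ze * G Np"
    by (rule G_commute) (use m_int in \<open>auto dest!: sets simp: idx_def far_def\<close>)
  finally show ?thesis .
qed

lemma strip_z: "AL * M (- int m) * T1i = G zl"
proof -
  let ?O = "rev (map uminus Ol)"
  have inv: "G Ol * G ?O = 1\<^sub>m N"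
    by (rule gprod_gfied_inverse(1)) (use m_int in \<open>auto dest!: sets\<close>)
  have "G Ol * G (Ze @ Np) = G (Ze @ Np) * G Ol"
    by (rule G_commute) (use m_int in \<open>auto dest!: sets simp: idx_def far_def\<close>)
  then have comm: "G Ol * (G Ze * G Np) = (G Ze * G Np) * G Ol" by (simp add: G_append)
  have "AL * M (- int m) * T1i = G Zo * (G Ol * (G Ze * G Np)) * G ?O"
    unfolding AL_def using T1i_eq by (simp add: assoc_mult_mat[of _ N N _ N _ N])
  also have "\<dots> = G Zo * (G Ze * G Np) * (G Ol * G ?O)"
    unfolding comm by (simp add: assoc_mult_mat[of _ N N _ N _ N])
  also have "\<dots> = G Zo * G Ze * G Np"
    by (simp add: inv assoc_mult_mat[of _ N N _ N _ N])
  finally show ?thesis by (simp add: G_zl)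
qed

text \<open>The pencil $L(\lambda)$ is $\lambda X_1 - X_0$.\<close>

definition X0 where "X0 = G wl * G Ol * G (Zo @ rc)"
definition X1 where "X1 = G zl * G Ol * G (Zo @ rc)"

lemma X0_list: "X0 = G (Ol @ El @ [0] @ Ol @ Zo @ rc)"
  unfolding X0_def G_wl G_append by (simp add: assoc_mult_mat[of _ N N _ N _ N])

lemma X1_list: "X1 = G (Zo @ Ze @ Np @ Ol @ Zo @ rc)"
  unfolding X1_def G_zl G_append by (simp add: assoc_mult_mat[of _ N N _ N _ N])

lemma G_rev_Ol: "G (rev Ol) = G Ol" and G_rev_El: "G (rev El) = G El"
  and G_rev_Zo: "G (rev Zo) = G Zo" and G_rev_Ze: "G (rev Ze) = G Ze"
proof -
  show "G (rev Ol) = G Ol" by (rule G_rev, intro conjI far_same_parity) (use m_int in \<open>auto dest!: sets simp: idx_def\<close>)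
  show "G (rev El) = G El" by (rule G_rev, intro conjI far_same_parity) (use m_int in \<open>auto dest!: sets simp: idx_def\<close>)
  show "G (rev Zo) = G Zo" by (rule G_rev, intro conjI far_same_parity) (use m_int in \<open>auto dest!: sets simp: idx_def\<close>)
  show "G (rev Ze) = G Ze" by (rule G_rev, intro conjI far_same_parity) (use m_int in \<open>auto dest!: sets simp: idx_def\<close>)
qed

lemma rc_Np: "G (rev rc) = G rc" "G Np * G rc = G rc * G (rev Np)"
proof -
  have comm: "M (i - int m) * M (j - int m) = M (j - int m) * M (i - int m)"
    if "0 \<le> i" "i + 2 \<le> j" "j \<le> int p" for i j
    by (rule gfied_commute) (use that m_int in \<open>auto simp: idx_def far_def\<close>)
  show "G (rev rc) = G rc"
    unfolding rc_def rev_map gprod_map by (rule rev_c_palindrome) (simp, rule comm, auto)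
  show "G Np * G rc = G rc * G (rev Np)"
    unfolding rc_def Np_def rev_map gprod_map by (rule rev_c_flip) (simp, rule comm, auto)
qed

text \<open>Reversing the tuple can be undone by admissible commutations; the same holds for \<open>X1\<close>, where the run
  \<open>Np\<close> is moved past \<open>rc\<close> by \<open>rc_Np\<close>.\<close>

lemma X0_palindrome: "G (rev (Ol @ El @ [0] @ Ol @ Zo @ rc)) = X0"
proof -
  have 1: "G (rc @ Zo) * G (Ol @ [0] @ El @ Ol) = G (Ol @ [0] @ El @ Ol) * G (rc @ Zo)"
    by (rule G_commute) (use m_int in \<open>auto dest!: sets simp: idx_def far_def\<close>)
  have 2: "G rc * G Zo = G Zo * G rc" 
    by (rule G_commute) (use m_int in \<open>auto dest!: sets simp: idx_def far_def\<close>)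
  have 3: "G [0] * G El = G El * G [0]"
    by (rule G_commute) (use m_int in \<open>auto dest!: sets simp: idx_def far_def\<close>)
  have "G (rev (Ol @ El @ [0] @ Ol @ Zo @ rc)) = G (rc @ Zo) * G (Ol @ [0] @ El @ Ol)"
    by (simp add: G_append G_rev_Ol G_rev_El G_rev_Zo rc_Np assoc_mult_mat[of _ N N _ N _ N])
  also have "\<dots> = G Ol * (G [0] * G El) * G Ol * (G rc * G Zo)"
    unfolding 1 by (simp add: G_append assoc_mult_mat[of _ N N _ N _ N])
  also have "\<dots> = X0"
    unfolding 2 3 X0_list by (simp add: G_append assoc_mult_mat[of _ N N _ N _ N])
  finally show ?thesis .
qed

lemma X1_palindrome: "G (rev (Zo @ Ze @ Np @ Ol @ Zo @ rc)) = X1"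
proof -
  have 1: "G rc * G (Zo @ Ol) = G (Zo @ Ol) * G rc"
    by (rule G_commute) (use m_int in \<open>auto dest!: sets simp: idx_def far_def\<close>)
  have 2: "G rc * G (Ze @ Zo) = G (Ze @ Zo) * G rc" 
    by (rule G_commute) (use m_int in \<open>auto dest!: sets simp: idx_def far_def\<close>)
  have 3: "G Np * G Ze = G Ze * G Np"
    by (rule G_commute) (use m_int in \<open>auto dest!: sets simp: idx_def far_def\<close>)
  have 4: "G Ol * G (Ze @ Np @ Zo) = G (Ze @ Np @ Zo) * G Ol"
    by (rule G_commute) (use m_int in \<open>auto dest!: sets simp: idx_def far_def\<close>)
  have 5: "G Zo * G Ol = G Ol * G Zo"
    by (rule G_commute) (use m_int in \<open>auto dest!: sets simp: idx_def far_def\<close>)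
  have 6: "G Np * G Zo * G Ol = G Np * G Ol * G Zo"
    by (simp add: 5 assoc_mult_mat[of _ N N _ N _ N])
  have "G (rev (Zo @ Ze @ Np @ Ol @ Zo @ rc)) = G rc * G (Zo @ Ol) * G (rev Np) * G (Ze @ Zo)"
    by (simp add: G_append G_rev_Ol G_rev_Ze G_rev_Zo rc_Np(1) assoc_mult_mat[of _ N N _ N _ N])
  also have "\<dots> = G (Zo @ Ol) * (G rc * G (rev Np)) * G (Ze @ Zo)"
    unfolding 1 by (simp add: assoc_mult_mat[of _ N N _ N _ N])
  also have "\<dots> = G (Zo @ Ol) * G Np * (G rc * G (Ze @ Zo))"
    unfolding rc_Np(2)[symmetric] by (simp add: assoc_mult_mat[of _ N N _ N _ N])
  also have "\<dots> = G Zo * (G Ol * ((G Np * G Ze) * G Zo)) * G rc"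
    unfolding 2 by (simp add: G_append assoc_mult_mat[of _ N N _ N _ N])
  also have "\<dots> = G Zo * (G Ol * G (Ze @ Np @ Zo)) * G rc"
    unfolding 3 by (simp add: G_append assoc_mult_mat[of _ N N _ N _ N])
  also have "\<dots> = G Zo * G Ze * (G Np * G Zo * G Ol) * G rc"
    unfolding 4 by (simp add: G_append assoc_mult_mat[of _ N N _ N _ N])
  also have "\<dots> = X1"
    unfolding 6 X1_list by (simp add: G_append assoc_mult_mat[of _ N N _ N _ N])
  finally show ?thesis .
qed

end

section \<open>Sign similarity\<close>

definition sg :: "nat \<Rightarrow> nat \<Rightarrow> (nat \<Rightarrow> nat) \<Rightarrow> 'a :: comm_ring_1 mat" where
  "sg m n q = bdiag m n (\<lambda>b. (- 1) ^ q b \<cdot>\<^sub>m 1\<^sub>m n)"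

lemma bdiag_carrier [simp]: "bdiag m n f \<in> carrier_mat (m * n) (m * n)"
  by (simp add: bdiag_def)

lemma sg_carrier [simp]: "sg m n q \<in> carrier_mat (m * n) (m * n)"
  by (simp add: sg_def)

lemma bacts_sg: "bacts m n (sg m n q) (\<lambda>x b a. (- 1) ^ q b * x b a)"
  unfolding sg_def by (rule bacts_cong[OF bacts_bdiag]) (simp add: mv_scalar)

lemma sg_sg: "sg m n q * sg m n q = 1\<^sub>m (m * n)"
  by (rule bacts_eqI[OF bacts_mult[OF bacts_sg bacts_sg] bacts_one])
    (simp flip: mult.assoc power_add)

lemma sg_cong: "(\<And>b. b < m \<Longrightarrow> even (q b + q' b)) \<Longrightarrow> sg m n q = sg m n q'"
  by (rule bacts_eqI[OF bacts_sg bacts_sg]) (auto simp: minus_one_power_iff)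

lemma sg_Suc: "sg m n (\<lambda>b. Suc (q b)) = (- sg m n q :: 'a :: comm_ring_1 mat)"
proof -
  have "- sg m n q = (- 1) \<cdot>\<^sub>m (sg m n q :: 'a mat)" by (intro eq_matI) auto
  then have "bacts m n (- sg m n q :: 'a mat) (\<lambda>x b a. - 1 * ((- 1) ^ q b * x b a))"
    using bacts_smult[OF bacts_sg[of m n q], of "- 1 :: 'a"] by (simp only:)
  then show ?thesis by (intro bacts_eqI[OF bacts_sg]) auto
qed

text \<open>Replacing $c_i$ by $(-1)^i c_i$ in $M_i$ amounts to multiplying by sign matrices whose exponents, on the blocks
  touched by $M_i$, differ by $|i|$ between the left and the right.  The identity blocks off the diagonal keep
  their sign exactly under the condition \<open>condq\<close>.\<close>

definition stepq :: "nat \<Rightarrow> int \<Rightarrow> (nat \<Rightarrow> nat) \<Rightarrow> nat \<Rightarrow> nat" where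
  "stepq m i q b = q b + (if b \<in> pr m i then nat \<bar>i\<bar> else 0)"

definition condq :: "nat \<Rightarrow> int \<Rightarrow> (nat \<Rightarrow> nat) \<Rightarrow> bool" where
  "condq m i q \<longleftrightarrow> (0 < \<bar>i\<bar> \<longrightarrow> \<bar>i\<bar> < int m \<longrightarrow> even (q (m - nat \<bar>i\<bar> - 1) + q (m - nat \<bar>i\<bar>) + nat \<bar>i\<bar>))"

lemma sign_gfied:
  fixes c c' :: "nat \<Rightarrow> 'a :: comm_ring_1 mat"
  assumes c: "\<And>j. c j \<in> carrier_mat n n" "\<And>j. c' j = (- 1) ^ j \<cdot>\<^sub>m c j"
    and i: "idx m i" "condq m i q"
  shows "gfied m n c' i = sg m n q * gfied m n c i * sg m n (stepq m i q)"
proof (rule bacts_eqI[OF bacts_gfied[OF i(1)] bacts_mult[OF bacts_mult[OF bacts_sg bacts_gfied[OF i(1)]] bacts_sg]])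
  fix x :: "nat \<Rightarrow> nat \<Rightarrow> 'a" and b a assume b: "b < m" and a: "a < n"
  have mv': "mv n (c' j) z a = (- 1) ^ j * mv n (c j) z a" for j z
    using a c(1)[of j] by (simp add: mv_def c(2) sum_distrib_left mult.assoc)
  show "fapp m n c' i x b a = (- 1) ^ q b * fapp m n c i (\<lambda>b a. (- 1) ^ stepq m i q b * x b a) b a"
    using i(1)
  proof (cases rule: idx_cases)
    case zero
    then show ?thesis
      by (simp add: fapp_def stepq_def mv' mv_smult minus_one_power_iff)
  next
    case low
    then show ?thesis
      by (simp add: fapp_def stepq_def mv' mv_smult minus_one_power_iff)
  next
    case (mid k)
    have ev: "even (q k + q (k + 1) + nat \<bar>i\<bar>)"
      using i mid(1,2,4) unfolding condq_def mid(3) idx_def by auto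
    show ?thesis
    proof (cases "i > 0")
      case True
      then have "nat \<bar>i\<bar> = nat i" by simp
      then show ?thesis unfolding fapp_mid[OF mid(1-3)] using mid(5) True ev
        by (cases "even (q k)"; cases "even (q (k + 1))"; cases "even (nat i)"; cases "even (q b)")
          (auto simp: stepq_def mv' mv_smult mv_uminus minus_one_power_iff)
    next
      case False
      then have "nat \<bar>i\<bar> = nat (- i)" by simp
      then show ?thesis unfolding fapp_mid[OF mid(1-3)] using mid(5) False ev
        by (cases "even (q k)"; cases "even (q (k + 1))"; cases "even (nat (- i))"; cases "even (q b)")
          (auto simp: stepq_def mv' mv_smult mv_uminus minus_one_power_iff)
    qed
  qed
qed

text \<open>For a product the exponents are passed on from factor to factor, and \<open>condq\<close> has to hold at each of them.  In total the
  exponent of block \<open>b\<close> changes by \<open>cnt m t b\<close>.\<close>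

fun okq :: "nat \<Rightarrow> (nat \<Rightarrow> nat) \<Rightarrow> int list \<Rightarrow> bool" where
  "okq m q [] = True"
| "okq m q (i # t) = (condq m i q \<and> okq m (stepq m i q) t)"

fun cnt :: "nat \<Rightarrow> int list \<Rightarrow> nat \<Rightarrow> nat" where
  "cnt m [] b = 0"
| "cnt m (i # t) b = (if b \<in> pr m i then nat \<bar>i\<bar> else 0) + cnt m t b"

lemma cnt_append [simp]: "cnt m (t @ u) b = cnt m t b + cnt m u b"
  by (induction t) auto

lemma sign_gprod:
  fixes c c' :: "nat \<Rightarrow> 'a :: comm_ring_1 mat"
  assumes c: "\<And>j. c j \<in> carrier_mat n n" "\<And>j. c' j = (- 1) ^ j \<cdot>\<^sub>m c j"
    and t: "\<And>i. i \<in> set t \<Longrightarrow> idx m i" "okq m q t"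
  shows "gprod (m * n) (gfied m n c') t = sg m n q * gprod (m * n) (gfied m n c) t * sg m n (\<lambda>b. q b + cnt m t b)"
  using t
proof (induction t arbitrary: q)
  case Nil
  then show ?case by (simp add: sg_sg right_mult_one_mat[of _ "m * n" "m * n"])
next
  case (Cons i t)
  let ?q = "stepq m i q" and ?G = "gprod (m * n) (gfied m n c) t"
  have q: "(\<lambda>b. ?q b + cnt m t b) = (\<lambda>b. q b + cnt m (i # t) b)"
    by (auto simp: stepq_def)
  have IH: "gprod (m * n) (gfied m n c') t = sg m n ?q * ?G * sg m n (\<lambda>b. ?q b + cnt m t b)"
    by (rule Cons.IH) (use Cons.prems in auto)
  have "gprod (m * n) (gfied m n c') (i # t) =
     (sg m n q * gfied m n c i * sg m n ?q) * (sg m n ?q * ?G * sg m n (\<lambda>b. ?q b + cnt m t b))"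
    using IH sign_gfied[OF c, of m i q] Cons.prems by simp
  also have "\<dots> = sg m n q * gfied m n c i * (sg m n ?q * sg m n ?q) * ?G * sg m n (\<lambda>b. ?q b + cnt m t b)"
    by (simp add: assoc_mult_mat[of _ "m * n" "m * n" _ "m * n" _ "m * n"])
  also have "\<dots> = sg m n q * gprod (m * n) (gfied m n c) (i # t) * sg m n (\<lambda>b. q b + cnt m (i # t) b)"
    unfolding sg_sg q by (simp add: assoc_mult_mat[of _ "m * n" "m * n" _ "m * n" _ "m * n"])
  finally show ?case .
qed

lemma condq_cong:
  assumes "\<And>b. b \<in> pr m i \<Longrightarrow> even (q b + q' b)"
  shows "condq m i q \<longleftrightarrow> condq m i q'"
proof -
  have "even (q (m - nat \<bar>i\<bar> - 1) + q' (m - nat \<bar>i\<bar> - 1))" "even (q (m - nat \<bar>i\<bar>) + q' (m - nat \<bar>i\<bar>))"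
    if "0 < \<bar>i\<bar>" "\<bar>i\<bar> < int m"
  proof -
    have "m - nat \<bar>i\<bar> - 1 \<in> pr m i" "m - nat \<bar>i\<bar> \<in> pr m i" using that by (auto simp: pr_def)
    then show "even (q (m - nat \<bar>i\<bar> - 1) + q' (m - nat \<bar>i\<bar> - 1))" "even (q (m - nat \<bar>i\<bar>) + q' (m - nat \<bar>i\<bar>))"
      using assms by blast+
  qed
  then show ?thesis unfolding condq_def even_add by auto
qed

lemma okq_cong:
  assumes "\<And>b. b < m \<Longrightarrow> even (q b + q' b)"
  shows "okq m q t \<longleftrightarrow> okq m q' t"
  using assms
proof (induction t arbitrary: q q')
  case (Cons i t)
  have "condq m i q \<longleftrightarrow> condq m i q'"
    by (rule condq_cong) (use Cons.prems in \<open>auto simp: pr_def\<close>)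
  moreover have "okq m (stepq m i q) t \<longleftrightarrow> okq m (stepq m i q') t"
    by (rule Cons.IH) (use Cons.prems in \<open>auto simp: stepq_def\<close>)
  ultimately show ?case by simp
qed simp

lemma okq_append: "okq m q (t @ u) \<longleftrightarrow> okq m q t \<and> okq m (\<lambda>b. q b + cnt m t b) u"
proof (induction t arbitrary: q)
  case (Cons i t)
  have "(\<lambda>b. stepq m i q b + cnt m t b) = (\<lambda>b. q b + cnt m (i # t) b)"
    by (auto simp: stepq_def)
  then show ?case using Cons[of "stepq m i q"] by simp
qed simp

text \<open>No two different factors touch the same block, so the exponents seen by a factor are not influenced by the others.\<close>

definition scattered :: "int list \<Rightarrow> bool" where
  "scattered t \<longleftrightarrow> distinct t \<and> (\<forall>i\<in>set t. \<forall>j\<in>set t. i \<noteq> j \<longrightarrow> far i j)"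

lemma scattered_Cons: "scattered (i # t) \<Longrightarrow> scattered t \<and> (\<forall>j\<in>set t. far i j)"
  by (auto simp: scattered_def)

lemma okq_scattered:
  assumes "scattered t" "\<And>i. i \<in> set t \<Longrightarrow> condq m i q"
  shows "okq m q t"
  using assms
proof (induction t arbitrary: q)
  case (Cons i t)
  have "condq m j (stepq m i q)" if "j \<in> set t" for j
  proof -
    have "pr m j \<inter> pr m i = {}"
      using scattered_Cons[OF Cons.prems(1)] that by (metis far_disjoint far_sym)
    then have "condq m j q \<longleftrightarrow> condq m j (stepq m i q)"
      by (intro condq_cong) (auto simp: stepq_def)
    then show ?thesis using Cons.prems(2)[of j] that by simp
  qed
  then show ?case using Cons scattered_Cons[OF Cons.prems(1)] by auto
qed simp

lemma cnt_even: "(\<And>i. i \<in> set t \<Longrightarrow> even i) \<Longrightarrow> even (cnt m t b)"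
  by (induction t) (auto simp: even_nat_iff)

lemma cnt_zero: "(\<And>i. i \<in> set t \<Longrightarrow> b \<notin> pr m i) \<Longrightarrow> cnt m t b = 0"
  by (induction t) auto

lemma cnt_odd:
  assumes "scattered t" "\<And>i. i \<in> set t \<Longrightarrow> odd i"
  shows "odd (cnt m t b) \<longleftrightarrow> (\<exists>i\<in>set t. b \<in> pr m i)"
  using assms
proof (induction t)
  case (Cons i t)
  have far: "far i j" if "j \<in> set t" for j using scattered_Cons[OF Cons.prems(1)] that by simp
  have IH: "odd (cnt m t b) \<longleftrightarrow> (\<exists>i\<in>set t. b \<in> pr m i)"
    using Cons scattered_Cons[OF Cons.prems(1)] by simp
  show ?case
  proof (cases "b \<in> pr m i")
    case True
    then have "b \<notin> pr m j" if "j \<in> set t" for j using far_disjoint[OF far[OF that], of m] by blast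
    then have "cnt m t b = 0" by (intro cnt_zero) auto
    then show ?thesis using True Cons.prems(2)[of i] by (simp add: even_nat_iff)
  next
    case False
    then show ?thesis using IH by simp
  qed
qed simp

lemma pr_shift: "i \<le> int m \<Longrightarrow> 0 \<le> i \<Longrightarrow> b \<in> pr m (i - int m) \<longleftrightarrow> b < m \<and> (int b = i - 1 \<or> int b = i)"
  by (auto simp: pr_def)

lemma upto_Suc_right: "[0..int (Suc s)] = [0..int s] @ [int s + 1]"
  using upto_rec2[of 0 "int (Suc s)"] by (simp add: add.commute)

text \<open>The run $-m, \dots, s - m$ touches each block before \<open>s\<close> twice, by factors whose indices are consecutive.\<close>

lemma cnt_shift:
  assumes "s < m" "b < m"
  shows "even (cnt m (map (\<lambda>i. i - int m) [0..int s]) b + (if b < s then 1 else if b = s then m - s else 0))"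
  using assms(1)
proof (induction s)
  case 0
  then show ?case using assms(2) by (auto simp: pr_def)
next
  case (Suc s)
  have w: "nat \<bar>int s + 1 - int m\<bar> = m - Suc s" using Suc.prems by auto
  have p: "b \<in> pr m (int s + 1 - int m) \<longleftrightarrow> b = s \<or> b = Suc s"
    using pr_shift[of "int s + 1" m b] Suc.prems assms(2) by auto
  have eq: "cnt m (map (\<lambda>i. i - int m) [0..int (Suc s)]) b
     = cnt m (map (\<lambda>i. i - int m) [0..int s]) b + (if b = s \<or> b = Suc s then m - Suc s else 0)"
    unfolding upto_Suc_right map_append cnt_append by (simp add: p w del: nat_abs_int_diff)
  have IH: "even (cnt m (map (\<lambda>i. i - int m) [0..int s]) b + (if b < s then 1 else if b = s then m - s else 0))"
    using Suc by simp
  have "even (m - s + (m - Suc s) + 1)" using Suc.prems by simp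
  then show ?case using IH unfolding eq by (auto split: if_splits)
qed

lemma okq_shift:
  assumes "s < m" "\<And>b. b < s \<Longrightarrow> odd (q b + q (Suc b))"
  shows "okq m q (map (\<lambda>i. i - int m) [0..int s])"
  using assms
proof (induction s)
  case 0
  then show ?case by (simp add: condq_def)
next
  case (Suc s)
  let ?t = "map (\<lambda>i. i - int m) [0..int s]"
  have w: "nat \<bar>int s + 1 - int m\<bar> = m - Suc s" using Suc.prems by auto
  have e: "even (cnt m ?t s + (m - s))" "even (cnt m ?t (Suc s))"
    using cnt_shift[of s m s] cnt_shift[of s m "Suc s"] Suc.prems by auto
  have "m - (m - Suc s) - 1 = s" "m - (m - Suc s) = Suc s" using Suc.prems by auto
  moreover have "even (m - s + (m - Suc s) + 1)" using Suc.prems by simp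
  ultimately have "condq m (int s + 1 - int m) (\<lambda>b. q b + cnt m ?t b)"
    unfolding condq_def w using e Suc.prems(2)[of s] by auto
  moreover have "okq m q ?t" using Suc by simp
  ultimately show ?case unfolding upto_Suc_right map_append okq_append by simp
qed

lemma okq_rev_c:
  assumes "p \<le> m" "\<And>b. Suc b < p \<Longrightarrow> odd (q b + q (Suc b))"
  shows "okq m q (map (\<lambda>i. i - int m) (rev_c p)) \<and>
    (\<forall>b<m. even (cnt m (map (\<lambda>i. i - int m) (rev_c p)) b + (if b < p then m + p + 1 else 0)))"
  using assms
proof (induction p arbitrary: q)
  case (Suc p)
  let ?t = "map (\<lambda>i. i - int m) [0..int p]" and ?u = "map (\<lambda>i. i - int m) (rev_c p)"
  have ok: "okq m q ?t" using Suc.prems by (intro okq_shift) auto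
  have cnt: "even (cnt m ?t b + (if b < p then 1 else if b = p then m - p else 0))" if "b < m" for b
    using Suc.prems that by (intro cnt_shift) auto
  have alt: "odd ((q b + cnt m ?t b) + (q (Suc b) + cnt m ?t (Suc b)))" if "Suc b < p" for b
    using Suc.prems(2)[of b] cnt[of b] cnt[of "Suc b"] that Suc.prems(1) by auto
  have IH: "okq m (\<lambda>b. q b + cnt m ?t b) ?u"
     "\<And>b. b < m \<Longrightarrow> even (cnt m ?u b + (if b < p then m + p + 1 else 0))"
    using Suc.IH[of "\<lambda>b. q b + cnt m ?t b"] alt Suc.prems(1) by auto
  have "even (cnt m (map (\<lambda>i. i - int m) (rev_c (Suc p))) b + (if b < Suc p then m + Suc p + 1 else 0))"
    if "b < m" for b
  proof -
    have "even (m - p + (m + p))" using Suc.prems by auto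
    then show ?thesis
      using cnt[OF that] IH(2)[OF that] unfolding rev_c_Suc map_append cnt_append
      by (cases "b < p"; cases "b = p") auto
  qed
  then show ?case using ok IH(1) unfolding rev_c_Suc map_append okq_append by blast
qed simp

context gfpr
begin

lemma bounds: "p < m" "p \<le> m" "2 * e < m" "p + 2 * e < m" "0 < m"
  by (simp_all add: m_eq)

text \<open>The sign exponents of the quasi-identity.  Blocks \<open>b\<close> and \<open>b + 1\<close> are the pair of the index \<open>m - 1 - b\<close>; the sign changes
  there if the index is odd, equals \<open>h = 2 * e\<close>, or belongs to the run \<open>Np\<close>.\<close>

fun qd :: "nat \<Rightarrow> nat" where
  "qd 0 = 0"
| "qd (Suc b) = qd b + (if odd (m - 1 - b) \<or> m - 1 - b = 2 * e \<or> m - p \<le> m - 1 - b then 1 else 0)"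

declare qd.simps [simp del]

lemma set_Ol_iff: "i \<in> set Ol \<longleftrightarrow> 1 \<le> i \<and> i \<le> 2 * int e - 1 \<and> odd i"
proof
  assume i: "1 \<le> i \<and> i \<le> 2 * int e - 1 \<and> odd i"
  then obtain k where k: "i = 2 * k + 1" by (elim conjE oddE)
  have "i = int (2 * e) - 2 * int (nat (int e - 1 - k)) - 1" "nat (int e - 1 - k) < e" using i k by auto
  then show "i \<in> set Ol" unfolding Ol_def set_map by (intro image_eqI[where x = "nat (int e - 1 - k)"]) auto
qed (rule set_Ol)

lemma set_El_iff: "i \<in> set El \<longleftrightarrow> 2 \<le> i \<and> i \<le> 2 * int e \<and> even i"
proof
  assume i: "2 \<le> i \<and> i \<le> 2 * int e \<and> even i"
  then obtain k where k: "i = 2 * k" by (elim conjE evenE)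
  have "i = int (2 * e) - 2 * int (nat (int e - k))" "nat (int e - k) < e" using i k by auto
  then show "i \<in> set El" unfolding El_def set_map by (intro image_eqI[where x = "nat (int e - k)"]) auto
qed (rule set_El)

lemma set_Zo_iff: "i \<in> set Zo \<longleftrightarrow> 2 * int e + 2 \<le> - i \<and> - i \<le> int m - int p - 1 \<and> even i"
proof
  assume i: "2 * int e + 2 \<le> - i \<and> - i \<le> int m - int p - 1 \<and> even i"
  then obtain k where k: "i = 2 * k" by (elim conjE evenE)
  have "i = int (p + 2 * s) - 2 * int (nat (- k - int e - 1)) - 1 - int m" "nat (- k - int e - 1) < s"
    using i k m_int by auto
  then show "i \<in> set Zo" unfolding Zo_def set_map by (intro image_eqI[where x = "nat (- k - int e - 1)"]) auto
qed (rule set_Zo)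

lemma set_Ze_iff: "i \<in> set Ze \<longleftrightarrow> 2 * int e + 1 \<le> - i \<and> - i \<le> int m - int p - 2 \<and> odd i"
proof
  assume i: "2 * int e + 1 \<le> - i \<and> - i \<le> int m - int p - 2 \<and> odd i"
  then obtain k where k: "i = 2 * k + 1" by (elim conjE oddE)
  have "i = int (p + 2 * s) - 2 * int (nat (- k - int e - 1)) - int m" "nat (- k - int e - 1) < s"
    using i k m_int by auto
  then show "i \<in> set Ze" unfolding Ze_def set_map by (intro image_eqI[where x = "nat (- k - int e - 1)"]) auto
qed (rule set_Ze)

lemma scattered_sets: "scattered Ol" "scattered El" "scattered Zo" "scattered Ze"
proof -
  have *: "scattered t" if "distinct t" "\<And>i j. i \<in> set t \<Longrightarrow> j \<in> set t \<Longrightarrow> even (i - j) \<and> (i > 0 \<and> j > 0 \<or> i < 0 \<and> j < 0)" for t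
    unfolding scattered_def using that far_same_parity by blast
  show "scattered Ol"
  proof (rule *)
    show "distinct Ol" by (auto simp: Ol_def distinct_map inj_on_def)
  qed (auto dest!: set_Ol)
  show "scattered El"
  proof (rule *)
    show "distinct El" by (auto simp: El_def distinct_map inj_on_def)
  qed (auto dest!: set_El)
  show "scattered Zo"
  proof (rule *)
    show "distinct Zo" by (auto simp: Zo_def distinct_map inj_on_def)
  qed (auto dest!: set_Zo)
  show "scattered Ze"
  proof (rule *)
    show "distinct Ze" by (auto simp: Ze_def distinct_map inj_on_def)
  qed (auto dest!: set_Ze)
qed

lemma cnt_Ol: "b < m \<Longrightarrow> odd (cnt m Ol b) \<longleftrightarrow> m \<le> b + 2 * e"
proof (subst cnt_odd[OF scattered_sets(1)])
  assume b: "b < m"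
  show "(\<exists>i\<in>set Ol. b \<in> pr m i) \<longleftrightarrow> m \<le> b + 2 * e"
  proof
    assume "m \<le> b + 2 * e"
    moreover define i where "i = (if odd (int m - int b) then int m - int b else int m - int b - 1)"
    ultimately have "i \<in> set Ol" "b \<in> pr m i" using b unfolding set_Ol_iff pr_def i_def by (auto, presburger+)
    then show "\<exists>i\<in>set Ol. b \<in> pr m i" by blast
  qed (auto simp: pr_def dest!: set_Ol)
qed (use set_Ol in auto)

lemma cnt_Ze: "b < m \<Longrightarrow> odd (cnt m Ze b) \<longleftrightarrow> p < b \<and> b + 2 * e < m"
proof (subst cnt_odd[OF scattered_sets(4)])
  assume b: "b < m"
  show "(\<exists>i\<in>set Ze. b \<in> pr m i) \<longleftrightarrow> p < b \<and> b + 2 * e < m"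
  proof
    assume "p < b \<and> b + 2 * e < m"
    moreover define i where "i = (if odd (int m - int b) then int b - int m else int b + 1 - int m)"
    ultimately have "i \<in> set Ze" "b \<in> pr m i" using b m_int unfolding set_Ze_iff pr_def i_def by (auto, presburger+)
    then show "\<exists>i\<in>set Ze. b \<in> pr m i" by blast
  qed (auto simp: pr_def dest!: set_Ze)
qed (use set_Ze in auto)

lemma condq_qd:
  assumes "0 < \<bar>i\<bar>" "\<bar>i\<bar> < int m" "odd i \<or> \<bar>i\<bar> \<noteq> 2 * int e \<and> \<bar>i\<bar> < int m - int p"
  shows "condq m i qd"
proof -
  define k where "k = nat \<bar>i\<bar>"
  have k: "0 < k" "k < m" "odd k \<or> k \<noteq> 2 * e \<and> k < m - p" using assms by (auto simp: k_def even_nat_iff)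
  have "m - k = Suc (m - k - 1)" "m - 1 - (m - k - 1) = k" using k by auto
  then have "qd (m - k) = qd (m - k - 1) + (if odd k \<or> k = 2 * e \<or> m - p \<le> k then 1 else 0)"
    by (metis qd.simps(2))
  then show ?thesis unfolding condq_def k_def[symmetric] using k by auto
qed

lemma condq_qd_top:
  assumes "0 < e"
  shows "condq m (2 * int e) (\<lambda>b. qd b + (if m \<le> b + 2 * e then 1 else 0))"
proof -
  have k: "nat \<bar>2 * int e\<bar> = 2 * e" by simp
  note [simp] = qd.simps
  define d where "d = m - 2 * e - 1"
  have d: "m - 2 * e = Suc d" "m - 1 - d = 2 * e" "d + 2 * e < m" "m \<le> Suc d + 2 * e"
    using bounds assms by (auto simp: d_def)
  have "qd (Suc d) = qd d + 1" using d(2) by simp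
  then show ?thesis unfolding condq_def k d(1) using d(3,4) by auto
qed

lemma qd_alt: "b < p \<Longrightarrow> odd (qd b + qd (Suc b))"
proof -
  assume "b < p"
  then have "m - p \<le> m - 1 - b" using bounds by linarith
  then show ?thesis by (simp add: qd.simps)
qed

lemma odd_mp: "odd (m + p)"
  by (simp add: m_eq)

text \<open>The exponents \<open>qd\<close> meet the condition at every factor of \<open>X0\<close>, and after the last factor they have changed by even
  numbers, so the same sign matrix appears on both sides.  For \<open>X1\<close> all changes are odd, which is the
  overall minus sign of a skew-symmetric leading coefficient.\<close>

lemma X0_signs:
  "okq m qd (Ol @ El @ [0] @ Ol @ Zo @ rc)" "b < m \<Longrightarrow> even (cnt m (Ol @ El @ [0] @ Ol @ Zo @ rc) b)"
proof -
  define q1 where "q1 = (\<lambda>b. qd b + (if m \<le> b + 2 * e then 1 else 0))"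
  have El: "even (cnt m El b)" for b by (rule cnt_even) (use set_El in auto)
  have Zo: "even (cnt m Zo b)" for b by (rule cnt_even) (use set_Zo in auto)
  have O1: "okq m qd Ol"
    by (rule okq_scattered[OF scattered_sets(1) condq_qd]) (use m_int in \<open>auto dest!: set_Ol\<close>)
  have same: "condq m i q1 \<longleftrightarrow> condq m i qd" if "0 < i" "i < 2 * int e" for i
  proof -
    have "m \<le> (m - nat \<bar>i\<bar> - 1) + 2 * e" "m \<le> (m - nat \<bar>i\<bar>) + 2 * e" using that m_int by auto
    then have q: "q1 (m - nat \<bar>i\<bar> - 1) = Suc (qd (m - nat \<bar>i\<bar> - 1))" "q1 (m - nat \<bar>i\<bar>) = Suc (qd (m - nat \<bar>i\<bar>))"
      unfolding q1_def by (simp_all only: if_True add_Suc_right One_nat_def add_0_right)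
    show ?thesis unfolding condq_def q by simp
  qed
  have E1: "okq m q1 El"
  proof (rule okq_scattered[OF scattered_sets(2)])
    fix i assume i: "i \<in> set El"
    show "condq m i q1"
    proof (cases "i = 2 * int e")
      case True
      have "0 < e" using set_El[OF i] True by linarith
      then show ?thesis unfolding True q1_def by (rule condq_qd_top)
    next
      case False
      then have r: "0 < i" "i < 2 * int e" using set_El[OF i] by auto
      have "condq m i qd" by (rule condq_qd) (use r m_int in auto)
      then show ?thesis using same[OF r] by blast
    qed
  qed
  have O2: "okq m q1 Ol"
  proof (rule okq_scattered[OF scattered_sets(1)])
    fix i assume i: "i \<in> set Ol"
    have r: "0 < i" "i < 2 * int e" using set_Ol[OF i] by auto
    have "condq m i qd" by (rule condq_qd) (use r m_int in auto)
    then show "condq m i q1" using same[OF r] by blast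
  qed
  have Z: "okq m qd Zo"
    by (rule okq_scattered[OF scattered_sets(3) condq_qd]) (use m_int in \<open>auto dest!: set_Zo\<close>)
  have rc: "okq m qd rc" "\<And>b. b < m \<Longrightarrow> even (cnt m rc b)"
    using okq_rev_c[of p m qd] bounds(2) qd_alt odd_mp by (auto simp: rc_def split: if_splits)
  have q1: "even (q1 b + qd b + cnt m Ol b)" if "b < m" for b
    using cnt_Ol[OF that] unfolding q1_def by auto
  have p1: "okq m (\<lambda>b. qd b + cnt m Ol b) El"
  proof -
    have "okq m (\<lambda>b. qd b + cnt m Ol b) El \<longleftrightarrow> okq m q1 El"
      by (rule okq_cong, drule q1) auto
    then show ?thesis using E1 by blast
  qed
  have p2: "okq m (\<lambda>b. qd b + cnt m Ol b + cnt m El b) [0]" by (simp add: condq_def)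
  have p3: "okq m (\<lambda>b. qd b + cnt m Ol b + cnt m El b + cnt m [0] b) Ol"
  proof -
    have "okq m (\<lambda>b. qd b + cnt m Ol b + cnt m El b + cnt m [0] b) Ol \<longleftrightarrow> okq m q1 Ol"
      by (rule okq_cong, drule q1) (auto simp: El)
    then show ?thesis using O2 by blast
  qed
  have p4: "okq m (\<lambda>b. qd b + cnt m Ol b + cnt m El b + cnt m [0] b + cnt m Ol b) Zo" 
  proof -
    have "okq m (\<lambda>b. qd b + cnt m Ol b + cnt m El b + cnt m [0] b + cnt m Ol b) Zo \<longleftrightarrow> okq m qd Zo"
      by (rule okq_cong) (auto simp: El)
    then show ?thesis using Z by blast
  qed
  have p5: "okq m (\<lambda>b. qd b + cnt m Ol b + cnt m El b + cnt m [0] b + cnt m Ol b + cnt m Zo b) rc" 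
  proof -
    have "okq m (\<lambda>b. qd b + cnt m Ol b + cnt m El b + cnt m [0] b + cnt m Ol b + cnt m Zo b) rc \<longleftrightarrow> okq m qd rc"
      by (rule okq_cong) (auto simp: El Zo)
    then show ?thesis using rc(1) by blast
  qed
  show "okq m qd (Ol @ El @ [0] @ Ol @ Zo @ rc)"
    unfolding okq_append by (intro conjI O1 p1 p2 p3 p4 p5)
  show "b < m \<Longrightarrow> even (cnt m (Ol @ El @ [0] @ Ol @ Zo @ rc) b)"
    using El[of b] Zo[of b] rc(2)[of b] cnt_even[of "[0]" m b] unfolding cnt_append even_add by simp
qed

lemma X1_signs:
  "okq m qd (Zo @ Ze @ Np @ Ol @ Zo @ rc)" "b < m \<Longrightarrow> odd (cnt m (Zo @ Ze @ Np @ Ol @ Zo @ rc) b)"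
proof -
  have Zo: "even (cnt m Zo b)" for b by (rule cnt_even) (use set_Zo in auto)
  have Np: "odd (cnt m Np b) \<longleftrightarrow> b \<le> p" if "b < m" for b
  proof -
    have "odd (m - p)" using odd_mp bounds(2) by simp
    then show ?thesis using cnt_shift[of p m b] that bounds(1) unfolding Np_def by (auto split: if_splits)
  qed
  have Z: "okq m qd Zo"
    by (rule okq_scattered[OF scattered_sets(3) condq_qd]) (use m_int in \<open>auto dest!: set_Zo\<close>)
  have E: "okq m qd Ze"
    by (rule okq_scattered[OF scattered_sets(4) condq_qd]) (use m_int in \<open>auto dest!: set_Ze\<close>)
  have O: "okq m qd Ol"
    by (rule okq_scattered[OF scattered_sets(1) condq_qd]) (use m_int in \<open>auto dest!: set_Ol\<close>)
  have p1: "okq m (\<lambda>b. qd b + cnt m Zo b) Ze"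
    using E Zo okq_cong[of m "\<lambda>b. qd b + cnt m Zo b" qd Ze] by auto
  have p2: "okq m (\<lambda>b. qd b + cnt m Zo b + cnt m Ze b) Np"
  proof -
    have "odd (qd b + cnt m Zo b + cnt m Ze b + (qd (Suc b) + cnt m Zo (Suc b) + cnt m Ze (Suc b)))" if "b < p" for b
      using qd_alt[OF that] Zo cnt_Ze[of b] cnt_Ze[of "Suc b"] that bounds by auto
    then show ?thesis unfolding Np_def using bounds by (intro okq_shift) auto
  qed
  have p3: "okq m (\<lambda>b. qd b + cnt m Zo b + cnt m Ze b + cnt m Np b) Ol"
  proof (rule okq_scattered[OF scattered_sets(1)])
    fix i assume i: "i \<in> set Ol"
    have "condq m i (\<lambda>b. qd b + cnt m Zo b + cnt m Ze b + cnt m Np b) \<longleftrightarrow> condq m i qd"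
    proof (rule condq_cong)
      fix b assume "b \<in> pr m i"
      then have b: "b < m" "m \<le> b + 2 * e" using set_Ol[OF i] by (auto simp: pr_def)
      then have "p < b" using bounds by linarith
      then have "even (cnt m Zo b)" "even (cnt m Ze b)" "even (cnt m Np b)"
        using b Zo cnt_Ze[OF b(1)] Np[OF b(1)] by auto
      then show "even ((qd b + cnt m Zo b + cnt m Ze b + cnt m Np b) + qd b)" by simp
    qed
    then show "condq m i (\<lambda>b. qd b + cnt m Zo b + cnt m Ze b + cnt m Np b)"
      using condq_qd[of i] set_Ol[OF i] m_int by auto
  qed
  have odd4: "odd (cnt m Zo b + cnt m Ze b + cnt m Np b + cnt m Ol b)" if "b < m" for b
  proof -
    consider "b \<le> p" "b + 2 * e < m" | "p < b" "b + 2 * e < m" | "p < b" "m \<le> b + 2 * e"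
      using bounds by linarith
    then show ?thesis using Zo[of b] cnt_Ze[OF that] Np[OF that] cnt_Ol[OF that] by cases auto
  qed
  have shift: "condq m i (\<lambda>b. Suc (q b)) \<longleftrightarrow> condq m i q" for i q by (auto simp: condq_def)
  have p4: "okq m (\<lambda>b. qd b + cnt m Zo b + cnt m Ze b + cnt m Np b + cnt m Ol b) Zo"
  proof -
    have "okq m (\<lambda>b. Suc (qd b)) Zo"
      by (rule okq_scattered[OF scattered_sets(3)], unfold shift, rule condq_qd) (use m_int in \<open>auto dest!: set_Zo\<close>)
    then show ?thesis using odd4
      okq_cong[of m "\<lambda>b. qd b + cnt m Zo b + cnt m Ze b + cnt m Np b + cnt m Ol b" "\<lambda>b. Suc (qd b)" Zo] by auto
  qed
  have rc: "okq m (\<lambda>b. Suc (qd b)) rc" "\<And>b. b < m \<Longrightarrow> even (cnt m rc b)"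
    using okq_rev_c[of p m "\<lambda>b. Suc (qd b)"] bounds(2) qd_alt odd_mp by (auto simp: rc_def split: if_splits)
  have p5: "okq m (\<lambda>b. qd b + cnt m Zo b + cnt m Ze b + cnt m Np b + cnt m Ol b + cnt m Zo b) rc"
    using rc(1) odd4 Zo
      okq_cong[of m "\<lambda>b. qd b + cnt m Zo b + cnt m Ze b + cnt m Np b + cnt m Ol b + cnt m Zo b" "\<lambda>b. Suc (qd b)" rc] by auto
  show "okq m qd (Zo @ Ze @ Np @ Ol @ Zo @ rc)"
    unfolding okq_append by (intro conjI Z p1 p2 p3 p4 p5)
  show "b < m \<Longrightarrow> odd (cnt m (Zo @ Ze @ Np @ Ol @ Zo @ rc) b)"
    using odd4[of b] Zo[of b] rc(2)[of b] unfolding cnt_append even_add by blast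
qed

end

lemma (in gfpr_mats) transposes:
  assumes c: "\<And>j. c j \<in> carrier_mat n n" "\<And>j. (c j)\<^sup>T = (- 1) ^ j \<cdot>\<^sub>m c j"
  shows "X0\<^sup>T = sg m n qd * X0 * sg m n qd" "X1\<^sup>T = - (sg m n qd * X1 * sg m n qd)"
proof -
  interpret t: gfpr_mats m e p s n "\<lambda>j. (c j)\<^sup>T" by unfold_locales
  have tr: "(G t)\<^sup>T = t.G (rev t)" if "\<And>i. i \<in> set t \<Longrightarrow> idx m i" for t
  proof -
    have "(G t)\<^sup>T = gprod N (\<lambda>i. (M i)\<^sup>T) (rev t)" by (rule transpose_gprod) simp
    also have "\<dots> = t.G (rev t)"
      by (rule gprod_cong) (use that in \<open>auto intro!: transpose_gfied c\<close>)
    finally show ?thesis .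
  qed
  have "X0\<^sup>T = t.X0"
    unfolding X0_list t.X0_palindrome[symmetric] by (rule tr) (use idx_sets in auto)
  also have "t.X0 = sg m n qd * X0 * sg m n (\<lambda>b. qd b + cnt m (Ol @ El @ [0] @ Ol @ Zo @ rc) b)"
    unfolding X0_list t.X0_list by (rule sign_gprod[OF c(1,2) _ X0_signs(1)]) (use idx_sets in auto)
  also have "sg m n (\<lambda>b. qd b + cnt m (Ol @ El @ [0] @ Ol @ Zo @ rc) b) = sg m n qd"
    by (rule sg_cong) (use X0_signs(2) in auto)
  finally show "X0\<^sup>T = sg m n qd * X0 * sg m n qd" .
  have "X1\<^sup>T = t.X1"
    unfolding X1_list t.X1_palindrome[symmetric] by (rule tr) (use idx_sets in auto)
  also have "t.X1 = sg m n qd * X1 * sg m n (\<lambda>b. qd b + cnt m (Zo @ Ze @ Np @ Ol @ Zo @ rc) b)"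
    unfolding X1_list t.X1_list by (rule sign_gprod[OF c(1,2) _ X1_signs(1)]) (use idx_sets in auto)
  also have "sg m n (\<lambda>b. qd b + cnt m (Zo @ Ze @ Np @ Ol @ Zo @ rc) b) = sg m n (\<lambda>b. Suc (qd b))"
    by (rule sg_cong) (use X1_signs(2) in auto)
  also have "sg m n qd * X1 * sg m n (\<lambda>b. Suc (qd b)) = - (sg m n qd * X1 * sg m n qd)"
  proof -
    have "sg m n qd * X1 \<in> carrier_mat N N" by (simp add: X1_def)
    then have "dim_col (sg m n qd * X1) = dim_row (sg m n qd :: 'a mat)" by (metis carrier_matD sg_carrier)
    then show ?thesis unfolding sg_Suc by (rule uminus_mult_right_mat)
  qed
  finally show "X1\<^sup>T = - (sg m n qd * X1 * sg m n qd)" .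
qed

section \<open>Uniqueness of the signs\<close>

text \<open>Signs given by their values instead of exponents; this form covers every quasi-identity matrix.\<close>

definition dg :: "nat \<Rightarrow> nat \<Rightarrow> (nat \<Rightarrow> 'a :: comm_ring_1) \<Rightarrow> 'a mat" where
  "dg m n \<epsilon> = bdiag m n (\<lambda>b. \<epsilon> b \<cdot>\<^sub>m 1\<^sub>m n)"

lemma dg_carrier [simp]: "dg m n \<epsilon> \<in> carrier_mat (m * n) (m * n)"
  "dim_row (dg m n \<epsilon>) = m * n" "dim_col (dg m n \<epsilon>) = m * n"
  by (auto simp: dg_def bdiag_def)

lemma bacts_dg: "bacts m n (dg m n \<epsilon>) (\<lambda>x b a. \<epsilon> b * x b a)"
  unfolding dg_def by (rule bacts_cong[OF bacts_bdiag]) (simp add: mv_scalar)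

lemma mat_vec_smult:
  fixes A :: "'a :: comm_ring_1 mat"
  assumes "A \<in> carrier_mat k l" "v \<in> carrier_vec l"
  shows "A *\<^sub>v (t \<cdot>\<^sub>v v) = t \<cdot>\<^sub>v (A *\<^sub>v v)"
  using assms by (auto intro!: eq_vecI simp: scalar_prod_def sum_distrib_left algebra_simps)

lemma bacts_scale:
  assumes "bacts m n M f" "b < m" "a < n"
  shows "f (\<lambda>b a. t * x b a) b a = t * (f x b a :: 'a :: comm_ring_1)"
proof -
  have "unblk m n (f (\<lambda>b a. t * x b a)) = M *\<^sub>v (t \<cdot>\<^sub>v unblk m n x)"
    by (simp add: unblk_smult bacts_apply[OF assms(1)])
  also have "\<dots> = t \<cdot>\<^sub>v (M *\<^sub>v unblk m n x)"
    using bacts_carrier[OF assms(1)] by (intro mat_vec_smult[of _ "m * n" "m * n"]) auto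
  also have "\<dots> = unblk m n (\<lambda>b a. t * f x b a)"
    by (simp add: bacts_apply[OF assms(1)] unblk_smult)
  finally show ?thesis using assms unfolding unblk_eq_iff by blast
qed

text \<open>The block in position \<open>(b, j)\<close> is multiplied by the product of two signs, and it determines this product if it is not zero.\<close>

lemma sign_link:
  fixes X :: "'a :: idom mat"
  assumes X: "bacts m n X f"
    and eq: "dg m n \<epsilon> * X * dg m n \<epsilon> = dg m n \<epsilon>' * X * dg m n \<epsilon>'"
    and ne: "f (single j y) b a \<noteq> 0" and lt: "j < m" "b < m" "a < n"
  shows "\<epsilon> b * \<epsilon> j = \<epsilon>' b * \<epsilon>' j"
proof -
  have act: "(dg m n \<epsilon> * X * dg m n \<epsilon>) *\<^sub>v unblk m n (single j y)
      = unblk m n (\<lambda>b a. \<epsilon> b * (\<epsilon> j * f (single j y) b a))" for \<epsilon>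
  proof -
    have s: "(\<lambda>b a. \<epsilon> b * single j y b a) = (\<lambda>b a. \<epsilon> j * single j y b a)"
      by (auto simp: single_def fun_eq_iff)
    show ?thesis
      using bacts_apply[OF bacts_mult[OF bacts_mult[OF bacts_dg X] bacts_dg], of \<epsilon> \<epsilon> "single j y"]
      unfolding s by (simp add: unblk_eq_iff bacts_scale[OF X])
  qed
  have "unblk m n (\<lambda>b a. \<epsilon> b * (\<epsilon> j * f (single j y) b a)) = unblk m n (\<lambda>b a. \<epsilon>' b * (\<epsilon>' j * f (single j y) b a))"
    unfolding act[symmetric] eq ..
  then have "\<epsilon> b * (\<epsilon> j * f (single j y) b a) = \<epsilon>' b * (\<epsilon>' j * f (single j y) b a)"
    using lt unfolding unblk_eq_iff by blast
  then have "(\<epsilon> b * \<epsilon> j) * f (single j y) b a = (\<epsilon>' b * \<epsilon>' j) * f (single j y) b a"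
    by (simp add: mult.assoc)
  then show ?thesis using ne by simp
qed

lemma fapp_zero:
  assumes "idx m i" "\<And>b. b \<in> pr m i \<Longrightarrow> x b = (\<lambda>a. 0)"
  shows "fapp m n c i x = x"
  using assms(1)
proof (cases rule: idx_cases)
  case zero
  then have "x (m - 1) = (\<lambda>a. 0)" using assms(2) by simp
  then show ?thesis using zero by (intro ext) (simp add: fapp_def)
next
  case low
  then have "x 0 = (\<lambda>a. 0)" using assms(2) by simp
  then show ?thesis using low by (intro ext) (simp add: fapp_def)
next
  case (mid k)
  then have "x k = (\<lambda>a. 0)" "x (k + 1) = (\<lambda>a. 0)" using assms(2) by auto
  then show ?thesis using mid by (intro ext) (simp add: fapp_mid)
qed

lemma gapp_zero:
  assumes "\<And>i. i \<in> set t \<Longrightarrow> idx m i" "\<And>i b. i \<in> set t \<Longrightarrow> b \<in> pr m i \<Longrightarrow> x b = (\<lambda>a. 0)"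
  shows "gapp m n c t x = x"
  using assms
proof (induction t)
  case (Cons i t)
  have "gapp m n c t x = x" by (rule Cons.IH) (use Cons.prems in auto)
  moreover have "fapp m n c i x = x" by (rule fapp_zero) (use Cons.prems in auto)
  ultimately show ?case by simp
qed simp

lemma gapp_single_fix:
  assumes "\<And>i. i \<in> set t \<Longrightarrow> idx m i" "\<And>i. i \<in> set t \<Longrightarrow> b \<notin> pr m i"
  shows "gapp m n c t (single b y) = single b y"
proof (rule gapp_zero[OF assms(1)])
  fix i b' assume "i \<in> set t" "b' \<in> pr m i"
  then have "b' \<noteq> b" using assms(2) by blast
  then show "single b y b' = (\<lambda>a. 0)" by (simp add: single_def)
qed

lemma fapp_single_up:
  assumes "0 < i" "i < int m"
  shows "fapp m n c i (single (m - nat i) y) = single (m - nat i - 1) y"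
proof -
  have k: "i \<noteq> 0" "i \<noteq> - int m" "m - nat \<bar>i\<bar> = (m - nat i - 1) + 1" using assms by auto
  have d: "m - nat i = Suc (m - nat i - 1)" using assms by auto
  show ?thesis
    by (intro ext, subst d) (use assms in \<open>auto simp: fapp_mid[OF k] single_def\<close>)
qed

lemma fapp_single_down:
  assumes "0 < i" "i < int m"
  shows "fapp m n c (- i) (single (m - nat i - 1) y) = single (m - nat i) y"
proof -
  have k: "- i \<noteq> 0" "- i \<noteq> - int m" "m - nat \<bar>- i\<bar> = (m - nat i - 1) + 1" using assms by auto
  have d: "m - nat i = Suc (m - nat i - 1)" using assms by auto
  show ?thesis
    by (intro ext, subst (2) d) (use assms in \<open>auto simp: fapp_mid[OF k] single_def\<close>)
qed

lemma gapp_single_hit: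
  assumes t: "scattered t" "\<And>j. j \<in> set t \<Longrightarrow> idx m j" and i: "i \<in> set t"
    and b: "b \<in> pr m i" "b' \<in> pr m i" "fapp m n c i (single b y) = single b' y"
  shows "gapp m n c t (single b y) = single b' y"
proof -
  obtain u v where uv: "t = u @ i # v" using i by (meson split_list)
  have far: "far j i" "idx m j" if "j \<in> set u \<union> set v" for j
  proof -
    have "j \<noteq> i" "j \<in> set t" using t(1) that unfolding uv scattered_def by auto
    then show "far j i" "idx m j" using t i by (simp_all add: scattered_def)
  qed
  have nin: "b \<notin> pr m j" "b' \<notin> pr m j" if "j \<in> set u \<union> set v" for j
    using far_disjoint[OF far(1)[OF that], of m] b by auto
  have "gapp m n c v (single b y) = single b y" "gapp m n c u (single b' y) = single b' y"
    using far nin by (auto intro!: gapp_single_fix)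
  then show ?thesis using b(3) by (simp add: uv)
qed

text \<open>The run $-m, \dots, s - m$ is a block companion matrix: it shifts the first blocks down and distributes block \<open>s\<close> over
  them.\<close>

lemma gapp_shift:
  assumes "s < m"
  shows "gapp m n c (map (\<lambda>i. i - int m) [0..int s]) x b =
    (if b = 0 then mv n (c m) (x s) else if b \<le> s then (\<lambda>a. x (b - 1) a + mv n (c (m - b)) (x s) a) else x b)"
  using assms
proof (induction s arbitrary: x b)
  case 0
  then show ?case by (auto simp: fapp_def)
next
  case (Suc s)
  have k: "int s + 1 - int m \<noteq> 0" "int s + 1 - int m \<noteq> - int m" "m - nat \<bar>int s + 1 - int m\<bar> = s + 1"
    "nat (- (int s + 1 - int m)) = m - Suc s" "\<not> int s + 1 - int m > 0"
    using Suc.prems by auto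
  have nb: "nat (int m - int b) = m - b" for b by auto
  show ?case
    unfolding upto_Suc_right map_append gapp_append
    using Suc.prems by (subst Suc.IH) (auto simp: fapp_mid[OF k(1-3)] k(4,5) nb fun_eq_iff)
qed

text \<open>The product over \<open>rev_c (Suc s)\<close> carries $A_m$ on its block antidiagonal.\<close>

lemma gapp_rev_c:
  assumes "s < m" "b \<le> s"
  shows "gapp m n c (map (\<lambda>i. i - int m) (rev_c (Suc s))) (single b y) (s - b) = mv n (c m) y"
  using assms
proof (induction s)
  case 0
  then show ?case by (simp add: rev_c_Suc fapp_def single_def)
next
  case (Suc s)
  let ?t = "map (\<lambda>i. i - int m) (rev_c (Suc s))"
  define x where "x = gapp m n c ?t (single b y)"
  have id: "idx m i \<and> Suc s \<notin> pr m i" if "i \<in> set ?t" for i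
    using that Suc.prems by (auto simp: idx_def pr_def dest!: set_rev_c)
  have *: "gapp m n c (map (\<lambda>i. i - int m) (rev_c (Suc (Suc s)))) (single b y) (Suc s - b)
    = gapp m n c (map (\<lambda>i. i - int m) [0..int (Suc s)]) x (Suc s - b)"
    unfolding rev_c_Suc[of "Suc s"] by (simp add: x_def)
  show ?case
  proof (cases "b = Suc s")
    case True
    have "x = single b y" unfolding x_def by (rule gapp_single_fix) (use id True in auto)
    then show ?thesis unfolding * using True Suc.prems by (subst gapp_shift) (auto simp: single_def)
  next
    case False
    have "x (Suc s) = single b y (Suc s)"
      unfolding x_def by (rule gapp_outside) (use id Suc.prems in auto)
    then have z: "x (Suc s) = (\<lambda>a. 0)" using False by (auto simp: single_def)
    have "x (s - b) = mv n (c m) y" unfolding x_def using Suc False by auto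
    moreover have "Suc s - b \<noteq> 0" "Suc s - b \<le> Suc s" "Suc s - b - 1 = s - b" using False Suc.prems by auto
    ultimately show ?thesis unfolding * using Suc.prems by (subst gapp_shift) (auto simp: z)
  qed
qed

context gfpr_mats
begin

abbreviation "g \<equiv> gapp m n c"

lemma bacts_X0: "bacts m n X0 (g (Ol @ El @ [0] @ Ol @ Zo @ rc))"
  and bacts_X1: "bacts m n X1 (g (Zo @ Ze @ Np @ Ol @ Zo @ rc))"
  unfolding X0_list X1_list by (rule bacts_gprod, use idx_sets in auto)+

lemma g_fix:
  assumes "\<And>i. i \<in> set t \<Longrightarrow> idx m i \<and> b \<notin> pr m i"
  shows "g t (single b y) = single b y"
  by (rule gapp_single_fix) (use assms in auto)

lemma g_Ol: "i \<in> set Ol \<Longrightarrow> g Ol (single (m - nat i) y) = single (m - nat i - 1) y"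
proof (rule gapp_single_hit[OF scattered_sets(1)])
  assume i: "i \<in> set Ol"
  show "i \<in> set Ol" by (rule i)
  show "fapp m n c (i) (single (m - nat i) y) = single (m - nat i - 1) y"
    by (rule fapp_single_up) (use i m_int in \<open>auto dest!: set_Ol\<close>)
qed (use m_int in \<open>auto dest!: set_Ol simp: pr_def idx_def\<close>)

lemma g_El: "i \<in> set El \<Longrightarrow> g El (single (m - nat i) y) = single (m - nat i - 1) y"
proof (rule gapp_single_hit[OF scattered_sets(2)])
  assume i: "i \<in> set El"
  show "i \<in> set El" by (rule i)
  show "fapp m n c (i) (single (m - nat i) y) = single (m - nat i - 1) y"
    by (rule fapp_single_up) (use i m_int in \<open>auto dest!: set_El\<close>)
qed (use m_int in \<open>auto dest!: set_El simp: pr_def idx_def\<close>)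

lemma g_Zo: "- i \<in> set Zo \<Longrightarrow> g Zo (single (m - nat i - 1) y) = single (m - nat i) y"
proof (rule gapp_single_hit[OF scattered_sets(3)])
  assume i: "- i \<in> set Zo"
  show "- i \<in> set Zo" by (rule i)
  show "fapp m n c (- i) (single (m - nat i - 1) y) = single (m - nat i) y"
    by (rule fapp_single_down) (use i m_int in \<open>auto dest!: set_Zo\<close>)
qed (use m_int in \<open>auto dest!: set_Zo simp: pr_def idx_def\<close>)

lemma g_Ze: "- i \<in> set Ze \<Longrightarrow> g Ze (single (m - nat i - 1) y) = single (m - nat i) y"
proof (rule gapp_single_hit[OF scattered_sets(4)])
  assume i: "- i \<in> set Ze"
  show "- i \<in> set Ze" by (rule i)
  show "fapp m n c (- i) (single (m - nat i - 1) y) = single (m - nat i) y"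
    by (rule fapp_single_down) (use i m_int in \<open>auto dest!: set_Ze\<close>)
qed (use m_int in \<open>auto dest!: set_Ze simp: pr_def idx_def\<close>)

text \<open>This and the next lemmas describe columns of \<open>X0\<close> and \<open>X1\<close>.  Outside the first \<open>p\<close> blocks there are identity blocks
  which lead from block to block; among the first \<open>p\<close> blocks, and from there to block 0, there are copies of $A_m$.\<close>

lemma X1_W:
  assumes "odd i" "1 \<le> i" "i \<le> 2 * int e - 1"
  shows "g (Zo @ Ze @ Np @ Ol @ Zo @ rc) (single (m - nat i) y) = single (m - nat i - 1) y"
proof -
  have i: "i \<in> set Ol" using assms by (simp add: set_Ol_iff)
  have 1: "g (Zo @ rc) (single (m - nat i) y) = single (m - nat i) y"
    by (rule g_fix) (use assms m_int in \<open>auto simp: pr_def idx_def dest!: sets\<close>)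
  have 2: "g (Zo @ Ze @ Np) (single (m - nat i - 1) y) = single (m - nat i - 1) y"
    by (rule g_fix) (use assms m_int in \<open>auto simp: pr_def idx_def dest!: sets\<close>)
  have "g (Zo @ Ze @ Np @ Ol @ Zo @ rc) (single (m - nat i) y) = g (Zo @ Ze @ Np) (g Ol (g (Zo @ rc) (single (m - nat i) y)))"
    by simp
  then show ?thesis unfolding 1 g_Ol[OF i] 2 .
qed

lemma X0_W:
  assumes "odd i" "1 \<le> i" "i \<le> 2 * int e - 1"
  shows "g (Ol @ El @ [0] @ Ol @ Zo @ rc) (single (m - nat i) y)
    = single (if i = 2 * int e - 1 then m - 2 * e - 1 else m - nat (i + 2) - 1) y"
proof -
  have i: "i \<in> set Ol" "i + 1 \<in> set El" using assms by (auto simp: set_Ol_iff set_El_iff)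
  have 1: "g (Zo @ rc) (single (m - nat i) y) = single (m - nat i) y"
    by (rule g_fix) (use assms m_int in \<open>auto simp: pr_def idx_def dest!: sets\<close>)
  have 2: "g [0] (single (m - nat i - 1) y) = single (m - nat i - 1) y"
    by (rule g_fix) (use assms m_int in \<open>auto simp: pr_def idx_def dest!: sets\<close>)
  have d: "m - nat i - 1 = m - nat (i + 1)" "m - nat (i + 1) - 1 = m - nat (i + 2)" using assms by auto
  have 3: "g El (single (m - nat i - 1) y) = single (m - nat (i + 2)) y"
    unfolding d(1) g_El[OF i(2)] d(2) ..
  have 4: "g Ol (single (m - nat (i + 2)) y) = single (if i = 2 * int e - 1 then m - 2 * e - 1 else m - nat (i + 2) - 1) y"
  proof (cases "i = 2 * int e - 1")
    case True
    then have m': "m - nat (i + 2) = m - 2 * e - 1" by auto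
    have "g Ol (single (m - 2 * e - 1) y) = single (m - 2 * e - 1) y"
      by (rule g_fix) (use assms m_int in \<open>auto simp: pr_def idx_def dest!: sets\<close>)
    then show ?thesis unfolding m' if_P[OF True] .
  next
    case False
    have "i + 2 \<in> set Ol" unfolding set_Ol_iff using assms False by presburger
    then show ?thesis using False by (simp add: g_Ol)
  qed
  have "g (Ol @ El @ [0] @ Ol @ Zo @ rc) (single (m - nat i) y) = g Ol (g El (g [0] (g Ol (g (Zo @ rc) (single (m - nat i) y)))))"
    by simp
  then show ?thesis unfolding 1 g_Ol[OF i(1)] 2 3 4 .
qed

lemma X0_Z:
  assumes "even i" "2 * int e + 2 \<le> i" "i \<le> int m - int p - 1"
  shows "g (Ol @ El @ [0] @ Ol @ Zo @ rc) (single (m - nat i - 1) y) = single (m - nat i) y"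
proof -
  have i: "- i \<in> set Zo" using assms by (simp add: set_Zo_iff)
  have 1: "g rc (single (m - nat i - 1) y) = single (m - nat i - 1) y"
    by (rule g_fix) (use assms m_int in \<open>auto simp: pr_def idx_def dest!: sets\<close>)
  have 2: "g (Ol @ El @ [0] @ Ol) (single (m - nat i) y) = single (m - nat i) y"
    by (rule g_fix) (use assms m_int in \<open>auto simp: pr_def idx_def dest!: sets\<close>)
  have "g (Ol @ El @ [0] @ Ol @ Zo @ rc) (single (m - nat i - 1) y) = g (Ol @ El @ [0] @ Ol) (g Zo (g rc (single (m - nat i - 1) y)))"
    by simp
  then show ?thesis unfolding 1 g_Zo[OF i] 2 .
qed

lemma X1_Z:
  assumes "even i" "2 * int e + 2 \<le> i" "i \<le> int m - int p - 1"
  shows "g (Zo @ Ze @ Np @ Ol @ Zo @ rc) (single (m - nat i - 1) y)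
    = single (if i = 2 * int e + 2 then m - 2 * e - 1 else m - nat (i - 2)) y"
proof -
  have i: "- i \<in> set Zo" "- (i - 1) \<in> set Ze" using assms m_int by (auto simp: set_Zo_iff set_Ze_iff)
  have 1: "g rc (single (m - nat i - 1) y) = single (m - nat i - 1) y"
    by (rule g_fix) (use assms m_int in \<open>auto simp: pr_def idx_def dest!: sets\<close>)
  have 2: "g (Np @ Ol) (single (m - nat i) y) = single (m - nat i) y"
    by (rule g_fix) (use assms m_int in \<open>auto simp: pr_def idx_def dest!: sets\<close>)
  have d: "m - nat i = m - nat (i - 1) - 1" "m - nat (i - 1) = m - nat (i - 2) - 1" using assms m_int by auto
  have 3: "g Ze (single (m - nat i) y) = single (m - nat (i - 2) - 1) y"
    unfolding d(1) g_Ze[OF i(2)] unfolding d(2) ..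
  have 4: "g Zo (single (m - nat (i - 2) - 1) y) = single (if i = 2 * int e + 2 then m - 2 * e - 1 else m - nat (i - 2)) y"
  proof (cases "i = 2 * int e + 2")
    case True
    then have m': "m - nat (i - 2) - 1 = m - 2 * e - 1" by auto
    have "g Zo (single (m - 2 * e - 1) y) = single (m - 2 * e - 1) y"
      by (rule g_fix) (use assms m_int in \<open>auto simp: pr_def idx_def dest!: sets\<close>)
    then show ?thesis unfolding m' if_P[OF True] .
  next
    case False
    have "- (i - 2) \<in> set Zo" unfolding set_Zo_iff using assms False by presburger
    then show ?thesis unfolding if_not_P[OF False] by (rule g_Zo)
  qed
  have "g (Zo @ Ze @ Np @ Ol @ Zo @ rc) (single (m - nat i - 1) y) = g Zo (g Ze (g (Np @ Ol) (g Zo (g rc (single (m - nat i - 1) y)))))"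
    by simp
  then show ?thesis unfolding 1 g_Zo[OF i(1)] 2 3 4 .
qed

lemma rc_top:
  assumes "b < p"
  shows "g rc (single b y) (p - 1 - b) = mv n (c m) y"
  using gapp_rev_c[of "p - 1" m b n c y] assms bounds by (simp add: rc_def)

lemma X0_top:
  assumes "b < p"
  shows "g (Ol @ El @ [0] @ Ol @ Zo @ rc) (single b y) (p - 1 - b) = mv n (c m) y"
proof -
  have "g (Ol @ El @ [0] @ Ol @ Zo @ rc) (single b y) (p - 1 - b)
    = g (Ol @ El @ [0] @ Ol @ Zo) (g rc (single b y)) (p - 1 - b)" by simp
  also have "\<dots> = g rc (single b y) (p - 1 - b)"
    by (rule gapp_outside) (use assms m_int in \<open>auto simp: pr_def idx_def dest!: sets\<close>)
  finally show ?thesis using rc_top[OF assms] by simp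
qed

lemma X1_top:
  assumes "0 < b" "b < p"
  shows "g (Zo @ Ze @ Np @ Ol @ Zo @ rc) (single b y) (p - b) = mv n (c m) y"
proof -
  let ?x = "g rc (single b y)"
  have out: "?x b' = (\<lambda>a. 0)" if "p \<le> b'" "b' < m" for b'
  proof -
    have "?x b' = single b y b'"
      by (rule gapp_outside) (use that m_int in \<open>auto simp: pr_def idx_def dest!: sets\<close>)
    then show ?thesis using that assms by (auto simp: single_def)
  qed
  have 1: "g (Ol @ Zo) ?x = ?x"
    by (rule gapp_zero) (use m_int in \<open>auto simp: pr_def idx_def dest!: sets intro!: out\<close>)
  have "g (Zo @ Ze @ Np @ Ol @ Zo @ rc) (single b y) (p - b) = g (Zo @ Ze) (g Np (g (Ol @ Zo) ?x)) (p - b)" by simp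
  also have "\<dots> = g Np (g (Ol @ Zo) ?x) (p - b)"
    by (rule gapp_outside) (use assms m_int in \<open>auto simp: pr_def idx_def dest!: sets\<close>)
  also have "\<dots> = ?x (p - b - 1)"
    unfolding 1 Np_def using assms bounds by (subst gapp_shift) (auto simp: out)
  also have "\<dots> = mv n (c m) y" using rc_top[OF assms(2), of y] by (metis diff_commute)
  finally show ?thesis .
qed

lemma X1_corner:
  assumes "0 < p"
  shows "g (Zo @ Ze @ Np @ Ol @ Zo @ rc) (single (if s = 0 then p else p + 1) y) 0 = mv n (c m) y"
proof -
  let ?j = "if s = 0 then p else p + 1"
  have 1: "g rc (single ?j y) = single ?j y"
    by (rule g_fix) (use assms m_int in \<open>auto simp: pr_def idx_def dest!: sets split: if_splits\<close>)
  define x where "x = g (Ol @ Zo) (single ?j y)"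
  have 2: "x p = y"
  proof (cases "s = 0")
    case True
    then have zo: "Zo = []" "?j = p" unfolding Zo_def by simp_all
    have "x = single p y" unfolding x_def zo append_Nil2
      by (rule g_fix) (use m_int in \<open>auto simp: pr_def idx_def dest!: sets\<close>)
    then show ?thesis by (simp add: single_def)
  next
    case False
    define i where "i = int p + 1 - int m"
    have i: "i \<in> set Zo" "idx m i" using False m_int by (auto simp: i_def set_Zo_iff idx_def)
    obtain u v where uv: "Zo = u @ i # v" using i(1) by (meson split_list)
    have far: "far j i" "idx m j" if "j \<in> set u \<union> set v" for j
    proof -
      have "j \<noteq> i" "j \<in> set Zo" using scattered_sets(3) that unfolding uv scattered_def by auto
      then show "far j i" "idx m j" using scattered_sets(3) i(1) idx_sets by (simp_all add: scattered_def)
    qed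
    have pi: "p \<in> pr m i" "p + 1 \<in> pr m i" using m_int False by (auto simp: i_def pr_def)
    have nin: "p \<notin> pr m j" "p + 1 \<notin> pr m j" if "j \<in> set u \<union> set v" for j
      using far_disjoint[OF far(1)[OF that], of m] pi by auto
    have v: "g v (single (p + 1) y) = single (p + 1) y"
      by (rule gapp_single_fix) (use far nin in auto)
    have k: "i \<noteq> 0" "i \<noteq> - int m" "m - nat \<bar>i\<bar> = p + 1" "\<not> i > 0" using m_int False by (auto simp: i_def)
    have "x p = g (Ol @ u) (fapp m n c i (single (p + 1) y)) p"
      using False by (simp add: x_def uv v[simplified])
    also have "\<dots> = fapp m n c i (single (p + 1) y) p"
      by (rule gapp_outside) (use far nin bounds m_int in \<open>auto simp: pr_def idx_def dest!: sets\<close>)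
    also have "\<dots> = y" using k(4) by (simp add: fapp_mid[OF k(1-3)] single_def)
    finally show ?thesis .
  qed
  have "g (Zo @ Ze @ Np @ Ol @ Zo @ rc) (single ?j y) 0 = g (Zo @ Ze) (g Np (g (Ol @ Zo) (g rc (single ?j y)))) 0"
    by simp
  also have "\<dots> = g (Zo @ Ze) (g Np x) 0" unfolding 1 x_def ..
  also have "\<dots> = g Np x 0"
    by (rule gapp_outside) (use assms m_int in \<open>auto simp: pr_def idx_def dest!: sets\<close>)
  also have "\<dots> = mv n (c m) y" unfolding Np_def using bounds by (subst gapp_shift) (auto simp: 2)
  finally show ?thesis .
qed

end

text \<open>Nonzero blocks of \<open>X0\<close> and \<open>X1\<close> connect all block indices, so two sign matrices with the same effect agree up to a
  common sign.  The first \<open>p\<close> blocks are connected through $A_m$ only, hence the condition that it is not zero.\<close>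

lemma sign_unique:
  fixes c :: "nat \<Rightarrow> 'a :: idom mat"
  assumes loc: "gfpr m e p s" and c: "c m \<in> carrier_mat n n" "c m \<noteq> 0\<^sub>m n n"
    and X0: "dg m n \<epsilon> * gfpr_mats.X0 m e p s n c * dg m n \<epsilon> = dg m n \<epsilon>' * gfpr_mats.X0 m e p s n c * dg m n \<epsilon>'"
    and X1: "dg m n \<epsilon> * gfpr_mats.X1 m e p s n c * dg m n \<epsilon> = dg m n \<epsilon>' * gfpr_mats.X1 m e p s n c * dg m n \<epsilon>'"
    and sgn: "\<And>b. b < m \<Longrightarrow> \<epsilon> b \<in> {1, - 1}" "\<And>b. b < m \<Longrightarrow> \<epsilon>' b \<in> {1, - 1}"
  shows "(\<forall>b<m. \<epsilon>' b = \<epsilon> b) \<or> (\<forall>b<m. \<epsilon>' b = - \<epsilon> b)"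
proof -
  interpret gfpr m e p s by fact
  interpret gfpr_mats m e p s n c by unfold_locales
  \<comment> \<open>It suffices that this product of signs is constant; every nonzero block gives one equality.\<close>
  define d where "d b = \<epsilon> b * \<epsilon>' b" for b
  have link: "d b = d j" if "\<epsilon> b * \<epsilon> j = \<epsilon>' b * \<epsilon>' j" "b < m" "j < m" for b j
    using that(1) sgn(1)[OF that(2)] sgn(2)[OF that(2)] sgn(1)[OF that(3)] sgn(2)[OF that(3)]
    unfolding d_def by auto
  note l0 = link[OF sign_link[OF bacts_X0 X0]] and l1 = link[OF sign_link[OF bacts_X1 X1]]
  obtain a0 a1 where a: "a0 < n" "a1 < n" "c m $$ (a0, a1) \<noteq> 0"
  proof -
    have "\<not> (\<forall>i<n. \<forall>j<n. c m $$ (i, j) = 0)"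
      using c by (metis (no_types, lifting) carrier_matD eq_matI index_zero_mat)
    then show thesis using that by blast
  qed
  define y where "y = (\<lambda>a. if a = a1 then 1 else 0 :: 'a)"
  have y: "mv n (c m) y a0 \<noteq> 0"
    unfolding mv_def y_def using a by (subst sum_one[of a1]) auto
  have y1: "y a1 \<noteq> 0" by (simp add: y_def)
  have pure0: "d b = d j" if "g (Ol @ El @ [0] @ Ol @ Zo @ rc) (single j y) = single b y" "b < m" "j < m" for b j
    by (rule l0[of j y b a1]) (use that y1 a in \<open>auto simp: single_def\<close>)
  have pure1: "d b = d j" if "g (Zo @ Ze @ Np @ Ol @ Zo @ rc) (single j y) = single b y" "b < m" "j < m" for b j
    by (rule l1[of j y b a1]) (use that y1 a in \<open>auto simp: single_def\<close>)
  \<comment> \<open>The last \<open>2 * e\<close> blocks form a chain whose steps come alternately from \<open>X1\<close> and \<open>X0\<close>.\<close>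
  have W1: "d (m - Suc (2 * k)) = d (m - Suc (2 * k) - 1)" if "k < e" for k
    using pure1[OF X1_W[of "2 * int k + 1"]] that m_int by (simp add: nat_add_distrib nat_mult_distrib)
  have W0: "d (m - Suc (2 * k)) = (if Suc k = e then d (m - 2 * e - 1) else d (m - Suc (2 * Suc k) - 1))" if "k < e" for k
  proof -
    have e1: "nat (2 * int k + 1) = Suc (2 * k)" "nat (2 * int k + 1 + 2) = Suc (2 * Suc k)"
      "2 * int k + 1 = 2 * int e - 1 \<longleftrightarrow> Suc k = e" by auto
    have "d (if Suc k = e then m - 2 * e - 1 else m - Suc (2 * Suc k) - 1) = d (m - Suc (2 * k))"
      by (rule pure0) (use X0_W[of "2 * int k + 1" y, unfolded e1] that bounds in auto)
    then show ?thesis by (cases "Suc k = e") auto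
  qed
  have W: "d (m - Suc (2 * k)) = d (m - 2 * e - 1)" if "k < e" for k
    using that
  proof (induction "e - k" arbitrary: k)
    case (Suc q)
    then show ?case using W0[OF Suc.prems] W1[of "Suc k"] Suc.hyps(1)[of "Suc k"] by (cases "Suc k = e") auto
  qed simp
  have top: "d b = d (m - 2 * e - 1)" if bm: "m - 2 * e \<le> b" "b < m" for b
  proof -
    consider k where "k < e" "b = m - Suc (2 * k)" | k where "k < e" "b = m - Suc (2 * k) - 1"
    proof (cases "odd (m - b)")
      case True
      then obtain k where "m - b = 2 * k + 1" by (elim oddE)
      then have "k < e" "b = m - Suc (2 * k)" using bm by auto
      then show thesis by (rule that(1))
    next
      case False
      then have "even (m - b)" by simp
      then obtain k where "m - b = 2 * k" by (elim evenE)
      then have "k - 1 < e" "b = m - Suc (2 * (k - 1)) - 1" using bm by auto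
      then show thesis by (rule that(2))
    qed
    then show ?thesis using W W1 by cases metis+
  qed
  \<comment> \<open>The blocks from \<open>p\<close> up to \<open>m - 2 * e - 1\<close> form a second chain, ending in the same block.\<close>
  have Z0: "d (m - 2 * k) = d (m - 2 * k - 1)" if "e < k" "k \<le> e + s" for k
    using pure0[OF X0_Z[of "2 * int k"]] that m_int by (simp add: nat_mult_distrib)
  have Z1: "d (m - 2 * k - 1) = (if k = Suc e then d (m - 2 * e - 1) else d (m - 2 * (k - 1)))" if "e < k" "k \<le> e + s" for k
  proof -
    have e1: "nat (2 * int k) = 2 * k" "nat (2 * int k - 2) = 2 * (k - 1)"
      "2 * int k = 2 * int e + 2 \<longleftrightarrow> k = Suc e" by auto
    have "d (if k = Suc e then m - 2 * e - 1 else m - 2 * (k - 1)) = d (m - 2 * k - 1)"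
      by (rule pure1) (use X1_Z[of "2 * int k" y, unfolded e1] that m_int in auto)
    then show ?thesis by (cases "k = Suc e") auto
  qed
  have Z: "d (m - 2 * k - 1) = d (m - 2 * e - 1)" if "e < k" "k \<le> e + s" for k
    using that
  proof (induction k)
    case (Suc k)
    then show ?case using Z1[OF Suc.prems] Z0[of k] by (cases "k = e") auto
  qed simp
  have mid: "d b = d (m - 2 * e - 1)" if "p \<le> b" "b < m - 2 * e" for b
  proof (cases "odd (m - b)")
    case True
    then obtain k where k: "m - b = 2 * k + 1" by (elim oddE)
    then have "b = m - 2 * k - 1" "k = e \<or> e < k \<and> k \<le> e + s" using that m_eq by auto
    then show ?thesis using Z by auto
  next
    case False
    then have "even (m - b)" by simp
    then obtain k where k: "m - b = 2 * k" by (elim evenE)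
    then have "b = m - 2 * k" "e < k \<and> k \<le> e + s" using that m_eq by auto
    then show ?thesis using Z Z0 by auto
  qed
  \<comment> \<open>The antidiagonals \<open>b \<mapsto> p - 1 - b\<close> of \<open>X0\<close> and \<open>b \<mapsto> p - b\<close> of \<open>X1\<close> together connect the first \<open>p\<close> blocks.\<close>
  have T0: "d (p - 1 - b) = d b" if "b < p" for b
    by (rule l0[of b y "p - 1 - b" a0]) (use that y a bounds X0_top[OF that, of y] in auto)
  have T1: "d (p - b) = d b" if "0 < b" "b < p" for b
    by (rule l1[of b y "p - b" a0]) (use that y a bounds X1_top[OF that, of y] in auto)
  have Tc: "d 0 = d (m - 2 * e - 1)" if "0 < p"
  proof -
    have j: "(if s = 0 then p else p + 1) < m - 2 * e" "p \<le> (if s = 0 then p else p + 1)" using m_eq by auto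
    have "d 0 = d (if s = 0 then p else p + 1)"
      by (rule l1[of _ y 0 a0]) (use that y a j bounds X1_corner[OF that, of y] in auto)
    then show ?thesis using mid[OF j(2,1)] by simp
  qed
  have T: "d b = d 0" if "b < p" for b
    using that
  proof (induction b)
    case (Suc b)
    have "d (Suc b) = d (p - 1 - Suc b)" using T0[OF Suc.prems] by simp
    also have "p - 1 - Suc b = p - (b + 2)" by simp
    finally have "d (Suc b) = d (p - (b + 2))" .
    moreover have "d (p - (Suc b)) = d (Suc b)" using T1[of "Suc b"] Suc.prems by simp
    moreover have "d (p - 1 - b) = d b" using T0[of b] Suc.prems by simp
    ultimately show ?case using Suc by simp
  qed simp
  have all: "d b = d (m - 2 * e - 1)" if "b < m" for b
  proof -
    consider "b < p" | "p \<le> b" "b < m - 2 * e" | "m - 2 * e \<le> b" by linarith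
    then show ?thesis
    proof cases
      case 1
      then have "0 < p" by simp
      then show ?thesis using T[OF 1] Tc by simp
    qed (use mid top that in blast)+
  qed
  have "m - 2 * e - 1 < m" using bounds by simp
  then have "d (m - 2 * e - 1) = 1 \<or> d (m - 2 * e - 1) = - 1"
    using sgn(1)[of "m - 2 * e - 1"] sgn(2)[of "m - 2 * e - 1"] unfolding d_def by auto
  then show ?thesis
  proof
    assume "d (m - 2 * e - 1) = 1"
    then have "\<epsilon>' b = \<epsilon> b" if "b < m" for b
      using all[OF that] sgn(1)[OF that] sgn(2)[OF that] unfolding d_def by auto
    then show ?thesis by blast
  next
    assume "d (m - 2 * e - 1) = - 1"
    then have "\<epsilon>' b = - \<epsilon> b" if "b < m" for b
      using all[OF that] sgn(1)[OF that] sgn(2)[OF that] unfolding d_def by auto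
    then show ?thesis by blast
  qed
qed

section \<open>Rank\<close>

lemma full_column_rank:
  fixes M :: "complex mat"
  assumes M: "M \<in> carrier_mat k r" and inj: "\<And>v. v \<in> carrier_vec r \<Longrightarrow> M *\<^sub>v v = 0\<^sub>v k \<Longrightarrow> v = 0\<^sub>v r"
  shows "vec_space.rank k M = r"
proof -
  interpret vec_space "TYPE(complex)" k .
  have dist: "distinct (cols M)"
  proof (rule ccontr)
    assume "\<not> distinct (cols M)"
    then obtain i j where ij: "i < r" "j < r" "i \<noteq> j" "col M i = col M j"
      using M by (auto simp: distinct_conv_nth)
    let ?v = "unit_vec r i - unit_vec r j :: complex vec"
    have "M *\<^sub>v ?v = M *\<^sub>v unit_vec r i - M *\<^sub>v unit_vec r j"
      by (rule mult_minus_distrib_mat_vec[OF M]) auto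
    also have "\<dots> = 0\<^sub>v k"
    proof -
      have "M *\<^sub>v unit_vec r l = col M l" if "l < r" for l
        using M that by (intro eq_vecI) auto
      then show ?thesis using ij M by simp
    qed
    finally have "?v = 0\<^sub>v r" by (intro inj) auto
    then have "?v $ i = 0" using ij by simp
    then show False using ij by simp
  qed
  show ?thesis
  proof (rule lin_indpt_full_rank[OF M dist], rule)
    assume "lin_dep (set (cols M))"
    then obtain v where "v \<in> carrier_vec r" "v \<noteq> 0\<^sub>v r" "M *\<^sub>v v = 0\<^sub>v k"
      using lin_depE[OF M _ dist] by blast
    then show False using inj by blast
  qed
qed

text \<open>If a maximal independent set of columns had fewer than \<open>r\<close> members, a nonzero vector would be orthogonal to it and hence
  to all columns.\<close>

lemma full_row_rank:
  fixes M :: "complex mat"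
  assumes M: "M \<in> carrier_mat r l"
    and inj: "\<And>v. v \<in> carrier_vec r \<Longrightarrow> (\<And>j. j < l \<Longrightarrow> v \<bullet> col M j = 0) \<Longrightarrow> v = 0\<^sub>v r"
  shows "vec_space.rank r M = r"
proof -
  interpret vec_space "TYPE(complex)" r .
  obtain S where S: "finite S" "maximal S (\<lambda>T. T \<subseteq> set (cols M) \<and> lin_indpt T)"
    using maximal_exists_superset[of "set (cols M)" "\<lambda>T. T \<subseteq> set (cols M) \<and> lin_indpt T" "{}"]
    by (auto simp: finite_lin_indpt2)
  have Sc: "S \<subseteq> set (cols M)" "lin_indpt S" using S(2) by (auto simp: maximal_def)
  have cc: "set (cols M) \<subseteq> carrier_vec r" using M cols_dim by blast
  have rank: "rank M = card S" by (rule rank_card_indpt[OF M S(2)])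
  have le: "card S \<le> r"
    using li_le_dim(2)[OF fin_dim _ Sc(2)] Sc(1) cc dim_is_n by auto
  have "\<not> card S < r"
  proof
    assume lt: "card S < r"
    obtain xs where xs: "set xs = S" "distinct xs" using S(1) finite_distinct_list by blast
    \<comment> \<open>The rows are the chosen columns, padded by zero rows: a singular matrix.\<close>
    define A where "A = mat r r (\<lambda>(i, j). if i < length xs then (xs ! i) $ j else 0)"
    have A: "A \<in> carrier_mat r r" by (simp add: A_def)
    have len: "length xs < r" using xs lt distinct_card by fastforce
    have "A\<^sup>T *\<^sub>v unit_vec r (r - 1) = 0\<^sub>v r"
      using len by (intro eq_vecI) (auto simp: A_def)
    then have "det A\<^sup>T = 0"
      using len by (subst det_0_iff_vec_prod_zero_field[of _ r]) (auto simp: A_def intro!: exI[of _ "unit_vec r (r - 1)"])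
    then have "det A = 0" using det_transpose[OF A] by simp
    then obtain w where w: "w \<in> carrier_vec r" "w \<noteq> 0\<^sub>v r" "A *\<^sub>v w = 0\<^sub>v r"
      using det_0_iff_vec_prod_zero_field[OF A] by blast
    have orthS: "w \<bullet> x = 0" if xS: "x \<in> S" for x
    proof -
      obtain i where i: "i < length xs" "x = xs ! i" using xS unfolding xs(1)[symmetric] by (auto simp: in_set_conv_nth)
      have x: "x \<in> carrier_vec r" using xS Sc cc by blast
      have "row A i = x" using i x len by (intro eq_vecI) (auto simp: A_def)
      moreover have "row A i \<bullet> w = (A *\<^sub>v w) $ i" using i len A by simp
      ultimately have "x \<bullet> w = 0" using w(3) i len by simp
      then show ?thesis using comm_scalar_prod[OF x w(1)] by simp
    qed
    have orth: "w \<bullet> x = 0" if x: "x \<in> set (cols M)" for x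
    proof -
      have Scar: "S \<subseteq> carrier_vec r" using Sc(1) cc by (rule subset_trans)
      have xcar: "x \<in> carrier_vec r" using cc x by (rule subsetD)
      have "x \<in> span S"
      proof (cases "x \<in> S")
        case True
        show ?thesis by (rule span_mem[OF Scar True])
      next
        case False
        have "\<not> lin_indpt (insert x S)"
        proof
          assume "lin_indpt (insert x S)"
          then have "S = insert x S" using S(2) x Sc(1) unfolding maximal_def by auto
          then show False using False by auto
        qed
        then have "lin_dep (S \<union> {x})" by simp
        then show ?thesis using lin_dep_iff_in_span[OF Scar Sc(2) xcar False] by simp
      qed
      then obtain a where "lincomb a S = x"
        using finite_in_span[OF S(1) Scar] by auto
      then have "x = lincomb a S" by (rule sym)
      moreover have "w \<bullet> lincomb a S = (\<Sum>x\<in>S. a x * (w \<bullet> x))"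
      proof -
        have car: "(\<lambda>x. a x \<cdot>\<^sub>v x) \<in> S \<rightarrow> carrier_vec r" using Sc(1) cc by auto
        have "w \<bullet> lincomb a S = (\<Sum>i<r. w $ i * (\<Sum>x\<in>S. a x * x $ i))"
        proof -
          have "lincomb a S \<in> carrier_vec r" using Sc(1) cc by (intro lincomb_closed) auto
          moreover have "lincomb a S $ i = (\<Sum>x\<in>S. a x * x $ i)" if "i < r" for i
            using lincomb_index[OF that] Sc(1) cc by auto
          ultimately show ?thesis by (simp add: scalar_prod_def atLeast0LessThan)
        qed
        also have "\<dots> = (\<Sum>x\<in>S. a x * (\<Sum>i<r. w $ i * x $ i))"
          unfolding sum_distrib_left by (subst sum.swap) (simp add: mult.left_commute)
        also have "\<dots> = (\<Sum>x\<in>S. a x * (w \<bullet> x))"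
        proof (rule sum.cong[OF refl])
          fix x assume "x \<in> S"
          then have "dim_vec x = r" using Sc(1) cc by auto
          then show "a x * (\<Sum>i<r. w $ i * x $ i) = a x * (w \<bullet> x)"
            by (simp add: scalar_prod_def atLeast0LessThan)
        qed
        finally show ?thesis .
      qed
      ultimately show ?thesis using orthS by simp
    qed
    have "w = 0\<^sub>v r"
      by (rule inj[OF w(1)]) (use orth M in \<open>auto simp: cols_def\<close>)
    then show False using w by simp
  qed
  then show ?thesis using le rank by simp
qed

section \<open>Transfer functions\<close>

definition cf :: "complex \<Rightarrow> complex poly fract" where
  "cf a = to_fract [:a:]"

lemma comm_ring_hom_cf: "comm_ring_hom cf"
proof
  fix x y
  show "cf (x + y) = cf x + cf y" unfolding cf_def to_fract_add[symmetric] by simp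
  show "cf (x * y) = cf x * cf y" unfolding cf_def to_fract_mult[symmetric] by simp
  show "cf 1 = 1" unfolding cf_def one_pCons[symmetric] by (rule to_fract_1)
  show "cf 0 = 0" unfolding cf_def by simp
qed

interpretation cf: comm_ring_hom cf by (rule comm_ring_hom_cf)

lemma comm_ring_hom_to_fract: "comm_ring_hom (to_fract :: complex poly \<Rightarrow> complex poly fract)"
  by unfold_locales simp_all

interpretation tf: comm_ring_hom "to_fract :: complex poly \<Rightarrow> complex poly fract" by (rule comm_ring_hom_to_fract)

lemma comm_ring_hom_const: "comm_ring_hom (\<lambda>a :: complex. [:a:])"
  by unfold_locales (auto simp: one_pCons)

interpretation cp: comm_ring_hom "\<lambda>a :: complex. [:a:]" by (rule comm_ring_hom_const)

definition lamF :: "complex poly fract" where "lamF = to_fract lam"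

abbreviation cm :: "complex mat \<Rightarrow> complex poly fract mat" where
  "cm \<equiv> map_mat cf"

lemma rat_mat_const: "rat_mat (const_mat A) = cm A"
  by (auto simp: rat_mat_def const_mat_def cf_def)

lemma rat_mat_pencil:
  assumes "E \<in> carrier_mat k l" "A \<in> carrier_mat k l"
  shows "rat_mat (lam \<cdot>\<^sub>m const_mat E - const_mat A) = lamF \<cdot>\<^sub>m cm E - cm A"
proof (rule eq_matI)
  fix i j assume "i < dim_row (lamF \<cdot>\<^sub>m cm E - cm A)" "j < dim_col (lamF \<cdot>\<^sub>m cm E - cm A)"
  then have ij: "i < k" "j < l" using assms by auto
  have "rat_mat (lam \<cdot>\<^sub>m const_mat E - const_mat A) $$ (i, j) = to_fract (lam * [:E $$ (i, j):] - [:A $$ (i, j):])"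
    using ij assms by (simp add: rat_mat_def const_mat_def)
  also have "\<dots> = lamF * cf (E $$ (i, j)) - cf (A $$ (i, j))"
    unfolding tf.hom_minus tf.hom_mult lamF_def cf_def ..
  finally show "rat_mat (lam \<cdot>\<^sub>m const_mat E - const_mat A) $$ (i, j) = (lamF \<cdot>\<^sub>m cm E - cm A) $$ (i, j)"
    using ij assms by simp
qed (use assms in \<open>auto simp: rat_mat_def const_mat_def\<close>)

lemma complex_at_infinity_neq_bot: "(at_infinity :: complex filter) \<noteq> bot"
proof
  assume "(at_infinity :: complex filter) = bot"
  then have "eventually (\<lambda>x :: complex. False) at_infinity" by simp
  then obtain b where "\<And>x :: complex. b \<le> norm x \<Longrightarrow> False" unfolding eventually_at_infinity by blast
  from this[of "of_real \<bar>b\<bar>"] show False by (simp add: abs_ge_self)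
qed

lemma eventually_poly_nonzero:
  fixes q :: "complex poly"
  assumes "q \<noteq> 0"
  shows "eventually (\<lambda>t. poly q t \<noteq> 0) at_infinity"
proof -
  have fin: "finite {t. poly q t = 0}" using assms by (rule poly_roots_finite)
  define b where "b = (\<Sum>t\<in>{t. poly q t = 0}. norm t) + 1"
  have "poly q t \<noteq> 0" if "b \<le> norm t" for t
  proof
    assume "poly q t = 0"
    then have "norm t \<le> (\<Sum>t\<in>{t. poly q t = 0}. norm t)"
      using fin by (intro member_le_sum) auto
    then show False using that by (simp add: b_def)
  qed
  then show ?thesis unfolding eventually_at_infinity by blast
qed

abbreviation "flim \<equiv> fract_limit_at_infinity"

lemma flimE:
  assumes "flim x c"
  obtains p q where "q \<noteq> 0" "x = Fract p q" "((\<lambda>t. poly p t / poly q t) \<longlongrightarrow> c) at_infinity"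
  using assms unfolding fract_limit_at_infinity_def by blast

lemma flim_unique:
  assumes "flim x c" "flim x d"
  shows "c = d"
proof -
  obtain p q where 1: "q \<noteq> 0" "x = Fract p q" "((\<lambda>t. poly p t / poly q t) \<longlongrightarrow> c) at_infinity"
    using assms(1) by (rule flimE)
  obtain p' q' where 2: "q' \<noteq> 0" "x = Fract p' q'" "((\<lambda>t. poly p' t / poly q' t) \<longlongrightarrow> d) at_infinity"
    using assms(2) by (rule flimE)
  have "p * q' = p' * q" using 1 2 by (simp add: eq_fract)
  then have eqt: "poly p t * poly q' t = poly p' t * poly q t" for t by (metis poly_mult)
  have "eventually (\<lambda>t. poly p t / poly q t = poly p' t / poly q' t) at_infinity"
    using eventually_poly_nonzero[OF 1(1)] eventually_poly_nonzero[OF 2(1)]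
    by eventually_elim (simp add: frac_eq_eq eqt)
  then have "((\<lambda>t. poly p' t / poly q' t) \<longlongrightarrow> c) at_infinity"
    by (rule Lim_transform_eventually[OF 1(3)])
  then show ?thesis using 2(3) tendsto_unique complex_at_infinity_neq_bot by blast
qed

lemma flim_const: "flim (cf a) a"
  unfolding fract_limit_at_infinity_def cf_def to_fract_def
  by (intro exI[of _ "[:a:]"] exI[of _ 1]) auto

lemma flim_add:
  assumes "flim x c" "flim y d"
  shows "flim (x + y) (c + d)"
proof -
  obtain p q where 1: "q \<noteq> 0" "x = Fract p q" "((\<lambda>t. poly p t / poly q t) \<longlongrightarrow> c) at_infinity"
    using assms(1) by (rule flimE)
  obtain p' q' where 2: "q' \<noteq> 0" "y = Fract p' q'" "((\<lambda>t. poly p' t / poly q' t) \<longlongrightarrow> d) at_infinity"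
    using assms(2) by (rule flimE)
  have "eventually (\<lambda>t. poly p t / poly q t + poly p' t / poly q' t = poly (p * q' + p' * q) t / poly (q * q') t) at_infinity"
    using eventually_poly_nonzero[OF 1(1)] eventually_poly_nonzero[OF 2(1)]
    by eventually_elim (simp add: add_frac_eq)
  then have "((\<lambda>t. poly (p * q' + p' * q) t / poly (q * q') t) \<longlongrightarrow> c + d) at_infinity"
    by (rule Lim_transform_eventually[OF tendsto_add[OF 1(3) 2(3)]])
  then show ?thesis unfolding fract_limit_at_infinity_def using 1 2
    by (intro exI[of _ "p * q' + p' * q"] exI[of _ "q * q'"]) auto
qed

lemma flim_mult:
  assumes "flim x c" "flim y d"
  shows "flim (x * y) (c * d)"
proof -
  obtain p q where 1: "q \<noteq> 0" "x = Fract p q" "((\<lambda>t. poly p t / poly q t) \<longlongrightarrow> c) at_infinity"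
    using assms(1) by (rule flimE)
  obtain p' q' where 2: "q' \<noteq> 0" "y = Fract p' q'" "((\<lambda>t. poly p' t / poly q' t) \<longlongrightarrow> d) at_infinity"
    using assms(2) by (rule flimE)
  have "((\<lambda>t. poly (p * p') t / poly (q * q') t) \<longlongrightarrow> c * d) at_infinity"
    using tendsto_mult[OF 1(3) 2(3)] by simp
  then show ?thesis unfolding fract_limit_at_infinity_def using 1 2
    by (intro exI[of _ "p * p'"] exI[of _ "q * q'"]) auto
qed

lemma flim_inverse:
  assumes "flim x c" "c \<noteq> 0"
  shows "flim (inverse x) (inverse c)"
proof -
  obtain p q where 1: "q \<noteq> 0" "x = Fract p q" "((\<lambda>t. poly p t / poly q t) \<longlongrightarrow> c) at_infinity"
    using assms(1) by (rule flimE)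
  have "p \<noteq> 0"
  proof
    assume "p = 0"
    then have "((\<lambda>t :: complex. 0 :: complex) \<longlongrightarrow> c) at_infinity" using 1(3) by simp
    then show False using assms(2) complex_at_infinity_neq_bot by (simp add: tendsto_const_iff)
  qed
  moreover have "((\<lambda>t. poly q t / poly p t) \<longlongrightarrow> inverse c) at_infinity"
    using tendsto_inverse[OF 1(3) assms(2)] by simp
  ultimately show ?thesis unfolding fract_limit_at_infinity_def using 1
    by (intro exI[of _ q] exI[of _ p]) auto
qed

lemma lam_nonzero: "lamF \<noteq> 0"
  by (simp add: lamF_def)

lemma flim_mu: "flim (inverse lamF) 0"
proof -
  have "((\<lambda>t :: complex. poly 1 t / poly lam t) \<longlongrightarrow> 0) at_infinity"
    using tendsto_inverse_0[where 'a = complex] by (simp add: divide_inverse)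
  moreover have "inverse lamF = Fract 1 lam" by (simp add: lamF_def to_fract_def)
  ultimately show ?thesis unfolding fract_limit_at_infinity_def
    by (intro exI[of _ 1] exI[of _ lam]) auto
qed

lemma flim_uminus: "flim x c \<Longrightarrow> flim (- x) (- c)"
  using flim_mult[OF flim_const[of "- 1"], of x c] by (simp add: cf.hom_uminus)

lemma flim_sum: "(\<And>i. i \<in> S \<Longrightarrow> flim (f i) (g i)) \<Longrightarrow> flim (sum f S) (sum g S)"
  by (induction S rule: infinite_finite_induct) (use flim_const[of 0] in \<open>auto intro: flim_add\<close>)

lemma flim_prod: "(\<And>i. i \<in> S \<Longrightarrow> flim (f i) (g i)) \<Longrightarrow> flim (prod f S) (prod g S)"
  by (induction S rule: infinite_finite_induct) (use flim_const[of 1] in \<open>auto intro: flim_mult\<close>)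

definition proper :: "complex poly fract set" where
  "proper = {x. \<exists>c. flim x c}"

lemma subring_proper: "subring_set proper"
proof -
  have "1 \<in> proper" using flim_const[of 1] by (auto simp: proper_def)
  then show ?thesis
    unfolding subring_set_def proper_def by (auto intro: flim_add flim_mult flim_uminus)
qed

lemma flim_det:
  assumes A: "A \<in> carrier_mat k k" and C: "C \<in> carrier_mat k k"
    and l: "\<And>i j. i < k \<Longrightarrow> j < k \<Longrightarrow> flim (A $$ (i, j)) (C $$ (i, j))"
  shows "flim (det A) (det C)"
proof -
  have "flim (\<Sum>p | p permutes {0..<k}. signof p * (\<Prod>i = 0..<k. A $$ (i, p i)))
      (\<Sum>p | p permutes {0..<k}. signof p * (\<Prod>i = 0..<k. C $$ (i, p i)))"
  proof (intro flim_sum flim_mult flim_prod)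
    fix p assume "p \<in> {p. p permutes {0..<k}}"
    show "flim (signof p) (signof p)"
      using flim_const[of 1] flim_const[of "- 1"] by (auto simp: sign_def cf.hom_uminus)
    fix i assume "i \<in> {0..<k}"
    then show "flim (A $$ (i, p i)) (C $$ (i, p i))"
      using l permutes_in_image[of p "{0..<k}" i] \<open>p \<in> _\<close> by auto
  qed
  then show ?thesis using A C by (simp add: det_def)
qed

text \<open>The limits of a matrix and of its inverse have determinants whose product is 1.\<close>

lemma inv_over_biproper:
  assumes "inv_over proper k U"
  shows "biproper k U"
proof -
  obtain U' where *: "U \<in> carrier_mat k k" "U' \<in> carrier_mat k k" "over proper U" "over proper U'"
    "U * U' = 1\<^sub>m k"
    using assms unfolding inv_over_def by blast
  define lim where "lim x = (SOME c. flim x c)" for x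
  have lim: "flim x (lim x)" if "x \<in> proper" for x
    using that someI_ex unfolding lim_def proper_def by fast
  define C C' where "C = map_mat lim U" and "C' = map_mat lim U'"
  have C: "C \<in> carrier_mat k k" "C' \<in> carrier_mat k k" using * by (auto simp: C_def C'_def)
  have el: "flim (U $$ (i, j)) (C $$ (i, j))" "flim (U' $$ (i, j)) (C' $$ (i, j))" if "i < k" "j < k" for i j
    using that * lim by (auto simp: C_def C'_def over_def)
  have "flim (det U * det U') (det C * det C')"
    using flim_det[OF *(1) C(1)] flim_det[OF *(2) C(2)] el by (intro flim_mult) auto
  moreover have "det U * det U' = cf 1" using det_mult[OF *(1,2)] * by simp
  ultimately have "det C * det C' = 1" using flim_unique flim_const by metis
  then have "det C \<noteq> 0" by auto
  then show ?thesis unfolding biproper_def using * C el by blast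
qed

lemma field_inverse_exists:
  fixes A :: "'a :: field mat"
  assumes "A \<in> carrier_mat k k" "det A \<noteq> 0"
  obtains B where "B \<in> carrier_mat k k" "A * B = 1\<^sub>m k" "B * A = 1\<^sub>m k"
  using det_non_zero_imp_unit[OF assms, of "()"] unfolding Units_def ring_mat_def by auto

lemma one_smult_mat [simp]: "(1 :: 'a :: monoid_mult) \<cdot>\<^sub>m A = A"
  by (rule eq_matI) auto

text \<open>In $\lambda E - A = \lambda (E - \lambda^{-1} A)$ the second factor tends to the nonsingular matrix $E$, so its determinant is a unit
  among the proper functions and its inverse, given by the adjugate, is proper.\<close>

lemma resolvent:
  assumes E: "E \<in> carrier_mat r r" and A: "A \<in> carrier_mat r r" and d: "det E \<noteq> 0"
  shows "det (lamF \<cdot>\<^sub>m cm E - cm A) \<noteq> 0"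
    "\<exists>Z. Z \<in> carrier_mat r r \<and> over proper Z \<and> (lamF \<cdot>\<^sub>m cm E - cm A) * Z = 1\<^sub>m r \<and> Z * (lamF \<cdot>\<^sub>m cm E - cm A) = 1\<^sub>m r"
proof -
  let ?F = "cm E - inverse lamF \<cdot>\<^sub>m cm A" and ?P = "lamF \<cdot>\<^sub>m cm E - cm A"
  have F: "?F \<in> carrier_mat r r" and P: "?P \<in> carrier_mat r r" using E A by auto
  have PF: "?P = lamF \<cdot>\<^sub>m ?F"
    using E A lam_nonzero by (intro eq_matI) (auto simp: algebra_simps)
  have ent: "flim (?F $$ (i, j)) (E $$ (i, j))" if "i < r" "j < r" for i j
    using that E A flim_add[OF flim_const[of "E $$ (i, j)"] flim_uminus[OF flim_mult[OF flim_mu flim_const[of "A $$ (i, j)"]]]]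
    by simp
  have lim: "flim (det ?F) (det E)" by (rule flim_det[OF F E]) (use ent in auto)
  have ne: "det ?F \<noteq> 0"
    using lim flim_const[of 0] flim_unique d by (metis cf.hom_zero)
  then show "det ?P \<noteq> 0" unfolding PF using lam_nonzero F by (simp add: det_smult)
  define Z where "Z = (inverse lamF * inverse (det ?F)) \<cdot>\<^sub>m adj_mat ?F"
  have Z: "Z \<in> carrier_mat r r" using adj_mat(1)[OF F] by (simp add: Z_def)
  have "over proper ?F" using ent E A unfolding over_def proper_def by auto
  then have "over proper (adj_mat ?F)"
  proof -
    have "adj_mat ?F $$ (i, j) \<in> proper" if "i < r" "j < r" for i j
    proof -
      have md: "mat_delete ?F j i \<in> carrier_mat (r - 1) (r - 1)" by (rule mat_delete_carrier[OF F])
      have md': "mat_delete E j i \<in> carrier_mat (r - 1) (r - 1)" by (rule mat_delete_carrier[OF E])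
      have "flim (det (mat_delete ?F j i)) (det (mat_delete E j i))"
      proof (rule flim_det[OF md md'])
        fix i' j' assume *: "i' < r - 1" "j' < r - 1"
        show "flim (mat_delete ?F j i $$ (i', j')) (mat_delete E j i $$ (i', j'))"
        proof -
          let ?a = "if i' < j then i' else Suc i'" and ?b = "if j' < i then j' else Suc j'"
          have "mat_delete ?F j i $$ (i', j') = ?F $$ (?a, ?b)" "mat_delete E j i $$ (i', j') = E $$ (?a, ?b)"
            using * E A unfolding mat_delete_def by simp_all
          moreover have "?a < r" "?b < r" using * by auto
          ultimately show ?thesis using ent[of ?a ?b] by (simp only:)
        qed
      qed
      then have "det (mat_delete ?F j i) \<in> proper" by (auto simp: proper_def)
      moreover have "(- 1) ^ (j + i) \<in> proper"
        using subring_setD[OF subring_proper] by (cases "even (j + i)") auto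
      ultimately show ?thesis
        using that E A unfolding adj_mat_def cofactor_def by (auto intro: subring_setD[OF subring_proper])
    qed
    then show ?thesis using adj_mat(1)[OF F] by (auto simp: over_def)
  qed
  moreover have "inverse lamF * inverse (det ?F) \<in> proper"
    using flim_mult[OF flim_mu flim_inverse[OF lim d]] by (auto simp: proper_def)
  ultimately have "over proper Z" unfolding Z_def by (intro over_smult[OF subring_proper])
  moreover have "?P * Z = 1\<^sub>m r" "Z * ?P = 1\<^sub>m r"
  proof -
    have sc: "lamF * (inverse lamF * inverse (det ?F)) * det ?F = 1"
    proof -
      have "lamF * (inverse lamF * inverse d) * d = 1" if "d \<noteq> 0" for d
        using lam_nonzero that by (simp add: field_simps)
      then show ?thesis using ne by blast
    qed
    have "?P * Z = (lamF * (inverse lamF * inverse (det ?F)) * det ?F) \<cdot>\<^sub>m 1\<^sub>m r"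
      unfolding PF Z_def using F adj_mat[OF F]
      by (simp add: mult_smult_distrib[of _ r r _ r] mult_smult_assoc_mat[of _ r r _ r] mult.assoc mult.left_commute, intro eq_matI, simp_all add: mult_ac)
    then show "?P * Z = 1\<^sub>m r" unfolding sc by simp
    have "Z * ?P = (lamF * (inverse lamF * inverse (det ?F)) * det ?F) \<cdot>\<^sub>m 1\<^sub>m r"
      unfolding PF Z_def using F adj_mat[OF F]
      by (simp add: mult_smult_distrib[of _ r r _ r] mult_smult_assoc_mat[of _ r r _ r] mult.assoc mult.left_commute, intro eq_matI, simp_all add: mult_ac)
    then show "Z * ?P = 1\<^sub>m r" unfolding sc by simp
  qed
  ultimately show "\<exists>Z. Z \<in> carrier_mat r r \<and> over proper Z \<and> ?P * Z = 1\<^sub>m r \<and> Z * ?P = 1\<^sub>m r"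
    using Z by blast
qed

definition resolv :: "complex mat \<Rightarrow> complex mat \<Rightarrow> complex poly fract mat" where
  "resolv E A = the (mat_inverse (lamF \<cdot>\<^sub>m cm E - cm A))"

lemma resolv:
  assumes E: "E \<in> carrier_mat r r" and A: "A \<in> carrier_mat r r" and d: "det E \<noteq> 0"
  shows "resolv E A \<in> carrier_mat r r" "over proper (resolv E A)"
    "(lamF \<cdot>\<^sub>m cm E - cm A) * resolv E A = 1\<^sub>m r" "resolv E A * (lamF \<cdot>\<^sub>m cm E - cm A) = 1\<^sub>m r"
proof -
  let ?P = "lamF \<cdot>\<^sub>m cm E - cm A"
  have P: "?P \<in> carrier_mat r r" using E A by auto
  obtain Z where Z: "Z \<in> carrier_mat r r" "over proper Z" "?P * Z = 1\<^sub>m r" "Z * ?P = 1\<^sub>m r"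
    using resolvent(2)[OF assms] by blast
  have "mat_inverse ?P \<noteq> None"
    using mat_inverse(1)[OF P, of "()"] det_non_zero_imp_unit[OF P resolvent(1)[OF assms], of "()"] by auto
  then obtain X where X: "mat_inverse ?P = Some X" by auto
  have X': "X \<in> carrier_mat r r" "?P * X = 1\<^sub>m r" "X * ?P = 1\<^sub>m r" using mat_inverse(2)[OF P X] by auto
  have "X = X * (?P * Z)" by (simp only: Z(3) right_mult_one_mat[OF X'(1)])
  also have "\<dots> = (X * ?P) * Z" using assoc_mult_mat[OF X'(1) P Z(1)] by simp
  also have "\<dots> = Z" by (simp only: X'(3) left_mult_one_mat[OF Z(1)])
  finally have "X = Z" .
  then have "resolv E A = Z" using X by (simp add: resolv_def)
  then show "resolv E A \<in> carrier_mat r r" "over proper (resolv E A)" "?P * resolv E A = 1\<^sub>m r" "resolv E A * ?P = 1\<^sub>m r"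
    using Z by auto
qed

lemma transfer_eq:
  assumes "E \<in> carrier_mat r r" "A \<in> carrier_mat r r"
  shows "transfer_function D C E A B = rat_mat D + cm C * resolv E A * cm B"
  unfolding transfer_function_def rat_mat_const rat_mat_pencil[OF assms] resolv_def ..

section \<open>Minimal realizations\<close>

lemma matrix_with_last_row:
  fixes v :: "complex vec"
  assumes v: "v \<in> carrier_vec (Suc k)" "v \<noteq> 0\<^sub>v (Suc k)"
  obtains U where "U \<in> carrier_mat (Suc k) (Suc k)" "det U \<noteq> 0" "row U k = v"
proof -
  obtain i where i: "i < Suc k" "v $ i \<noteq> 0" using v by (metis carrier_vecD eq_vecI index_zero_vec)
  define U where "U = mat (Suc k) (Suc k) (\<lambda>(a, b). if a = k then v $ b
     else if a = i then (if b = k then 1 else 0) else if a = b then 1 else 0)"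
  have U: "U \<in> carrier_mat (Suc k) (Suc k)" by (simp add: U_def)
  have row: "row U k = v" using v by (intro eq_vecI) (auto simp: U_def)
  have "det U \<noteq> 0"
  proof
    assume "det U = 0"
    then obtain x where x: "x \<in> carrier_vec (Suc k)" "x \<noteq> 0\<^sub>v (Suc k)" "U *\<^sub>v x = 0\<^sub>v (Suc k)"
      using det_0_iff_vec_prod_zero_field[OF U] by blast
    have Ux: "(\<Sum>b<Suc k. U $$ (a, b) * x $ b) = 0" if "a < Suc k" for a
    proof -
      have "(U *\<^sub>v x) $ a = (\<Sum>b<Suc k. U $$ (a, b) * x $ b)"
        using that U x(1) by (simp add: scalar_prod_def atLeast0LessThan)
      then show ?thesis using x(3) that by simp
    qed
    have other: "x $ a = 0" if "a < Suc k" "a \<noteq> i" for a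
    proof -
      have "(\<Sum>b<Suc k. U $$ ((if a = k then i else a), b) * x $ b) = x $ a"
        using that i by (subst sum_one[of a]) (auto simp: U_def)
      then show ?thesis using Ux[of "if a = k then i else a"] that i by (simp del: sum.lessThan_Suc)
    qed
    have "(\<Sum>b<Suc k. U $$ (k, b) * x $ b) = v $ i * x $ i"
      using i other by (subst sum_one[of i]) (auto simp: U_def)
    then have "x $ i = 0" using Ux[of k] i by (simp del: sum.lessThan_Suc)
    then have "x = 0\<^sub>v (Suc k)" using other x(1) by (intro eq_vecI) (metis index_zero_vec carrier_vecD)+
    then show False using x by simp
  qed
  then show thesis using that U row by blast
qed

text \<open>Suppose that \<open>v\<close> is a nonzero left null vector of \<open>B\<close> and of \<open>A - t E\<close>.  Coordinates with last row \<open>v\<close> on the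
  left and dual to $v^T E$ on the right make the last row of $\lambda E - A$ equal to $(0, \dots, 0, \lambda - t)$ and the last row
  of $B$ zero.  The last state is then never excited and can be deleted, against minimality.\<close>

lemma minimal_left_kernel:
  assumes min: "is_minimal_realization n r G P C E A B"
    and v: "v \<in> carrier_vec r" "\<And>j. j < n \<Longrightarrow> v \<bullet> col B j = 0" "\<And>j. j < r \<Longrightarrow> v \<bullet> col (A - t \<cdot>\<^sub>m E) j = 0"
  shows "v = 0\<^sub>v r"
proof (rule ccontr)
  assume nz: "v \<noteq> 0\<^sub>v r"
  have real: "P \<in> carrier_mat n n" "C \<in> carrier_mat n r" "E \<in> carrier_mat r r" "A \<in> carrier_mat r r"
    "B \<in> carrier_mat r n" "det E \<noteq> 0" "G = transfer_function P C E A B"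
    and least: "\<And>r' P' C' E' A' B'. is_realization n r' G P' C' E' A' B' \<Longrightarrow> r \<le> r'"
    using min unfolding is_minimal_realization_def is_realization_def by blast+
  obtain k where k: "r = Suc k" using nz v(1) by (cases r) auto
  note car = real(2-5)[unfolded k]
  obtain U where U: "U \<in> carrier_mat (Suc k) (Suc k)" "det U \<noteq> 0" "row U k = v"
    using matrix_with_last_row[of v k] v nz k by auto
  define u where "u = E\<^sup>T *\<^sub>v v"
  have u: "u \<in> carrier_vec (Suc k)" unfolding u_def using car v(1)[unfolded k] by (intro mult_mat_vec_carrier[of _ _ "Suc k"]) auto
  have "det E\<^sup>T \<noteq> 0" using det_transpose[OF car(2)] real(6) by simp
  then have "u \<noteq> 0\<^sub>v (Suc k)"
    using det_0_iff_vec_prod_zero_field[of "E\<^sup>T" "Suc k"] car v nz k unfolding u_def by auto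
  then obtain W where W: "W \<in> carrier_mat (Suc k) (Suc k)" "det W \<noteq> 0" "row W k = u"
    using matrix_with_last_row[OF u] by blast
  obtain V where V: "V \<in> carrier_mat (Suc k) (Suc k)" "W * V = 1\<^sub>m (Suc k)" "V * W = 1\<^sub>m (Suc k)"
    using field_inverse_exists[OF W(1,2)] by blast
  obtain Ui where Ui: "Ui \<in> carrier_mat (Suc k) (Suc k)" "Ui * U = 1\<^sub>m (Suc k)"
    using field_inverse_exists[OF U(1,2)] by blast
  \<comment> \<open>The realization in the new coordinates; only the last rows of the new matrices need to be computed.\<close>
  define E' A' B' C' where "E' = U * E * V" and "A' = U * A * V" and "B' = U * B" and "C' = C * V"
  have car': "E' \<in> carrier_mat (Suc k) (Suc k)" "A' \<in> carrier_mat (Suc k) (Suc k)" "B' \<in> carrier_mat (Suc k) n" "C' \<in> carrier_mat n (Suc k)"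
    using U V car by (auto simp: E'_def A'_def B'_def C'_def)
  have uV: "u \<bullet> col V j = (if j = k then 1 else 0)" if "j < Suc k" for j
  proof -
    have "(W * V) $$ (k, j) = u \<bullet> col V j" using that W V(1) by simp
    then show ?thesis unfolding V(2) using that by auto
  qed
  have rowUX: "row (U * X) k = X\<^sup>T *\<^sub>v v" if "X \<in> carrier_mat (Suc k) l" for X l
  proof (rule eq_vecI)
    fix j assume "j < dim_vec (X\<^sup>T *\<^sub>v v)"
    then have j: "j < l" using that by simp
    have "row (U * X) k $ j = v \<bullet> col X j" using that U j by simp
    also have "\<dots> = col X j \<bullet> v" using that v k j by (intro comm_scalar_prod[of _ "Suc k"]) auto
    finally show "row (U * X) k $ j = (X\<^sup>T *\<^sub>v v) $ j" using that j by simp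
  qed (use that U in auto)
  have Ek: "E' $$ (k, j) = (if j = k then 1 else 0)" if "j < Suc k" for j
  proof -
    have "E' $$ (k, j) = row (U * E) k \<bullet> col V j" unfolding E'_def by (rule index_mult_mat(1)) (use that U V car in simp_all)
    then show ?thesis using rowUX[OF car(2)] uV[OF that] by (simp add: u_def)
  qed
  have ATv: "A\<^sup>T *\<^sub>v v = t \<cdot>\<^sub>v u"
  proof (rule eq_vecI)
    fix j assume "j < dim_vec (t \<cdot>\<^sub>v u)"
    then have j: "j < Suc k" using u by simp
    have "v \<bullet> col (A - t \<cdot>\<^sub>m E) j = v \<bullet> col A j - t * (v \<bullet> col E j)"
      using j car v k by (simp add: scalar_prod_def sum_subtractf sum_distrib_left algebra_simps)
    then have "v \<bullet> col A j = t * (v \<bullet> col E j)" using v(3)[of j] j k by simp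
    moreover have "v \<bullet> col X j = col X j \<bullet> v" if "X \<in> carrier_mat (Suc k) (Suc k)" for X
      using that v k j by (intro comm_scalar_prod[of _ "Suc k"]) auto
    ultimately show "(A\<^sup>T *\<^sub>v v) $ j = (t \<cdot>\<^sub>v u) $ j" using j car by (simp add: u_def)
  qed (use car u in auto)
  have Ak: "A' $$ (k, j) = (if j = k then t else 0)" if "j < Suc k" for j
  proof -
    have "A' $$ (k, j) = row (U * A) k \<bullet> col V j" unfolding A'_def by (rule index_mult_mat(1)) (use that U V car in simp_all)
    also have "\<dots> = (t \<cdot>\<^sub>v u) \<bullet> col V j" using rowUX[OF car(3)] ATv by simp
    also have "\<dots> = t * (u \<bullet> col V j)" using u V by simp
    finally show ?thesis using uV[OF that] by simp
  qed
  have Bk: "B' $$ (k, j) = 0" if "j < n" for j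
    using that U car v(2)[OF that] by (simp add: B'_def)
  define E1 A1 B1 C1 where "E1 = mat k k (\<lambda>(i, j). E' $$ (i, j))" and "A1 = mat k k (\<lambda>(i, j). A' $$ (i, j))"
    and "B1 = mat k n (\<lambda>(i, j). B' $$ (i, j))" and "C1 = mat n k (\<lambda>(i, j). C' $$ (i, j))"
  have car1: "E1 \<in> carrier_mat k k" "A1 \<in> carrier_mat k k" "B1 \<in> carrier_mat k n" "C1 \<in> carrier_mat n k"
    by (auto simp: E1_def A1_def B1_def C1_def)
  have "E' = four_block_mat E1 (mat k 1 (\<lambda>(i, j). E' $$ (i, k))) (0\<^sub>m 1 k) (1\<^sub>m 1)"
    using car' Ek by (intro eq_matI) (auto simp: E1_def less_Suc_eq)
  then have "det E' = det E1"
    using det_four_block_mat_lower_left_zero[OF car1(1), of "mat k 1 (\<lambda>(i, j). E' $$ (i, k))" 1 "0\<^sub>m 1 k" "1\<^sub>m 1"] by simp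
  moreover have "det E' = det U * det E * det V"
    unfolding E'_def using U V car by (simp add: det_mult[of _ "Suc k"])
  moreover have "det V \<noteq> 0" using det_mult[OF W(1) V(1)] V by auto
  ultimately have dE1: "det E1 \<noteq> 0" using U(2) real(6) by (metis mult_eq_0_iff)
  \<comment> \<open>The smaller system, extended by a zero state, solves the larger one.\<close>
  define X1 where "X1 = resolv E1 A1 * cm B1"
  have X1: "X1 \<in> carrier_mat k n" using resolv(1)[OF car1(1,2) dE1] car1 by (auto simp: X1_def)
  have PX1: "(lamF \<cdot>\<^sub>m cm E1 - cm A1) * X1 = cm B1"
  proof -
    have "(lamF \<cdot>\<^sub>m cm E1 - cm A1) * X1 = ((lamF \<cdot>\<^sub>m cm E1 - cm A1) * resolv E1 A1) * cm B1"
      unfolding X1_def using resolv(1)[OF car1(1,2) dE1] car1 by (intro assoc_mult_mat[symmetric, of _ k k _ k _ n]) auto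
    then show ?thesis using resolv(3)[OF car1(1,2) dE1] car1 by (simp add: left_mult_one_mat[of _ k n])
  qed
  define X' where "X' = mat (Suc k) n (\<lambda>(i, j). if i < k then X1 $$ (i, j) else 0)"
  have X': "X' \<in> carrier_mat (Suc k) n" by (simp add: X'_def)
  have sumX': "(\<Sum>l<Suc k. f l * X' $$ (l, j)) = (\<Sum>l<k. f l * X1 $$ (l, j))" if "j < n" for f j
    using that by (simp add: X'_def)
  let ?P = "lamF \<cdot>\<^sub>m cm E - cm A" and ?P' = "lamF \<cdot>\<^sub>m cm E' - cm A'"
  have P': "?P' * X' = cm B'"
  proof (rule eq_matI)
    fix i j assume "i < dim_row (cm B')" "j < dim_col (cm B')"
    then have ij: "i < Suc k" "j < n" using car' by auto
    have "(?P' * X') $$ (i, j) = (\<Sum>l<Suc k. ?P' $$ (i, l) * X' $$ (l, j))"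
      using ij car' X' by (simp add: scalar_prod_def atLeast0LessThan del: sum.lessThan_Suc)
    also have "\<dots> = (\<Sum>l<k. ?P' $$ (i, l) * X1 $$ (l, j))" by (rule sumX'[OF ij(2)])
    also have "\<dots> = cm B' $$ (i, j)"
    proof (cases "i < k")
      case True
      have "(\<Sum>l<k. ?P' $$ (i, l) * X1 $$ (l, j)) = ((lamF \<cdot>\<^sub>m cm E1 - cm A1) * X1) $$ (i, j)"
        using True ij car' car1 X1 by (simp add: scalar_prod_def atLeast0LessThan E1_def A1_def)
      then show ?thesis using PX1 True ij car' by (simp add: B1_def)
    next
      case False
      then have "i = k" using ij by simp
      then show ?thesis using ij car' Ek Ak Bk by simp
    qed
    finally show "(?P' * X') $$ (i, j) = cm B' $$ (i, j)" .
  qed (use car' X' in auto)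
  have hom: "cm (X * Y) = cm X * cm Y" if "X \<in> carrier_mat a b" "Y \<in> carrier_mat b c" for X Y a b c
    using that by (rule cf.mat_hom_mult)
  have PP: "?P' = cm U * ?P * cm V"
  proof -
    have "cm U * ?P = lamF \<cdot>\<^sub>m (cm U * cm E) - cm U * cm A"
      using U car by (simp add: mult_minus_distrib_mat[of _ "Suc k" "Suc k" _ "Suc k"] mult_smult_distrib[of _ "Suc k" "Suc k" _ "Suc k"])
    moreover have "(lamF \<cdot>\<^sub>m (cm U * cm E) - cm U * cm A) * cm V = lamF \<cdot>\<^sub>m (cm U * cm E * cm V) - cm U * cm A * cm V"
      using U V car by (simp add: minus_mult_distrib_mat[of _ "Suc k" "Suc k"] mult_smult_assoc_mat[of _ "Suc k" "Suc k" _ "Suc k"])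
    ultimately show ?thesis unfolding E'_def A'_def using U V car
      by (simp add: hom[of _ "Suc k" "Suc k" _ "Suc k"])
  qed
  have Pc: "?P \<in> carrier_mat (Suc k) (Suc k)" using car by auto
  have YB: "?P * (cm V * X') = cm B"
  proof -
    have "cm Ui * (?P' * X') = (cm Ui * cm U) * (?P * (cm V * X'))"
      unfolding PP using Ui U V X' Pc
      by (simp add: assoc_mult_mat[of _ "Suc k" "Suc k" _ "Suc k" _ "Suc k"] assoc_mult_mat[of _ "Suc k" "Suc k" _ "Suc k" _ n])
    moreover have "cm Ui * cm U = 1\<^sub>m (Suc k)" using Ui U by (simp add: hom[symmetric] cf.mat_hom_one)
    moreover have "cm Ui * cm B' = cm B"
      unfolding B'_def using Ui U car
      by (simp add: hom[symmetric, of _ "Suc k" "Suc k" _ n] assoc_mult_mat[symmetric, of _ "Suc k" "Suc k" _ "Suc k" _ n] left_mult_one_mat[of _ "Suc k" n])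
    moreover have "?P * (cm V * X') \<in> carrier_mat (Suc k) n" using Pc V X' by auto
    ultimately show ?thesis unfolding P' by (simp add: left_mult_one_mat[of _ "Suc k" n])
  qed
  have Rc: "resolv E A \<in> carrier_mat (Suc k) (Suc k)" "resolv E A * ?P = 1\<^sub>m (Suc k)"
    using resolv[OF car(2,3) real(6)] by auto
  have "resolv E A * cm B = cm V * X'"
  proof -
    have "resolv E A * cm B = (resolv E A * ?P) * (cm V * X')"
      unfolding YB[symmetric] using Rc Pc V X' by (intro assoc_mult_mat[symmetric, of _ "Suc k" "Suc k" _ "Suc k" _ n]) auto
    then show ?thesis using Rc V X' by (simp add: left_mult_one_mat[of _ "Suc k" n])
  qed
  then have "cm C * resolv E A * cm B = cm C * (cm V * X')"
    using car Rc by (simp add: assoc_mult_mat[of _ n "Suc k" _ "Suc k" _ n])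
  also have "\<dots> = cm C' * X'"
    unfolding C'_def using car V X' by (simp add: hom[of _ n "Suc k" _ "Suc k"] assoc_mult_mat[of _ n "Suc k" _ "Suc k" _ n])
  also have "\<dots> = cm C1 * X1"
  proof (rule eq_matI)
    fix i j assume "i < dim_row (cm C1 * X1)" "j < dim_col (cm C1 * X1)"
    then have ij: "i < n" "j < n" using car1 X1 by auto
    have "(cm C' * X') $$ (i, j) = (\<Sum>l<Suc k. cm C' $$ (i, l) * X' $$ (l, j))"
      using ij car' X' by (simp add: scalar_prod_def atLeast0LessThan del: sum.lessThan_Suc)
    also have "\<dots> = (\<Sum>l<k. cm C' $$ (i, l) * X1 $$ (l, j))" by (rule sumX'[OF ij(2)])
    also have "\<dots> = (cm C1 * X1) $$ (i, j)"
      using ij car' car1 X1 by (simp add: scalar_prod_def atLeast0LessThan C1_def)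
    finally show "(cm C' * X') $$ (i, j) = (cm C1 * X1) $$ (i, j)" .
  qed (use car' car1 X' X1 in auto)
  also have "\<dots> = cm C1 * resolv E1 A1 * cm B1"
    unfolding X1_def using car1 resolv(1)[OF car1(1,2) dE1] by (intro assoc_mult_mat[symmetric, of _ n k _ k _ n]) auto
  finally have "G = transfer_function P C1 E1 A1 B1"
    unfolding real(7) transfer_eq[OF car(2,3)] transfer_eq[OF car1(1,2)] by simp
  then have "is_realization n k G P C1 E1 A1 B1"
    using real car1 dE1 by (simp add: is_realization_def)
  then show False using least k by fastforce
qed

section \<open>Pencils\<close>

lemma const_mat_dims [simp]: "dim_row (const_mat A) = dim_row A" "dim_col (const_mat A) = dim_col A"
  by (simp_all add: const_mat_def)

lemma const_mat_carrier [simp]: "A \<in> carrier_mat k l \<Longrightarrow> const_mat A \<in> carrier_mat k l"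
  by (auto simp: const_mat_def)

lemma const_mat_mult:
  "A \<in> carrier_mat k l \<Longrightarrow> B \<in> carrier_mat l q \<Longrightarrow> const_mat (A * B) = const_mat A * const_mat B"
  unfolding const_mat_def by (rule cp.mat_hom_mult)

lemma pencil_mult_right:
  assumes "Y \<in> carrier_mat k k" "X \<in> carrier_mat k k" "R \<in> carrier_mat k k"
  shows "(lam \<cdot>\<^sub>m const_mat Y - const_mat X) * const_mat R = lam \<cdot>\<^sub>m const_mat (Y * R) - const_mat (X * R)"
  using assms const_mat_mult[OF assms(1,3)] const_mat_mult[OF assms(2,3)]
  by (subst minus_mult_distrib_mat[of _ k k _ _ k]) (simp_all add: mult_smult_assoc_mat[of _ k k _ k])

lemma pencil_mult_left:
  assumes "Y \<in> carrier_mat k k" "X \<in> carrier_mat k k" "R \<in> carrier_mat k k"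
  shows "const_mat R * (lam \<cdot>\<^sub>m const_mat Y - const_mat X) = lam \<cdot>\<^sub>m const_mat (R * Y) - const_mat (R * X)"
  using assms const_mat_mult[OF assms(3,1)] const_mat_mult[OF assms(3,2)]
  by (subst mult_minus_distrib_mat[of _ k k _ k]) (simp_all add: mult_smult_distrib[of _ k k _ k])

text \<open>For pencils, T-evenness says that the constant coefficient is symmetric and the leading one skew-symmetric.\<close>

lemma T_even_pencil:
  assumes "Y \<in> carrier_mat k k" "X \<in> carrier_mat k k"
  shows "T_even_poly (lam \<cdot>\<^sub>m const_mat Y - const_mat X) \<longleftrightarrow> X\<^sup>T = X \<and> Y\<^sup>T = - Y"
proof -
  have "T_even_poly (lam \<cdot>\<^sub>m const_mat Y - const_mat X)
      \<longleftrightarrow> (\<forall>i<k. \<forall>j<k. pcompose (lam * [:Y $$ (j, i):] - [:X $$ (j, i):]) (- lam) = lam * [:Y $$ (i, j):] - [:X $$ (i, j):])"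
    unfolding T_even_poly_def mat_eq_iff using assms by (auto simp: const_mat_def)
  also have "\<dots> \<longleftrightarrow> (\<forall>i<k. \<forall>j<k. X $$ (j, i) = X $$ (i, j) \<and> Y $$ (j, i) = - Y $$ (i, j))"
  proof -
    have "pcompose (lam * [:a:] - [:b:]) (- lam) = lam * [:a':] - [:b':] \<longleftrightarrow> b = b' \<and> a = - a'" for a b a' b' :: complex
      by (auto simp: pcompose_pCons)
    then show ?thesis by simp
  qed
  also have "\<dots> \<longleftrightarrow> X\<^sup>T = X \<and> Y\<^sup>T = - Y"
    unfolding mat_eq_iff using assms by auto
  finally show ?thesis .
qed

lemma coeff_reflect: "coeff (pcompose p (- lam)) i = (- 1) ^ i * coeff p i"
proof (induction p arbitrary: i)
  case (pCons a p)
  show ?case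
    using pCons.IH by (cases i) (auto simp: pcompose_pCons coeff_pCons)
qed simp

lemma T_even_coeff:
  assumes P: "P \<in> carrier_mat n n" and "T_even_poly P"
  shows "(coeff_mat P i)\<^sup>T = (- 1) ^ i \<cdot>\<^sub>m coeff_mat P i"
proof (rule eq_matI)
  fix a b assume "a < dim_row ((- 1) ^ i \<cdot>\<^sub>m coeff_mat P i)" "b < dim_col ((- 1) ^ i \<cdot>\<^sub>m coeff_mat P i)"
  then have ab: "a < n" "b < n" using P by (auto simp: coeff_mat_def)
  have "(map_mat (\<lambda>p. pcompose p (- lam)) P)\<^sup>T $$ (b, a) = P $$ (b, a)"
    using assms(2) by (simp add: T_even_poly_def)
  then have "pcompose (P $$ (a, b)) (- lam) = P $$ (b, a)" using ab P by simp
  then have "coeff (P $$ (b, a)) i = (- 1) ^ i * coeff (P $$ (a, b)) i"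
    using coeff_reflect[of "P $$ (a, b)" i] by simp
  then show "(coeff_mat P i)\<^sup>T $$ (a, b) = ((- 1) ^ i \<cdot>\<^sub>m coeff_mat P i) $$ (a, b)"
    using ab P by (simp add: coeff_mat_def)
qed (use P in \<open>auto simp: coeff_mat_def\<close>)

section \<open>Block structure\<close>

text \<open>The direct sum of two matrices, as a four-block matrix so that the multiplication rules for these apply.\<close>

definition dsum :: "'a :: zero mat \<Rightarrow> 'a mat \<Rightarrow> 'a mat" where
  "dsum A B = four_block_mat A (0\<^sub>m (dim_row A) (dim_col B)) (0\<^sub>m (dim_row B) (dim_col A)) B"

lemma dsum: "diag_block_mat [A, B] = dsum A B"
  by (rule eq_matI) (auto simp: Let_def dsum_def)

lemma dsum_carrier [simp]: "A \<in> carrier_mat k k \<Longrightarrow> B \<in> carrier_mat l l \<Longrightarrow> dsum A B \<in> carrier_mat (k + l) (k + l)"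
  by (auto simp: dsum_def)

lemma dsum_four_block:
  fixes A :: "'a :: comm_ring_1 mat"
  assumes "A \<in> carrier_mat k k" "B \<in> carrier_mat l l"
    and "X \<in> carrier_mat k k" "C \<in> carrier_mat k l" "D \<in> carrier_mat l k" "H \<in> carrier_mat l l"
  shows "dsum A B * four_block_mat X C D H = four_block_mat (A * X) (A * C) (B * D) (B * H)"
    "four_block_mat X C D H * dsum A B = four_block_mat (X * A) (C * B) (D * A) (H * B)"
proof -
  have d: "dsum A B = four_block_mat A (0\<^sub>m k l) (0\<^sub>m l k) B" using assms by (auto simp: dsum_def)
  note c = assms mult_carrier_mat[OF assms(1,4)] mult_carrier_mat[OF assms(2,5)] mult_carrier_mat[OF assms(4,2)] mult_carrier_mat[OF assms(5,1)]
  show "dsum A B * four_block_mat X C D H = four_block_mat (A * X) (A * C) (B * D) (B * H)"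
    unfolding d using c by (subst mult_four_block_mat[of _ k k _ l _ l _ _ k _ l]) simp_all
  show "four_block_mat X C D H * dsum A B = four_block_mat (X * A) (C * B) (D * A) (H * B)"
    unfolding d using c by (subst mult_four_block_mat[of _ k k _ l _ l _ _ k _ l]) simp_all
qed

lemma dsum_mult:
  fixes A :: "'a :: comm_ring_1 mat"
  assumes "A \<in> carrier_mat k k" "B \<in> carrier_mat l l" "X \<in> carrier_mat k k" "Y \<in> carrier_mat l l"
  shows "dsum A B * dsum X Y = dsum (A * X) (B * Y)"
  using dsum_four_block(1)[OF assms(1,2,3) zero_carrier_mat zero_carrier_mat assms(4)] assms
  by (simp add: dsum_def)

lemma dsum_one: "dsum (1\<^sub>m k) (1\<^sub>m l :: 'a :: {zero, one} mat) = 1\<^sub>m (k + l)"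
  by (rule eq_matI) (auto simp: dsum_def)

lemma gprod_dsum:
  fixes M :: "int \<Rightarrow> 'a :: comm_ring_1 mat"
  assumes "\<And>i. i \<in> set t \<Longrightarrow> M i \<in> carrier_mat k k" "\<And>i. i \<in> set t \<Longrightarrow> K i \<in> carrier_mat l l"
  shows "gprod (k + l) (\<lambda>i. dsum (M i) (K i)) t = dsum (gprod k M t) (gprod l K t)"
  using assms
proof (induction t)
  case (Cons i t)
  have "gprod k M t \<in> carrier_mat k k" "gprod l K t \<in> carrier_mat l l"
    using Cons.prems by (auto intro!: gprod_carrier)
  then show ?case using Cons by (simp add: gprod_def dsum_mult[of _ k _ l])
qed (simp add: dsum_one)

lemma gprod_ones: "(\<And>i. i \<in> set t \<Longrightarrow> K i = 1\<^sub>m l) \<Longrightarrow> gprod l K t = (1\<^sub>m l :: 'a :: comm_ring_1 mat)"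
  by (induction t) (auto simp: gprod_def)

lemma kronecker_col:
  assumes X: "X \<in> carrier_mat n r" and j: "0 < j" "j \<le> m"
  shows "kronecker (e_col m j) X = Ecol m n (j - 1) * X"
proof (rule eq_matI)
  fix a b assume "a < dim_row (Ecol m n (j - 1) * X)" "b < dim_col (Ecol m n (j - 1) * X)"
  then have "a < m * n" and b: "b < r" using X by auto
  then obtain d y where a: "d < m" "y < n" "a = d * n + y" by (auto elim: block_cases)
  have al: "a < m * n" by fact
  have "(Ecol m n (j - 1) * X) $$ (a, b) = (\<Sum>x<n. (if a = (j - 1) * n + x then 1 else 0) * X $$ (x, b))"
    using al b X by (simp add: scalar_prod_def atLeast0LessThan Ecol_def)
  also have "\<dots> = (\<Sum>x<n. (if d = j - 1 \<and> y = x then 1 else 0) * X $$ (x, b))"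
    using a by (intro sum.cong refl) (simp add: block_eq)
  also have "\<dots> = (if d = j - 1 then X $$ (y, b) else 0)"
    using sum_delta_inner[OF a(2), of "\<lambda>x. X $$ (x, b)"] by auto
  also have "\<dots> = kronecker (e_col m j) X $$ (a, b)"
  proof -
    have "a div n = d" "a mod n = y" using a block_index by auto
    moreover have "e_col m j $$ (d, 0) = (if d = j - 1 then 1 else 0)"
      using a j by (simp add: e_col_def mat_of_cols_index)
    moreover have "b div r = 0" "b mod r = b" using b by auto
    ultimately show ?thesis using al b X by (simp add: kronecker_def e_col_def)
  qed
  finally show "kronecker (e_col m j) X $$ (a, b) = (Ecol m n (j - 1) * X) $$ (a, b)" by simp
qed (use X in \<open>auto simp: kronecker_def e_col_def\<close>)

lemma kronecker_transpose: "(kronecker A B)\<^sup>T = kronecker A\<^sup>T (B :: 'a :: comm_ring_1 mat)\<^sup>T"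
proof -
  have "x mod b < b" if "x < a * b" for x a b :: nat
    using that by (cases b) auto
  then show ?thesis by (intro eq_matI) (auto simp: kronecker_def less_mult_imp_div_less)
qed

lemma kronecker_row:
  assumes B: "B \<in> carrier_mat r n" and j: "0 < j" "j \<le> m"
  shows "kronecker (e_col m j)\<^sup>T B = B * (Ecol m n (j - 1))\<^sup>T"
proof -
  have "kronecker (e_col m j)\<^sup>T B = (kronecker (e_col m j) B\<^sup>T)\<^sup>T" by (simp add: kronecker_transpose)
  also have "\<dots> = (Ecol m n (j - 1) * B\<^sup>T)\<^sup>T" using B j by (subst kronecker_col) auto
  also have "\<dots> = B * (Ecol m n (j - 1))\<^sup>T" using B by (subst transpose_mult[of _ _ n _ r]) auto
  finally show ?thesis .
qed

context gfpr
begin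

text \<open>The number $j = m - i_0(\mathbf w)$ of the statement (\<open>tuple_i0_wl\<close>).\<close>

definition je :: nat where "je = (if e = 0 then m else m - 1)"

lemma je: "0 < je" "je \<le> m" "je - 1 < m"
  using m_int by (auto simp: je_def)

end

context gfpr_mats
begin

text \<open>The factors of \<open>X0\<close> on the two sides of $M_0$.  In $\mathbb L$ they move the borders $B^T$ and $B$ from the last block
  to block \<open>je\<close>: among these factors only $M_1$, which is present if \<open>e\<close> is positive, touches the last block.\<close>

definition W where "W = G Ol * G El"

definition Y where "Y = G Ol * G (Zo @ rc)"

lemma WY_carrier [simp]: "W \<in> carrier_mat N N" "Y \<in> carrier_mat N N"
  by (simp_all add: W_def Y_def)

lemma X_WY: "X0 = W * M 0 * Y" "X1 = G zl * Y"
  unfolding X0_def X1_def W_def Y_def G_wl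
  by (simp_all add: assoc_mult_mat[of _ N N _ N _ N])

lemma border_col: "W * Ecol m n (m - 1) = Ecol m n (je - 1)"
proof -
  have "bacts m n W (g (Ol @ El))"
    unfolding W_def G_append[symmetric] by (rule bacts_gprod) (use idx_sets in auto)
  moreover have "g (Ol @ El) (single (m - 1) y) = single (je - 1) y" for y :: "nat \<Rightarrow> 'a"
  proof (cases "e = 0")
    case True
    have "Ol = []" "El = []" "je = m" unfolding Ol_def El_def je_def using True by simp_all
    then show ?thesis by simp
  next
    case False
    have "g El (single (m - 1) y) = single (m - 1) y"
      by (rule g_fix) (use m_int in \<open>auto simp: pr_def idx_def dest!: set_El\<close>)
    moreover have "g Ol (single (m - nat 1) y) = single (m - nat 1 - 1) y"
      by (rule g_Ol) (use False in \<open>simp add: set_Ol_iff\<close>)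
    ultimately show ?thesis using False by (simp add: gapp_def je_def)
  qed
  ultimately show ?thesis
    by (intro bacts_Ecol) (use je in auto)
qed

lemma border_row: "(Ecol m n (m - 1))\<^sup>T * Y = (Ecol m n (je - 1))\<^sup>T"
proof (rule bacts_Erow)
  show "bacts m n Y (g (Ol @ (Zo @ rc)))"
    unfolding Y_def G_append[symmetric] by (rule bacts_gprod) (use idx_sets in auto)
  show "m - 1 < m" "je - 1 < m" using je by auto
  fix x :: "nat \<Rightarrow> nat \<Rightarrow> 'a" and a assume a: "a < n"
  have out: "g (Zo @ rc) x (je - 1) = x (je - 1)"
    by (rule gapp_outside) (use je m_int in \<open>auto simp: pr_def idx_def je_def dest!: set_Zo set_rc\<close>)
  have "g Ol z (m - 1) a = z (je - 1) a" for z
  proof (cases "e = 0")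
    case True
    have "Ol = []" "je = m" unfolding Ol_def je_def using True by simp_all
    then show ?thesis by simp
  next
    case False
    have "1 \<in> set Ol" using False by (simp add: set_Ol_iff)
    have "Ol = map (\<lambda>j. int (2 * e) - 2 * int j - 1) [0..<e - 1] @ [1]"
      using False unfolding Ol_def by (cases e) auto
    then have "g Ol z (m - 1) a = g (map (\<lambda>j. int (2 * e) - 2 * int j - 1) [0..<e - 1]) (g [1] z) (m - 1) a"
      by (simp add: gapp_def)
    also have "\<dots> = g [1] z (m - 1) a"
      by (subst gapp_outside) (use je m_int in \<open>auto simp: pr_def idx_def\<close>)
    also have "\<dots> = z (m - 1 - 1) a"
    proof -
      have "3 \<le> m" using False m_int by linarith
      then show ?thesis by (auto simp: fapp_def)
    qed
    finally show ?thesis using False by (simp add: je_def)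
  qed
  then show "g (Ol @ (Zo @ rc)) x (m - 1) a = x (je - 1) a"
    using out by (simp add: gapp_def)
qed

end

lemma bdiag_index:
  "i < m * n \<Longrightarrow> j < m * n \<Longrightarrow> bdiag m n f $$ (i, j) = (if i div n = j div n then f (i div n) $$ (i mod n, j mod n) else 0)"
  by (simp add: bdiag_def)

lemma bdiag_Suc:
  assumes "\<And>b. f b \<in> carrier_mat n n"
  shows "bdiag (Suc m) n f = dsum (f 0) (bdiag m n (\<lambda>b. f (Suc b)))"
proof (rule eq_matI)
  have f0: "dim_row (f 0) = n" "dim_col (f 0) = n" using assms by auto
  fix i j assume "i < dim_row (dsum (f 0) (bdiag m n (\<lambda>b. f (Suc b))))" "j < dim_col (dsum (f 0) (bdiag m n (\<lambda>b. f (Suc b))))"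
  then have ij: "i < n + m * n" "j < n + m * n" using f0 by (auto simp: dsum_def bdiag_def)
  have n: "0 < n" using ij by (cases n) auto
  have div: "k div n = (if k < n then 0 else Suc ((k - n) div n))" "k mod n = (if k < n then k else (k - n) mod n)" for k
    using le_div_geq[OF n, of k] le_mod_geq[of n k] by auto
  have "dsum (f 0) (bdiag m n (\<lambda>b. f (Suc b))) $$ (i, j) =
      (if i < n then if j < n then f 0 $$ (i, j) else 0 else if j < n then 0 else bdiag m n (\<lambda>b. f (Suc b)) $$ (i - n, j - n))"
    using ij f0 by (simp add: dsum_def bdiag_def)
  moreover have "bdiag (Suc m) n f $$ (i, j) = (if i div n = j div n then f (i div n) $$ (i mod n, j mod n) else 0)"
    using ij by (simp add: bdiag_index)
  moreover have "bdiag m n (\<lambda>b. f (Suc b)) $$ (i - n, j - n)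
      = (if (i - n) div n = (j - n) div n then f (Suc ((i - n) div n)) $$ ((i - n) mod n, (j - n) mod n) else 0)"
    if "\<not> i < n" "\<not> j < n"
    using that ij by (intro bdiag_index) auto
  ultimately show "bdiag (Suc m) n f $$ (i, j) = dsum (f 0) (bdiag m n (\<lambda>b. f (Suc b))) $$ (i, j)"
    unfolding div(1)[of i] div(1)[of j] div(2)[of i] div(2)[of j] by (cases "i < n"; cases "j < n") simp_all
qed (use carrier_matD[OF assms] in \<open>auto simp: dsum_def bdiag_def\<close>)

lemma diag_blocks:
  fixes f :: "nat \<Rightarrow> 'a :: comm_ring_1 mat"
  assumes "\<And>b. f b \<in> carrier_mat n n"
  shows "diag_block_mat (map f [0..<m]) = bdiag m n f"
  using assms
proof (induction m arbitrary: f)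
  case 0
  show ?case by (rule eq_matI) (auto simp: bdiag_def)
next
  case (Suc m)
  have "map f [0..<Suc m] = f 0 # map (\<lambda>b. f (Suc b)) [0..<m]"
    by (simp add: map_upt_Suc del: upt_Suc)
  then have "diag_block_mat (map f [0..<Suc m]) = dsum (f 0) (diag_block_mat (map (\<lambda>b. f (Suc b)) [0..<m]))"
    by (simp add: dsum_def Let_def)
  also have "diag_block_mat (map (\<lambda>b. f (Suc b)) [0..<m]) = bdiag m n (\<lambda>b. f (Suc b))"
    by (rule Suc.IH) (rule Suc.prems)
  finally show ?case by (simp add: bdiag_Suc Suc.prems)
qed

lemma quasi_identity_iff:
  "quasi_identity m n \<epsilon> Q \<longleftrightarrow> (\<forall>i\<in>{1..m}. \<epsilon> i \<in> {1, -1}) \<and> Q = dg m n (\<lambda>b. \<epsilon> (Suc b))"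
proof -
  have "map (\<lambda>i. \<epsilon> i \<cdot>\<^sub>m 1\<^sub>m n) [1..<m + 1] = map (\<lambda>b. \<epsilon> (Suc b) \<cdot>\<^sub>m 1\<^sub>m n) [0..<m]"
    by (simp add: map_Suc_upt[symmetric] comp_def del: upt_Suc)
  moreover have "diag_block_mat (map (\<lambda>b. \<epsilon> (Suc b) \<cdot>\<^sub>m 1\<^sub>m n) [0..<m]) = bdiag m n (\<lambda>b. \<epsilon> (Suc b) \<cdot>\<^sub>m 1\<^sub>m n)"
    by (rule diag_blocks) simp
  ultimately show ?thesis unfolding quasi_identity_def dg_def by (simp only:)
qed

lemma dg_index: "i < m * n \<Longrightarrow> j < m * n \<Longrightarrow> dg m n \<epsilon> $$ (i, j) = (if i = j then \<epsilon> (i div n) else 0)"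
proof -
  assume ij: "i < m * n" "j < m * n"
  then have n: "0 < n" by (cases n) auto
  have "i = j \<longleftrightarrow> i div n = j div n \<and> i mod n = j mod n" by (metis div_mult_mod_eq)
  then show ?thesis using ij n by (auto simp: dg_def bdiag_index)
qed

lemma dg_transpose: "(dg m n \<epsilon>)\<^sup>T = dg m n \<epsilon>"
  by (rule eq_matI) (auto simp: dg_index)

lemma dg_mult: "dg m n \<epsilon> * dg m n \<epsilon>' = dg m n (\<lambda>b. \<epsilon> b * \<epsilon>' b)"
  by (rule bacts_eqI[OF bacts_mult[OF bacts_dg bacts_dg] bacts_dg]) (simp add: mult.assoc)

lemma dg_smult: "t \<cdot>\<^sub>m dg m n \<epsilon> = dg m n (\<lambda>b. t * \<epsilon> b)"
  by (rule eq_matI) (auto simp: dg_index)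

lemma dg_cong: "(\<And>b. b < m \<Longrightarrow> \<epsilon> b = \<epsilon>' b) \<Longrightarrow> dg m n \<epsilon> = dg m n \<epsilon>'"
  by (rule bacts_eqI[OF bacts_dg bacts_dg]) simp

lemma dg_one: "(\<And>b. b < m \<Longrightarrow> \<epsilon> b = 1) \<Longrightarrow> dg m n \<epsilon> = 1\<^sub>m (m * n)"
  by (rule bacts_eqI[OF bacts_dg bacts_one]) simp

lemma dg_Ecol: "b < m \<Longrightarrow> \<epsilon> b = 1 \<Longrightarrow> dg m n \<epsilon> * Ecol m n b = Ecol m n b"
  by (rule bacts_Ecol[OF bacts_dg]) (auto simp: single_def)

lemma sg_dg: "sg m n q = dg m n (\<lambda>b. (- 1) ^ q b)"
  by (rule bacts_eqI[OF bacts_sg bacts_dg]) simp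

lemma pencil_four_block:
  assumes "X \<in> carrier_mat k k" "Y \<in> carrier_mat k k" "C \<in> carrier_mat k r" "D \<in> carrier_mat r k"
    "A \<in> carrier_mat r r" "E \<in> carrier_mat r r"
  shows "lam \<cdot>\<^sub>m const_mat (dsum Y (- E)) - const_mat (four_block_mat X (- C) (- D) (- A))
    = four_block_mat (lam \<cdot>\<^sub>m const_mat Y - const_mat X) (const_mat C) (const_mat D) (const_mat A - lam \<cdot>\<^sub>m const_mat E)"
  by (rule eq_matI) (use assms in \<open>auto simp: dsum_def const_mat_def\<close>)

lemma four_block_eq_iff:
  assumes "A \<in> carrier_mat k k" "B \<in> carrier_mat k l" "C \<in> carrier_mat l k" "D \<in> carrier_mat l l"
    "A' \<in> carrier_mat k k" "B' \<in> carrier_mat k l" "C' \<in> carrier_mat l k" "D' \<in> carrier_mat l l"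
  shows "four_block_mat A B C D = four_block_mat A' B' C' D' \<longleftrightarrow> A = A' \<and> B = B' \<and> C = C' \<and> D = D'"
proof
  assume eq: "four_block_mat A B C D = four_block_mat A' B' C' D'"
  have ent: "four_block_mat A B C D $$ (i, j) = four_block_mat A' B' C' D' $$ (i, j)" for i j
    by (simp only: eq)
  have "A $$ (i, j) = A' $$ (i, j)" if "i < k" "j < k" for i j
    using ent[of i j] that assms by simp
  moreover have "B $$ (i, j) = B' $$ (i, j)" if "i < k" "j < l" for i j
    using ent[of i "k + j"] that assms by simp
  moreover have "C $$ (i, j) = C' $$ (i, j)" if "i < l" "j < k" for i j
    using ent[of "k + i" j] that assms by simp
  moreover have "D $$ (i, j) = D' $$ (i, j)" if "i < l" "j < l" for i j
    using ent[of "k + i" "k + j"] that assms by simp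
  ultimately show "A = A' \<and> B = B' \<and> C = C' \<and> D = D'"
    using assms by (auto intro!: eq_matI)
qed auto

section \<open>The linearization of a realization\<close>

text \<open>A minimal T-even realization together with parameters that describe the tuples.\<close>

locale realized = gfpr m e p s for m e p s +
  fixes n r :: nat and Gr :: "complex poly fract mat" and P :: "complex poly mat" and Em Am Bm :: "complex mat"
  assumes lead: "coeff_mat P m \<noteq> 0\<^sub>m n n" and above: "\<And>i. i > m \<Longrightarrow> coeff_mat P i = 0\<^sub>m n n"
    and minimal: "is_minimal_T_even_realization n r Gr P Em Am Bm"
begin

sublocale gfpr_mats m e p s n "coeff_mat P" by unfold_locales

lemma min_real: "is_minimal_realization n r Gr P Bm\<^sup>T Em Am Bm"
  and P_even: "T_even_poly P" and state_even: "T_even_poly (lam \<cdot>\<^sub>m const_mat Em - const_mat Am)"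
  using minimal by (auto simp: is_minimal_T_even_realization_def)

lemma car [simp]: "P \<in> carrier_mat n n" "Em \<in> carrier_mat r r" "Am \<in> carrier_mat r r" "Bm \<in> carrier_mat r n"
  and det_Em: "det Em \<noteq> 0" and Gr: "Gr = transfer_function P Bm\<^sup>T Em Am Bm"
  using min_real by (auto simp: is_minimal_realization_def is_realization_def)

lemma coeff_car [simp]: "coeff_mat P i \<in> carrier_mat n n"
  using car(1) by (auto simp: coeff_mat_def)

lemma Am_sym: "Am\<^sup>T = Am" and Em_skew: "Em\<^sup>T = - Em"
  using state_even T_even_pencil[OF car(2,3)] by auto

definition sn :: "nat \<Rightarrow> complex" where "sn b = (- 1) ^ qd b"

text \<open>The quasi-identity of the theorem, normalized so that the sign of block \<open>je\<close> is 1.  The factor \<open>s\<close> of the statement is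
  then 1.\<close>

definition Qs :: "complex mat" where "Qs = dg m n (\<lambda>b. sn (je - 1) * sn b)"

lemma sn: "sn b \<in> {1, -1}" "sn b * sn b = 1"
  by (auto simp: sn_def minus_one_power_iff)

lemma X_carrier [simp]: "X0 \<in> carrier_mat N N" "X1 \<in> carrier_mat N N"
  by (simp_all add: X_WY)

lemma Qs_carrier [simp]: "Qs \<in> carrier_mat N N" "dim_row Qs = N" "dim_col Qs = N" by (simp_all add: Qs_def)

lemma sandwich:
  assumes "X \<in> carrier_mat N N"
  shows "sg m n qd * X * sg m n qd = Qs * X * Qs"
proof -
  have "Qs = sn (je - 1) \<cdot>\<^sub>m sg m n qd" by (simp add: Qs_def sg_dg dg_smult sn_def)
  then have "Qs * X * Qs = sn (je - 1) \<cdot>\<^sub>m (sn (je - 1) \<cdot>\<^sub>m (sg m n qd * X * sg m n qd))"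
    using assms by (simp add: mult_smult_distrib[of _ N N _ N] mult_smult_assoc_mat[of _ N N _ N])
  also have "\<dots> = (sn (je - 1) * sn (je - 1)) \<cdot>\<^sub>m (sg m n qd * X * sg m n qd)"
    by (rule eq_matI) (simp_all add: mult.assoc)
  finally show ?thesis by (simp only: sn(2) one_smult_mat)
qed

lemma Qs_Qs: "Qs * Qs = 1\<^sub>m N"
  unfolding Qs_def dg_mult
  by (rule dg_one) (use sn(2) in \<open>simp add: mult.assoc mult.left_commute\<close>)

lemma Qs_col: "Qs * Ecol m n (je - 1) = Ecol m n (je - 1)"
  unfolding Qs_def by (rule dg_Ecol) (use je sn(2) in auto)

lemma X_transpose: "X0\<^sup>T = Qs * X0 * Qs" "X1\<^sup>T = - (Qs * X1 * Qs)"
  using transposes[OF coeff_car T_even_coeff[OF car(1) P_even]] by (simp_all add: sandwich)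

text \<open>The T-evenness of \<open>Q\<close> times the pencil, in terms of its two coefficients.\<close>

definition even_sign :: "complex mat \<Rightarrow> bool" where
  "even_sign Q \<longleftrightarrow> (Q * X0)\<^sup>T = Q * X0 \<and> (Q * X1)\<^sup>T = - (Q * X1)"

lemma even_sign_Qs: "even_sign Qs"
proof -
  have QT: "Qs\<^sup>T = Qs" by (simp add: Qs_def dg_transpose)
  have "(Qs * X0)\<^sup>T = Qs * X0 * (Qs * Qs)"
    by (simp add: transpose_mult[of _ N N _ N] X_transpose QT assoc_mult_mat[of _ N N _ N _ N])
  moreover have "(Qs * X1)\<^sup>T = - (Qs * X1 * (Qs * Qs))"
    by (simp add: transpose_mult[of _ N N _ N] X_transpose QT assoc_mult_mat[of _ N N _ N _ N] uminus_mult_left_mat)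
  ultimately show ?thesis unfolding Qs_Qs even_sign_def by (simp add: right_mult_one_mat[of _ N N])
qed

lemma even_sign_unique:
  assumes sgn: "\<And>b. b < m \<Longrightarrow> \<epsilon> b \<in> {1, -1}" and ev: "even_sign (dg m n \<epsilon>)"
  shows "(\<forall>b<m. \<epsilon> b = sn (je - 1) * sn b) \<or> (\<forall>b<m. \<epsilon> b = - (sn (je - 1) * sn b))"
proof -
  let ?D = "dg m n \<epsilon>"
  have DD: "?D * ?D = 1\<^sub>m N" unfolding dg_mult by (rule dg_one) (use sgn in force)
  have DX: "?D * X * ?D = X\<^sup>T" if X: "X \<in> carrier_mat N N" and t: "(?D * X)\<^sup>T = ?D * X" for X
  proof -
    have "?D * X = X\<^sup>T * ?D" using t X by (simp add: transpose_mult[of _ N N _ N] dg_transpose)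
    then have "?D * X * ?D = X\<^sup>T * (?D * ?D)" using X by (simp add: assoc_mult_mat[of _ N N _ N _ N])
    then show ?thesis using X by (simp add: DD right_mult_one_mat[of _ N N])
  qed
  have "?D * X0 * ?D = Qs * X0 * Qs"
    using DX[of X0] ev by (simp add: even_sign_def X_transpose)
  moreover have "?D * X1 * ?D = Qs * X1 * Qs"
  proof -
    have "?D * X1 = - ((?D * X1)\<^sup>T)" using ev by (simp add: even_sign_def)
    also have "\<dots> = - (X1\<^sup>T * ?D)" by (simp add: transpose_mult[of _ N N _ N] dg_transpose)
    also have "\<dots> = Qs * X1 * Qs * ?D" by (simp add: X_transpose uminus_mult_left_mat)
    finally have "?D * X1 * ?D = Qs * X1 * Qs * (?D * ?D)" by (simp add: assoc_mult_mat[of _ N N _ N _ N])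
    then show ?thesis by (simp add: DD right_mult_one_mat[of _ N N])
  qed
  moreover have "sn (je - 1) * sn b \<in> {1, -1}" for b using sn(1)[of b] sn(1)[of "je - 1"] by auto
  ultimately show ?thesis
    using sign_unique[where c = "coeff_mat P" and \<epsilon> = "\<lambda>b. sn (je - 1) * sn b" and \<epsilon>' = \<epsilon>, OF gfpr_axioms coeff_car lead] sgn unfolding Qs_def by metis
qed

definition Lp where "Lp = lam \<cdot>\<^sub>m const_mat X1 - const_mat X0"

definition Cb where "Cb = Ecol m n (je - 1) * Bm\<^sup>T"

definition Db where "Db = Bm * (Ecol m n (je - 1))\<^sup>T"

lemma CD_carrier [simp]: "Cb \<in> carrier_mat N r" "Db \<in> carrier_mat r N"
  by (auto simp: Cb_def Db_def intro!: mult_carrier_mat[of _ _ n])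

lemma CD_transpose: "Cb\<^sup>T = Db" "Db\<^sup>T = Cb"
proof -
  show C: "Cb\<^sup>T = Db"
    unfolding Cb_def Db_def by (subst transpose_mult[of _ N n _ r]) auto
  then show "Db\<^sup>T = Cb" by (metis transpose_transpose)
qed

lemma T_even_L: "Q \<in> carrier_mat N N \<Longrightarrow> T_even_poly (const_mat Q * Lp) \<longleftrightarrow> even_sign Q"
proof -
  assume Q: "Q \<in> carrier_mat N N"
  have L: "const_mat Q * Lp = lam \<cdot>\<^sub>m const_mat (Q * X1) - const_mat (Q * X0)"
    unfolding Lp_def by (rule pencil_mult_left[of _ N]) (use Q in simp_all)
  show ?thesis unfolding L even_sign_def by (rule T_even_pencil[of _ N]) (use Q in simp_all)
qed

definition LLp where "LLp = lam \<cdot>\<^sub>m const_mat (dsum X1 (- Em)) - const_mat (four_block_mat X0 (- Cb) (- Db) (- Am))"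

lemma sign_LLp:
  assumes Q: "Q \<in> carrier_mat N N"
  shows "const_mat (dsum Q (1\<^sub>m r)) * LLp
    = lam \<cdot>\<^sub>m const_mat (dsum (Q * X1) (- Em)) - const_mat (four_block_mat (Q * X0) (- (Q * Cb)) (- Db) (- Am))"
proof -
  have "dsum Q (1\<^sub>m r) * dsum X1 (- Em) = dsum (Q * X1) (- Em)"
    using Q by (subst dsum_mult[of _ N _ r]) (simp_all add: left_mult_one_mat[of _ r r] left_mult_one_mat[of _ r N])
  moreover have "dsum Q (1\<^sub>m r) * four_block_mat X0 (- Cb) (- Db) (- Am) = four_block_mat (Q * X0) (- (Q * Cb)) (- Db) (- Am)"
  proof -
    have "Q * (- Cb) = - (Q * Cb)" using Q carrier_matD[OF CD_carrier(1)] by (intro uminus_mult_right_mat) auto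
    then show ?thesis
      using Q by (subst dsum_four_block(1)[of _ N _ r]) (simp_all add: left_mult_one_mat[of _ r r] left_mult_one_mat[of _ r N])
  qed
  ultimately show ?thesis unfolding LLp_def
    using Q by (subst pencil_mult_left[of _ "N + r"]) auto
qed

text \<open>The blocks of the state equation are symmetric as they stand, so only the border gives a condition in addition to that
  on the pencil: \<open>Q\<close> has to fix the column border.\<close>

lemma T_even_LL:
  assumes Q: "Q \<in> carrier_mat N N"
  shows "T_even_poly (const_mat (dsum Q (1\<^sub>m r)) * LLp) \<longleftrightarrow> even_sign Q \<and> Q * Cb = Cb"
proof -
  have QC: "Q * Cb \<in> carrier_mat N r" using Q by (rule mult_carrier_mat) simp
  have QX: "Q * X0 \<in> carrier_mat N N" "Q * X1 \<in> carrier_mat N N" using Q by auto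
  have 1: "(four_block_mat (Q * X0) (- (Q * Cb)) (- Db) (- Am))\<^sup>T
      = four_block_mat ((Q * X0)\<^sup>T) (- Cb) (- ((Q * Cb)\<^sup>T)) (- Am)"
    using QC QX by (subst transpose_four_block_mat[of _ N N _ r _ r]) (auto simp: transpose_uminus CD_transpose Am_sym)
  have 2: "(dsum (Q * X1) (- Em))\<^sup>T = four_block_mat ((Q * X1)\<^sup>T) (0\<^sub>m N r) (0\<^sub>m r N) Em"
    unfolding dsum_def using QX carrier_matD[OF Q] carrier_matD[OF X_carrier(2)] carrier_matD[OF car(2)]
    by (subst transpose_four_block_mat[of _ N N _ r _ r]) (auto simp: transpose_uminus Em_skew)
  have 3: "- dsum (Q * X1) (- Em) = four_block_mat (- (Q * X1)) (0\<^sub>m N r) (0\<^sub>m r N) Em"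
    using carrier_matD[OF Q] carrier_matD[OF X_carrier(2)] carrier_matD[OF car(2)]
    by (intro eq_matI) (auto simp: dsum_def)
  have "- Cb = - (Q * Cb) \<longleftrightarrow> Q * Cb = Cb" by (metis uminus_uminus_mat)
  moreover have "- ((Q * Cb)\<^sup>T) = - Db \<longleftrightarrow> Q * Cb = Cb"
    using CD_transpose by (metis uminus_uminus_mat transpose_transpose)
  ultimately show ?thesis
    unfolding sign_LLp[OF Q] even_sign_def using Q QC QX
    by (subst T_even_pencil[of _ "N + r"], simp, simp)
      (simp add: 1 2 3 four_block_eq_iff[of _ N _ r], blast)
qed

lemma Qs_Cb: "Qs * Cb = Cb"
proof -
  have "Qs * Cb = (Qs * Ecol m n (je - 1)) * Bm\<^sup>T"
    unfolding Cb_def by (rule assoc_mult_mat[symmetric, of _ N N _ n _ r]) auto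
  then show ?thesis unfolding Qs_col Cb_def .
qed

end

section \<open>The end form of the elimination\<close>

text \<open>The diagonal end form of the elimination: \<open>X\<close> in the last block, \<open>t\<close> in the others.\<close>

definition corner :: "nat \<Rightarrow> nat \<Rightarrow> 'a :: comm_ring_1 \<Rightarrow> 'a mat \<Rightarrow> 'a mat" where
  "corner m n t X = bdiag m n (\<lambda>b. if b = m - 1 then X else t \<cdot>\<^sub>m 1\<^sub>m n)"

lemma corner_carrier [simp]: "corner m n t X \<in> carrier_mat (m * n) (m * n)"
  by (simp add: corner_def)

lemma bacts_corner: "bacts m n (corner m n t X) (\<lambda>x b. if b = m - 1 then mv n X (x b) else (\<lambda>a. t * x b a))"
  unfolding corner_def by (rule bacts_cong[OF bacts_bdiag]) (simp add: mv_scalar)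

lemma mv_plus:
  assumes "A \<in> carrier_mat n n" "B \<in> carrier_mat n n" "a < n"
  shows "mv n (A + B) z a = mv n A z a + mv n B (z :: nat \<Rightarrow> 'a :: comm_ring_1) a"
  using mv_smult_add[OF assms, of 1 z] by simp

lemma mv_uminus_mat:
  assumes "A \<in> carrier_mat n n" "a < n"
  shows "mv n (- A) z a = - mv n A (z :: nat \<Rightarrow> 'a :: comm_ring_1) a"
  using assms unfolding mv_def by (auto simp: sum_negf[symmetric] intro!: sum.cong)

lemma pivot_end:
  assumes H: "H \<in> carrier_mat n n" and c: "c 0 \<in> carrier_mat n n" and m: "0 < m"
  shows "pivot m n t (m - 1) H - gfied m n c 0 = corner m n (- 1) (H + c 0)"
proof (rule bacts_eqI[OF bacts_minus[OF bacts_pivot bacts_gfied] bacts_corner])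
  show "idx m 0" using m by (simp add: idx_def)
  fix x b a assume "b < m" and a: "a < n"
  then consider "b < m - 1" | "b = m - 1" by linarith
  then show "(if b < m - 1 then \<lambda>a. 0 else if b = m - 1 then mv n H (x b) else (\<lambda>a. t * x b a)) a - fapp m n c 0 x b a
    = (if b = m - 1 then mv n (H + c 0) (x b) else (\<lambda>a. - 1 * x b a)) a"
    by cases (simp_all add: fapp_def mv_plus[OF H c a])
qed

lemma corner_smult:
  assumes "X \<in> carrier_mat n n"
  shows "- corner m n (- 1) X = corner m n 1 (- X)"
  by (rule eq_matI) (use assms in \<open>auto simp: corner_def bdiag_def elim!: block_cases simp: block_index\<close>)

lemma corner_signs:
  assumes "X \<in> carrier_mat n n"
  shows "dg m n (\<lambda>b. if b = m - 1 then 1 else - 1) * corner m n (- 1) X = corner m n 1 X"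
  by (rule bacts_eqI[OF bacts_mult[OF bacts_dg bacts_corner] bacts_corner]) auto

lemma corner_dsum:
  fixes X :: "'a :: comm_ring_1 mat"
  assumes X: "X \<in> carrier_mat n n" and m: "0 < m"
  shows "corner m n 1 X = dsum (1\<^sub>m ((m - 1) * n)) X"
proof (rule eq_matI)
  obtain k where k: "m = Suc k" using m by (cases m) auto
  have mk: "m - 1 = k" using k by simp
  fix i j assume "i < dim_row (dsum (1\<^sub>m ((m - 1) * n)) X)" "j < dim_col (dsum (1\<^sub>m ((m - 1) * n)) X)"
  then have ij: "i < m * n" "j < m * n" using X by (auto simp: dsum_def k)
  then obtain b a b' a' where *: "b < m" "a < n" "b' < m" "a' < n"
    and rs: "i = b * n + a" "j = b' * n + a'"
    by (auto elim!: block_cases)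
  have lt: "i < k * n \<longleftrightarrow> b < k" "j < k * n \<longleftrightarrow> b' < k"
    unfolding rs using * block_less by blast+
  have top: "i - k * n = a" if "\<not> i < k * n"
  proof -
    have "b = k" using that lt * k by auto
    then show ?thesis by (simp add: rs)
  qed
  have top': "j - k * n = a'" if "\<not> j < k * n"
  proof -
    have "b' = k" using that lt * k by auto
    then show ?thesis by (simp add: rs)
  qed
  have eq: "i = j \<longleftrightarrow> b = b' \<and> a = a'" unfolding rs using * block_eq by blast
  have "dsum (1\<^sub>m (k * n)) X $$ (i, j) = (if i < k * n then if j < k * n then (if i = j then 1 else 0) else 0
      else if j < k * n then 0 else X $$ (i - k * n, j - k * n))"
    using ij X k by (auto simp: dsum_def)
  also have "\<dots> = (if b = b' then (if b = k then X else 1 \<cdot>\<^sub>m 1\<^sub>m n) $$ (a, a') else 0)"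
    using top top' lt eq * k by auto
  also have "\<dots> = corner m n 1 X $$ (i, j)"
    using ij * unfolding corner_def mk by (simp add: bdiag_index rs block_index)
  finally show "corner m n 1 X $$ (i, j) = dsum (1\<^sub>m ((m - 1) * n)) X $$ (i, j)" unfolding mk by simp
qed (use X m in \<open>cases m; auto simp: corner_def bdiag_def dsum_def\<close>)+

lemma horner_carrier: "\<Lambda> \<in> carrier_mat n n \<Longrightarrow> (\<And>j. c j \<in> carrier_mat n n) \<Longrightarrow> horner c t i \<Lambda> \<in> carrier_mat n n"
  by (induction i arbitrary: \<Lambda>) auto

lemma horner_index:
  assumes "\<Lambda> \<in> carrier_mat n n" "\<And>j. c j \<in> carrier_mat n n" "a < n" "b < n"
  shows "horner c t i \<Lambda> $$ (a, b) = t ^ i * \<Lambda> $$ (a, b) + (\<Sum>j<i. t ^ Suc j * c (Suc j) $$ (a, b))"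
  using assms
proof (induction i arbitrary: \<Lambda>)
  case (Suc i)
  have "t \<cdot>\<^sub>m (\<Lambda> + c (Suc i)) \<in> carrier_mat n n" using Suc.prems(1,2) by auto
  then have "horner c t (Suc i) \<Lambda> $$ (a, b) = t ^ i * (t \<cdot>\<^sub>m (\<Lambda> + c (Suc i))) $$ (a, b) + (\<Sum>j<i. t ^ Suc j * c (Suc j) $$ (a, b))"
    using Suc by simp
  moreover have "(t \<cdot>\<^sub>m (\<Lambda> + c (Suc i))) $$ (a, b) = t * (\<Lambda> $$ (a, b) + c (Suc i) $$ (a, b))"
    using Suc.prems(1,3,4) carrier_matD[OF Suc.prems(2)[of "Suc i"]] by simp
  ultimately show ?case by (simp add: algebra_simps)
qed simp

lemma horner_total:
  assumes c: "\<And>j. c j \<in> carrier_mat n n" and m: "0 < m" and ab: "a < n" "b < n"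
  shows "(horner c t (m - 1) (t \<cdot>\<^sub>m c m) + c 0) $$ (a, b) = (\<Sum>j\<le>m. t ^ j * c j $$ (a, b))"
proof -
  obtain k where k: "m = Suc k" using m by (cases m) auto
  have dims: "dim_row (c j) = n" "dim_col (c j) = n" for j using carrier_matD[OF c] by auto
  have car: "t \<cdot>\<^sub>m c m \<in> carrier_mat n n" using c by auto
  have "(horner c t (m - 1) (t \<cdot>\<^sub>m c m) + c 0) $$ (a, b) = horner c t k (t \<cdot>\<^sub>m c m) $$ (a, b) + c 0 $$ (a, b)"
    using ab by (simp add: k dims)
  also have "\<dots> = t ^ k * (t * c m $$ (a, b)) + (\<Sum>j<k. t ^ Suc j * c (Suc j) $$ (a, b)) + c 0 $$ (a, b)"
    using ab by (simp add: horner_index[OF car c] dims)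
  also have "\<dots> = (\<Sum>j<Suc k. t ^ Suc j * c (Suc j) $$ (a, b)) + c 0 $$ (a, b)"
    by (simp add: k algebra_simps)
  also have "\<dots> = (\<Sum>j<Suc (Suc k). t ^ j * c j $$ (a, b))"
    by (subst (2) sum.lessThan_Suc_shift) simp
  finally show ?thesis by (simp add: k lessThan_Suc_atMost)
qed

lemma inv_over_unimodular:
  assumes "inv_over UNIV k (U :: complex poly mat)"
  shows "unimodular k U"
proof -
  obtain U' where U: "U \<in> carrier_mat k k" "U' \<in> carrier_mat k k" "U * U' = 1\<^sub>m k"
    using assms by (auto simp: inv_over_def)
  have "det U * det U' = 1" using det_mult[OF U(1,2)] U(3) by simp
  then have "det U dvd 1" by (metis dvd_triv_left)
  then obtain c where "det U = [:c:]" "c dvd 1" unfolding is_unit_poly_iff by blast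
  then show ?thesis using U by (auto simp: unimodular_def)
qed

lemma subring_UNIV: "subring_set UNIV"
  by (simp add: subring_set_def)

lemma over_UNIV [simp]: "over UNIV A"
  by (simp add: over_def)

lemma (in comm_ring_hom) inv_over_map:
  assumes A: "inv_over UNIV k A" and R: "\<And>a. hom a \<in> R"
  shows "inv_over R k (map_mat hom A)"
proof -
  obtain A' where "A \<in> carrier_mat k k" "A' \<in> carrier_mat k k" "A * A' = 1\<^sub>m k" "A' * A = 1\<^sub>m k"
    using A by (auto simp: inv_over_def)
  then show ?thesis
    by (intro inv_overI[of _ _ "map_mat hom A'"]) (auto simp: over_def R mat_hom_mult[symmetric] mat_hom_one)
qed

lemma inv_over_det:
  fixes A :: "'a :: field mat"
  assumes "A \<in> carrier_mat k k" "det A \<noteq> 0"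
  shows "inv_over UNIV k A"
  using field_inverse_exists[OF assms] assms by (metis inv_overI over_UNIV)

lemma det_dsum: "A \<in> carrier_mat k k \<Longrightarrow> B \<in> carrier_mat l l \<Longrightarrow> det (dsum A B) = det A * det (B :: 'a :: field mat)"
  unfolding dsum_def by (subst det_four_block_mat_lower_left_zero[of _ k _ l]) auto

lemma (in comm_ring_hom) map_Ecol: "map_mat hom (Ecol m n b) = Ecol m n b"
  by (rule eq_matI) (auto simp: Ecol_def)

context realized
begin

lemma Db_index:
  assumes "i < r" "a < n"
  shows "Db $$ (i, (je - 1) * n + a) = Bm $$ (i, a)"
proof -
  have lt: "(je - 1) * n + a < N" using je assms block_index(1)[of "je - 1" m a n] by (simp add: mult.commute)
  have "Db $$ (i, (je - 1) * n + a) = (\<Sum>x<n. Bm $$ (i, x) * (if (je - 1) * n + a = (je - 1) * n + x then 1 else 0))"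
    using assms lt by (simp add: Db_def scalar_prod_def atLeast0LessThan Ecol_def carrier_matD[OF car(4)])
  also have "\<dots> = Bm $$ (i, a)" by (subst sum_one[of a]) (use assms in auto)
  finally show ?thesis .
qed

lemma je_block: "a < n \<Longrightarrow> (je - 1) * n + a < N"
  using je block_index(1)[of "je - 1" m a n] by (simp add: mult.commute)

lemma Cb_index: "i < r \<Longrightarrow> a < n \<Longrightarrow> Cb $$ ((je - 1) * n + a, i) = Bm $$ (i, a)"
  using Db_index[of i a] je_block[of a] carrier_matD[OF CD_carrier(1)]
  by (simp add: CD_transpose(1)[symmetric])

text \<open>The border contains a copy of \<open>B\<close>, so a left null vector is one of the realization.\<close>

lemma rank_row: "vec_space.rank r (append_cols Db (Am - t \<cdot>\<^sub>m Em)) = r"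
proof (rule full_row_rank)
  have D: "Db \<in> carrier_mat r N" and K: "Am - t \<cdot>\<^sub>m Em \<in> carrier_mat r r" by (simp, intro minus_carrier_mat smult_carrier_mat car)
  note dims = carrier_matD[OF D] carrier_matD[OF K]
  show "append_cols Db (Am - t \<cdot>\<^sub>m Em) \<in> carrier_mat r (N + r)"
    using dims by (auto simp: append_cols_def)
  fix v assume v: "v \<in> carrier_vec r" and orth: "\<And>j. j < N + r \<Longrightarrow> v \<bullet> col (append_cols Db (Am - t \<cdot>\<^sub>m Em)) j = 0"
  have colD: "col (append_cols Db (Am - t \<cdot>\<^sub>m Em)) j = col Db j" if "j < N" for j
    using that dims by (intro eq_vecI) (auto simp: append_cols_def)
  have colK: "col (append_cols Db (Am - t \<cdot>\<^sub>m Em)) (N + j) = col (Am - t \<cdot>\<^sub>m Em) j" if "j < r" for j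
    using that dims by (intro eq_vecI) (auto simp: append_cols_def)
  show "v = 0\<^sub>v r"
  proof (rule minimal_left_kernel[OF min_real v])
    fix j assume j: "j < n"
    have "col Db ((je - 1) * n + j) = col Bm j"
      using j je_block[OF j] dims by (intro eq_vecI) (auto simp: Db_index[simplified] carrier_matD[OF car(4)])
    then show "v \<bullet> col Bm j = 0" using orth[of "(je - 1) * n + j"] colD je_block[OF j] by simp
  next
    fix j assume "j < r"
    then show "v \<bullet> col (Am - t \<cdot>\<^sub>m Em) j = 0" using orth[of "N + j"] colK by simp
  qed
qed

text \<open>By symmetry of \<open>A\<close> and skew-symmetry of \<open>E\<close>, a right null vector at \<open>t\<close> is a left null vector at \<open>- t\<close>.\<close>

lemma rank_col: "vec_space.rank (N + r) (Cb @\<^sub>r (Am - t \<cdot>\<^sub>m Em)) = r"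
proof (rule full_column_rank)
  have C: "Cb \<in> carrier_mat N r" and K: "Am - t \<cdot>\<^sub>m Em \<in> carrier_mat r r" by (simp, intro minus_carrier_mat smult_carrier_mat car)
  show "Cb @\<^sub>r (Am - t \<cdot>\<^sub>m Em) \<in> carrier_mat (N + r) r" using C K by (rule carrier_append_rows)
  fix v :: "complex vec" assume v: "v \<in> carrier_vec r" and zero: "(Cb @\<^sub>r (Am - t \<cdot>\<^sub>m Em)) *\<^sub>v v = 0\<^sub>v (N + r)"
  have split: "(Cb *\<^sub>v v) @\<^sub>v ((Am - t \<cdot>\<^sub>m Em) *\<^sub>v v) = 0\<^sub>v N @\<^sub>v 0\<^sub>v r"
    using zero mat_mult_append[OF C K v] by (auto intro!: eq_vecI)
  have Cv: "Cb *\<^sub>v v = 0\<^sub>v N" and Kv: "(Am - t \<cdot>\<^sub>m Em) *\<^sub>v v = 0\<^sub>v r"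
    using split append_vec_eq[of "Cb *\<^sub>v v" N "0\<^sub>v N"] mult_mat_vec_carrier[OF C v] by auto
  have sym: "Am $$ (i, j) = Am $$ (j, i)" "Em $$ (i, j) = - Em $$ (j, i)" if "i < r" "j < r" for i j
  proof -
    have "Am\<^sup>T $$ (j, i) = Am $$ (j, i)" "Em\<^sup>T $$ (j, i) = (- Em) $$ (j, i)" by (simp_all only: Am_sym Em_skew)
    then show "Am $$ (i, j) = Am $$ (j, i)" "Em $$ (i, j) = - Em $$ (j, i)"
      using that carrier_matD[OF car(2)] carrier_matD[OF car(3)] by auto
  qed
  show "v = 0\<^sub>v r"
  proof (rule minimal_left_kernel[OF min_real v])
    fix j assume j: "j < n"
    have "v \<bullet> col Bm j = (\<Sum>i<r. v $ i * Bm $$ (i, j))"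
      using j by (simp add: scalar_prod_def atLeast0LessThan carrier_matD[OF car(4)])
    also have "\<dots> = (\<Sum>i<r. Cb $$ ((je - 1) * n + j, i) * v $ i)"
      using j by (intro sum.cong refl) (simp only: Cb_index lessThan_iff mult.commute[of "v $ _"])
    also have "\<dots> = (Cb *\<^sub>v v) $ ((je - 1) * n + j)"
      using je_block[OF j] carrier_vecD[OF v] by (simp add: scalar_prod_def atLeast0LessThan carrier_matD[OF CD_carrier(1)])
    finally have "v \<bullet> col Bm j = (Cb *\<^sub>v v) $ ((je - 1) * n + j)" .
    then show "v \<bullet> col Bm j = 0" using Cv je_block[OF j] by simp
  next
    fix j assume j: "j < r"
    have "v \<bullet> col (Am - (- t) \<cdot>\<^sub>m Em) j = (\<Sum>i<r. v $ i * (Am $$ (i, j) + t * Em $$ (i, j)))"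
      using j by (simp add: scalar_prod_def atLeast0LessThan carrier_matD[OF car(2)] carrier_matD[OF car(3)])
    also have "\<dots> = (\<Sum>i<r. (Am $$ (j, i) - t * Em $$ (j, i)) * v $ i)"
    proof (intro sum.cong refl)
      fix i assume "i \<in> {..<r}"
      then show "v $ i * (Am $$ (i, j) + t * Em $$ (i, j)) = (Am $$ (j, i) - t * Em $$ (j, i)) * v $ i"
        unfolding sym(1)[OF \<open>i \<in> _\<close>[unfolded lessThan_iff] j] sym(2)[OF \<open>i \<in> _\<close>[unfolded lessThan_iff] j] by (simp add: mult.commute)
    qed
    also have "\<dots> = ((Am - t \<cdot>\<^sub>m Em) *\<^sub>v v) $ j"
      using j carrier_vecD[OF v] by (simp add: scalar_prod_def atLeast0LessThan carrier_matD[OF car(2)] carrier_matD[OF car(3)])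
    finally have "v \<bullet> col (Am - (- t) \<cdot>\<^sub>m Em) j = ((Am - t \<cdot>\<^sub>m Em) *\<^sub>v v) $ j" .
    then show "v \<bullet> col (Am - (- t) \<cdot>\<^sub>m Em) j = 0" using Kv j by simp
  qed
qed

end

section \<open>Unimodular equivalence\<close>

lemma (in comm_ring_hom) map_gprod_gfied:
  assumes "\<And>j. c j \<in> carrier_mat n n" "\<And>i. i \<in> set t \<Longrightarrow> idx m i"
  shows "map_mat hom (gprod (m * n) (gfied m n c) t) = gprod (m * n) (gfied m n (\<lambda>j. map_mat hom (c j))) t"
proof -
  have "map_mat hom (gprod (m * n) (gfied m n c) t) = gprod (m * n) (\<lambda>i. map_mat hom (gfied m n c i)) t"
    by (rule map_gprod) simp
  also have "\<dots> = gprod (m * n) (gfied m n (\<lambda>j. map_mat hom (c j))) t"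
    by (rule gprod_cong) (use assms in \<open>auto intro!: map_gfied\<close>)
  finally show ?thesis .
qed

lemma (in comm_ring_hom) map_Erow: "map_mat hom ((Ecol m n b)\<^sup>T) = (Ecol m n b)\<^sup>T"
  by (rule eq_matI) (auto simp: Ecol_def)

lemma Ecol_mult_index:
  assumes C: "C \<in> carrier_mat n l" and ij: "i < m * n" "j < l"
  shows "(Ecol m n b * C) $$ (i, j) = (if i div n = b then C $$ (i mod n, j) else (0 :: 'a :: comm_ring_1))"
proof -
  obtain d y where i: "d < m" "y < n" "i = d * n + y" using ij(1) by (elim block_cases)
  have "(Ecol m n b * C) $$ (i, j) = (\<Sum>x<n. (if d = b \<and> y = x then 1 else 0) * C $$ (x, j))"
    using i C ij by (simp add: scalar_prod_def atLeast0LessThan Ecol_def block_eq)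
  also have "\<dots> = (if d = b then C $$ (y, j) else 0)"
    using sum_delta_inner[OF i(2), of "\<lambda>x. C $$ (x, j)"] by auto
  finally show ?thesis using i by (simp add: block_index)
qed

lemma border_chain:
  fixes S :: "'a :: comm_ring_1 mat"
  assumes sq: "S \<in> carrier_mat N N" "U \<in> carrier_mat N N" "V \<in> carrier_mat N N" "W \<in> carrier_mat N N"
  shows "x \<in> carrier_mat N n \<Longrightarrow> b \<in> carrier_mat n r \<Longrightarrow> (S * U * V) * ((W * x) * b) = S * (U * ((V * W) * x)) * b"
    "d \<in> carrier_mat r n \<Longrightarrow> y \<in> carrier_mat n N \<Longrightarrow> (d * (y * S)) * (U * V) = d * ((y * (S * U)) * V)"
proof -
  assume x: "x \<in> carrier_mat N n" and b: "b \<in> carrier_mat n r"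
  have X: "A * z \<in> carrier_mat N n" if "A \<in> carrier_mat N N" "z \<in> carrier_mat N n" for A z :: "'a mat"
    using that by (rule mult_carrier_mat)
  have Wxb: "(W * x) * b \<in> carrier_mat N r" using X[OF sq(4) x] b by (rule mult_carrier_mat)
  have "S * (U * ((V * W) * x)) = (S * U * V) * (W * x)"
    using sq x X by (simp add: assoc_mult_mat[of _ N N _ N _ N] assoc_mult_mat[of _ N N _ N _ n])
  then show "(S * U * V) * ((W * x) * b) = S * (U * ((V * W) * x)) * b"
    using assoc_mult_mat[of "S * U * V" N N "W * x" n b r] sq X[OF sq(4) x] b by simp
next
  assume d: "d \<in> carrier_mat r n" and y: "y \<in> carrier_mat n N"
  have Y: "z * A \<in> carrier_mat n N" if "A \<in> carrier_mat N N" "z \<in> carrier_mat n N" for A z :: "'a mat"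
    using that by (auto intro: mult_carrier_mat)
  have "(d * (y * S)) * (U * V) = d * ((y * S) * (U * V))"
    using d Y[OF sq(1) y] sq by (intro assoc_mult_mat[of _ r n _ N _ N]) simp_all
  also have "(y * S) * (U * V) = (y * (S * U)) * V"
    using y Y sq by (simp add: assoc_mult_mat[of _ N N _ N _ N] assoc_mult_mat[of _ n N _ N _ N])
  finally show "(d * (y * S)) * (U * V) = d * ((y * (S * U)) * V)" .
qed

lemma last_block:
  fixes i m n :: nat
  assumes "i < m * n"
  shows "i div n = m - 1 \<longleftrightarrow> (m - 1) * n \<le> i" "i div n = m - 1 \<Longrightarrow> i mod n = i - (m - 1) * n"
proof -
  obtain d y where i: "d < m" "y < n" "i = d * n + y" using assms by (elim block_cases)
  have "i < (m - 1) * n \<longleftrightarrow> d < m - 1" unfolding i using block_less i by blast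
  then show "i div n = m - 1 \<longleftrightarrow> (m - 1) * n \<le> i" using i by (auto simp: block_index)
  show "i div n = m - 1 \<Longrightarrow> i mod n = i - (m - 1) * n" using i by (auto simp: block_index)
qed

lemma dsum_one_four_block:
  fixes P :: "'a :: comm_ring_1 mat"
  assumes P: "P \<in> carrier_mat n n" and C: "C \<in> carrier_mat n r" and D: "D \<in> carrier_mat r n" and H: "H \<in> carrier_mat r r"
    and m: "0 < m"
  shows "dsum (1\<^sub>m ((m - 1) * n)) (four_block_mat P C D H)
    = four_block_mat (dsum (1\<^sub>m ((m - 1) * n)) P) (Ecol m n (m - 1) * C) (D * (Ecol m n (m - 1))\<^sup>T) H"
proof (rule eq_matI)
  obtain k where k: "k = (m - 1) * n" "m * n = k + n" using m by (cases m) auto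
  note last = last_block[of _ m n, folded k(1), unfolded k(2)]
  have EC: "(Ecol m n (m - 1) * C) $$ (i, j) = (if k \<le> i then C $$ (i - k, j) else 0)" if "i < k + n" "j < r" for i j
    using Ecol_mult_index[OF C, of i m j "m - 1"] last[of i] that k by auto
  have DE: "(D * (Ecol m n (m - 1))\<^sup>T) $$ (i, j) = (if k \<le> j then D $$ (i, j - k) else 0)" if "i < r" "j < k + n" for i j
  proof -
    have "D * (Ecol m n (m - 1))\<^sup>T = (Ecol m n (m - 1) * D\<^sup>T)\<^sup>T"
      using D by (subst transpose_mult[of _ "m * n" n _ r]) auto
    also have "\<dots> $$ (i, j) = (Ecol m n (m - 1) * D\<^sup>T) $$ (j, i)" using that D k by simp
    also have "\<dots> = (if k \<le> j then D $$ (i, j - k) else 0)"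
      using Ecol_mult_index[of "D\<^sup>T" n r j m i "m - 1"] last[of j] that D k by auto
    finally show ?thesis .
  qed
  fix i j assume "i < dim_row (four_block_mat (dsum (1\<^sub>m ((m - 1) * n)) P) (Ecol m n (m - 1) * C) (D * (Ecol m n (m - 1))\<^sup>T) H)"
    "j < dim_col (four_block_mat (dsum (1\<^sub>m ((m - 1) * n)) P) (Ecol m n (m - 1) * C) (D * (Ecol m n (m - 1))\<^sup>T) H)"
  then have ij: "i < k + n + r" "j < k + n + r" using P H k by (auto simp: dsum_def)
  have shift: "\<not> x < k \<Longrightarrow> x - k < n \<longleftrightarrow> x < k + n" for x by linarith
  note dims = carrier_matD[OF P] carrier_matD[OF C] carrier_matD[OF D] carrier_matD[OF H]
  show "dsum (1\<^sub>m ((m - 1) * n)) (four_block_mat P C D H) $$ (i, j)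
    = four_block_mat (dsum (1\<^sub>m ((m - 1) * n)) P) (Ecol m n (m - 1) * C) (D * (Ecol m n (m - 1))\<^sup>T) H $$ (i, j)"
    unfolding k(1)[symmetric] using shift[of i] shift[of j] ij dims EC[of i "j - (k + n)"] DE[of "i - (k + n)" j]
    by (cases "i < k"; cases "j < k"; cases "i < k + n"; cases "j < k + n") (simp_all add: dsum_def diff_diff_left)
next
  have "m * n = (m - 1) * n + n" using m by (cases m) auto
  then show "dim_row (dsum (1\<^sub>m ((m - 1) * n)) (four_block_mat P C D H))
     = dim_row (four_block_mat (dsum (1\<^sub>m ((m - 1) * n)) P) (Ecol m n (m - 1) * C) (D * (Ecol m n (m - 1))\<^sup>T) H)"
    "dim_col (dsum (1\<^sub>m ((m - 1) * n)) (four_block_mat P C D H))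
     = dim_col (four_block_mat (dsum (1\<^sub>m ((m - 1) * n)) P) (Ecol m n (m - 1) * C) (D * (Ecol m n (m - 1))\<^sup>T) H)"
    using P H by (simp_all add: dsum_def)
qed

lemma matrix_from_coefficients:
  assumes P: "P \<in> carrier_mat n n" and above: "\<And>i. i > m \<Longrightarrow> coeff_mat P i = 0\<^sub>m n n" and ab: "a < n" "b < n"
  shows "P $$ (a, b) = (\<Sum>j\<le>m. lam ^ j * const_mat (coeff_mat P j) $$ (a, b))"
proof -
  have "coeff (P $$ (a, b)) i = 0" if "i > m" for i
  proof -
    have "coeff_mat P i $$ (a, b) = 0" using above[OF that] ab by simp
    then show ?thesis using ab P by (simp add: coeff_mat_def)
  qed
  then have "degree (P $$ (a, b)) \<le> m" by (intro degree_le) auto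
  then have "P $$ (a, b) = (\<Sum>i\<le>m. monom (coeff (P $$ (a, b)) i) i)"
    by (rule poly_as_sum_of_monoms'[symmetric])
  also have "\<dots> = (\<Sum>j\<le>m. lam ^ j * const_mat (coeff_mat P j) $$ (a, b))"
    using ab P by (intro sum.cong refl) (simp add: monom_altdef const_mat_def coeff_mat_def)
  finally show ?thesis .
qed

lemma pivot_start:
  assumes c: "c m \<in> carrier_mat n n" and m: "0 < m"
  shows "pivot m n t 0 (t \<cdot>\<^sub>m c m) = t \<cdot>\<^sub>m gfied m n c (- int m)"
proof (rule bacts_eqI[OF bacts_pivot bacts_smult[OF bacts_gfied]])
  show "idx m (- int m)" using m by (simp add: idx_def)
  fix x b a assume "b < m" "a < n"
  then show "(if b < 0 then \<lambda>a. 0 else if b = 0 then mv n (t \<cdot>\<^sub>m c m) (x b) else (\<lambda>a. t * x b a)) a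
      = t * fapp m n c (- int m) x b a"
    using m by (simp add: fapp_def mv_def sum_distrib_left mult.assoc carrier_matD[OF c])
qed

context realized
begin

lemma m_pos: "0 < m" using m_int by linarith

text \<open>Constant invertible matrices between which the stripped pencil stands.\<close>

definition Lc where "Lc = Qs * AL"

definition Rc where "Rc = T1i * Y"

lemma LR_carrier [simp]: "Lc \<in> carrier_mat N N" "Rc \<in> carrier_mat N N"
  by (simp_all add: Lc_def Rc_def)

lemma factor: "Qs * X1 = Lc * M (- int m) * Rc" "Qs * X0 = Lc * (L1 * M 0 * T1) * Rc"
  unfolding Lc_def Rc_def X1_def X0_def Y_def strip_z[symmetric] strip_w[symmetric]
  by (simp_all add: assoc_mult_mat[of _ N N _ N _ N])

lemma factor_col: "Ecol m n (je - 1) = Lc * (L1 * Ecol m n (m - 1))"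
proof -
  have "Ecol m n (je - 1) = Qs * (AL * L1 * Ecol m n (m - 1))"
    unfolding AL_L1 W_def[symmetric] border_col Qs_col ..
  also have "\<dots> = Lc * (L1 * Ecol m n (m - 1))"
  proof -
    have "L1 * Ecol m n (m - 1) \<in> carrier_mat N n" by (rule mult_carrier_mat[of _ _ N]) simp_all
    then show ?thesis
      unfolding Lc_def by (simp add: assoc_mult_mat[of _ N N _ N _ N] assoc_mult_mat[of _ N N _ N _ n])
  qed
  finally show ?thesis .
qed

lemma factor_row: "(Ecol m n (je - 1))\<^sup>T = ((Ecol m n (m - 1))\<^sup>T * T1) * Rc"
proof -
  have "(Ecol m n (je - 1))\<^sup>T = (Ecol m n (m - 1))\<^sup>T * ((T1 * T1i) * Y)"
    unfolding T1_inverse border_row[symmetric] by (simp add: left_mult_one_mat[of _ N N])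
  also have "\<dots> = ((Ecol m n (m - 1))\<^sup>T * T1) * Rc"
    unfolding Rc_def by (simp add: assoc_mult_mat[of _ N N _ N _ N] assoc_mult_mat[of _ n N _ N _ N])
  finally show ?thesis .
qed

lemma inv_const: "(\<And>i. i \<in> set t \<Longrightarrow> 0 < \<bar>i\<bar> \<and> \<bar>i\<bar> < int m) \<Longrightarrow> inv_over UNIV N (G t)"
  by (rule inv_over_gprod[OF subring_UNIV]) auto

lemma inv_Lc: "inv_over UNIV N Lc"
  unfolding Lc_def AL_def G_append[symmetric]
proof (rule inv_over_mult[OF subring_UNIV])
  show "inv_over UNIV N Qs" using Qs_Qs by (intro inv_overI[of _ _ Qs]) auto
  show "inv_over UNIV N (G (Zo @ Ol))"
    by (rule inv_const) (use m_int in \<open>auto dest!: set_Zo set_Ol\<close>)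
qed

lemma inv_lead:
  assumes "det (coeff_mat P m) \<noteq> 0"
  shows "inv_over UNIV N (M (- int m))"
proof (rule inv_over_det)
  have "M (- int m) = fiedler m n (coeff_mat P) (- int m)"
    using m_pos by (intro fiedler_eq_gfied[symmetric]) (auto simp: idx_def)
  also have "\<dots> = dsum (coeff_mat P m) (1\<^sub>m ((m - 1) * n))"
    using m_pos by (simp add: fiedler_def dsum del: diag_block_mat.simps)
  finally have "det (M (- int m)) = det (coeff_mat P m)"
    using det_dsum[OF coeff_car one_carrier_mat] by simp
  then show "det (M (- int m)) \<noteq> 0" using assms by simp
qed simp

text \<open>The only factor that may be singular is $M_{-m}$, which occurs in $\mathbf c_z$ exactly if \<open>p\<close> is positive.\<close>

lemma inv_Rc:
  assumes "det (coeff_mat P m) = 0 \<longrightarrow> p = 0"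
  shows "inv_over UNIV N Rc"
proof -
  have rc: "inv_over UNIV N (G t)" if "set t \<subseteq> set rc" for t
    using that
  proof (induction t)
    case Nil
    show ?case by (simp add: inv_over_one[OF subring_UNIV])
  next
    case (Cons i t)
    have i: "i \<in> set rc" using Cons.prems by simp
    have "p \<noteq> 0" using i by (auto simp: rc_def dest!: set_rev_c)
    then have d: "det (coeff_mat P m) \<noteq> 0" using assms by auto
    have "inv_over UNIV N (M i)"
    proof (cases "i = - int m")
      case True
      then show ?thesis using inv_lead[OF d] by simp
    next
      case False
      then show ?thesis using set_rc[OF i] m_int
        by (intro inv_over_gfied[OF subring_UNIV]) auto
    qed
    then show ?case using Cons by (auto simp: gprod_def intro!: inv_over_mult[OF subring_UNIV])
  qed
  have Y: "Y = G (Ol @ Zo) * G rc" unfolding Y_def by (simp add: G_append assoc_mult_mat[of _ N N _ N _ N])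
  have "inv_over UNIV N (G (Ol @ Zo))"
    by (rule inv_const) (use m_int in \<open>auto dest!: set_Zo set_Ol\<close>)
  moreover have "inv_over UNIV N (G rc)" by (rule rc) simp
  ultimately have "inv_over UNIV N Y" unfolding Y by (rule inv_over_mult[OF subring_UNIV])
  moreover have "inv_over UNIV N T1i" using T1_inverse by (intro inv_overI[of _ _ T1]) auto
  ultimately show ?thesis unfolding Rc_def by (intro inv_over_mult[OF subring_UNIV])
qed

text \<open>The Horner scheme over the polynomials, with the indeterminate as parameter, returns $P(\lambda)$.\<close>

lemma horner_P:
  "horner (\<lambda>j. const_mat (coeff_mat P j)) lam (m - 1) (lam \<cdot>\<^sub>m const_mat (coeff_mat P m)) + const_mat (coeff_mat P 0) = P"
    (is "?H = P")
proof (rule eq_matI)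
  have H: "?H \<in> carrier_mat n n" by (intro add_carrier_mat) auto
  fix a b assume "a < dim_row P" "b < dim_col P"
  then have ab: "a < n" "b < n" using carrier_matD[OF car(1)] by auto
  show "?H $$ (a, b) = P $$ (a, b)"
    using horner_total[where c = "\<lambda>j. const_mat (coeff_mat P j)" and t = lam, OF _ m_pos ab]
      matrix_from_coefficients[OF car(1) above ab] by simp
qed (use carrier_matD[OF car(1)] in \<open>auto simp: coeff_mat_def\<close>)

text \<open>The elimination over the polynomials, with the indeterminate as parameter.  Since it fixes the borders, the state equation
  can be carried along unchanged.\<close>

lemma unimodular_part:
  assumes nd: "det (coeff_mat P m) = 0 \<longrightarrow> p = 0"
  shows "\<exists>U V. unimodular N U \<and> unimodular N V \<and>
    dsum U (1\<^sub>m r) * four_block_mat (lam \<cdot>\<^sub>m const_mat (Qs * X1) - const_mat (Qs * X0)) (const_mat Cb) (const_mat Db)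
        (const_mat Am - lam \<cdot>\<^sub>m const_mat Em) * dsum V (1\<^sub>m r)
      = dsum (1\<^sub>m ((m - 1) * n)) (system_matrix P Em Am Bm)"
proof -
  let ?c = "\<lambda>j. const_mat (coeff_mat P j)"
  interpret q: gfpr_mats m e p s n ?c by unfold_locales
  have hom: "const_mat (G t) = q.G t" if "\<And>i. i \<in> set t \<Longrightarrow> idx m i" for t
    unfolding const_mat_def by (rule cp.map_gprod_gfied) (use that in auto)
  have hL: "const_mat L1 = q.L1" and hT: "const_mat T1 = q.T1"
  proof -
    have "idx m i" if "0 < i \<and> i \<le> int (2 * E + p)" for i
      using that m1 m_pos by (auto simp: idx_def)
    then show "const_mat L1 = q.L1" "const_mat T1 = q.T1"
      unfolding L1_def q.L1_def T1_def q.T1_def by (auto intro!: hom dest!: set_Lt set_Rt)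
  qed
  have hM: "const_mat (M i) = q.M i" if "idx m i" for i
    unfolding const_mat_def by (rule cp.map_gfied) (use that in auto)
  have idxs: "idx m 0" "idx m (- int m)" using m_pos by (auto simp: idx_def)
  obtain Lci where Lci: "Lci \<in> carrier_mat N N" "Lc * Lci = 1\<^sub>m N" "Lci * Lc = 1\<^sub>m N"
    using inv_Lc by (auto simp: inv_over_def)
  obtain Rci where Rci: "Rci \<in> carrier_mat N N" "Rc * Rci = 1\<^sub>m N" "Rci * Rc = 1\<^sub>m N"
    using inv_Rc[OF nd] by (auto simp: inv_over_def)
  define lc li rc' ri where "lc = const_mat Lc" and "li = const_mat Lci" and "rc' = const_mat Rc" and "ri = const_mat Rci"
  have c1: "const_mat (1\<^sub>m k) = (1\<^sub>m k)" for k unfolding const_mat_def by (rule cp.mat_hom_one)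
  have cs [simp]: "lc \<in> carrier_mat N N" "li \<in> carrier_mat N N" "rc' \<in> carrier_mat N N" "ri \<in> carrier_mat N N"
    using Lci Rci by (auto simp: lc_def li_def rc'_def ri_def)
  have inv: "li * lc = 1\<^sub>m N" "lc * li = 1\<^sub>m N" "rc' * ri = 1\<^sub>m N" "ri * rc' = 1\<^sub>m N"
    unfolding lc_def li_def rc'_def ri_def using Lci Rci
    by (simp_all add: const_mat_mult[of _ N N _ N, symmetric] c1)
  define K where "K = lam \<cdot>\<^sub>m q.M (- int m) - q.L1 * q.M 0 * q.T1"
  have K [simp]: "K \<in> carrier_mat N N" unfolding K_def by (intro minus_carrier_mat) simp
  have pen: "lam \<cdot>\<^sub>m const_mat (Qs * X1) - const_mat (Qs * X0) = lc * K * rc'"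
  proof -
    have "lam \<cdot>\<^sub>m const_mat (Qs * X1) - const_mat (Qs * X0)
        = const_mat Lc * (lam \<cdot>\<^sub>m const_mat (M (- int m)) - const_mat (L1 * M 0 * T1)) * const_mat Rc"
      unfolding factor by (simp only: pencil_mult_left[of _ N] pencil_mult_right[of _ N] mats_carrier gfied_carrier LR_carrier mult_square_carrier)
    moreover have "const_mat (L1 * M 0 * T1) = q.L1 * q.M 0 * q.T1"
      by (simp add: const_mat_mult[of _ N N _ N] hL hT hM idxs)
    ultimately show ?thesis unfolding K_def lc_def rc'_def by (simp only: hM idxs)
  qed
  have m1': "2 * E + p = m - 1" using m1 by simp
  obtain U V where U: "inv_over UNIV N U" and V: "inv_over UNIV N V"
    and UKV: "U * (pivot m n lam (m - 1 - (m - 1)) (lam \<cdot>\<^sub>m ?c m) - q.L1 * q.M 0 * q.T1) * V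
      = pivot m n lam (m - 1) (horner ?c lam (m - 1) (lam \<cdot>\<^sub>m ?c m)) - q.M 0"
    and UE: "U * (q.L1 * Ecol m n (m - 1)) = Ecol m n (m - 1)"
    and EV: "((Ecol m n (m - 1))\<^sup>T * q.T1) * V = (Ecol m n (m - 1))\<^sup>T"
    using elimination[OF subring_UNIV UNIV_I, of ?c n m "m - 1" "lam \<cdot>\<^sub>m ?c m" lam \<beta>] m_pos
    unfolding q.L1_def q.T1_def q.\<beta>_def \<beta>_def m1' by auto
  have Uc [simp]: "U \<in> carrier_mat N N" "V \<in> carrier_mat N N" using U V by (auto dest: inv_over_carrier)
  have piv: "pivot m n lam 0 (lam \<cdot>\<^sub>m ?c m) = lam \<cdot>\<^sub>m q.M (- int m)"
    by (rule pivot_start) (simp_all add: m_pos)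
  have UKV': "U * K * V = corner m n (- 1) P"
  proof -
    have "U * K * V = pivot m n lam (m - 1) (horner ?c lam (m - 1) (lam \<cdot>\<^sub>m ?c m)) - q.M 0"
      using UKV unfolding K_def by (simp only: diff_self_eq_0 piv)
    also have "\<dots> = corner m n (- 1) P"
      by (subst pivot_end[OF _ _ m_pos]) (simp_all add: horner_carrier horner_P[simplified])
    finally show ?thesis .
  qed
  \<comment> \<open>The elimination leaves \<open>- 1\<close> in all blocks but the last.\<close>
  define S :: "complex poly mat" where "S = dg m n (\<lambda>b. if b = m - 1 then 1 else - 1)"
  have S [simp]: "S \<in> carrier_mat N N" by (simp add: S_def)
  have SS: "S * S = 1\<^sub>m N" unfolding S_def dg_mult by (rule dg_one) auto
  have SE: "S * Ecol m n (m - 1) = Ecol m n (m - 1)"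
    unfolding S_def by (rule dg_Ecol) (use m_pos in auto)
  define Ut where "Ut = S * U * li"
  define Vt where "Vt = ri * V"
  have Ut [simp]: "Ut \<in> carrier_mat N N" "Vt \<in> carrier_mat N N" by (simp_all add: Ut_def Vt_def)
  have 1: "Ut * (lc * K * rc') * Vt = corner m n 1 P"
  proof -
    have "Ut * (lc * K * rc') * Vt = S * (U * ((li * lc) * K * (rc' * ri)) * V)"
      unfolding Ut_def Vt_def by (simp add: assoc_mult_mat[of _ N N _ N _ N])
    also have "\<dots> = S * (U * K * V)"
      unfolding inv by (simp add: left_mult_one_mat[of _ N N] right_mult_one_mat[of _ N N])
    also have "\<dots> = corner m n 1 P" unfolding UKV' S_def by (rule corner_signs) simp
    finally show ?thesis .
  qed
  have cE: "const_mat (Ecol m n b) = Ecol m n b" for b unfolding const_mat_def by (rule cp.map_Ecol)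
  have cET: "const_mat ((Ecol m n b)\<^sup>T) = (Ecol m n b)\<^sup>T" for b
    unfolding const_mat_def by (rule cp.map_Erow)
  have 2: "Ut * const_mat Cb = Ecol m n (m - 1) * const_mat (Bm\<^sup>T)"
  proof -
    have LE: "L1 * Ecol m n (m - 1) \<in> carrier_mat N n" "q.L1 * Ecol m n (m - 1) \<in> carrier_mat N n"
      by (rule mult_carrier_mat[of _ _ N], simp_all)+
    have col: "Ecol m n (je - 1) = lc * (q.L1 * Ecol m n (m - 1))"
    proof -
      have "(Ecol m n (je - 1) :: complex poly mat) = const_mat (Lc * (L1 * Ecol m n (m - 1)))"
        unfolding factor_col[symmetric] cE ..
      also have "\<dots> = lc * const_mat (L1 * Ecol m n (m - 1))"
        unfolding lc_def by (rule const_mat_mult[OF LR_carrier(1) LE(1)])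
      also have "const_mat (L1 * Ecol m n (m - 1)) = q.L1 * Ecol m n (m - 1)"
        unfolding const_mat_mult[OF mats_carrier(2) Ecol_carrier(1)] hL cE ..
      finally show ?thesis .
    qed
    have BT: "Bm\<^sup>T \<in> carrier_mat n r" by simp
    have "const_mat Cb = Ecol m n (je - 1) * const_mat (Bm\<^sup>T)"
      unfolding Cb_def const_mat_mult[OF Ecol_carrier(1) BT] cE ..
    then have "Ut * const_mat Cb = S * (U * ((li * lc) * (q.L1 * Ecol m n (m - 1)))) * const_mat (Bm\<^sup>T)"
      unfolding col Ut_def
      using border_chain(1)[OF S Uc(1) cs(2) cs(1) LE(2) const_mat_carrier[OF BT]] by simp
    also have "(li * lc) * (q.L1 * Ecol m n (m - 1)) = q.L1 * Ecol m n (m - 1)"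
      unfolding inv by (rule left_mult_one_mat[of _ N n]) (rule mult_carrier_mat[of _ _ N], simp_all)
    finally show ?thesis by (simp only: UE SE)
  qed
  have 3: "const_mat Db * Vt = const_mat Bm * (Ecol m n (m - 1))\<^sup>T"
  proof -
    have ET: "(Ecol m n b)\<^sup>T \<in> carrier_mat n N" for b by simp
    have TE: "(Ecol m n (m - 1))\<^sup>T * T1 \<in> carrier_mat n N" "(Ecol m n (m - 1))\<^sup>T * q.T1 \<in> carrier_mat n N"
      by (rule mult_carrier_mat[of _ _ N], simp_all)+
    have row: "(Ecol m n (je - 1))\<^sup>T = ((Ecol m n (m - 1))\<^sup>T * q.T1) * rc'"
    proof -
      have "((Ecol m n (je - 1))\<^sup>T :: complex poly mat) = const_mat ((Ecol m n (m - 1))\<^sup>T * T1 * Rc)"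
        unfolding factor_row[symmetric] cET ..
      also have "\<dots> = const_mat ((Ecol m n (m - 1))\<^sup>T * T1) * rc'"
        unfolding rc'_def by (rule const_mat_mult[OF TE(1) LR_carrier(2)])
      also have "const_mat ((Ecol m n (m - 1))\<^sup>T * T1) = (Ecol m n (m - 1))\<^sup>T * q.T1"
        unfolding const_mat_mult[OF ET mats_carrier(3)] hT cET ..
      finally show ?thesis .
    qed
    have "const_mat Db = const_mat Bm * (Ecol m n (je - 1))\<^sup>T"
      unfolding Db_def const_mat_mult[OF car(4) ET] cET ..
    then have "const_mat Db * Vt = const_mat Bm * ((((Ecol m n (m - 1))\<^sup>T * q.T1) * (rc' * ri)) * V)"
      unfolding row Vt_def
      using border_chain(2)[OF cs(3) cs(4) Uc(2) S const_mat_carrier[OF car(4)] TE(2)] by simp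
    also have "((Ecol m n (m - 1))\<^sup>T * q.T1) * (rc' * ri) = (Ecol m n (m - 1))\<^sup>T * q.T1"
      unfolding inv by (rule right_mult_one_mat[of _ n N]) (rule mult_carrier_mat[of _ _ N], simp_all)
    finally show ?thesis by (simp only: EV)
  qed
  have H: "const_mat Am - lam \<cdot>\<^sub>m const_mat Em \<in> carrier_mat r r"
    by (intro minus_carrier_mat smult_carrier_mat const_mat_carrier car)
  have "dsum Ut (1\<^sub>m r) * four_block_mat (lc * K * rc') (const_mat Cb) (const_mat Db) (const_mat Am - lam \<cdot>\<^sub>m const_mat Em) * dsum Vt (1\<^sub>m r)
      = four_block_mat (Ut * (lc * K * rc') * Vt) (Ut * const_mat Cb) (const_mat Db * Vt) (const_mat Am - lam \<cdot>\<^sub>m const_mat Em)"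
  proof -
    have X: "Ut * const_mat Cb \<in> carrier_mat N r" by (rule mult_carrier_mat[of _ _ N]) simp_all
    show ?thesis using H X
      by (subst dsum_four_block(1)[of _ N _ r], simp_all only: Ut one_carrier_mat K cs mult_square_carrier const_mat_carrier CD_carrier)
        (subst dsum_four_block(2)[of _ N _ r], simp_all add: left_mult_one_mat[of _ r r] left_mult_one_mat[of _ r N] right_mult_one_mat[of _ r r] right_mult_one_mat[of _ N r])
  qed
  also have "\<dots> = dsum (1\<^sub>m ((m - 1) * n)) (system_matrix P Em Am Bm)"
    unfolding 1 2 3 system_matrix_def corner_dsum[OF car(1) m_pos]
    by (rule dsum_one_four_block[symmetric, OF _ _ _ H m_pos]) simp_all
  finally have eq: "dsum Ut (1\<^sub>m r) * four_block_mat (lam \<cdot>\<^sub>m const_mat (Qs * X1) - const_mat (Qs * X0)) (const_mat Cb) (const_mat Db)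
        (const_mat Am - lam \<cdot>\<^sub>m const_mat Em) * dsum Vt (1\<^sub>m r) = dsum (1\<^sub>m ((m - 1) * n)) (system_matrix P Em Am Bm)"
    unfolding pen .
  have "inv_over UNIV N li" "inv_over UNIV N ri" "inv_over UNIV N S"
    using inv SS by (auto intro: inv_overI[of _ _ lc] inv_overI[of _ _ rc'] inv_overI[of _ _ S])
  then have "inv_over UNIV N Ut" "inv_over UNIV N Vt"
    unfolding Ut_def Vt_def using U V by (auto intro!: inv_over_mult[OF subring_UNIV])
  then show ?thesis using eq inv_over_unimodular by blast
qed

end

section \<open>Reversal of the pencil\<close>

text \<open>The permutation matrix that reverses the order of the blocks.\<close>

definition flip :: "nat \<Rightarrow> nat \<Rightarrow> 'a :: comm_ring_1 mat" where
  "flip m n = mat (m * n) (m * n) (\<lambda>(r, s). if s div n = m - 1 - r div n \<and> r mod n = s mod n then 1 else 0)"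

lemma flip_carrier [simp]: "flip m n \<in> carrier_mat (m * n) (m * n)"
  by (simp add: flip_def)

lemma bacts_flip: "bacts m n (flip m n) (\<lambda>x b. x (m - 1 - b))"
proof (rule bactsI)
  fix x :: "nat \<Rightarrow> nat \<Rightarrow> 'a" and b a assume b: "b < m" and a: "a < n"
  have "(\<Sum>c<m. \<Sum>d<n. flip m n $$ (b * n + a, c * n + d) * x c d)
      = (\<Sum>c<m. \<Sum>d<n. (if c = m - 1 - b \<and> a = d then 1 else 0) * x c d)"
    using a b by (intro sum.cong refl) (simp add: flip_def block_index)
  also have "\<dots> = (\<Sum>d<n. (if a = d then 1 else 0) * x (m - 1 - b) d)"
    by (subst sum_one[of "m - 1 - b"]) (use b in auto)
  also have "\<dots> = x (m - 1 - b) a" by (rule sum_delta_inner[OF a])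
  finally show "(\<Sum>c<m. \<Sum>d<n. flip m n $$ (b * n + a, c * n + d) * x c d) = x (m - 1 - b) a" .
qed simp

lemma flip_flip: "flip m n * flip m n = 1\<^sub>m (m * n)"
  by (rule bacts_eqI[OF bacts_mult[OF bacts_flip bacts_flip] bacts_one]) simp

text \<open>Reversing the blocks turns $M_{-j}$ into $M_{m-j}$ for the polynomial with coefficients $-c_{m-i}$.\<close>

lemma flip_gfied:
  assumes c: "\<And>j. c j \<in> carrier_mat n n" and j: "0 < j" "j \<le> m"
  shows "flip m n * gfied m n c (- int j) * flip m n = gfied m n (\<lambda>i. - c (m - i)) (int m - int j)"
proof (rule bacts_eqI[OF bacts_mult[OF bacts_mult[OF bacts_flip bacts_gfied] bacts_flip] bacts_gfied])
  show "idx m (- int j)" "idx m (int m - int j)" using j by (auto simp: idx_def)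
  fix x :: "nat \<Rightarrow> nat \<Rightarrow> 'a" and b a assume b: "b < m" and a: "a < n"
  show "fapp m n c (- int j) (\<lambda>b. x (m - 1 - b)) (m - 1 - b) a = fapp m n (\<lambda>i. - c (m - i)) (int m - int j) x b a"
  proof (cases "j = m")
    case True
    have "m - 1 - b = 0 \<longleftrightarrow> b = m - 1" using b by auto
    then show ?thesis using b j True by (auto simp: fapp_def mv_uminus_mat[OF c a])
  next
    case False
    then have jm: "j < m" using j by simp
    have nats: "nat (int m - int j) = m - j" "m - (m - j) = j" using jm by auto
    consider "b = j" | "b = j - 1" | "b \<noteq> j" "b \<noteq> j - 1" by blast
    then show ?thesis
    proof cases
      case 1
      have "m - 1 - (m - 1 - j + 1) = j - 1" "m - 1 - j = m - j - 1" "j \<noteq> j - 1" using jm j by auto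
      then show ?thesis using 1 jm j unfolding fapp_def nats by simp
    next
      case 2
      have "m - 1 - b = m - j" "m - 1 - (m - j - 1) = j" "m - 1 - (m - j) = j - 1" "m - j \<noteq> m - j - 1" using 2 jm j by auto
      then show ?thesis using 2 jm j unfolding fapp_def nats by (simp add: mv_uminus_mat[OF c a])
    next
      case 3
      have "m - 1 - b \<noteq> m - j" "m - 1 - b \<noteq> m - j - 1" "m - 1 - (m - 1 - b) = b" using 3 jm j b by auto
      then show ?thesis using 3 jm j unfolding fapp_def nats by simp
    qed
  qed
qed

lemma flip_gfied_0:
  assumes c: "\<And>j. c j \<in> carrier_mat n n" and m: "0 < m"
  shows "flip m n * gfied m n c 0 * flip m n = gfied m n (\<lambda>i. - c (m - i)) (- int m)"
proof (rule bacts_eqI[OF bacts_mult[OF bacts_mult[OF bacts_flip bacts_gfied] bacts_flip] bacts_gfied])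
  show "idx m 0" "idx m (- int m)" using m by (auto simp: idx_def)
  fix x :: "nat \<Rightarrow> nat \<Rightarrow> 'a" and b a assume b: "b < m" and a: "a < n"
  have "m - 1 - b = m - 1 \<longleftrightarrow> b = 0" using b by auto
  then show "fapp m n c 0 (\<lambda>b. x (m - 1 - b)) (m - 1 - b) a = fapp m n (\<lambda>i. - c (m - i)) (- int m) x b a"
    using b m by (auto simp: fapp_def mv_uminus_mat[OF c a])
qed

lemma flip_gprod:
  assumes c: "\<And>j. c j \<in> carrier_mat n n" and t: "\<And>j. j \<in> set t \<Longrightarrow> 0 < j \<and> j < int m"
  shows "flip m n * gprod (m * n) (gfied m n c) (map uminus t) * flip m n
    = gprod (m * n) (gfied m n (\<lambda>i. - c (m - i))) (map (\<lambda>j. int m - j) t)"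
  using t
proof (induction t)
  case Nil
  show ?case by (simp add: flip_flip right_mult_one_mat[of _ "m * n" "m * n"])
next
  case (Cons j t)
  let ?N = "m * n" and ?J = "flip m n" and ?A = "gfied m n c (- j)" and ?B = "gprod (m * n) (gfied m n c) (map uminus t)"
  obtain k where k: "j = int k" "0 < k" "k \<le> m" using Cons.prems[of j] by (metis list.set_intros(1) nat_0_le nat_less_iff of_nat_0_less_iff of_nat_less_iff order_less_imp_le)
  have car: "?J \<in> carrier_mat ?N ?N" "?A \<in> carrier_mat ?N ?N" "?B \<in> carrier_mat ?N ?N" by simp_all
  have "?J * (?A * ?B) * ?J = (?J * ?A * (?J * ?J)) * ?B * ?J"
    unfolding flip_flip using car by (simp add: right_mult_one_mat[of _ ?N ?N] assoc_mult_mat[of _ ?N ?N _ ?N _ ?N])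
  also have "\<dots> = (?J * ?A * ?J) * (?J * ?B * ?J)"
    using car by (simp add: assoc_mult_mat[of _ ?N ?N _ ?N _ ?N])
  also have "\<dots> = gfied m n (\<lambda>i. - c (m - i)) (int m - j) * gprod ?N (gfied m n (\<lambda>i. - c (m - i))) (map (\<lambda>j. int m - j) t)"
    using Cons flip_gfied[OF c k(2,3)] by (simp add: k(1))
  finally show ?case by (simp add: gprod_def)
qed

lemma filter_reflect:
  fixes m :: nat
  shows "map (\<lambda>j. m - j) (filter \<beta> [1..<m]) = rev (filter (\<lambda>i. \<beta> (m - i)) [1..<m])"
proof -
  have r: "rev [1..<m] = map (\<lambda>j. m - j) [1..<m]"
    by (rule nth_equalityI) (auto simp: rev_nth)
  have "rev (filter (\<lambda>i. \<beta> (m - i)) [1..<m]) = filter (\<lambda>i. \<beta> (m - i)) (map (\<lambda>j. m - j) [1..<m])"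
    by (simp only: rev_filter r)
  also have "\<dots> = map (\<lambda>j. m - j) (filter (\<lambda>j. \<beta> (m - (m - j))) [1..<m])"
    by (simp add: filter_map comp_def)
  also have "filter (\<lambda>j. \<beta> (m - (m - j))) [1..<m] = filter \<beta> [1..<m]"
    by (rule filter_cong) auto
  finally show ?thesis by simp
qed

text \<open>Inverting and reversing the outer factors gives lists of the same form, for the reflected distribution of indices.\<close>

lemma LR_reflect:
  assumes m: "0 < m"
  shows "map (\<lambda>j. int m - j) (rev (Lt \<beta> (m - 1))) = Lt (\<lambda>i. \<beta> (m - i)) (m - 1)"
    "map (\<lambda>j. int m - j) (rev (Rt \<beta> (m - 1))) = Rt (\<lambda>i. \<beta> (m - i)) (m - 1)"
proof -
  have S: "Suc (m - 1) = m" using m by simp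
  have int: "map (\<lambda>j. int m - j) (map int xs) = map int (map (\<lambda>j. m - j) xs)" if "set xs \<subseteq> {1..<m}" for xs
    using that by (induction xs) auto
  have sub: "set (filter \<gamma> [1..<m]) \<subseteq> {1..<m}" for \<gamma> by auto
  show "map (\<lambda>j. int m - j) (rev (Lt \<beta> (m - 1))) = Lt (\<lambda>i. \<beta> (m - i)) (m - 1)"
    unfolding Lt_def S rev_map[symmetric] rev_rev_ident int[OF sub] filter_reflect ..
  have "map (\<lambda>j. int m - j) (rev (Rt \<beta> (m - 1))) = rev (map int (map (\<lambda>j. m - j) (filter (\<lambda>j. \<not> \<beta> j) [1..<m])))"
    unfolding Rt_def S rev_map[symmetric] int[OF sub] ..
  also have "\<dots> = Rt (\<lambda>i. \<beta> (m - i)) (m - 1)"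
    unfolding Rt_def S filter_reflect rev_map[symmetric] rev_rev_ident ..
  finally show "map (\<lambda>j. int m - j) (rev (Rt \<beta> (m - 1))) = Rt (\<lambda>i. \<beta> (m - i)) (m - 1)" .
qed

text \<open>Multiplying by the inverses of \<open>L\<close> and \<open>T\<close> moves the outer factors from $M_0$ to $M_{-m}$; after reversal of the blocks, the
  roles of the two have been exchanged and \<open>elimination\<close> applies to the coefficients $-c_{m-i}$.\<close>

lemma reversed_elimination:
  fixes c :: "nat \<Rightarrow> 'a :: comm_ring_1 mat" and \<beta> :: "nat \<Rightarrow> bool"
  assumes R: "subring_set R" and t: "t \<in> R"
    and c: "\<And>j. c j \<in> carrier_mat n n" "\<And>j. over R (c j)" and m: "0 < m"
  defines "L \<equiv> gprod (m * n) (gfied m n c) (Lt \<beta> (m - 1))" and "T \<equiv> gprod (m * n) (gfied m n c) (Rt \<beta> (m - 1))"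
    and "d \<equiv> \<lambda>i. - c (m - i)"
  shows "\<exists>U V. inv_over R (m * n) U \<and> inv_over R (m * n) V \<and>
    U * (gfied m n c (- int m) - t \<cdot>\<^sub>m (L * gfied m n c 0 * T)) * V
      = corner m n 1 (- (horner d t (m - 1) (t \<cdot>\<^sub>m d m) + d 0))"
proof -
  let ?N = "m * n" and ?J = "flip m n :: 'a mat" and ?M = "gfied m n c" and ?D = "gfied m n d"
  let ?\<beta> = "\<lambda>i. \<beta> (m - i)"
  define Li Ti where "Li = gprod ?N ?M (rev (map uminus (Lt \<beta> (m - 1))))" and "Ti = gprod ?N ?M (rev (map uminus (Rt \<beta> (m - 1))))"
  define L' T' where "L' = gprod ?N ?D (Lt ?\<beta> (m - 1))" and "T' = gprod ?N ?D (Rt ?\<beta> (m - 1))"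
  have d: "d j \<in> carrier_mat n n" "over R (d j)" for j
    using c R by (auto simp: d_def intro: over_uminus)
  have car [simp]: "L \<in> carrier_mat ?N ?N" "T \<in> carrier_mat ?N ?N" "Li \<in> carrier_mat ?N ?N" "Ti \<in> carrier_mat ?N ?N"
    "L' \<in> carrier_mat ?N ?N" "T' \<in> carrier_mat ?N ?N"
    by (simp_all add: L_def T_def Li_def Ti_def L'_def T'_def)
  have rng: "0 < j \<and> j < int m" if "j \<in> set (Lt \<beta> (m - 1)) \<union> set (Rt \<beta> (m - 1))" for j
    using that m by (auto dest!: set_Lt set_Rt)
  have rng': "0 < \<bar>j\<bar> \<and> \<bar>j\<bar> < int m" if "j \<in> set (Lt \<beta> (m - 1)) \<union> set (Rt \<beta> (m - 1))" for j
    using rng[OF that] by auto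
  have inv: "Li * L = 1\<^sub>m ?N" "T * Ti = 1\<^sub>m ?N"
    unfolding Li_def L_def T_def Ti_def using rng' by (auto intro!: gprod_gfied_inverse)
  have flipL: "?J * Li * ?J = L'" and flipT: "?J * Ti * ?J = T'"
    unfolding Li_def Ti_def L'_def T'_def d_def rev_map LR_reflect[OF m, of \<beta>, symmetric]
    by (rule flip_gprod[OF c(1)], use rng in simp)+
  have flipm: "?J * ?M (- int m) * ?J = ?D 0" and flip0: "?J * ?M 0 * ?J = ?D (- int m)"
    using flip_gfied[OF c(1), of m m] flip_gfied_0[OF c(1) m] m by (simp_all add: d_def)
  have tc: "t \<cdot>\<^sub>m d m \<in> carrier_mat n n" "over R (t \<cdot>\<^sub>m d m)" using d R t by (auto intro: over_smult)
  obtain U V where U: "inv_over R ?N U" and V: "inv_over R ?N V"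
    and UV: "U * (pivot m n t (m - 1 - (m - 1)) (t \<cdot>\<^sub>m d m) - L' * ?D 0 * T') * V
      = pivot m n t (m - 1) (horner d t (m - 1) (t \<cdot>\<^sub>m d m)) - ?D 0"
    using elimination[where c = d and \<beta> = "?\<beta>" and i = "m - 1" and \<Lambda> = "t \<cdot>\<^sub>m d m" and m = m, OF R t d(1) d(2)] m tc unfolding L'_def T'_def by auto
  have Uc [simp]: "U \<in> carrier_mat ?N ?N" "V \<in> carrier_mat ?N ?N" using U V by (auto dest: inv_over_carrier)
  let ?Q = "t \<cdot>\<^sub>m ?D (- int m) - L' * ?D 0 * T'"
  have Q: "?Q \<in> carrier_mat ?N ?N" by (intro minus_carrier_mat) simp
  have UQV: "U * ?Q * V = corner m n (- 1) (horner d t (m - 1) (t \<cdot>\<^sub>m d m) + d 0)"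
  proof -
    have "U * ?Q * V = pivot m n t (m - 1) (horner d t (m - 1) (t \<cdot>\<^sub>m d m)) - ?D 0"
      using UV by (simp only: diff_self_eq_0 pivot_start[where c = d and m = m, OF d(1) m])
    also have "\<dots> = corner m n (- 1) (horner d t (m - 1) (t \<cdot>\<^sub>m d m) + d 0)"
      by (rule pivot_end[OF horner_carrier[OF tc(1) d(1)] d(1) m])
    finally show ?thesis .
  qed
  let ?X = "?M (- int m) - t \<cdot>\<^sub>m (L * ?M 0 * T)"
  have X: "?X \<in> carrier_mat ?N ?N" by (intro minus_carrier_mat smult_carrier_mat) simp
  have core: "(?J * Li) * ?X * (Ti * ?J) = - ?Q"
  proof -
    have "(?J * Li) * ?X * (Ti * ?J) = (?J * Li) * ?M (- int m) * (Ti * ?J) - (?J * Li) * (t \<cdot>\<^sub>m (L * ?M 0 * T)) * (Ti * ?J)"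
      by (simp add: mult_minus_distrib_mat[of _ ?N ?N _ ?N] minus_mult_distrib_mat[of _ ?N ?N _ _ ?N])
    also have "(?J * Li) * ?M (- int m) * (Ti * ?J) = L' * ?D 0 * T'"
    proof -
      have "L' * ?D 0 * T' = ?J * Li * (?J * ?J) * ?M (- int m) * (?J * ?J) * Ti * ?J"
        unfolding flipL[symmetric] flipT[symmetric] flipm[symmetric] by (simp add: assoc_mult_mat[of _ ?N ?N _ ?N _ ?N])
      then show ?thesis unfolding flip_flip
        by (simp add: right_mult_one_mat[of _ ?N ?N] assoc_mult_mat[of _ ?N ?N _ ?N _ ?N])
    qed
    also have "(?J * Li) * (t \<cdot>\<^sub>m (L * ?M 0 * T)) * (Ti * ?J) = t \<cdot>\<^sub>m ?D (- int m)"
    proof -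
      have "(?J * Li) * (t \<cdot>\<^sub>m (L * ?M 0 * T)) * (Ti * ?J) = t \<cdot>\<^sub>m ((?J * Li) * (L * ?M 0 * T) * (Ti * ?J))"
        by (simp add: mult_smult_distrib[of _ ?N ?N _ ?N] mult_smult_assoc_mat[of _ ?N ?N _ ?N])
      also have "(?J * Li) * (L * ?M 0 * T) * (Ti * ?J) = ?J * ((Li * L) * ?M 0 * (T * Ti)) * ?J"
        by (simp add: assoc_mult_mat[of _ ?N ?N _ ?N _ ?N])
      also have "\<dots> = ?D (- int m)"
        unfolding inv by (simp add: left_mult_one_mat[of _ ?N ?N] right_mult_one_mat[of _ ?N ?N] flip0)
      finally show ?thesis .
    qed
    also have "L' * ?D 0 * T' - t \<cdot>\<^sub>m ?D (- int m) = - ?Q"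
      by (rule eq_matI) (simp_all add: carrier_matD[OF car(5)] carrier_matD[OF car(6)])
    finally show ?thesis .
  qed
  have "(U * (?J * Li)) * ?X * ((Ti * ?J) * V) = U * ((?J * Li) * ?X * (Ti * ?J)) * V"
    using X by (simp add: assoc_mult_mat[of _ ?N ?N _ ?N _ ?N])
  also have "\<dots> = - (U * ?Q * V)"
  proof -
    have neg: "A * (- ?Q) = - (A * ?Q)" if "A \<in> carrier_mat ?N ?N" for A
      using that Q carrier_matD[OF Q] carrier_matD[OF that] by (intro uminus_mult_right_mat) simp
    have "(- (U * ?Q)) * V = - (U * ?Q * V)"
      using mult_square_carrier[OF Uc(1) Q] Uc(2) by (intro uminus_mult_left_mat) (metis carrier_matD)
    then show ?thesis unfolding core neg[OF Uc(1)] .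
  qed
  also have "\<dots> = corner m n 1 (- (horner d t (m - 1) (t \<cdot>\<^sub>m d m) + d 0))"
    unfolding UQV by (rule corner_smult) (intro add_carrier_mat d)
  finally have eq: "(U * (?J * Li)) * ?X * ((Ti * ?J) * V) = corner m n 1 (- (horner d t (m - 1) (t \<cdot>\<^sub>m d m) + d 0))" .
  have oJ: "over R ?J" using subring_setD[OF R] by (auto simp: over_def flip_def)
  have iJ: "inv_over R ?N ?J" by (rule inv_overI[of _ _ ?J]) (simp_all add: oJ flip_flip)
  have iL: "inv_over R ?N Li" and iT: "inv_over R ?N Ti"
    unfolding Li_def Ti_def by (rule inv_over_gprod[OF R], use c rng' in auto)+
  have "inv_over R ?N (U * (?J * Li))" "inv_over R ?N ((Ti * ?J) * V)"
    by (intro inv_over_mult[OF R] U V iJ iL iT)+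
  then show ?thesis using eq by blast
qed

section \<open>Reflection of rational matrices\<close>

lemma pcompose_one: "pcompose 1 p = (1 :: 'a :: comm_semiring_1 poly)"
  by (simp only: one_pCons pcompose_const)

lemma fract_reflect_hom: "comm_ring_hom fract_reflect"
proof
  define \<rho> where "\<rho> p = pcompose p (- lam)" for p :: "complex poly"
  have nz: "q \<noteq> 0 \<Longrightarrow> \<rho> q \<noteq> 0" for q unfolding \<rho>_def using pcompose_neg_lam_eq_0_iff by blast
  have \<rho>: "\<rho> (p + q) = \<rho> p + \<rho> q" "\<rho> (p * q) = \<rho> p * \<rho> q" for p q
    by (simp_all add: \<rho>_def pcompose_add pcompose_mult)
  have F: "q \<noteq> 0 \<Longrightarrow> fract_reflect (Fract p q) = Fract (\<rho> p) (\<rho> q)" for p q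
    unfolding \<rho>_def by (rule fract_reflect_Fract)
  have \<rho>1: "\<rho> 1 = 1" "\<rho> 0 = 0" by (simp_all add: \<rho>_def pcompose_one)
  show "fract_reflect 1 = 1" "fract_reflect 0 = 0"
    using F[of 1 1] F[of 1 0] \<rho>1 by (simp_all add: One_fract_def Zero_fract_def)
  fix x y :: "complex poly fract"
  obtain a b where x: "x = Fract a b" "b \<noteq> 0" by (cases x)
  obtain c d where y: "y = Fract c d" "d \<noteq> 0" by (cases y)
  show "fract_reflect (x + y) = fract_reflect x + fract_reflect y"
    using x y nz by (simp add: F \<rho>)
  show "fract_reflect (x * y) = fract_reflect x * fract_reflect y"
    using x y nz by (simp add: F \<rho>)
qed

interpretation fr: comm_ring_hom fract_reflect by (rule fract_reflect_hom)

lemma fract_reflect_to_fract: "fract_reflect (to_fract p) = to_fract (pcompose p (- lam))"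
  unfolding to_fract_def by (subst fract_reflect_Fract) (simp_all add: pcompose_one)

lemma fract_reflect_cf: "fract_reflect (cf a) = cf a"
  by (simp add: cf_def fract_reflect_to_fract)

lemma fract_reflect_lamF: "fract_reflect lamF = - lamF"
proof -
  have "pcompose lam (- lam) = - lam" by (simp add: pcompose_pCons pcompose_one)
  then show ?thesis unfolding lamF_def fract_reflect_to_fract by (simp only: tf.hom_uminus)
qed

text \<open>Reflection is a ring homomorphism, and $(-\lambda E - A)^T = \lambda E - A$, so the reflected and transposed
  resolvent is the resolvent itself.\<close>

lemma T_even_transfer:
  assumes F: "F \<in> carrier_mat k k" "T_even_poly F" and C: "C \<in> carrier_mat k r" and E: "E \<in> carrier_mat r r" and A: "A \<in> carrier_mat r r"
    and D: "C\<^sup>T = D" and sk: "E\<^sup>T = - E" "A\<^sup>T = A" "det E \<noteq> 0"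
  shows "T_even_rat (transfer_function F C E A D)"
proof -
  let ?\<rho> = "map_mat fract_reflect" and ?P = "lamF \<cdot>\<^sub>m cm E - cm A" and ?R = "resolv E A"
  note R = resolv[OF E A sk(3)]
  have Pc: "?P \<in> carrier_mat r r" using A by (intro minus_carrier_mat) simp
  have Dc: "D \<in> carrier_mat r k" using C D by auto
  have \<rho>cm: "?\<rho> (cm X) = cm X" for X by (rule eq_matI) (auto simp: fract_reflect_cf)
  have PT: "(?\<rho> ?P)\<^sup>T = ?P"
  proof (rule eq_matI)
    fix i j assume "i < dim_row ?P" "j < dim_col ?P"
    then have ij: "i < r" "j < r" using A by auto
    have "E\<^sup>T $$ (i, j) = (- E) $$ (i, j)" "A\<^sup>T $$ (i, j) = A $$ (i, j)" by (simp_all only: sk)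
    then have "E $$ (j, i) = - E $$ (i, j)" "A $$ (j, i) = A $$ (i, j)" using ij A E by auto
    then show "(?\<rho> ?P)\<^sup>T $$ (i, j) = ?P $$ (i, j)"
      using ij A E by (simp add: fr.hom_minus fr.hom_mult fr.hom_uminus fract_reflect_cf fract_reflect_lamF cf.hom_uminus)
  qed (use A in auto)
  have "?R = (?\<rho> ?R)\<^sup>T"
  proof -
    have "?\<rho> (?P * ?R) = ?\<rho> ?P * ?\<rho> ?R" using Pc R(1) by (rule fr.mat_hom_mult)
    then have "?\<rho> ?P * ?\<rho> ?R = 1\<^sub>m r" unfolding R(3) fr.mat_hom_one by (rule sym)
    then have "(?\<rho> ?P * ?\<rho> ?R)\<^sup>T = 1\<^sub>m r" by (simp only: transpose_one)
    then have "(?\<rho> ?R)\<^sup>T * ?P = 1\<^sub>m r"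
      using Pc R(1) transpose_mult[of "?\<rho> ?P" r r "?\<rho> ?R" r] by (simp add: PT)
    then have "((?\<rho> ?R)\<^sup>T * ?P) * ?R = ?R" using R(1) by (simp add: left_mult_one_mat[of _ r r])
    moreover have "((?\<rho> ?R)\<^sup>T * ?P) * ?R = (?\<rho> ?R)\<^sup>T * (?P * ?R)"
      using R(1) Pc by (intro assoc_mult_mat[of _ r r _ r _ r]) auto
    ultimately show ?thesis unfolding R(3) using R(1) by (simp add: right_mult_one_mat[of _ r r])
  qed
  note RT = this[symmetric]
  have cT: "(cm C)\<^sup>T = cm D" "(cm D)\<^sup>T = cm C" using D C by (auto simp: map_mat_transpose[symmetric])
  have CRD: "(?\<rho> (cm C * ?R * cm D))\<^sup>T = cm C * ?R * cm D"
  proof -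
    have "?\<rho> (cm C * ?R * cm D) = cm C * ?\<rho> ?R * cm D"
    proof -
      have CR: "cm C * ?R \<in> carrier_mat k r" using C R(1) by auto
      have "?\<rho> (cm C * ?R * cm D) = ?\<rho> (cm C * ?R) * ?\<rho> (cm D)" using CR Dc by (intro fr.mat_hom_mult) auto
      also have "?\<rho> (cm C * ?R) = ?\<rho> (cm C) * ?\<rho> ?R" using C R(1) by (intro fr.mat_hom_mult) auto
      finally show ?thesis unfolding \<rho>cm .
    qed
    also have "(cm C * ?\<rho> ?R * cm D)\<^sup>T = (cm D)\<^sup>T * ((?\<rho> ?R)\<^sup>T * (cm C)\<^sup>T)"
    proof -
      have "(cm C * ?\<rho> ?R * cm D)\<^sup>T = (cm D)\<^sup>T * (cm C * ?\<rho> ?R)\<^sup>T"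
        using C R(1) Dc by (intro transpose_mult[of _ k r _ k]) auto
      also have "(cm C * ?\<rho> ?R)\<^sup>T = (?\<rho> ?R)\<^sup>T * (cm C)\<^sup>T"
        using C R(1) by (intro transpose_mult[of _ k r _ r]) auto
      finally show ?thesis .
    qed
    also have "\<dots> = cm C * ?R * cm D"
      unfolding cT RT using C R(1) Dc by (intro assoc_mult_mat[symmetric, of _ k r _ r _ k]) auto
    finally show ?thesis .
  qed
  have FT: "(?\<rho> (rat_mat F))\<^sup>T = rat_mat F"
  proof -
    have "?\<rho> (rat_mat F) = rat_mat (map_mat (\<lambda>p. pcompose p (- lam)) F)"
      by (rule eq_matI) (auto simp: rat_mat_def fract_reflect_to_fract simp del: minus_pCons)
    moreover have "(rat_mat X)\<^sup>T = rat_mat (X\<^sup>T)" for X by (rule eq_matI) (auto simp: rat_mat_def)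
    ultimately show ?thesis using F(2) by (simp only: T_even_poly_def)
  qed
  have car: "rat_mat F \<in> carrier_mat k k" "cm C * ?R * cm D \<in> carrier_mat k k"
    using F C R(1) Dc by (auto simp: rat_mat_def)
  have add: "(?\<rho> (X + Z))\<^sup>T = (?\<rho> X)\<^sup>T + (?\<rho> Z)\<^sup>T"
    if "X \<in> carrier_mat k k" "Z \<in> carrier_mat k k" for X Z
    by (rule eq_matI) (use that in \<open>auto simp: fr.hom_add\<close>)
  from add[OF car] have "(?\<rho> (rat_mat F + cm C * ?R * cm D))\<^sup>T = (?\<rho> (rat_mat F))\<^sup>T + (?\<rho> (cm C * ?R * cm D))\<^sup>T" .
  then show ?thesis unfolding T_even_rat_def transfer_eq[OF E A] by (simp only: CRD FT)
qed

section \<open>The transfer function at infinity\<close>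

lemma gfied_cong:
  assumes "idx m i" "c (nat \<bar>i\<bar>) = c' (nat \<bar>i\<bar>)"
  shows "gfied m n c i = gfied m n c' i"
proof -
  have "fapp m n c i = fapp m n c' i"
  proof (cases "0 < i")
    case True
    then have "c (nat i) = c' (nat i)" using assms(2) by simp
    then show ?thesis using True by (intro ext) (simp add: fapp_def)
  next
    case False
    then have *: "c (nat (- i)) = c' (nat (- i))" using assms(2) by simp
    then have "i = 0 \<Longrightarrow> c 0 = c' 0" "i = - int m \<Longrightarrow> c m = c' m" by simp_all
    then show ?thesis using False * by (intro ext) (simp add: fapp_def)
  qed
  then show ?thesis
    using bacts_gfied[OF assms(1), of n c] bacts_gfied[OF assms(1), of n c'] by (intro bacts_eqI) simp_all
qed

lemma Ecol_sandwich:
  assumes Z: "Z \<in> carrier_mat n n"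
  shows "Ecol m n b * Z * (Ecol m n b)\<^sup>T = bdiag m n (\<lambda>d. if d = b then Z else (0\<^sub>m n n :: 'a :: comm_ring_1 mat))"
proof -
  have ZE: "Z * (Ecol m n b)\<^sup>T \<in> carrier_mat n (m * n)" using Z by (rule mult_carrier_mat) simp
  have ZT: "Z * (Ecol m n b)\<^sup>T = (Ecol m n b * Z\<^sup>T)\<^sup>T"
    using Z by (subst transpose_mult[of _ "m * n" n _ n]) auto
  have ZTc: "Z\<^sup>T \<in> carrier_mat n n" using Z by simp
  have "Ecol m n b * Z * (Ecol m n b)\<^sup>T = Ecol m n b * (Z * (Ecol m n b)\<^sup>T)"
    using Z by (intro assoc_mult_mat[of _ "m * n" n _ n _ "m * n"]) auto
  also have "\<dots> = bdiag m n (\<lambda>d. if d = b then Z else 0\<^sub>m n n)"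
  proof (rule eq_matI)
    fix i j assume "i < dim_row (bdiag m n (\<lambda>d. if d = b then Z else 0\<^sub>m n n))"
      "j < dim_col (bdiag m n (\<lambda>d. if d = b then Z else 0\<^sub>m n n))"
    then have ij: "i < m * n" "j < m * n" by (auto simp: bdiag_def)
    then have md: "i mod n < n" "j mod n < n" using block_split by blast+
    have "(Z * (Ecol m n b)\<^sup>T) $$ (i mod n, j) = (Ecol m n b * Z\<^sup>T) $$ (j, i mod n)"
      unfolding ZT using md ij Z by simp
    also have "\<dots> = (if j div n = b then Z\<^sup>T $$ (j mod n, i mod n) else 0)"
      by (rule Ecol_mult_index[OF ZTc ij(2) md(1)])
    also have "\<dots> = (if j div n = b then Z $$ (i mod n, j mod n) else 0)" using md Z by simp
    finally have zz: "(Z * (Ecol m n b)\<^sup>T) $$ (i mod n, j) = (if j div n = b then Z $$ (i mod n, j mod n) else 0)" .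
    show "(Ecol m n b * (Z * (Ecol m n b)\<^sup>T)) $$ (i, j) = bdiag m n (\<lambda>d. if d = b then Z else 0\<^sub>m n n) $$ (i, j)"
      unfolding Ecol_mult_index[OF ZE ij] bdiag_index[OF ij] zz using md by auto
  qed (use ZE in \<open>auto simp: bdiag_def\<close>)
  finally show ?thesis .
qed

lemma gfied_0_shift:
  assumes c: "c 0 \<in> carrier_mat n n" "c' 0 = c 0 + Z" and Z: "Z \<in> carrier_mat n n" and m: "0 < m"
  shows "gfied m n c' 0 = gfied m n c 0 - Ecol m n (m - 1) * Z * (Ecol m n (m - 1))\<^sup>T"
  unfolding Ecol_sandwich[OF Z]
proof (rule bacts_eqI[OF bacts_gfied bacts_minus[OF bacts_gfied bacts_bdiag]])
  show "idx m 0" "idx m 0" using m by (simp_all add: idx_def)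
  fix x b a assume "b < m" and a: "a < n"
  show "fapp m n c' 0 x b a = fapp m n c 0 x b a - mv n (if b = m - 1 then Z else 0\<^sub>m n n) (x b) a"
    using a by (auto simp: fapp_def c(2) mv_plus[OF c(1) Z a] mv_zero_mat)
qed

text \<open>The contribution of the state equation to the transfer function has the same outer factors as the pencil.\<close>

lemma border_sandwich:
  fixes l :: "'a :: comm_ring_1 mat"
  assumes l: "l \<in> carrier_mat N N" and x: "x \<in> carrier_mat N n" and b: "b \<in> carrier_mat n r" and R: "R \<in> carrier_mat r r"
    and d: "d \<in> carrier_mat r n" and y: "y \<in> carrier_mat n N" and w: "w \<in> carrier_mat N N"
  shows "((l * x) * b) * R * (d * (y * w)) = l * ((x * (b * R * d)) * y) * w"
proof -
  have A: "l * x \<in> carrier_mat N n" using l x by (rule mult_carrier_mat)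
  have bR: "b * R \<in> carrier_mat n r" using b R by (rule mult_carrier_mat)
  have Z: "b * R * d \<in> carrier_mat n n" using bR d by (rule mult_carrier_mat)
  have yw: "y * w \<in> carrier_mat n N" using y w by (rule mult_carrier_mat)
  have dyw: "d * (y * w) \<in> carrier_mat r N" using d yw by (rule mult_carrier_mat)
  have Zyw: "b * R * d * (y * w) \<in> carrier_mat n N" using Z yw by (rule mult_carrier_mat)
  have xZ: "x * (b * R * d) \<in> carrier_mat N n" using x Z by (rule mult_carrier_mat)
  have xZy: "x * (b * R * d) * y \<in> carrier_mat N N" using xZ y by (rule mult_carrier_mat)
  have "((l * x) * b) * R * (d * (y * w)) = (l * x) * ((b * R) * (d * (y * w)))"
    unfolding assoc_mult_mat[OF A b R] by (rule assoc_mult_mat[OF A bR dyw])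
  also have "(b * R) * (d * (y * w)) = b * R * d * (y * w)"
    by (rule assoc_mult_mat[OF bR d yw, symmetric])
  also have "(l * x) * (b * R * d * (y * w)) = l * (x * (b * R * d * (y * w)))"
    by (rule assoc_mult_mat[OF l x Zyw])
  also have "x * (b * R * d * (y * w)) = (x * (b * R * d) * y) * w"
    unfolding assoc_mult_mat[OF xZ y w] by (rule assoc_mult_mat[OF x Z yw, symmetric])
  also have "l * ((x * (b * R * d) * y) * w) = l * ((x * (b * R * d)) * y) * w"
    by (rule assoc_mult_mat[OF l xZy w, symmetric])
  finally show ?thesis .
qed

lemma over_cm: "over proper (cm X)"
  using flim_const by (auto simp: over_def proper_def)

lemma cf_proper: "cf a \<in> proper"
  using flim_const by (auto simp: proper_def)

lemma sandwich_minus: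
  fixes A :: "'a :: comm_ring_1 mat"
  assumes A: "A \<in> carrier_mat N N" and B: "B \<in> carrier_mat N N" and X: "X \<in> carrier_mat N N" and Y: "Y \<in> carrier_mat N N"
  shows "A * (X - Y) * B = A * X * B - A * Y * B"
  using mult_minus_distrib_mat[OF A X Y] minus_mult_distrib_mat[OF mult_square_carrier[OF A X] mult_square_carrier[OF A Y] B]
  by simp

lemma sandwich_smult:
  fixes A :: "'a :: comm_ring_1 mat"
  assumes A: "A \<in> carrier_mat N N" and B: "B \<in> carrier_mat N N" and X: "X \<in> carrier_mat N N"
  shows "A * (t \<cdot>\<^sub>m X) * B = t \<cdot>\<^sub>m (A * X * B)"
  using mult_smult_distrib[OF A X, of t] mult_smult_assoc_mat[OF mult_square_carrier[OF A X] B, of t] by simp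

context realized
begin

definition Zf :: "complex poly fract mat" where "Zf = cm (Bm\<^sup>T) * resolv Em Am * cm Bm"

lemma Zf: "Zf \<in> carrier_mat n n" "over proper Zf" "Gr = rat_mat P + Zf"
proof -
  note R = resolv(1,2)[OF car(2,3) det_Em]
  have BR: "cm (Bm\<^sup>T) * resolv Em Am \<in> carrier_mat n r" using R(1) by (intro mult_carrier_mat[of _ _ r]) auto
  show "Zf \<in> carrier_mat n n" unfolding Zf_def by (rule mult_carrier_mat[OF BR]) simp
  show "over proper Zf" unfolding Zf_def using BR R carrier_matD[OF BR] carrier_matD[OF car(4)] carrier_matD[OF R(1)]
    by (intro over_mult[OF subring_proper] over_cm R) simp_all
  show "Gr = rat_mat P + Zf" unfolding Gr transfer_eq[OF car(2,3)] Zf_def ..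
qed

text \<open>The coefficients of \<open>P\<close>, with the strictly rational part of the transfer function added to the constant one.\<close>

definition cZ :: "nat \<Rightarrow> complex poly fract mat" where
  "cZ j = (if j = 0 then cm (coeff_mat P 0) + Zf else cm (coeff_mat P j))"

lemma cZ_carrier: "cZ j \<in> carrier_mat n n"
  using Zf(1) by (auto simp: cZ_def)

lemma cZ_over: "over proper (cZ j)"
proof (cases "j = 0")
  case True
  have "over proper (cm (coeff_mat P 0) + Zf)"
    by (rule over_add[OF subring_proper over_cm Zf(2) _ Zf(1)]) simp
  then show ?thesis using True by (simp add: cZ_def)
qed (simp add: cZ_def over_cm)

lemma Gr_index:
  assumes ab: "a < n" "b < n"
  shows "Gr $$ (a, b) = (\<Sum>i\<le>m. lamF ^ i * cZ i $$ (a, b))"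
proof -
  have Pab: "P $$ (a, b) = (\<Sum>j\<le>m. lam ^ j * const_mat (coeff_mat P j) $$ (a, b))"
    by (rule matrix_from_coefficients[OF car(1) above ab])
  have "rat_mat P $$ (a, b) = to_fract (P $$ (a, b))"
    using ab carrier_matD[OF car(1)] by (simp add: rat_mat_def)
  also have "\<dots> = (\<Sum>i\<le>m. to_fract (lam ^ i * const_mat (coeff_mat P i) $$ (a, b)))"
    unfolding Pab by (rule tf.hom_sum)
  also have "\<dots> = (\<Sum>i\<le>m. lamF ^ i * cm (coeff_mat P i) $$ (a, b))"
  proof (rule sum.cong[OF refl])
    fix i
    have "const_mat (coeff_mat P i) $$ (a, b) = [:coeff_mat P i $$ (a, b):]"
      using ab carrier_matD[OF coeff_car] by (simp add: const_mat_def)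
    then show "to_fract (lam ^ i * const_mat (coeff_mat P i) $$ (a, b)) = lamF ^ i * cm (coeff_mat P i) $$ (a, b)"
      using ab carrier_matD[OF coeff_car] by (simp only: tf.hom_mult tf.hom_power lamF_def cf_def index_map_mat)
  qed
  finally have P: "rat_mat P $$ (a, b) = (\<Sum>i\<le>m. lamF ^ i * cm (coeff_mat P i) $$ (a, b))" .
  have cZi: "cZ i $$ (a, b) = cm (coeff_mat P i) $$ (a, b) + (if i = 0 then Zf $$ (a, b) else 0)" for i
    using ab carrier_matD[OF Zf(1)] by (simp add: cZ_def)
  have "(\<Sum>i\<le>m. lamF ^ i * cZ i $$ (a, b))
      = (\<Sum>i\<le>m. lamF ^ i * cm (coeff_mat P i) $$ (a, b)) + (\<Sum>i\<le>m. lamF ^ i * (if i = 0 then Zf $$ (a, b) else 0))"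
    unfolding cZi by (simp only: distrib_left sum.distrib)
  also have "(\<Sum>i\<le>m. lamF ^ i * (if i = 0 then Zf $$ (a, b) else 0)) = (\<Sum>i\<le>m. if i = 0 then Zf $$ (a, b) else 0)"
    by (rule sum.cong) auto
  also have "\<dots> = Zf $$ (a, b)" by simp
  finally show ?thesis using P Zf(3) ab carrier_matD[OF Zf(1)] carrier_matD[OF car(1)] by (simp add: rat_mat_def)
qed

text \<open>The Horner scheme in the variable $\mu = 1/\lambda$ for the reversed coefficients: $\sum_j \mu^j c_{m-j} = \mu^m \sum_i \lambda^i c_i$.\<close>

lemma horner_G:
  defines "d \<equiv> \<lambda>i. - cZ (m - i)"
  shows "- (horner d (inverse lamF) (m - 1) (inverse lamF \<cdot>\<^sub>m d m) + d 0) = inverse lamF ^ m \<cdot>\<^sub>m Gr"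
proof (rule eq_matI)
  have d: "d j \<in> carrier_mat n n" for j using cZ_carrier by (simp add: d_def)
  have G: "Gr \<in> carrier_mat n n" using Zf by (simp add: rat_mat_def)
  let ?H = "horner d (inverse lamF) (m - 1) (inverse lamF \<cdot>\<^sub>m d m) + d 0"
  have H: "?H \<in> carrier_mat n n" by (rule add_carrier_mat[OF d])
  fix a b assume "a < dim_row (inverse lamF ^ m \<cdot>\<^sub>m Gr)" "b < dim_col (inverse lamF ^ m \<cdot>\<^sub>m Gr)"
  then have ab: "a < n" "b < n" using G by auto
  have "?H $$ (a, b) = (\<Sum>j\<le>m. inverse lamF ^ j * d j $$ (a, b))"
    by (rule horner_total[OF d m_pos ab])
  also have "\<dots> = (\<Sum>j\<le>m. - (inverse lamF ^ j * cZ (m - j) $$ (a, b)))"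
    using ab carrier_matD[OF cZ_carrier] by (intro sum.cong refl) (simp add: d_def)
  also have "\<dots> = - (\<Sum>j\<le>m. inverse lamF ^ j * cZ (m - j) $$ (a, b))" by (rule sum_negf)
  also have "(\<Sum>j\<le>m. inverse lamF ^ j * cZ (m - j) $$ (a, b)) = (\<Sum>i\<le>m. inverse lamF ^ (m - i) * cZ i $$ (a, b))"
    by (rule sum.reindex_bij_witness[of _ "\<lambda>i. m - i" "\<lambda>i. m - i"]) auto
  also have "\<dots> = (\<Sum>i\<le>m. inverse lamF ^ m * (lamF ^ i * cZ i $$ (a, b)))"
  proof (rule sum.cong[OF refl])
    fix i assume "i \<in> {..m}"
    then have "inverse lamF ^ m = inverse lamF ^ (m - i) * inverse lamF ^ i" by (simp flip: power_add)
    moreover have "inverse lamF ^ i * lamF ^ i = 1" using lam_nonzero by (simp flip: power_mult_distrib)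
    ultimately show "inverse lamF ^ (m - i) * cZ i $$ (a, b) = inverse lamF ^ m * (lamF ^ i * cZ i $$ (a, b))"
      by (simp add: mult.assoc[symmetric])
  qed
  also have "\<dots> = inverse lamF ^ m * Gr $$ (a, b)"
    unfolding Gr_index[OF ab] sum_distrib_left ..
  finally have "?H $$ (a, b) = - (inverse lamF ^ m * Gr $$ (a, b))" .
  then show "(- ?H) $$ (a, b) = (inverse lamF ^ m \<cdot>\<^sub>m Gr) $$ (a, b)"
    using ab H G by (simp del: index_add_mat)
next
  have d0: "d 0 \<in> carrier_mat n n" using cZ_carrier by (simp add: d_def)
  have G: "Gr \<in> carrier_mat n n" using Zf by (simp add: rat_mat_def)
  show "dim_row (- (horner d (inverse lamF) (m - 1) (inverse lamF \<cdot>\<^sub>m d m) + d 0)) = dim_row (inverse lamF ^ m \<cdot>\<^sub>m Gr)"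
    "dim_col (- (horner d (inverse lamF) (m - 1) (inverse lamF \<cdot>\<^sub>m d m) + d 0)) = dim_col (inverse lamF ^ m \<cdot>\<^sub>m Gr)"
    using d0 G by simp_all
qed

text \<open>Eliminating the state only changes $M_0$: the borders sit at the last block, and their product subtracts
  $B^T(\lambda E - A)^{-1}B$ from the last block of $M_0$, which is $-A_0$.\<close>

lemma transfer_factored:
  defines "l \<equiv> cm Lc" and "w \<equiv> cm Rc" and "L \<equiv> gprod N (gfied m n cZ) (Lt \<beta> (m - 1))" and "T \<equiv> gprod N (gfied m n cZ) (Rt \<beta> (m - 1))"
  shows "inverse lamF \<cdot>\<^sub>m transfer_function (lam \<cdot>\<^sub>m const_mat (Qs * X1) - const_mat (Qs * X0)) Cb Em Am Db
    = l * (gfied m n cZ (- int m) - inverse lamF \<cdot>\<^sub>m (L * gfied m n cZ 0 * T)) * w"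
proof -
  let ?c = "\<lambda>j. cm (coeff_mat P j)" and ?\<mu> = "inverse lamF"
  have m1': "2 * E + p = m - 1" using m1 by simp
  have idxs: "idx m 0" "idx m (- int m)" using m_pos by (auto simp: idx_def)
  have rng: "0 < i \<and> idx m i" if "0 < i \<and> i \<le> int (m - 1)" for i using that m_pos by (auto simp: idx_def)
  have LT: "cm L1 = L" "cm T1 = T"
  proof -
    have *: "cm (G t) = gprod N (gfied m n cZ) t" if "\<And>i. i \<in> set t \<Longrightarrow> 0 < i \<and> idx m i" for t
    proof -
      have "cm (G t) = gprod N (gfied m n ?c) t" by (rule cf.map_gprod_gfied) (use that in auto)
      also have "\<dots> = gprod N (gfied m n cZ) t"
      proof (rule gprod_cong)
        fix i assume "i \<in> set t"
        then have "0 < i \<and> idx m i" by (rule that)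
        then show "gfied m n ?c i = gfied m n cZ i" by (intro gfied_cong) (simp_all add: cZ_def)
      qed
      finally show ?thesis .
    qed
    show "cm L1 = L" "cm T1 = T"
      unfolding L1_def T1_def L_def T_def m1' by (rule *, use rng set_Lt set_Rt in blast)+
  qed
  have Mm: "cm (M (- int m)) = gfied m n cZ (- int m)"
  proof -
    have "cm (M (- int m)) = gfied m n ?c (- int m)" by (rule cf.map_gfied) (use idxs in auto)
    also have "\<dots> = gfied m n cZ (- int m)" by (rule gfied_cong[OF idxs(2)]) (use m_pos in \<open>simp add: cZ_def\<close>)
    finally show ?thesis .
  qed
  define EZ where "EZ = Ecol m n (m - 1) * Zf * (Ecol m n (m - 1))\<^sup>T"
  have EZ [simp]: "EZ \<in> carrier_mat N N" unfolding EZ_def Ecol_sandwich[OF Zf(1)] by simp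
  have M0: "gfied m n cZ 0 = cm (M 0) - EZ"
  proof -
    have "gfied m n cZ 0 = gfied m n ?c 0 - EZ"
      unfolding EZ_def by (rule gfied_0_shift[OF _ _ Zf(1) m_pos]) (simp_all add: cZ_def)
    also have "gfied m n ?c 0 = cm (M 0)" by (rule cf.map_gfied[symmetric]) (use idxs in auto)
    finally show ?thesis .
  qed
  have cs [simp]: "l \<in> carrier_mat N N" "w \<in> carrier_mat N N" "L \<in> carrier_mat N N" "T \<in> carrier_mat N N" "cm (M 0) \<in> carrier_mat N N"
    by (simp_all add: l_def w_def L_def T_def)
  have hom: "cm (X * Z) = cm X * cm Z" if "X \<in> carrier_mat a b" "Z \<in> carrier_mat b c" for X Z a b c
    using that by (rule cf.mat_hom_mult)
  have X1: "cm (Qs * X1) = l * gfied m n cZ (- int m) * w"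
    unfolding factor l_def w_def Mm[symmetric] by (simp add: hom[of _ N N _ N])
  have X0: "cm (Qs * X0) = l * (L * cm (M 0) * T) * w"
    unfolding factor l_def w_def LT[symmetric] by (simp add: hom[of _ N N _ N])
  have border: "cm Cb * resolv Em Am * cm Db = l * (L * EZ * T) * w"
  proof -
    let ?e = "Ecol m n (m - 1) :: complex poly fract mat"
    have BT: "Bm\<^sup>T \<in> carrier_mat n r" by simp
    have ET: "(Ecol m n b :: complex mat)\<^sup>T \<in> carrier_mat n N" for b by simp
    have LE: "L1 * Ecol m n (m - 1) \<in> carrier_mat N n" "L * ?e \<in> carrier_mat N n"
      by (rule mult_carrier_mat[of _ _ N], simp_all)+
    have TE: "(Ecol m n (m - 1))\<^sup>T * T1 \<in> carrier_mat n N" "?e\<^sup>T * T \<in> carrier_mat n N"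
      by (rule mult_carrier_mat[of _ _ N], simp_all)+
    have C: "cm Cb = (l * (L * ?e)) * cm (Bm\<^sup>T)"
      unfolding Cb_def hom[OF Ecol_carrier(1) BT] unfolding factor_col hom[OF LR_carrier(1) LE(1)] hom[OF mats_carrier(2) Ecol_carrier(1)] LT l_def cf.map_Ecol ..
    have D: "cm Db = cm Bm * ((?e\<^sup>T * T) * w)"
      unfolding Db_def hom[OF car(4) ET] unfolding factor_row hom[OF TE(1) LR_carrier(2)] hom[OF ET mats_carrier(3)] LT w_def cf.map_Erow ..
    have "cm Cb * resolv Em Am * cm Db = l * (((L * ?e) * Zf) * (?e\<^sup>T * T)) * w"
      unfolding C D Zf_def
      by (rule border_sandwich[OF cs(1) LE(2) _ resolv(1)[OF car(2,3) det_Em] _ TE(2) cs(2)]) simp_all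
    also have "((L * ?e) * Zf) * (?e\<^sup>T * T) = L * EZ * T"
    proof -
      have eZ: "?e * Zf \<in> carrier_mat N n" using Zf(1) by (intro mult_carrier_mat[of _ _ n]) auto
      have "((L * ?e) * Zf) * (?e\<^sup>T * T) = (L * (?e * Zf)) * (?e\<^sup>T * T)"
        using Zf(1) by (subst assoc_mult_mat[of L N N ?e n Zf n]) simp_all
      also have "\<dots> = L * ((?e * Zf) * (?e\<^sup>T * T))"
        by (rule assoc_mult_mat[OF cs(3) eZ TE(2)])
      also have "(?e * Zf) * (?e\<^sup>T * T) = EZ * T"
        unfolding EZ_def by (rule assoc_mult_mat[OF eZ _ cs(4), symmetric]) simp
      also have "L * (EZ * T) = L * EZ * T" by (rule assoc_mult_mat[OF cs(3) EZ cs(4), symmetric])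
      finally show ?thesis .
    qed
    finally show ?thesis .
  qed
  have S: "L * gfied m n cZ 0 * T = L * cm (M 0) * T - L * EZ * T"
    unfolding M0 by (rule sandwich_minus[OF cs(3) cs(4) cs(5) EZ])
  let ?a = "l * gfied m n cZ (- int m) * w" and ?b = "l * (L * cm (M 0) * T) * w" and ?d = "l * (L * EZ * T) * w"
  have abd: "?a \<in> carrier_mat N N" "?b \<in> carrier_mat N N" "?d \<in> carrier_mat N N" by simp_all
  have "l * (gfied m n cZ (- int m) - ?\<mu> \<cdot>\<^sub>m (L * gfied m n cZ 0 * T)) * w = ?a - ?\<mu> \<cdot>\<^sub>m (?b - ?d)"
  proof -
    have S': "L * gfied m n cZ 0 * T \<in> carrier_mat N N" by simp
    have "l * (gfied m n cZ (- int m) - ?\<mu> \<cdot>\<^sub>m (L * gfied m n cZ 0 * T)) * w = ?a - l * (?\<mu> \<cdot>\<^sub>m (L * gfied m n cZ 0 * T)) * w"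
      by (rule sandwich_minus[OF cs(1) cs(2) gfied_carrier(1) smult_carrier_mat[OF S']])
    also have "l * (?\<mu> \<cdot>\<^sub>m (L * gfied m n cZ 0 * T)) * w = ?\<mu> \<cdot>\<^sub>m (l * (L * gfied m n cZ 0 * T) * w)"
      by (rule sandwich_smult[OF cs(1) cs(2) S'])
    also have "l * (L * gfied m n cZ 0 * T) * w = ?b - ?d"
      unfolding S by (rule sandwich_minus[OF cs(1) cs(2)]) simp_all
    finally show ?thesis .
  qed
  also have "\<dots> = ?\<mu> \<cdot>\<^sub>m ((lamF \<cdot>\<^sub>m ?a - ?b) + ?d)"
  proof (rule eq_matI)
    have arith: "x - ?\<mu> * (y - z) = ?\<mu> * (lamF * x - y + z)" for x y z
      using lam_nonzero by (simp add: algebra_simps)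
    have ent: "(A - ?\<mu> \<cdot>\<^sub>m (B - D)) $$ (i, j) = (?\<mu> \<cdot>\<^sub>m ((lamF \<cdot>\<^sub>m A - B) + D)) $$ (i, j)"
      if "A \<in> carrier_mat N N" "B \<in> carrier_mat N N" "D \<in> carrier_mat N N" "i < N" "j < N" for A B D i j
      using that by (simp add: arith)
    fix i j assume "i < dim_row (?\<mu> \<cdot>\<^sub>m ((lamF \<cdot>\<^sub>m ?a - ?b) + ?d))" "j < dim_col (?\<mu> \<cdot>\<^sub>m ((lamF \<cdot>\<^sub>m ?a - ?b) + ?d))"
    then have "i < N" "j < N" using carrier_matD[OF abd(3)] by auto
    then show "(?a - ?\<mu> \<cdot>\<^sub>m (?b - ?d)) $$ (i, j) = (?\<mu> \<cdot>\<^sub>m ((lamF \<cdot>\<^sub>m ?a - ?b) + ?d)) $$ (i, j)"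
      by (rule ent[OF abd])
  qed (use carrier_matD[OF abd(3)] carrier_matD[OF abd(2)] in auto)
  also have "(lamF \<cdot>\<^sub>m ?a - ?b) + ?d
      = transfer_function (lam \<cdot>\<^sub>m const_mat (Qs * X1) - const_mat (Qs * X0)) Cb Em Am Db"
    unfolding transfer_eq[OF car(2,3)] border
    by (subst rat_mat_pencil[of _ N N]) (simp_all add: X1 X0)
  finally show ?thesis by (rule sym)
qed

text \<open>The reversed elimination over the proper rational functions.\<close>

lemma infinity_part:
  assumes nd: "det (coeff_mat P m) = 0 \<longrightarrow> p = 0"
  shows "\<exists>U V. biproper N U \<and> biproper N V \<and>
    U * (inverse (to_fract lam) \<cdot>\<^sub>m transfer_function (lam \<cdot>\<^sub>m const_mat (Qs * X1) - const_mat (Qs * X0)) Cb Em Am Db) * V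
      = dsum (1\<^sub>m ((m - 1) * n)) (inverse (to_fract lam) ^ m \<cdot>\<^sub>m Gr)"
proof -
  have mu: "inverse lamF \<in> proper" using flim_mu by (auto simp: proper_def)
  define X where "X = gfied m n cZ (- int m) - inverse lamF \<cdot>\<^sub>m (gprod N (gfied m n cZ) (Lt \<beta> (m - 1)) * gfied m n cZ 0 * gprod N (gfied m n cZ) (Rt \<beta> (m - 1)))"
  obtain U V where U: "inv_over proper N U" and V: "inv_over proper N V"
    and UV: "U * X * V = corner m n 1 (- (horner (\<lambda>i. - cZ (m - i)) (inverse lamF) (m - 1) (inverse lamF \<cdot>\<^sub>m - cZ (m - m)) + - cZ (m - 0)))"
    using reversed_elimination[where c = cZ and \<beta> = \<beta> and n = n, OF subring_proper mu cZ_carrier cZ_over m_pos] unfolding X_def by blast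
  have Gc: "inverse lamF ^ m \<cdot>\<^sub>m Gr \<in> carrier_mat n n" using Zf by (simp add: rat_mat_def)
  have UXV: "U * X * V = dsum (1\<^sub>m ((m - 1) * n)) (inverse lamF ^ m \<cdot>\<^sub>m Gr)"
    unfolding UV horner_G by (rule corner_dsum[OF Gc m_pos])
  obtain Lci where Lci: "Lci \<in> carrier_mat N N" "Lc * Lci = 1\<^sub>m N" "Lci * Lc = 1\<^sub>m N"
    using inv_Lc by (auto simp: inv_over_def)
  obtain Rci where Rci: "Rci \<in> carrier_mat N N" "Rc * Rci = 1\<^sub>m N" "Rci * Rc = 1\<^sub>m N"
    using inv_Rc[OF nd] by (auto simp: inv_over_def)
  have li: "inv_over proper N (cm Lci)" and ri: "inv_over proper N (cm Rci)"
    by (rule cf.inv_over_map[OF _ cf_proper], use Lci Rci in \<open>auto intro: inv_overI[of _ _ Lc] inv_overI[of _ _ Rc]\<close>)+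
  have Uc: "U \<in> carrier_mat N N" "V \<in> carrier_mat N N" using U V by (auto dest: inv_over_carrier)
  have cc: "cm Lc \<in> carrier_mat N N" "cm Rc \<in> carrier_mat N N" "cm Lci \<in> carrier_mat N N" "cm Rci \<in> carrier_mat N N"
    using Lci Rci by simp_all
  have Xc: "X \<in> carrier_mat N N" unfolding X_def by (intro minus_carrier_mat smult_carrier_mat) simp
  have inv: "cm Lci * cm Lc = 1\<^sub>m N" "cm Rc * cm Rci = 1\<^sub>m N"
    using Lci Rci cf.mat_hom_mult[OF Lci(1) LR_carrier(1)] cf.mat_hom_mult[OF LR_carrier(2) Rci(1)] by (simp_all add: cf.mat_hom_one)
  have tf: "inverse lamF \<cdot>\<^sub>m transfer_function (lam \<cdot>\<^sub>m const_mat (Qs * X1) - const_mat (Qs * X0)) Cb Em Am Db = cm Lc * X * cm Rc"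
    unfolding X_def by (rule transfer_factored)
  have "(U * cm Lci) * (cm Lc * X * cm Rc) * (cm Rci * V) = U * ((cm Lci * cm Lc) * X * (cm Rc * cm Rci)) * V"
    using Uc cc Xc by (simp add: assoc_mult_mat[of _ N N _ N _ N])
  also have "\<dots> = U * X * V"
    unfolding inv using Xc by (simp add: left_mult_one_mat[of _ N N] right_mult_one_mat[of _ N N])
  finally have "(U * cm Lci) * (inverse lamF \<cdot>\<^sub>m transfer_function (lam \<cdot>\<^sub>m const_mat (Qs * X1) - const_mat (Qs * X0)) Cb Em Am Db) * (cm Rci * V)
      = dsum (1\<^sub>m ((m - 1) * n)) (inverse lamF ^ m \<cdot>\<^sub>m Gr)"
    unfolding UXV tf .
  moreover have "biproper N (U * cm Lci)" "biproper N (cm Rci * V)"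
    by (intro inv_over_biproper inv_over_mult[OF subring_proper] U V li ri)+
  ultimately show ?thesis unfolding lamF_def by blast
qed

end

section \<open>Parameters of the tuples\<close>

lemma subseq_skip: "a \<notin> set xs \<Longrightarrow> subseq (a # ys) (xs @ zs) \<Longrightarrow> subseq (a # ys) zs"
  by (induction xs) auto

text \<open>The tuple $\mathbf w$ is $(0)$ or ends in $1, 2, 0$.  In the second case it contains $(1,0)$ but not $(2,1,0)$.\<close>

lemma (in gfpr) tuple_i0_wl: "m - tuple_i0 wl = je"
proof (cases "e = 0")
  case True
  have wl: "wl = [0]" unfolding wl_def using True by simp
  have "tuple_i0 wl = 0"
    unfolding tuple_i0_def
  proof (rule Greatest_equality)
    show "subseq (rev [0..int 0]) wl" by (simp add: wl)
    fix q assume "subseq (rev [0..int q]) wl"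
    then have "length (rev [0..int q]) \<le> length wl" by (rule list_emb_length)
    then show "q \<le> 0" by (simp add: wl)
  qed
  moreover have "je = m" unfolding je_def using True by simp
  ultimately show ?thesis by simp
next
  case False
  define xs where "xs = concat (map (\<lambda>j. [int (2 * e) - 2 * int j - 1..int (2 * e) - 2 * int j]) [0..<e - 1])"
  have up: "[1..2] = [1, 2 :: int]" by (simp add: upto_rec1)
  have "[0..<e] = [0..<e - 1] @ [e - 1]" using False by (cases e) auto
  moreover have "[int (2 * e) - 2 * int (e - 1) - 1..int (2 * e) - 2 * int (e - 1)] = [1, 2]"
  proof -
    have "int (2 * e) - 2 * int (e - 1) = 2" using False by (simp add: of_nat_diff)
    then show ?thesis using up by simp
  qed
  ultimately have wl: "wl = xs @ [1, 2, 0]" unfolding wl_def xs_def by simp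
  have big: "3 \<le> i" if "i \<in> set xs" for i
    using that by (auto simp: xs_def)
  have "tuple_i0 wl = 1"
    unfolding tuple_i0_def
  proof (rule Greatest_equality)
    have "[0..int 1] = [0, 1]" by (simp add: upto_rec1)
    then have "subseq (rev [0..int 1]) ([] @ [1, 2, 0])" by simp
    then show "subseq (rev [0..int 1]) wl" unfolding wl by (metis append_Nil list_emb_append2)
    fix q assume q: "subseq (rev [0..int q]) wl"
    show "q \<le> 1"
    proof (rule ccontr)
      assume "\<not> q \<le> 1"
      then have "[0..int q] = [0, 1, 2] @ [3..int q]" by (simp add: upto_rec1)
      then have "rev [0..int q] = rev [3..int q] @ [2, 1, 0]" by simp
      then have "subseq [2, 1, 0] (rev [0..int q])" by (metis list_emb_append2 subseq_order.order_refl)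
      then have "subseq [2, 1, 0] wl" using q by (rule subseq_order.order_trans)
      then have sub: "subseq [2, 1, 0] (xs @ [1, 2, 0])" unfolding wl .
      have "2 \<notin> set xs" using big[of 2] by auto
      then have "subseq [2, 1, 0] [1, 2, 0 :: int]" using sub by (rule subseq_skip)
      then show False by simp
    qed
  qed
  then show ?thesis using False by (simp add: je_def)
qed

lemma (in gfpr) idx_lists: "i \<in> set wl \<union> set zl \<union> set Ol \<union> set (Zo @ rc) \<Longrightarrow> idx m i"
proof -
  assume "i \<in> set wl \<union> set zl \<union> set Ol \<union> set (Zo @ rc)"
  moreover have "i \<in> set wl \<Longrightarrow> 0 \<le> i \<and> i < int m" using m_int by (auto simp: wl_def)
  moreover have "i \<in> set zl \<Longrightarrow> - int m \<le> i \<and> i < 0" using m_int by (auto simp: zl_def)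
  moreover have "i \<in> set Ol \<union> set (Zo @ rc) \<Longrightarrow> idx m i" using idx_sets by auto
  ultimately show "idx m i" by (auto simp: idx_def)
qed

context realized
begin

abbreviation "FP \<equiv> gprod (N + r) (fiedler_P m n r (coeff_mat P))"

abbreviation "FS \<equiv> gprod (N + r) (fiedler_S m n r (coeff_mat P) Em Am Bm)"

lemma fiedler_M: "idx m i \<Longrightarrow> fiedler m n (coeff_mat P) i = M i"
  by (rule fiedler_eq_gfied) simp_all

lemma FP: "(\<And>i. i \<in> set t \<Longrightarrow> idx m i) \<Longrightarrow> FP t = dsum (G t) (1\<^sub>m r)"
proof -
  assume t: "\<And>i. i \<in> set t \<Longrightarrow> idx m i"
  have "FP t = gprod (N + r) (\<lambda>i. dsum (M i) (1\<^sub>m r)) t"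
    by (rule gprod_cong) (simp add: fiedler_P_def dsum fiedler_M t del: diag_block_mat.simps)
  also have "\<dots> = dsum (G t) (gprod r (\<lambda>i. 1\<^sub>m r) t)" by (rule gprod_dsum) simp_all
  finally show ?thesis by (simp add: gprod_ones)
qed

lemma FS: "(\<And>i. i \<in> set t \<Longrightarrow> idx m i \<and> i \<noteq> 0) \<Longrightarrow> FS t = dsum (G t) (gprod r (\<lambda>i. if i = - int m then - Em else 1\<^sub>m r) t)"
proof -
  assume t: "\<And>i. i \<in> set t \<Longrightarrow> idx m i \<and> i \<noteq> 0"
  have "FS t = gprod (N + r) (\<lambda>i. dsum (M i) (if i = - int m then - Em else 1\<^sub>m r)) t"
  proof (rule gprod_cong)
    fix i assume "i \<in> set t"
    then have eq: "fiedler m n (coeff_mat P) i = M i" and nz: "i \<noteq> 0" using t fiedler_M by blast+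
    show "fiedler_S m n r (coeff_mat P) Em Am Bm i = dsum (M i) (if i = - int m then - Em else 1\<^sub>m r)"
      unfolding fiedler_S_def dsum eq using nz by simp
  qed
  also have "\<dots> = dsum (G t) (gprod r (\<lambda>i. if i = - int m then - Em else 1\<^sub>m r) t)"
    by (rule gprod_dsum) simp_all
  finally show ?thesis .
qed

lemma FS_zl: "FS zl = dsum (G zl) (- Em)"
proof -
  let ?K = "\<lambda>i. if i = - int m then - Em else 1\<^sub>m r"
  define u where "u = map (\<lambda>i. i - int m) (concat (map (\<lambda>j. [int (p + 2 * s) - 2 * int j - 1..int (p + 2 * s) - 2 * int j]) [0..<s]))"
  define v where "v = map (\<lambda>i. i - int m) [1..int p]"
  have zl: "zl = u @ - int m # v"
    unfolding zl_def u_def v_def by (simp add: upto_rec1)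
  have u: "- int m < i \<and> i < 0" if "i \<in> set u" for i
    using that m_int by (auto simp: u_def)
  have v: "- int m < i \<and> i < 0" if "i \<in> set v" for i
    using that m_int by (auto simp: v_def)
  have uv: "- int m \<le> i \<and> i < 0" if "i \<in> set zl" for i
    using that u[of i] v[of i] m_pos unfolding zl by auto
  have "FS zl = dsum (G zl) (gprod r ?K zl)"
    by (rule FS, drule uv) (auto simp: idx_def)
  also have "gprod r ?K zl = gprod r ?K u * (- Em * gprod r ?K v)"
    unfolding zl by (subst gprod_append) (auto simp: gprod_def)
  also have "gprod r ?K u = 1\<^sub>m r" by (rule gprod_ones) (use u in auto)
  also have "gprod r ?K v = 1\<^sub>m r" by (rule gprod_ones) (use v in auto)
  finally show ?thesis by (simp add: left_mult_one_mat[of _ r r] right_mult_one_mat[of _ r r])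
qed

lemma FS_wl: "FS wl = four_block_mat (W * M 0) (- Cb) (- (Bm * (Ecol m n (m - 1))\<^sup>T)) (- Am)"
proof -
  define u where "u = concat (map (\<lambda>j. [int (2 * e) - 2 * int j - 1..int (2 * e) - 2 * int j]) [0..<e])"
  have u: "0 < i \<and> idx m i" if "i \<in> set u" for i
    using that m_int by (auto simp: u_def idx_def)
  have BT: "Bm\<^sup>T \<in> carrier_mat n r" by simp
  have 0: "fiedler_S m n r (coeff_mat P) Em Am Bm 0
      = four_block_mat (M 0) (- (Ecol m n (m - 1) * Bm\<^sup>T)) (- (Bm * (Ecol m n (m - 1))\<^sup>T)) (- Am)"
    using m_pos kronecker_col[OF BT m_pos order_refl] kronecker_row[OF car(4) m_pos order_refl]
    by (simp add: fiedler_S_def fiedler_M idx_def)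
  have EB: "Ecol m n (m - 1) * Bm\<^sup>T \<in> carrier_mat N r" "Bm * (Ecol m n (m - 1))\<^sup>T \<in> carrier_mat r N"
    by (auto intro!: mult_carrier_mat[of _ _ n])
  have Fu: "FS u = dsum W (1\<^sub>m r)"
  proof -
    have "FS u = dsum (G u) (gprod r (\<lambda>i. if i = - int m then - Em else 1\<^sub>m r) u)"
      by (rule FS) (use u in force)
    also have "gprod r (\<lambda>i. if i = - int m then - Em else 1\<^sub>m r) u = 1\<^sub>m r"
      by (rule gprod_ones) (use u in force)
    also have "G u = W" unfolding u_def W_def by (rule G_pairs)
    finally show ?thesis .
  qed
  have c0: "fiedler_S m n r (coeff_mat P) Em Am Bm 0 \<in> carrier_mat (N + r) (N + r)"
    unfolding 0 using EB by (intro four_block_carrier_mat) simp_all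
  have "FS wl = FS u * fiedler_S m n r (coeff_mat P) Em Am Bm 0"
  proof -
    have cu: "fiedler_S m n r (coeff_mat P) Em Am Bm i \<in> carrier_mat (N + r) (N + r)" if "i \<in> set (u @ [0])" for i
    proof (cases "i = 0")
      case False
      then have "0 < i \<and> idx m i" using that u by auto
      then show ?thesis by (simp add: fiedler_S_def dsum fiedler_M del: diag_block_mat.simps)
    qed (use c0 in simp)
    have "FS wl = FS (u @ [0])" by (simp add: wl_def u_def)
    also have "\<dots> = FS u * FS [0]" by (rule gprod_append) (use cu in auto)
    finally show ?thesis using c0 by (simp add: gprod_def right_mult_one_mat[of _ "N + r" "N + r"])
  qed
  also have "\<dots> = four_block_mat (W * M 0) (W * (- (Ecol m n (m - 1) * Bm\<^sup>T))) (1\<^sub>m r * (- (Bm * (Ecol m n (m - 1))\<^sup>T))) (1\<^sub>m r * (- Am))"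
    unfolding Fu 0 using EB by (intro dsum_four_block(1)[of _ N _ r]) simp_all
  also have "W * (- (Ecol m n (m - 1) * Bm\<^sup>T)) = - Cb"
  proof -
    have "W * (- (Ecol m n (m - 1) * Bm\<^sup>T)) = - (W * (Ecol m n (m - 1) * Bm\<^sup>T))"
      by (rule uminus_mult_right_mat) (simp add: carrier_matD[OF WY_carrier(1)])
    also have "W * (Ecol m n (m - 1) * Bm\<^sup>T) = (W * Ecol m n (m - 1)) * Bm\<^sup>T"
      by (rule assoc_mult_mat[symmetric, of _ N N _ n _ r]) simp_all
    finally show ?thesis unfolding border_col Cb_def .
  qed
  also have "1\<^sub>m r * (- (Bm * (Ecol m n (m - 1))\<^sup>T)) = - (Bm * (Ecol m n (m - 1))\<^sup>T)"
    using EB by (intro left_mult_one_mat[of _ r N]) simp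
  also have "1\<^sub>m r * (- Am) = - Am" by (intro left_mult_one_mat[of _ r r]) simp
  finally show ?thesis .
qed

lemma LL_form:
  "(lam \<cdot>\<^sub>m const_mat (FS zl) - const_mat (FS wl)) * const_mat (FP Ol) * const_mat (FP (Zo @ rc)) = LLp"
proof -
  have FPs: "FP Ol = dsum (G Ol) (1\<^sub>m r)" "FP (Zo @ rc) = dsum (G (Zo @ rc)) (1\<^sub>m r)"
    by (rule FP, use idx_sets in auto)+
  have EB: "Bm * (Ecol m n (m - 1))\<^sup>T \<in> carrier_mat r N" by (auto intro!: mult_carrier_mat[of _ _ n])
  have Y: "dsum (G Ol) (1\<^sub>m r) * dsum (G (Zo @ rc)) (1\<^sub>m r) = dsum Y (1\<^sub>m r)"
    unfolding Y_def by (subst dsum_mult[of _ N _ r]) (simp_all add: left_mult_one_mat[of _ r r])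
  have DY: "(- (Bm * (Ecol m n (m - 1))\<^sup>T)) * Y = - Db"
  proof -
    have "(- (Bm * (Ecol m n (m - 1))\<^sup>T)) * Y = - ((Bm * (Ecol m n (m - 1))\<^sup>T) * Y)"
      by (rule uminus_mult_left_mat) (simp add: carrier_matD[OF WY_carrier(2)])
    also have "(Bm * (Ecol m n (m - 1))\<^sup>T) * Y = Bm * ((Ecol m n (m - 1))\<^sup>T * Y)"
      by (rule assoc_mult_mat[of _ r n _ N _ N]) simp_all
    finally show ?thesis unfolding border_row Db_def .
  qed
  have z: "FS zl * dsum Y (1\<^sub>m r) = dsum X1 (- Em)"
    unfolding FS_zl X_WY by (subst dsum_mult[of _ N _ r]) (simp_all add: right_mult_one_mat[of _ r r])
  have w: "FS wl * dsum Y (1\<^sub>m r) = four_block_mat X0 (- Cb) (- Db) (- Am)"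
    unfolding FS_wl X_WY DY[symmetric] using EB
    by (subst dsum_four_block(2)[of _ N _ r]) (simp_all add: right_mult_one_mat[of _ r r] right_mult_one_mat[of _ N r])
  have car': "FS zl \<in> carrier_mat (N + r) (N + r)" "FS wl \<in> carrier_mat (N + r) (N + r)"
    unfolding FS_zl FS_wl using EB by (auto intro!: four_block_carrier_mat)
  have d: "dsum (G Ol) (1\<^sub>m r) \<in> carrier_mat (N + r) (N + r)" "dsum (G (Zo @ rc)) (1\<^sub>m r) \<in> carrier_mat (N + r) (N + r)" by simp_all
  have pc: "lam \<cdot>\<^sub>m const_mat (FS zl) - const_mat (FS wl) \<in> carrier_mat (N + r) (N + r)"
    using car' by (intro minus_carrier_mat) simp
  have "(lam \<cdot>\<^sub>m const_mat (FS zl) - const_mat (FS wl)) * const_mat (FP Ol) * const_mat (FP (Zo @ rc))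
      = (lam \<cdot>\<^sub>m const_mat (FS zl) - const_mat (FS wl)) * const_mat (dsum Y (1\<^sub>m r))"
    unfolding FPs Y[symmetric] const_mat_mult[OF d]
    by (rule assoc_mult_mat[OF pc const_mat_carrier[OF d(1)] const_mat_carrier[OF d(2)]])
  also have "\<dots> = LLp"
    unfolding LLp_def z[symmetric] w[symmetric] by (rule pencil_mult_right[OF car']) simp
  finally show ?thesis .
qed

lemma L_form:
  "(lam \<cdot>\<^sub>m const_mat (G zl) - const_mat (G wl)) * const_mat (G Ol) * const_mat (G (Zo @ rc)) = Lp"
  unfolding Lp_def X0_def X1_def by (simp only: pencil_mult_right[of _ N] gprod_gfied_carrier mult_square_carrier)

text \<open>If \<open>B\<close> were zero, the transfer function would be a polynomial matrix, which is realized without any state.\<close>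

lemma input_nonzero:
  assumes "0 < r"
  obtains i a where "i < r" "a < n" "Bm $$ (i, a) \<noteq> 0"
proof -
  have "Bm \<noteq> 0\<^sub>m r n"
  proof
    assume B0: "Bm = 0\<^sub>m r n"
    note R = resolv(1)[OF car(2,3) det_Em]
    have "cm (Bm\<^sup>T) * resolv Em Am \<in> carrier_mat n r" using R by (intro mult_carrier_mat[of _ _ r]) auto
    then have "cm (Bm\<^sup>T) * resolv Em Am * 0\<^sub>m r n = 0\<^sub>m n n" by (rule right_mult_zero_mat)
    moreover have "cm Bm = 0\<^sub>m r n" unfolding B0 by (rule eq_matI) auto
    ultimately have "Gr = rat_mat P + 0\<^sub>m n n"
      unfolding Gr transfer_eq[OF car(2,3)] by (simp only:)
    moreover have "transfer_function P (0\<^sub>m n 0) (1\<^sub>m 0) (1\<^sub>m 0) (0\<^sub>m 0 n) = rat_mat P + 0\<^sub>m n n"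
    proof -
      have "det (1\<^sub>m 0 :: complex mat) \<noteq> 0" by simp
      then have "resolv (1\<^sub>m 0) (1\<^sub>m 0) \<in> carrier_mat 0 0" by (intro resolv(1)) auto
      then have "cm (0\<^sub>m n 0) * resolv (1\<^sub>m 0) (1\<^sub>m 0) * cm (0\<^sub>m 0 n) = 0\<^sub>m n n"
        by (intro eq_matI) (auto simp: scalar_prod_def)
      then show ?thesis by (subst transfer_eq[of _ 0]) auto
    qed
    ultimately have "is_realization n 0 Gr P (0\<^sub>m n 0) (1\<^sub>m 0) (1\<^sub>m 0) (0\<^sub>m 0 n)"
      by (simp add: is_realization_def)
    then have "r \<le> 0" using min_real unfolding is_minimal_realization_def by blast
    then show False using assms by simp
  qed
  then have "\<exists>i<r. \<exists>a<n. Bm $$ (i, a) \<noteq> 0"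
    using carrier_matD[OF car(4)] by (metis eq_matI index_zero_mat)
  then show thesis using that by blast
qed

text \<open>The sign of the block that carries the border is fixed by the border, since \<open>B\<close> is not zero.\<close>

lemma sign_at_border:
  assumes r: "0 < r" and sgn: "\<epsilon> (je - 1) \<in> {1, -1}" and fixes_Cb: "dg m n \<epsilon> * Cb = Cb"
  shows "\<epsilon> (je - 1) = 1"
proof (rule ccontr)
  assume "\<epsilon> (je - 1) \<noteq> 1"
  then have m1: "- 1 * \<epsilon> (je - 1) = 1" using sgn by auto
  have "Cb = dg m n (\<lambda>b. - 1 * \<epsilon> b) * Cb"
  proof -
    have "dg m n (\<lambda>b. - 1 * \<epsilon> b) * Cb = (dg m n (\<lambda>b. - 1 * \<epsilon> b) * Ecol m n (je - 1)) * Bm\<^sup>T"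
      unfolding Cb_def by (rule assoc_mult_mat[symmetric, of _ N N _ n _ r]) simp_all
    also have "dg m n (\<lambda>b. - 1 * \<epsilon> b) * Ecol m n (je - 1) = Ecol m n (je - 1)"
      by (rule dg_Ecol) (rule je(3), rule m1)
    finally show ?thesis by (simp only: Cb_def)
  qed
  also have "\<dots> = (- 1) \<cdot>\<^sub>m (dg m n \<epsilon> * Cb)"
    unfolding dg_smult[symmetric] by (rule mult_smult_assoc_mat[of _ N N _ r]) simp_all
  finally have C: "Cb = (- 1) \<cdot>\<^sub>m Cb" unfolding fixes_Cb .
  obtain i a where ia: "i < r" "a < n" "Bm $$ (i, a) \<noteq> 0" using input_nonzero[OF r] .
  have "Cb $$ ((je - 1) * n + a, i) = ((- 1) \<cdot>\<^sub>m Cb) $$ ((je - 1) * n + a, i)" using C by (rule arg_cong)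
  then have "Cb $$ ((je - 1) * n + a, i) = - Cb $$ ((je - 1) * n + a, i)"
    using je_block[OF ia(2)] ia(1) carrier_matD[OF CD_carrier(1)] by simp
  then have "Bm $$ (i, a) = - Bm $$ (i, a)" unfolding Cb_index[OF ia(1,2)] .
  then show False using ia(3) by simp
qed

abbreviation "Tp \<equiv> four_block_mat (lam \<cdot>\<^sub>m const_mat (Qs * X1) - const_mat (Qs * X0)) (const_mat Cb) (const_mat Db)
  (const_mat Am - lam \<cdot>\<^sub>m const_mat Em)"

lemma strong_linearization:
  assumes nd: "det (coeff_mat P m) = 0 \<longrightarrow> p = 0"
  shows "rosenbrock_strong_linearization m n r (system_matrix P Em Am Bm) Gr Tp"
proof -
  define X Y where "X = - (Qs * X0)" and "Y = - (Qs * X1)"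
  have XY: "X \<in> carrier_mat N N" "Y \<in> carrier_mat N N" by (simp_all add: X_def Y_def)
  have pen: "const_mat X - lam \<cdot>\<^sub>m const_mat Y = lam \<cdot>\<^sub>m const_mat (Qs * X1) - const_mat (Qs * X0)"
  proof -
    have "const_mat (- A) - lam \<cdot>\<^sub>m const_mat (- B) = lam \<cdot>\<^sub>m const_mat B - const_mat A"
      if "A \<in> carrier_mat N N" "B \<in> carrier_mat N N" for A B
      by (rule eq_matI) (use that in \<open>auto simp: const_mat_def\<close>)
    then show ?thesis by (simp add: X_def Y_def)
  qed
  obtain U V where uni: "unimodular N U" "unimodular N V"
    and UV: "dsum U (1\<^sub>m r) * Tp * dsum V (1\<^sub>m r) = dsum (1\<^sub>m ((m - 1) * n)) (system_matrix P Em Am Bm)"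
    using unimodular_part[OF nd] by blast
  obtain Ol' Or' where bi: "biproper N Ol'" "biproper N Or'"
    and inf: "Ol' * (inverse (to_fract lam) \<cdot>\<^sub>m transfer_function (const_mat X - lam \<cdot>\<^sub>m const_mat Y) Cb Em Am Db) * Or'
      = dsum (1\<^sub>m ((m - 1) * n)) (inverse (to_fract lam) ^ m \<cdot>\<^sub>m Gr)"
    using infinity_part[OF nd] unfolding pen by blast
  have c1: "const_mat (1\<^sub>m r) = (1\<^sub>m r)" unfolding const_mat_def by (rule cp.mat_hom_one)
  have i: "\<exists>U V U0 V0. unimodular N U \<and> unimodular N V \<and>
          U0 \<in> carrier_mat r r \<and> V0 \<in> carrier_mat r r \<and> det U0 \<noteq> 0 \<and> det V0 \<noteq> 0 \<and>
          diag_block_mat [U, const_mat U0] * Tp * diag_block_mat [V, const_mat V0]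
            = diag_block_mat [1\<^sub>m ((m - 1) * n), system_matrix P Em Am Bm]"
    unfolding dsum by (rule exI[of _ U], rule exI[of _ V], rule exI[of _ "1\<^sub>m r"], rule exI[of _ "1\<^sub>m r"])
      (simp only: c1 UV uni, simp)
  have ii: "\<exists>Ol Or. biproper N Ol \<and> biproper N Or \<and>
          Ol * (inverse (to_fract lam) \<cdot>\<^sub>m transfer_function (const_mat X - lam \<cdot>\<^sub>m const_mat Y) Cb Em Am Db) * Or
            = diag_block_mat [1\<^sub>m ((m - 1) * n), inverse (to_fract lam) ^ m \<cdot>\<^sub>m Gr]"
    unfolding dsum using bi inf by blast
  have ranks: "\<forall>t :: complex. vec_space.rank r (append_cols Db (Am - t \<cdot>\<^sub>m Em)) = r \<and> vec_space.rank (N + r) (Cb @\<^sub>r (Am - t \<cdot>\<^sub>m Em)) = r"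
    using rank_row rank_col by blast
  have T: "Tp = four_block_mat (const_mat X - lam \<cdot>\<^sub>m const_mat Y) (const_mat Cb) (const_mat Db) (const_mat Am - lam \<cdot>\<^sub>m const_mat Em)"
    unfolding pen ..
  show ?thesis
    unfolding rosenbrock_strong_linearization_def
    by (rule exI[of _ X], rule exI[of _ Y], rule exI[of _ Cb], rule exI[of _ Db], rule exI[of _ Am], rule exI[of _ Em])
      (intro conjI XY CD_carrier car det_Em T ranks i ii)
qed

end

theorem theorem4p21:
  fixes m n r h pw pz :: nat
    and G :: "complex poly fract mat"
    and P :: "complex poly mat"
    and E A B :: "complex mat"
    and w cw z cz :: "int list"
  assumes m_pos: "m \<ge> 1"
    and P_degree: "coeff_mat P m \<noteq> 0\<^sub>m n n" "\<forall>i>m. coeff_mat P i = 0\<^sub>m n n"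
    and G_even: "T_even_rat G"
    and realization: "is_minimal_T_even_realization n r G P E A B"
    and h: "h \<le> m - 1" "even h"
    and w: "simple_admissible_tuple h pw w" "cw = sym_complement h pw"
    and z: "admissible_tuple (m - h - 1) pz (tuple_shift z (int m))"
      "tuple_shift cz (int m) = sym_complement (m - h - 1) pz"
  shows
    "let c = coeff_mat P;
         M = tuple_prod (m * n) (fiedler m n c);
         MP = tuple_prod (m * n + r) (fiedler_P m n r c);
         MS = tuple_prod (m * n + r) (fiedler_S m n r c E A B);
         LL = (lam \<cdot>\<^sub>m const_mat (MS z) - const_mat (MS w)) * const_mat (MP cw) * const_mat (MP cz);
         L = (lam \<cdot>\<^sub>m const_mat (M z) - const_mat (M w)) * const_mat (M cw) * const_mat (M cz);
         j = m - tuple_i0 w;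
         C = kronecker (e_col m j) (transpose_mat B);
         D = kronecker (transpose_mat (e_col m j)) B
     in \<exists>\<epsilon> Q. quasi_identity m n \<epsilon> Q \<and> T_even_poly (const_mat Q * L) \<and>
          (\<forall>\<epsilon>' Q'. quasi_identity m n \<epsilon>' Q' \<and> T_even_poly (const_mat Q' * L)
             \<longrightarrow> Q' = Q \<or> Q' = - Q) \<and>
          (let s = \<epsilon> j;
               sQL = const_mat (s \<cdot>\<^sub>m Q) * L;
               QQ = diag_block_mat [s \<cdot>\<^sub>m Q, 1\<^sub>m r];
               T = const_mat QQ * LL
           in T = four_block_mat sQL (const_mat C) (const_mat D) (const_mat A - lam \<cdot>\<^sub>m const_mat E) \<and>
              T_even_poly T \<and>
              (\<forall>\<epsilon>' Q'. quasi_identity m n \<epsilon>' Q' \<and>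
                 T_even_poly (const_mat (diag_block_mat [Q', 1\<^sub>m r]) * LL) \<and>
                 (r = 0 \<longrightarrow> \<epsilon>' j = 1)
                 \<longrightarrow> diag_block_mat [Q', 1\<^sub>m r] = QQ) \<and>
              ((det (c m) = 0 \<longrightarrow> pz = 0)
                 \<longrightarrow> rosenbrock_strong_linearization m n r (system_matrix P E A B) G T) \<and>
              T_even_rat (transfer_function sQL C E A D))"
proof -
  have adm: "admissible_tuple h pw w" and pw01: "pw \<in> {0, 1}" using w(1) by (auto simp: simple_admissible_tuple_def)
  then have "pw \<le> h" "even (h - pw)" by (auto simp: admissible_tuple_def)
  \<comment> \<open>The index of the simple tuple has the parity of \<open>h\<close>.\<close>
  then have pw: "pw = 0" using pw01 h(2) by (cases "h = 0") auto
  obtain e where e: "h = 2 * e" using h(2) by (elim evenE)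
  define s where "s = (m - h - 1 - pz) div 2"
  have zle: "pz \<le> m - h - 1" "even (m - h - 1 - pz)" using z(1) by (auto simp: admissible_tuple_def)
  have k: "m - h - 1 = pz + 2 * s" using zle by (auto simp: s_def)
  have m: "m = 2 * e + 1 + pz + 2 * s" using k e h(1) m_pos by linarith
  interpret R: realized m e pz s n r G P E A B
  proof unfold_locales
    show "m = 2 * e + 1 + pz + 2 * s" by (rule m)
    show "coeff_mat P m \<noteq> 0\<^sub>m n n" by (rule P_degree(1))
    show "coeff_mat P i = 0\<^sub>m n n" if "m < i" for i using P_degree(2) that by blast
    show "is_minimal_T_even_realization n r G P E A B" by (rule realization)
  qed
  have wl: "w = R.wl"
    using adm unfolding admissible_tuple_def R.wl_def pw e by simp
  have cw: "cw = R.Ol"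
    unfolding w(2) sym_complement_def pw R.Ol_def e by simp
  have shift: "t = map (\<lambda>i. i - int m) (tuple_shift t (int m))" for t
    by (simp add: tuple_shift_def comp_def)
  have half: "(pz + 2 * s - pz) div 2 = s" by simp
  have zl: "z = R.zl"
  proof -
    have "tuple_shift z (int m) = concat (map (\<lambda>j. [int (pz + 2 * s) - 2 * int j - 1..int (pz + 2 * s) - 2 * int j]) [0..<s]) @ [0..int pz]"
      using z(1) unfolding admissible_tuple_def k half by blast
    then show ?thesis using shift[of z] unfolding R.zl_def by (simp only:)
  qed
  have cz: "cz = R.Zo @ R.rc"
  proof -
    have "tuple_shift cz (int m) = map (\<lambda>j. int (pz + 2 * s) - 2 * int j - 1) [0..<s] @ rev_c pz"
      unfolding z(2) sym_complement_def k half ..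
    then have "cz = map (\<lambda>i. i - int m) (map (\<lambda>j. int (pz + 2 * s) - 2 * int j - 1) [0..<s] @ rev_c pz)"
      using shift[of cz] by (simp only:)
    then show ?thesis by (simp add: R.Zo_def R.rc_def comp_def)
  qed
  have j: "m - tuple_i0 w = R.je" unfolding wl by (rule R.tuple_i0_wl)
  have idxs: "idx m i" if "i \<in> set w \<union> set z \<union> set cw \<union> set cz" for i
    using that R.idx_lists unfolding wl zl cw cz by blast
  have M: "tuple_prod (m * n) (fiedler m n (coeff_mat P)) t = R.G t" if "set t \<subseteq> set w \<union> set z \<union> set cw \<union> set cz" for t
    unfolding tuple_prod_eq_gprod by (rule gprod_cong) (use that idxs R.fiedler_M in blast)
  have L: "(lam \<cdot>\<^sub>m const_mat (tuple_prod (m * n) (fiedler m n (coeff_mat P)) z) - const_mat (tuple_prod (m * n) (fiedler m n (coeff_mat P)) w))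
      * const_mat (tuple_prod (m * n) (fiedler m n (coeff_mat P)) cw) * const_mat (tuple_prod (m * n) (fiedler m n (coeff_mat P)) cz) = R.Lp"
  proof -
    have "tuple_prod (m * n) (fiedler m n (coeff_mat P)) w = R.G R.wl" "tuple_prod (m * n) (fiedler m n (coeff_mat P)) z = R.G R.zl"
      "tuple_prod (m * n) (fiedler m n (coeff_mat P)) cw = R.G R.Ol" "tuple_prod (m * n) (fiedler m n (coeff_mat P)) cz = R.G (R.Zo @ R.rc)"
      using M[of w] M[of z] M[of cw] M[of cz] unfolding wl zl cw cz by blast+
    then show ?thesis using R.L_form by (simp only:)
  qed
  have LL: "(lam \<cdot>\<^sub>m const_mat (tuple_prod (m * n + r) (fiedler_S m n r (coeff_mat P) E A B) z)
      - const_mat (tuple_prod (m * n + r) (fiedler_S m n r (coeff_mat P) E A B) w))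
      * const_mat (tuple_prod (m * n + r) (fiedler_P m n r (coeff_mat P)) cw)
      * const_mat (tuple_prod (m * n + r) (fiedler_P m n r (coeff_mat P)) cz) = R.LLp"
    unfolding tuple_prod_eq_gprod wl zl cw cz by (rule R.LL_form)
  have C: "kronecker (e_col m R.je) B\<^sup>T = R.Cb"
    unfolding R.Cb_def by (rule kronecker_col[of _ n r]) (use R.je in simp_all)
  have D: "kronecker (e_col m R.je)\<^sup>T B = R.Db"
    unfolding R.Db_def by (rule kronecker_row[OF R.car(4)]) (use R.je in simp_all)
  \<comment> \<open>Parameters are numbered from 1, blocks from 0.\<close>
  define \<epsilon> where "\<epsilon> i = R.sn (R.je - 1) * R.sn (i - 1)" for i
  have \<epsilon>j: "\<epsilon> R.je = 1" using R.sn(2) by (simp add: \<epsilon>_def)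
  have qi: "quasi_identity m n \<epsilon> R.Qs"
    unfolding quasi_identity_iff
  proof (intro conjI ballI)
    show "\<epsilon> i \<in> {1, - 1}" for i using R.sn(1)[of "R.je - 1"] R.sn(1)[of "i - 1"] by (auto simp: \<epsilon>_def)
    show "R.Qs = dg m n (\<lambda>b. \<epsilon> (Suc b))" by (simp add: R.Qs_def \<epsilon>_def)
  qed
  have sign_cases: "(\<forall>b<m. \<epsilon>' (Suc b) = \<epsilon> (Suc b)) \<or> (\<forall>b<m. \<epsilon>' (Suc b) = - \<epsilon> (Suc b))"
    if "quasi_identity m n \<epsilon>' Q'" "R.even_sign Q'" for \<epsilon>' Q'
  proof -
    have "\<epsilon>' (Suc b) \<in> {1, - 1}" if "b < m" for b
      using \<open>quasi_identity m n \<epsilon>' Q'\<close> that unfolding quasi_identity_iff by force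
    moreover have "R.even_sign (dg m n (\<lambda>b. \<epsilon>' (Suc b)))"
      using that unfolding quasi_identity_iff by simp
    ultimately show ?thesis using R.even_sign_unique[of "\<lambda>b. \<epsilon>' (Suc b)"] by (simp add: \<epsilon>_def)
  qed
  have Qc: "Q' \<in> carrier_mat (m * n) (m * n)" if "quasi_identity m n \<epsilon>' Q'" for \<epsilon>' Q'
    using that unfolding quasi_identity_iff by auto
  have same: "Q' = R.Qs" if "quasi_identity m n \<epsilon>' Q'" "\<forall>b<m. \<epsilon>' (Suc b) = \<epsilon> (Suc b)" for \<epsilon>' Q'
    using that qi unfolding quasi_identity_iff by (auto intro: dg_cong)
  have opposite: "Q' = - R.Qs" if "quasi_identity m n \<epsilon>' Q'" "\<forall>b<m. \<epsilon>' (Suc b) = - \<epsilon> (Suc b)" for \<epsilon>' Q'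
  proof -
    have "Q' = dg m n (\<lambda>b. - 1 * \<epsilon> (Suc b))" using that unfolding quasi_identity_iff by (auto intro: dg_cong)
    also have "\<dots> = (- 1) \<cdot>\<^sub>m R.Qs" using qi unfolding quasi_identity_iff by (simp only: dg_smult)
    also have "\<dots> = - R.Qs" by (rule eq_matI) auto
    finally show ?thesis .
  qed
  have unique1: "Q' = R.Qs \<or> Q' = - R.Qs"
    if "quasi_identity m n \<epsilon>' Q' \<and> T_even_poly (const_mat Q' * R.Lp)" for \<epsilon>' Q'
    using that sign_cases same opposite R.T_even_L Qc by blast
  have unique2: "diag_block_mat [Q', 1\<^sub>m r] = diag_block_mat [R.Qs, 1\<^sub>m r]"
    if *: "quasi_identity m n \<epsilon>' Q' \<and> T_even_poly (const_mat (diag_block_mat [Q', 1\<^sub>m r]) * R.LLp) \<and> (r = 0 \<longrightarrow> \<epsilon>' R.je = 1)" for \<epsilon>' Q'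
  proof -
    have qi': "quasi_identity m n \<epsilon>' Q'" using * by blast
    have ev: "R.even_sign Q'" "Q' * R.Cb = R.Cb"
      using * R.T_even_LL[OF Qc[OF qi']] unfolding dsum by blast+
    have je: "Suc (R.je - 1) = R.je" "R.je \<in> {1..m}" using R.je by auto
    have "\<epsilon>' R.je = 1"
    proof (cases "r = 0")
      case False
      have "dg m n (\<lambda>b. \<epsilon>' (Suc b)) * R.Cb = R.Cb" using ev(2) qi' unfolding quasi_identity_iff by simp
      moreover have "\<epsilon>' (Suc (R.je - 1)) \<in> {1, - 1}" using qi' je unfolding quasi_identity_iff by simp
      ultimately have "\<epsilon>' (Suc (R.je - 1)) = 1" using R.sign_at_border[of "\<lambda>b. \<epsilon>' (Suc b)"] False by simp
      then show ?thesis using je by simp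
    qed (use * in blast)
    then have "\<not> (\<forall>b<m. \<epsilon>' (Suc b) = - \<epsilon> (Suc b))" using R.je(3) je(1) \<epsilon>j by (metis one_neq_neg_one)
    then have "Q' = R.Qs" using sign_cases[OF qi' ev(1)] same[OF qi'] by blast
    then show ?thesis by simp
  qed
  have sQL: "const_mat R.Qs * R.Lp = lam \<cdot>\<^sub>m const_mat (R.Qs * R.X1) - const_mat (R.Qs * R.X0)"
    unfolding R.Lp_def by (rule pencil_mult_left[of _ "m * n"]) simp_all
  have T: "const_mat (diag_block_mat [R.Qs, 1\<^sub>m r]) * R.LLp = R.Tp"
    unfolding dsum R.sign_LLp[OF R.Qs_carrier(1)] R.Qs_Cb by (rule pencil_four_block[of _ "m * n" _ _ r]) simp_all
  have T_even: "T_even_poly R.Tp"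
    unfolding T[symmetric] dsum R.T_even_LL[OF R.Qs_carrier(1)] using R.even_sign_Qs R.Qs_Cb by blast
  have L_even: "T_even_poly (const_mat R.Qs * R.Lp)"
    unfolding R.T_even_L[OF R.Qs_carrier(1)] by (rule R.even_sign_Qs)
  have rat_even: "T_even_rat (transfer_function (const_mat R.Qs * R.Lp) R.Cb E A R.Db)"
  proof (rule T_even_transfer[where k = "m * n" and r = r, OF _ L_even])
    show "const_mat R.Qs * R.Lp \<in> carrier_mat (m * n) (m * n)"
      unfolding sQL by (intro minus_carrier_mat) simp
  qed (use R.CD_transpose R.Em_skew R.Am_sym R.det_Em in simp_all)
  show ?thesis
    unfolding Let_def L LL j C D
  proof (rule exI[of _ \<epsilon>], rule exI[of _ R.Qs], unfold \<epsilon>j one_smult_mat T, intro conjI allI impI)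
    show "quasi_identity m n \<epsilon> R.Qs" by (rule qi)
    show "T_even_poly (const_mat R.Qs * R.Lp)" by (rule L_even)
    show "Q' = R.Qs \<or> Q' = - R.Qs" if "quasi_identity m n \<epsilon>' Q' \<and> T_even_poly (const_mat Q' * R.Lp)" for \<epsilon>' Q'
      by (rule unique1[OF that])
    show "R.Tp = four_block_mat (const_mat R.Qs * R.Lp) (const_mat R.Cb) (const_mat R.Db) (const_mat A - lam \<cdot>\<^sub>m const_mat E)"
      unfolding sQL ..
    show "T_even_poly R.Tp" by (rule T_even)
    show "diag_block_mat [Q', 1\<^sub>m r] = diag_block_mat [R.Qs, 1\<^sub>m r]"
      if "quasi_identity m n \<epsilon>' Q' \<and> T_even_poly (const_mat (diag_block_mat [Q', 1\<^sub>m r]) * R.LLp) \<and> (r = 0 \<longrightarrow> \<epsilon>' R.je = 1)" for \<epsilon>' Q'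
      by (rule unique2[OF that])
    show "rosenbrock_strong_linearization m n r (system_matrix P E A B) G R.Tp"
      if "det (coeff_mat P m) = 0 \<longrightarrow> pz = 0"
      by (rule R.strong_linearization[OF that])
    show "T_even_rat (transfer_function (const_mat R.Qs * R.Lp) R.Cb E A R.Db)" by (rule rat_even)
  qed
qed

end
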